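(* Let $W$ be a finite Coxeter group, $w\in W$, $\mathbb{K}$ a field, and $\mathcal{H}W^{(w)}$ the $w$-biHecke algebra. Write $\mathcal{RB_L}(w)$ for the set of reduced left blocks of $w$. (1) $\mathcal{H}W^{(w)}$ is the maximal algebra of operators on $T_w$ stabilizing all the subspaces $P^{(w)}_J$, for $J\in\mathcal{RB_L}(w)$. (2) For each pair $(u,v)\in[1,w]_R^2$ with $K^{(w)}(u)\subseteq K^{(w)}(v)$ there is a $(u,v)$-triangular element $f_{u,v}\in F$, such that these elements $f_{u,v}$ form a basis of $\mathcal{H}W^{(w)}$; in particular $$\dim\mathcal{H}W^{(w)}=|\{(u,v)\in[1,w]_R^2: J^{(w)}(u)\subseteq J^{(w)}(v)\}|.$$ (3) $\mathcal{H}W^{(w)}$ is (isomorphic to) the digraph algebra of the digraph $G^{(w)}$. (4) The family $(P^{(w)}_J)_{J\in\mathcal{RB_L}(w)}$ is a complete system of representatives of the indecomposable projective (right) modules of $\mathcal{H}W^{(w)}$. (5) The family $(S^{(w)}_J)_{J\in\mathcal{RB_L}(w)}$ is a complete system of representatives of the simple (right) modules of $\mathcal{H}W^{(w)}$, and $\dim S^{(w)}_J$ is the size of the corresponding $w$-descent class $\{u\in[1,w]_R: J^{(w)}(u)=J\}$. (6) $\mathcal{H}W^{(w)}$ is Morita equivalent to the poset algebra of the lattice $[1,w]_{\sqsubseteq}$.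
   Context: $W$ is a finite Coxeter group with simple reflections $(s_i)_{i\in I}$, identity $1$, length $\ell$; $D_R(w)=\{i:\ell(ws_i)<\ell(w)\}$. Right (resp. left) weak order: $u\le_R v$ (resp. $u\le_L v$) if some reduced word of $u$ is a left factor/prefix (resp. right factor/suffix) of a reduced word of $v$; $[1,w]_R=\{u:u\le_R w\}$. Bruhat order: subword order on reduced words. The biHecke monoid $M(W)$ is the monoid of functions $W\to W$, acting on the right, generated by $\pi_i,\overline\pi_i$ ($i\in I$), where $w.\pi_i=w$ if $i\in D_R(w)$ and $ws_i$ otherwise; $w.\overline\pi_i=ws_i$ if $i\in D_R(w)$ and $w$ otherwise. $T_w$ is the right $M(W)$-module with $\mathbb{K}$-basis $[1,w]_R$ and action: $u.\pi_i=u$ if $i\in D_R(u)$, $us_i$ if $i\notin D_R(u)$ and $us_i\in[1,w]_R$, $0$ otherwise; $u.\overline\pi_i=us_i$ if $i\in D_R(u)$ and $us_i\in[1,w]_R$, $u$ if $i\notin D_R(u)$ and $us_i\in[1,w]_R$, $0$ otherwise. $\mathcal{H}W^{(w)}$ is the subalgebra of $\mathrm{End}(T_w)$ (operators acting on the right) generated by the operators $\pi_i,\overline\pi_i$, $i\in I$; i.e. the quotient of $\mathbb{K}[M(W)]$ through its representation on $T_w$. For $J\subseteq I$, $W_J=\langle s_j:j\in J\rangle$. Each $w$ factors uniquely as $w=w_J\,{}^{J}w$ and $w=w^K\,{}_Kw$ with $w_J\in W_J$, ${}_Kw\in W_K$, and ${}^{J}w$ (resp. $w^K$) the minimal length element of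 $W_Jw$ (resp. $wW_K$). If $wW_K=W_Jw$ then $K$ is called a right block and $J$ the corresponding left block of $w$, and $v=w^K={}^Jw$ is called a cutting point of $w$, written $v\sqsubseteq w$; this makes $W$ a poset, and $[1,w]_{\sqsubseteq}=\{v:v\sqsubseteq w\}$. $J$ is left reduced (w.r.t. $w$) if $J'\subsetneq J$ implies ${}^{J'}w>_L{}^{J}w$; $K$ is right reduced if $K'\subsetneq K$ implies $w^{K'}>_R w^K$. For $u\in[1,w]_R$, $K^{(w)}(u)$ is the maximal reduced right block $K$ of $w$ with $u\le_R w^K$, and $J^{(w)}(u)$ is the corresponding left block. $\overleftarrow{s}_i$ is the linear operator on $T_w$ with $\overleftarrow{s}_i.u=s_iu$ if $s_iu\in[1,w]_R$ and $-u$ otherwise. $P^{(w)}_J=\{v\in T_w:\overleftarrow{s}_i.v=-v\ \forall i\in J\}$, and $S^{(w)}_J=P^{(w)}_J/\sum_{J'}P^{(w)}_{J'}$, the sum over reduced left blocks $J'\supsetneq J$ of $w$. $F$ is the submonoid of $\mathcal{H}W^{(w)}$ generated by the operators $\pi_i,\overline\pi_i$ and $s_i:=\pi_i+\overline\pi_i-1$, $i\in I$ (so $u.s_i=us_i$ if $us_i\in[1,w]_R$ and $-u$ otherwise). The paper regards each $f\in F$, up to signs, as a function from $[1,w]_R$ to $[1,w]_R$: for $u\in[1,w]_R$, $u.f=\pm v$ with $v\in[1,w]_R$. $f\in F$ is $(u,v)$-triangular if, ignoring signs, $v$ is the unique Bruhat-minimal element of $\mathrm{im}(f)$ and $u$ is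 the unique Bruhat-maximal element of $f^{-1}(v)$. $G^{(w)}$ is the digraph on $[1,w]_R$ with an edge $u\to v$ whenever $u=vs_i$ for some $i\in I$ and $J^{(w)}(u)\subseteq J^{(w)}(v)$. The digraph algebra of a digraph has basis the pairs $(u,v)$ such that there is a (possibly empty) directed path from $u$ to $v$, with product $(u,v)(v',x)=\delta_{v,v'}(u,x)$. The poset algebra of $[1,w]_{\sqsubseteq}$ is the incidence algebra, here with basis the pairs $(x,y)$ with $y\sqsubseteq x$ and product $(x,y)(y',z)=\delta_{y,y'}(x,z)$.
   Formalization: P_J is defined by antisymmetry under all reflections of W_J, not only s_i with i∈J (else (1) fails for w=s_1s_2 in S_3, J={1,2}); elements of F may kill basis vectors, so for triangularity they are partial functions up to sign, killed vectors being ignored in image and preimage. *)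

theory Defs
  imports
    "HOL-Library.Sublist"
    "HOL-Library.Infinite_Typeclass"
    "HOL-Algebra.QuotRing"
    "HOL-Algebra.Multiplicative_Group"
    "Jordan_Normal_Form.VS_Connect"
begin

section \<open>Coxeter groups\<close>

record ('w, 'i) coxeter = "'w monoid" +
  gens :: "'i set"
  simple_refl :: "'i \<Rightarrow> 'w"

definition word_prod :: "('w, 'i) coxeter \<Rightarrow> 'i list \<Rightarrow> 'w" where
  "word_prod W xs = foldr (\<lambda>i x. simple_refl W i \<otimes>\<^bsub>W\<^esub> x) xs \<one>\<^bsub>W\<^esub>"

text \<open>
  The congruence on words generated by \<open>(i j)\<^sup>m \<sim> \<epsilon>\<close> for \<open>m = m i j\<close>; no relation is imposed
  if \<open>m i j = 0\<close> (infinite order). In \<open>coxeter_group\<close> one has \<open>m i i = 1\<close>, so this monoid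
  presentation is the group presentation.
\<close>
inductive cox_cong :: "'i set \<Rightarrow> ('i \<Rightarrow> 'i \<Rightarrow> nat) \<Rightarrow> 'i list \<Rightarrow> 'i list \<Rightarrow> bool"
  for I m where
  cong_refl: "cox_cong I m xs xs"
| cong_sym: "cox_cong I m xs ys \<Longrightarrow> cox_cong I m ys xs"
| cong_trans: "cox_cong I m xs ys \<Longrightarrow> cox_cong I m ys zs \<Longrightarrow> cox_cong I m xs zs"
| cong_rel: "xs \<in> lists I \<Longrightarrow> ys \<in> lists I \<Longrightarrow> i \<in> I \<Longrightarrow> j \<in> I \<Longrightarrow>
    cox_cong I m (xs @ concat (replicate (m i j) [i, j]) @ ys) (xs @ ys)"

text \<open>
  \<^const>\<open>group.ord\<close> is \<open>0\<close> for elements of infinite order.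
\<close>
definition coxeter_group :: "('w, 'i) coxeter \<Rightarrow> bool" where
  "coxeter_group W \<longleftrightarrow>
     group W \<and> simple_refl W ` gens W \<subseteq> carrier W \<and> inj_on (simple_refl W) (gens W) \<and>
     generate W (simple_refl W ` gens W) = carrier W \<and>
     (\<forall>i\<in>gens W. group.ord W (simple_refl W i) = 2) \<and>
     (\<forall>xs\<in>lists (gens W). \<forall>ys\<in>lists (gens W).
        word_prod W xs = word_prod W ys \<longleftrightarrow>
        cox_cong (gens W)
          (\<lambda>i j. group.ord W (simple_refl W i \<otimes>\<^bsub>W\<^esub> simple_refl W j)) xs ys)"

definition cox_len :: "('w, 'i) coxeter \<Rightarrow> 'w \<Rightarrow> nat" where
  "cox_len W x = (LEAST n. \<exists>xs\<in>lists (gens W). length xs = n \<and> word_prod W xs = x)"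

definition reduced_word :: "('w, 'i) coxeter \<Rightarrow> 'i list \<Rightarrow> 'w \<Rightarrow> bool" where
  "reduced_word W xs x \<longleftrightarrow>
     xs \<in> lists (gens W) \<and> word_prod W xs = x \<and> length xs = cox_len W x"

definition right_le :: "('w, 'i) coxeter \<Rightarrow> 'w \<Rightarrow> 'w \<Rightarrow> bool" where
  "right_le W u v \<longleftrightarrow> (\<exists>xs ys. reduced_word W xs u \<and> reduced_word W (xs @ ys) v)"

definition left_le :: "('w, 'i) coxeter \<Rightarrow> 'w \<Rightarrow> 'w \<Rightarrow> bool" where
  "left_le W u v \<longleftrightarrow> (\<exists>xs ys. reduced_word W ys u \<and> reduced_word W (xs @ ys) v)"

definition bruhat_le :: "('w, 'i) coxeter \<Rightarrow> 'w \<Rightarrow> 'w \<Rightarrow> bool" where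
  "bruhat_le W u v \<longleftrightarrow>
     (\<exists>xs ys. reduced_word W xs u \<and> reduced_word W ys v \<and> subseq xs ys)"

definition right_interval :: "('w, 'i) coxeter \<Rightarrow> 'w \<Rightarrow> 'w set" where
  "right_interval W w = {u \<in> carrier W. right_le W u w}"

definition right_descents :: "('w, 'i) coxeter \<Rightarrow> 'w \<Rightarrow> 'i set" where
  "right_descents W w = {i \<in> gens W. cox_len W (w \<otimes>\<^bsub>W\<^esub> simple_refl W i) < cox_len W w}"


section \<open>Blocks and cutting points\<close>

definition parabolic :: "('w, 'i) coxeter \<Rightarrow> 'i set \<Rightarrow> 'w set" where
  "parabolic W J = generate W (simple_refl W ` J)"

text \<open>\<open>left_min W J w\<close> is \<open>\<^sup>Jw\<close> and \<open>right_min W K w\<close> is \<open>w\<^sup>K\<close>.\<close>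

definition left_min :: "('w, 'i) coxeter \<Rightarrow> 'i set \<Rightarrow> 'w \<Rightarrow> 'w" where
  "left_min W J w = (ARG_MIN (cox_len W) x. x \<in> parabolic W J #>\<^bsub>W\<^esub> w)"

definition right_min :: "('w, 'i) coxeter \<Rightarrow> 'i set \<Rightarrow> 'w \<Rightarrow> 'w" where
  "right_min W K w = (ARG_MIN (cox_len W) x. x \<in> w <#\<^bsub>W\<^esub> parabolic W K)"

text \<open>\<open>K\<close> is a right block of \<open>w\<close> and \<open>J\<close> is the corresponding left block.\<close>

definition block_pair :: "('w, 'i) coxeter \<Rightarrow> 'w \<Rightarrow> 'i set \<Rightarrow> 'i set \<Rightarrow> bool" where
  "block_pair W w J K \<longleftrightarrow>
     J \<subseteq> gens W \<and> K \<subseteq> gens W \<and> w <#\<^bsub>W\<^esub> parabolic W K = parabolic W J #>\<^bsub>W\<^esub> w"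

definition cutting_point :: "('w, 'i) coxeter \<Rightarrow> 'w \<Rightarrow> 'w \<Rightarrow> bool" where
  "cutting_point W v w \<longleftrightarrow>
     (\<exists>J K. block_pair W w J K \<and> v = right_min W K w \<and> v = left_min W J w)"

definition cut_interval :: "('w, 'i) coxeter \<Rightarrow> 'w \<Rightarrow> 'w set" where
  "cut_interval W w = {v. cutting_point W v w}"

definition left_reduced :: "('w, 'i) coxeter \<Rightarrow> 'w \<Rightarrow> 'i set \<Rightarrow> bool" where
  "left_reduced W w J \<longleftrightarrow>
     (\<forall>J'. J' \<subset> J \<longrightarrow> left_le W (left_min W J w) (left_min W J' w) \<and>
                    left_min W J w \<noteq> left_min W J' w)"

definition right_reduced :: "('w, 'i) coxeter \<Rightarrow> 'w \<Rightarrow> 'i set \<Rightarrow> bool" where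
  "right_reduced W w K \<longleftrightarrow>
     (\<forall>K'. K' \<subset> K \<longrightarrow> right_le W (right_min W K w) (right_min W K' w) \<and>
                    right_min W K w \<noteq> right_min W K' w)"

definition reduced_left_blocks :: "('w, 'i) coxeter \<Rightarrow> 'w \<Rightarrow> 'i set set" where
  "reduced_left_blocks W w = {J. (\<exists>K. block_pair W w J K) \<and> left_reduced W w J}"

definition reduced_right_blocks :: "('w, 'i) coxeter \<Rightarrow> 'w \<Rightarrow> 'i set set" where
  "reduced_right_blocks W w = {K. (\<exists>J. block_pair W w J K) \<and> right_reduced W w K}"

definition right_block_of :: "('w, 'i) coxeter \<Rightarrow> 'w \<Rightarrow> 'w \<Rightarrow> 'i set" where
  "right_block_of W w u =
     (GREATEST K. K \<in> reduced_right_blocks W w \<and> right_le W u (right_min W K w))"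

definition left_block_of :: "('w, 'i) coxeter \<Rightarrow> 'w \<Rightarrow> 'w \<Rightarrow> 'i set" where
  "left_block_of W w u = (THE J. block_pair W w J (right_block_of W w u))"


section \<open>Algebras and right modules\<close>

text \<open>
  A \<open>\<bbbK>\<close>-algebra is a record of type \<open>('k, 'a) module\<close> (a ring with a scalar multiplication),
  where the field \<open>\<bbbK>\<close> is the type \<open>'k\<close>. In a right module \<open>M\<close> over a ring \<open>A\<close>, the
  element \<open>x \<cdot> a\<close> is written \<open>a \<odot>\<^bsub>M\<^esub> x\<close>; note the order of the factors in \<open>act_mult\<close>. The
  fields \<open>mult\<close> and \<open>one\<close> of a module record play no role.
\<close>

locale right_module = A?: ring A + M?: abelian_group M
  for A :: "('a, 'b) ring_scheme" (structure)
    and M :: "('a, 'm, 'c) module_scheme" (structure) +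
  assumes act_closed: "a \<in> carrier A \<Longrightarrow> x \<in> carrier M \<Longrightarrow> a \<odot>\<^bsub>M\<^esub> x \<in> carrier M"
    and act_add_left: "a \<in> carrier A \<Longrightarrow> b \<in> carrier A \<Longrightarrow> x \<in> carrier M \<Longrightarrow>
      (a \<oplus>\<^bsub>A\<^esub> b) \<odot>\<^bsub>M\<^esub> x = a \<odot>\<^bsub>M\<^esub> x \<oplus>\<^bsub>M\<^esub> b \<odot>\<^bsub>M\<^esub> x"
    and act_add_right: "a \<in> carrier A \<Longrightarrow> x \<in> carrier M \<Longrightarrow> y \<in> carrier M \<Longrightarrow>
      a \<odot>\<^bsub>M\<^esub> (x \<oplus>\<^bsub>M\<^esub> y) = a \<odot>\<^bsub>M\<^esub> x \<oplus>\<^bsub>M\<^esub> a \<odot>\<^bsub>M\<^esub> y"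
    and act_mult: "a \<in> carrier A \<Longrightarrow> b \<in> carrier A \<Longrightarrow> x \<in> carrier M \<Longrightarrow>
      b \<odot>\<^bsub>M\<^esub> (a \<odot>\<^bsub>M\<^esub> x) = (a \<otimes>\<^bsub>A\<^esub> b) \<odot>\<^bsub>M\<^esub> x"
    and act_one: "x \<in> carrier M \<Longrightarrow> \<one>\<^bsub>A\<^esub> \<odot>\<^bsub>M\<^esub> x = x"

definition rmod_hom ::
  "('k, 'a) module \<Rightarrow> ('a, 'm) module \<Rightarrow> ('a, 'n) module \<Rightarrow> ('m \<Rightarrow> 'n) set" where
  "rmod_hom A M N =
     {h \<in> carrier M \<rightarrow>\<^sub>E carrier N.
        (\<forall>x\<in>carrier M. \<forall>y\<in>carrier M. h (x \<oplus>\<^bsub>M\<^esub> y) = h x \<oplus>\<^bsub>N\<^esub> h y) \<and>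
        (\<forall>a\<in>carrier A. \<forall>x\<in>carrier M. h (a \<odot>\<^bsub>M\<^esub> x) = a \<odot>\<^bsub>N\<^esub> h x)}"

definition rmod_iso :: "('k, 'a) module \<Rightarrow> ('a, 'm) module \<Rightarrow> ('a, 'n) module \<Rightarrow> bool" where
  "rmod_iso A M N \<longleftrightarrow> (\<exists>h\<in>rmod_hom A M N. bij_betw h (carrier M) (carrier N))"

text \<open>
  The locale \<open>Module.submodule\<close> only asks for an additive subgroup that is stable under
  scalars, so it also applies to right modules over noncommutative rings.
\<close>

definition direct_sum_decomp ::
  "('k, 'a) module \<Rightarrow> ('a, 'm) module \<Rightarrow> 'm set \<Rightarrow> 'm set \<Rightarrow> bool" where
  "direct_sum_decomp A M X Y \<longleftrightarrow>
     Module.submodule X A M \<and> Module.submodule Y A M \<and>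
     X \<inter> Y = {\<zero>\<^bsub>M\<^esub>} \<and> X <+>\<^bsub>M\<^esub> Y = carrier M"

definition simple_rmod :: "('k, 'a) module \<Rightarrow> ('a, 'm) module \<Rightarrow> bool" where
  "simple_rmod A M \<longleftrightarrow> right_module A M \<and> carrier M \<noteq> {\<zero>\<^bsub>M\<^esub>} \<and>
     (\<forall>X. Module.submodule X A M \<longrightarrow> X = {\<zero>\<^bsub>M\<^esub>} \<or> X = carrier M)"

definition indecomposable_rmod :: "('k, 'a) module \<Rightarrow> ('a, 'm) module \<Rightarrow> bool" where
  "indecomposable_rmod A M \<longleftrightarrow> right_module A M \<and> carrier M \<noteq> {\<zero>\<^bsub>M\<^esub>} \<and>
     (\<forall>X Y. direct_sum_decomp A M X Y \<longrightarrow> X = {\<zero>\<^bsub>M\<^esub>} \<or> Y = {\<zero>\<^bsub>M\<^esub>})"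

definition free_rmod :: "('k, 'a) module \<Rightarrow> 'x set \<Rightarrow> ('a, 'x \<Rightarrow> 'a) module" where
  "free_rmod A B =
     \<lparr>carrier = {f. (\<forall>x. f x \<in> carrier A) \<and> finite {x. f x \<noteq> \<zero>\<^bsub>A\<^esub>} \<and>
                    (\<forall>x. x \<notin> B \<longrightarrow> f x = \<zero>\<^bsub>A\<^esub>)},
      mult = undefined, one = undefined,
      zero = (\<lambda>x. \<zero>\<^bsub>A\<^esub>), add = (\<lambda>f g x. f x \<oplus>\<^bsub>A\<^esub> g x),
      smult = (\<lambda>a f x. f x \<otimes>\<^bsub>A\<^esub> a)\<rparr>"

text \<open>
  Direct summand of a free module. Index sets in the type \<open>'m\<close> suffice: a projective module
  is a summand of the free module on its own elements.
\<close>
definition projective_rmod :: "('k, 'a) module \<Rightarrow> ('a, 'm) module \<Rightarrow> bool" where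
  "projective_rmod A M \<longleftrightarrow> right_module A M \<and>
     (\<exists>(B :: 'm set) X Y. direct_sum_decomp A (free_rmod A B) X Y \<and>
        rmod_iso A M ((free_rmod A B)\<lparr>carrier := X\<rparr>))"

definition quotient_rmod :: "('a, 'm) module \<Rightarrow> 'm set \<Rightarrow> ('a, 'm set) module" where
  "quotient_rmod M N =
     \<lparr>carrier = a_rcosets\<^bsub>M\<^esub> N, mult = undefined, one = undefined,
      zero = N, add = set_add M,
      smult = (\<lambda>a X. \<Union>x\<in>X. N +>\<^bsub>M\<^esub> (a \<odot>\<^bsub>M\<^esub> x))\<rparr>"

text \<open>The \<open>\<bbbK>\<close>-vector space underlying a right module over a \<open>\<bbbK>\<close>-algebra.\<close>

definition restrict_scalars ::
  "('k, 'a) module \<Rightarrow> ('a, 'm) module \<Rightarrow> ('k, 'm) module" where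
  "restrict_scalars A M =
     \<lparr>carrier = carrier M, mult = undefined, one = undefined,
      zero = zero M, add = add M,
      smult = (\<lambda>c x. (c \<odot>\<^bsub>A\<^esub> \<one>\<^bsub>A\<^esub>) \<odot>\<^bsub>M\<^esub> x)\<rparr>"

definition is_subalgebra :: "'a set \<Rightarrow> ('k, 'a) module \<Rightarrow> bool" where
  "is_subalgebra B A \<longleftrightarrow> B \<subseteq> carrier A \<and> \<one>\<^bsub>A\<^esub> \<in> B \<and>
     (\<forall>x\<in>B. \<forall>y\<in>B. x \<oplus>\<^bsub>A\<^esub> y \<in> B \<and> x \<otimes>\<^bsub>A\<^esub> y \<in> B) \<and> (\<forall>c. \<forall>x\<in>B. c \<odot>\<^bsub>A\<^esub> x \<in> B)"

definition generated_subalgebra :: "('k, 'a) module \<Rightarrow> 'a set \<Rightarrow> 'a set" where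
  "generated_subalgebra A X = \<Inter>{B. is_subalgebra B A \<and> X \<subseteq> B}"

definition generated_submonoid :: "('k, 'a) module \<Rightarrow> 'a set \<Rightarrow> 'a set" where
  "generated_submonoid A X = \<Inter>{N. submonoid N A \<and> X \<subseteq> N}"

definition algebra_iso :: "('k, 'a) module \<Rightarrow> ('k, 'b) module \<Rightarrow> bool" where
  "algebra_iso A B \<longleftrightarrow>
     (\<exists>h\<in>ring_iso A B. \<forall>c. \<forall>x\<in>carrier A. h (c \<odot>\<^bsub>A\<^esub> x) = c \<odot>\<^bsub>B\<^esub> h x)"

text \<open>Operators act on the right: \<open>f \<otimes> g\<close> is \<open>f\<close> followed by \<open>g\<close>.\<close>

definition endo_algebra :: "('k, 'v) module \<Rightarrow> ('k, 'v \<Rightarrow> 'v) module" where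
  "endo_algebra V =
     \<lparr>carrier = {f \<in> carrier V \<rightarrow>\<^sub>E carrier V.
         (\<forall>x\<in>carrier V. \<forall>y\<in>carrier V. f (x \<oplus>\<^bsub>V\<^esub> y) = f x \<oplus>\<^bsub>V\<^esub> f y) \<and>
         (\<forall>c. \<forall>x\<in>carrier V. f (c \<odot>\<^bsub>V\<^esub> x) = c \<odot>\<^bsub>V\<^esub> f x)},
      mult = (\<lambda>f g. compose (carrier V) g f), one = (\<lambda>x\<in>carrier V. x),
      zero = (\<lambda>x\<in>carrier V. \<zero>\<^bsub>V\<^esub>), add = (\<lambda>f g. \<lambda>x\<in>carrier V. f x \<oplus>\<^bsub>V\<^esub> g x),
      smult = (\<lambda>c f. \<lambda>x\<in>carrier V. c \<odot>\<^bsub>V\<^esub> f x)\<rparr>"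

text \<open>
  For a finite preorder \<open>R\<close>: the algebra with basis \<open>R\<close> and product
  \<open>(u, v) (v', x) = \<delta>\<^bsub>v v'\<^esub> (u, x)\<close>. The element \<open>\<Sum> c\<^bsub>uv\<^esub> (u, v)\<close> is represented by its
  coefficient function.
\<close>
definition pair_algebra :: "('v \<times> 'v) set \<Rightarrow> ('k::field, 'v \<times> 'v \<Rightarrow> 'k) module" where
  "pair_algebra R =
     \<lparr>carrier = {f. \<forall>p. p \<notin> R \<longrightarrow> f p = 0},
      mult = (\<lambda>f g (u, x). \<Sum>v | (u, v) \<in> R \<and> (v, x) \<in> R. f (u, v) * g (v, x)),
      one = (\<lambda>(u, v). if u = v \<and> (u, v) \<in> R then 1 else 0),
      zero = (\<lambda>p. 0), add = (\<lambda>f g p. f p + g p), smult = (\<lambda>c f p. c * f p)\<rparr>"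

definition digraph_algebra ::
  "'v set \<Rightarrow> ('v \<times> 'v) set \<Rightarrow> ('k::field, 'v \<times> 'v \<Rightarrow> 'k) module" where
  "digraph_algebra V E = pair_algebra {(u, v). u \<in> V \<and> v \<in> V \<and> (u, v) \<in> E\<^sup>*}"

text \<open>Here \<open>r y x\<close> means \<open>y \<le> x\<close>, and the basis consists of the pairs \<open>(x, y)\<close> with \<open>y \<le> x\<close>.\<close>

definition poset_algebra ::
  "'v set \<Rightarrow> ('v \<Rightarrow> 'v \<Rightarrow> bool) \<Rightarrow> ('k::field, 'v \<times> 'v \<Rightarrow> 'k) module" where
  "poset_algebra V r = pair_algebra {(x, y). x \<in> V \<and> y \<in> V \<and> r y x}"


section \<open>Morita equivalence\<close>

text \<open>
  The category of right \<open>A\<close>-modules whose carrier is a set of elements of a type \<open>'u\<close>; the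
  morphisms are \<^const>\<open>rmod_hom\<close>.
\<close>

record ('a, 'b, 'u) rmod_map =
  fobj :: "('a, 'u) module \<Rightarrow> ('b, 'u) module"
  fmor :: "('a, 'u) module \<Rightarrow> ('a, 'u) module \<Rightarrow> ('u \<Rightarrow> 'u) \<Rightarrow> ('u \<Rightarrow> 'u)"

definition linear_functor ::
  "('k, 'a) module \<Rightarrow> ('k, 'b) module \<Rightarrow> ('a, 'b, 'u) rmod_map \<Rightarrow> bool" where
  "linear_functor A B F \<longleftrightarrow>
     (\<forall>M. right_module A M \<longrightarrow> right_module B (fobj F M)) \<and>
     (\<forall>M N f. right_module A M \<longrightarrow> right_module A N \<longrightarrow> f \<in> rmod_hom A M N \<longrightarrow>
        fmor F M N f \<in> rmod_hom B (fobj F M) (fobj F N)) \<and>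
     (\<forall>M. right_module A M \<longrightarrow>
        fmor F M M (\<lambda>x\<in>carrier M. x) = (\<lambda>x\<in>carrier (fobj F M). x)) \<and>
     (\<forall>L M N f g. right_module A L \<longrightarrow> right_module A M \<longrightarrow> right_module A N \<longrightarrow>
        f \<in> rmod_hom A L M \<longrightarrow> g \<in> rmod_hom A M N \<longrightarrow>
        fmor F L N (compose (carrier L) g f) =
          compose (carrier (fobj F L)) (fmor F M N g) (fmor F L M f)) \<and>
     (\<forall>M N f g. right_module A M \<longrightarrow> right_module A N \<longrightarrow>
        f \<in> rmod_hom A M N \<longrightarrow> g \<in> rmod_hom A M N \<longrightarrow>
        fmor F M N (\<lambda>x\<in>carrier M. f x \<oplus>\<^bsub>N\<^esub> g x) =
          (\<lambda>x\<in>carrier (fobj F M). fmor F M N f x \<oplus>\<^bsub>fobj F N\<^esub> fmor F M N g x)) \<and>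
     (\<forall>M N f c. right_module A M \<longrightarrow> right_module A N \<longrightarrow> f \<in> rmod_hom A M N \<longrightarrow>
        fmor F M N (\<lambda>x\<in>carrier M. (c \<odot>\<^bsub>A\<^esub> \<one>\<^bsub>A\<^esub>) \<odot>\<^bsub>N\<^esub> f x) =
          (\<lambda>x\<in>carrier (fobj F M). (c \<odot>\<^bsub>B\<^esub> \<one>\<^bsub>B\<^esub>) \<odot>\<^bsub>fobj F N\<^esub> fmor F M N f x))"

text \<open>\<open>\<eta>\<close> is a natural isomorphism from \<open>G \<circ> F\<close> to the identity functor.\<close>

definition nat_iso_id ::
  "('k, 'a) module \<Rightarrow> ('a, 'b, 'u) rmod_map \<Rightarrow> ('b, 'a, 'u) rmod_map \<Rightarrow>
   (('a, 'u) module \<Rightarrow> 'u \<Rightarrow> 'u) \<Rightarrow> bool" where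
  "nat_iso_id A F G \<eta> \<longleftrightarrow>
     (\<forall>M. right_module A M \<longrightarrow>
        \<eta> M \<in> rmod_hom A (fobj G (fobj F M)) M \<and>
        bij_betw (\<eta> M) (carrier (fobj G (fobj F M))) (carrier M)) \<and>
     (\<forall>M N f. right_module A M \<longrightarrow> right_module A N \<longrightarrow> f \<in> rmod_hom A M N \<longrightarrow>
        compose (carrier (fobj G (fobj F M))) (\<eta> N)
            (fmor G (fobj F M) (fobj F N) (fmor F M N f)) =
          compose (carrier (fobj G (fobj F M))) f (\<eta> M))"

text \<open>
  \<open>\<bbbK>\<close>-linear equivalence of the categories of right modules. HOL has no category of all
  modules, so the universe \<open>'u\<close> from which carriers are drawn is a parameter; the theorem is
  meant for every infinite type \<open>'u\<close>. Infinity is needed: over a finite field, the modules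
  that fit into a finite type need not correspond under a Morita equivalence.
\<close>
definition morita_equivalent ::
  "'u::infinite itself \<Rightarrow> ('k, 'a) module \<Rightarrow> ('k, 'b) module \<Rightarrow> bool" where
  "morita_equivalent U A B \<longleftrightarrow>
     (\<exists>(F :: ('a, 'b, 'u) rmod_map) (G :: ('b, 'a, 'u) rmod_map) \<eta> \<epsilon>.
        linear_functor A B F \<and> linear_functor B A G \<and>
        nat_iso_id A F G \<eta> \<and> nat_iso_id B G F \<epsilon>)"


section \<open>The translation module and the \<open>w\<close>-biHecke algebra\<close>

type_synonym ('k, 'w) operator = "('w \<Rightarrow> 'k) \<Rightarrow> ('w \<Rightarrow> 'k)"

text \<open>\<open>T\<^sub>w\<close>: functions supported on \<open>[1, w]\<^sub>R\<close>, with the basis vector \<open>u\<close> being \<open>bvec u\<close>.\<close>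

definition bvec :: "'w \<Rightarrow> 'w \<Rightarrow> 'k::field" where
  "bvec u = (\<lambda>v. if v = u then 1 else 0)"

definition T_space :: "('w, 'i) coxeter \<Rightarrow> 'w \<Rightarrow> ('k::field, 'w \<Rightarrow> 'k) module" where
  "T_space W w =
     \<lparr>carrier = {x. \<forall>u. u \<notin> right_interval W w \<longrightarrow> x u = 0},
      mult = undefined, one = undefined,
      zero = (\<lambda>u. 0), add = (\<lambda>x y u. x u + y u), smult = (\<lambda>c x u. c * x u)\<rparr>"

definition lin_ext ::
  "('w, 'i) coxeter \<Rightarrow> 'w \<Rightarrow> ('w \<Rightarrow> 'w \<Rightarrow> 'k::field) \<Rightarrow> ('k, 'w) operator" where
  "lin_ext W w \<phi> =
     (\<lambda>x\<in>carrier (T_space W w). \<lambda>v. \<Sum>u\<in>right_interval W w. x u * \<phi> u v)"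

definition pi_op :: "('w, 'i) coxeter \<Rightarrow> 'w \<Rightarrow> 'i \<Rightarrow> ('k::field, 'w) operator" where
  "pi_op W w i = lin_ext W w (\<lambda>u.
     if i \<in> right_descents W u then bvec u
     else if u \<otimes>\<^bsub>W\<^esub> simple_refl W i \<in> right_interval W w then bvec (u \<otimes>\<^bsub>W\<^esub> simple_refl W i)
     else (\<lambda>v. 0))"

definition pibar_op :: "('w, 'i) coxeter \<Rightarrow> 'w \<Rightarrow> 'i \<Rightarrow> ('k::field, 'w) operator" where
  "pibar_op W w i = lin_ext W w (\<lambda>u.
     if u \<otimes>\<^bsub>W\<^esub> simple_refl W i \<in> right_interval W w
     then (if i \<in> right_descents W u then bvec (u \<otimes>\<^bsub>W\<^esub> simple_refl W i) else bvec u)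
     else (\<lambda>v. 0))"

definition bihecke ::
  "('w, 'i) coxeter \<Rightarrow> 'w \<Rightarrow> ('k::field, ('k, 'w) operator) module" where
  "bihecke W w = (endo_algebra (T_space W w))
     \<lparr>carrier := generated_subalgebra (endo_algebra (T_space W w))
        (pi_op W w ` gens W \<union> pibar_op W w ` gens W)\<rparr>"

definition s_op :: "('w, 'i) coxeter \<Rightarrow> 'w \<Rightarrow> 'i \<Rightarrow> ('k::field, 'w) operator" where
  "s_op W w i =
     (pi_op W w i \<oplus>\<^bsub>bihecke W w\<^esub> pibar_op W w i) \<ominus>\<^bsub>bihecke W w\<^esub> \<one>\<^bsub>bihecke W w\<^esub>"

definition F_monoid :: "('w, 'i) coxeter \<Rightarrow> 'w \<Rightarrow> ('k::field, 'w) operator set" where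
  "F_monoid W w = generated_submonoid (bihecke W w)
     (pi_op W w ` gens W \<union> pibar_op W w ` gens W \<union> s_op W w ` gens W)"

definition sends :: "('k::field, 'w) operator \<Rightarrow> 'w \<Rightarrow> 'w \<Rightarrow> bool" where
  "sends f x y \<longleftrightarrow> f (bvec x) = bvec y \<or> f (bvec x) = (\<lambda>v. - bvec y v)"

text \<open>
  Elements of the monoid may annihilate basis vectors, so up to signs they are partial
  functions on \<open>[1, w]\<^sub>R\<close>; annihilated elements contribute nothing to image and preimages.
\<close>
definition triangular ::
  "('w, 'i) coxeter \<Rightarrow> 'w \<Rightarrow> 'w \<Rightarrow> 'w \<Rightarrow> ('k::field, 'w) operator \<Rightarrow> bool" where
  "triangular W w u v f \<longleftrightarrow>
     (let im = {y \<in> right_interval W w. \<exists>x\<in>right_interval W w. sends f x y};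
          pre = {x \<in> right_interval W w. sends f x v}
      in {y \<in> im. \<forall>z\<in>im. bruhat_le W z y \<longrightarrow> z = y} = {v} \<and>
         {x \<in> pre. \<forall>z\<in>pre. bruhat_le W x z \<longrightarrow> z = x} = {u})"

definition G_edges :: "('w, 'i) coxeter \<Rightarrow> 'w \<Rightarrow> ('w \<times> 'w) set" where
  "G_edges W w = {(u, v). u \<in> right_interval W w \<and> v \<in> right_interval W w \<and>
     (\<exists>i\<in>gens W. u = v \<otimes>\<^bsub>W\<^esub> simple_refl W i) \<and> left_block_of W w u \<subseteq> left_block_of W w v}"


section \<open>The modules \<open>P\<^sub>J\<close> and \<open>S\<^sub>J\<close>\<close>

definition left_op :: "('w, 'i) coxeter \<Rightarrow> 'w \<Rightarrow> 'w \<Rightarrow> ('k::field, 'w) operator" where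
  "left_op W w t = lin_ext W w (\<lambda>u.
     if t \<otimes>\<^bsub>W\<^esub> u \<in> right_interval W w then bvec (t \<otimes>\<^bsub>W\<^esub> u) else (\<lambda>v. - bvec u v))"

definition reflections :: "('w, 'i) coxeter \<Rightarrow> 'i set \<Rightarrow> 'w set" where
  "reflections W J =
     {a \<otimes>\<^bsub>W\<^esub> simple_refl W j \<otimes>\<^bsub>W\<^esub> inv\<^bsub>W\<^esub> a | a j. a \<in> parabolic W J \<and> j \<in> J}"

text \<open>
  \<open>P\<^sub>J\<close> as a subspace. Antisymmetry \<open>t . v = - v\<close> is imposed for all reflections \<open>t\<close> of \<open>W\<^sub>J\<close>,
  whereas the source states it for the simple ones \<open>s\<^sub>i\<close>, \<open>i \<in> J\<close>, only. For \<open>w\<close> the longest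
  element the two conditions agree. For other \<open>w\<close> the simple reflections do not suffice,
  and the space they define need not be stable under the action: for \<open>w = s\<^sub>1 s\<^sub>2\<close> in type
  \<open>A\<^sub>2\<close> and the reduced left block \<open>J = {1, 2}\<close> one has \<open>[1, w]\<^sub>R = {1, s\<^sub>1, s\<^sub>1 s\<^sub>2}\<close>, and one would
  get the span of \<open>1 - s\<^sub>1\<close> and \<open>s\<^sub>1 s\<^sub>2\<close>, while \<open>pibar_op\<close> of index \<open>2\<close> maps \<open>s\<^sub>1 s\<^sub>2\<close> to \<open>s\<^sub>1\<close>.
  The definition below gives the span of \<open>1 - s\<^sub>1 + s\<^sub>1 s\<^sub>2\<close>, which is stable.
\<close>
definition left_antisym :: "('w, 'i) coxeter \<Rightarrow> 'w \<Rightarrow> 'i set \<Rightarrow> ('w \<Rightarrow> 'k::field) set" where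
  "left_antisym W w J = {v \<in> carrier (T_space W w).
     \<forall>t\<in>reflections W J. left_op W w t v = (\<lambda>u. - v u)}"

definition T_rmod :: "('w, 'i) coxeter \<Rightarrow> 'w \<Rightarrow> (('k::field, 'w) operator, 'w \<Rightarrow> 'k) module" where
  "T_rmod W w =
     \<lparr>carrier = carrier (T_space W w), mult = undefined, one = undefined,
      zero = zero (T_space W w), add = add (T_space W w), smult = (\<lambda>f x. f x)\<rparr>"

definition P_rmod ::
  "('w, 'i) coxeter \<Rightarrow> 'w \<Rightarrow> 'i set \<Rightarrow> (('k::field, 'w) operator, 'w \<Rightarrow> 'k) module" where
  "P_rmod W w J = (T_rmod W w)\<lparr>carrier := left_antisym W w J\<rparr>"

definition P_above :: "('w, 'i) coxeter \<Rightarrow> 'w \<Rightarrow> 'i set \<Rightarrow> ('w \<Rightarrow> 'k::field) set" where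
  "P_above W w J =
     (let X = {J' \<in> reduced_left_blocks W w. J \<subset> J'}
      in {finsum (T_space W w) p X | p. \<forall>J'\<in>X. p J' \<in> left_antisym W w J'})"

definition S_rmod ::
  "('w, 'i) coxeter \<Rightarrow> 'w \<Rightarrow> 'i set \<Rightarrow> (('k::field, 'w) operator, ('w \<Rightarrow> 'k) set) module" where
  "S_rmod W w J = quotient_rmod (P_rmod W w J) (P_above W w J)"

end

theory Submission
  imports Defs
begin

text \<open>
  Right multiplication is compatible with left reflections on each coset \<open>W\<^sub>J x\<close>, so the operators
  of the algebra preserve every \<open>P\<^sub>J\<close>. The alternating sums over \<open>W\<^bsub>J(u)\<^esub> u\<close> form a basis of \<open>T\<^sub>w\<close>
  adapted to all the \<open>P\<^sub>J\<close> at once; in it, the operators preserving all \<open>P\<^sub>J\<close> are the matrices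
  supported on the pairs with \<open>J(u) \<subseteq> J(v)\<close>. Conversely each such pair has a Bruhat-triangular
  operator in \<open>F\<close>; these are linearly independent and exhaust the dimension, so the algebra is the
  whole stabiliser, an incidence algebra of a preorder. The rest is the module theory of such algebras.
\<close>

text \<open>Where J(u) and the cutting points come from: along a block J of w every inversion set
  splits into its part inside W_J and its part outside. With w = b v and v the cutting point, this
  makes [1,w]_R a product of [1,b]_R and [1,v]_R; lying below v then means having no left descent in
  J. Reduced blocks are closed under union, so each u has a largest one. The hard direction is to
  produce a triangular operator for each admissible pair. The s_i permute the basis up to sign but
  need not respect Bruhat order; the pi_i respect it but only climb. Undoing u by the s_i and
  climbing to v by the pi_i works as long as v has no left descent outside those of u. If every
  ascent creates a new left descent, one is at a cutting point or has to leave a coset x W_K = W_J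
  x, and then the truncation of T_w is the decisive help: pi_i annihilates whatever would leave the
  interval. From a cutting point all elements below it are reached by the s_i alone. The preorder
  J(u) <= J(v) is not antisymmetric, so in the module theory vertices count only up to equivalence,
  and a cutting point serves as the representative of its descent class.\<close>

lemma card_shift2:
  fixes e :: "nat \<Rightarrow> 'a"
  shows "card {k. k < 2 * Suc n \<and> t = e k} = (if t = e 0 then 1 else 0) +
    (if t = e 1 then 1 else 0) + card {k. k < 2 * n \<and> t = e (Suc (Suc k))}"
proof -
  have 1: "{k. k < 2 * Suc n \<and> t = e k} =
      (if t = e 0 then {0} else {}) \<union> (if t = e 1 then {1} else {}) \<union>
      (\<lambda>k. Suc (Suc k)) ` {k. k < 2 * n \<and> t = e (Suc (Suc k))}" (is "?L = ?A \<union> ?B \<union> ?C")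
  proof (intro Set.set_eqI iffI, goal_cases)
    case (1 k)
    consider "k = 0" | "k = 1" | k' where "k = Suc (Suc k')" by (metis One_nat_def not0_implies_Suc)
    thus ?case using 1 by cases auto
  qed (auto split: if_splits)
  have "card ?L = card (?A \<union> ?B) + card ?C" unfolding 1 by (rule card_Un_disjoint) auto
  also have "card (?A \<union> ?B) = card ?A + card ?B" by (rule card_Un_disjoint) auto
  also have "card ?C = card {k. k < 2 * n \<and> t = e (Suc (Suc k))}"
    by (rule card_image) (auto simp: inj_on_def)
  finally have c: "card ?L = card ?A + card ?B + card {k. k < 2 * n \<and> t = e (Suc (Suc k))}" .
  thus ?thesis by simp
qed

section \<open>Coxeter groups: reflections and the parity cocycle\<close>

locale coxeter_system =
  fixes W :: "('w, 'i) coxeter" (structure)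
  assumes coxeter: "coxeter_group W"
begin

declare in_listsD [rule del] in_listsI [rule del]

abbreviation "s \<equiv> simple_refl W"
abbreviation "I \<equiv> gens W"
abbreviation "l \<equiv> cox_len W"
abbreviation "wp \<equiv> word_prod W"
abbreviation "G \<equiv> carrier W"
abbreviation cox_mult (infixl "\<cdot>" 70) where "x \<cdot> y \<equiv> x \<otimes> y"
abbreviation "par \<equiv> parabolic W"
abbreviation "rdes \<equiv> right_descents W"
abbreviation "red \<equiv> reduced_word W"
abbreviation "rle \<equiv> right_le W"
abbreviation "brle \<equiv> bruhat_le W"

sublocale group W
  using coxeter by (simp add: coxeter_group_def)

lemma s_closed [simp]: "i \<in> I \<Longrightarrow> s i \<in> G"
  using coxeter by (auto simp: coxeter_group_def)

lemma s_inj: "i \<in> I \<Longrightarrow> j \<in> I \<Longrightarrow> s i = s j \<longleftrightarrow> i = j"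
  using coxeter by (auto simp: coxeter_group_def inj_on_def)

lemma s_sq [simp]: "i \<in> I \<Longrightarrow> s i \<cdot> s i = \<one>"
  using coxeter pow_ord_eq_1[of "s i"]
  by (auto simp: coxeter_group_def numeral_2_eq_2)

lemma s_inv [simp]: "i \<in> I \<Longrightarrow> inv (s i) = s i"
  by (simp add: inv_equality)

lemma s_cancel [simp]: "i \<in> I \<Longrightarrow> x \<in> G \<Longrightarrow> s i \<cdot> (s i \<cdot> x) = x"
  by (metis s_closed s_sq m_assoc l_one)

lemma s_cancel_right [simp]: "i \<in> I \<Longrightarrow> x \<in> G \<Longrightarrow> x \<cdot> s i \<cdot> s i = x"
  by (metis s_closed s_sq m_assoc r_one)

lemma inv_cancel [simp]: "x \<in> G \<Longrightarrow> y \<in> G \<Longrightarrow> inv x \<cdot> (x \<cdot> y) = y"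
  by (metis inv_closed l_inv l_one m_assoc)

lemma inv_cancel' [simp]: "x \<in> G \<Longrightarrow> y \<in> G \<Longrightarrow> x \<cdot> (inv x \<cdot> y) = y"
  by (metis inv_closed r_inv l_one m_assoc)

lemma left_cancel: "x \<in> G \<Longrightarrow> y \<in> G \<Longrightarrow> z \<in> G \<Longrightarrow> x \<cdot> y = x \<cdot> z \<longleftrightarrow> y = z"
  by (metis inv_cancel)

lemma right_cancel: "x \<in> G \<Longrightarrow> y \<in> G \<Longrightarrow> z \<in> G \<Longrightarrow> y \<cdot> x = z \<cdot> x \<longleftrightarrow> y = z"
  by (metis inv_closed m_assoc r_inv r_one)

lemma wp_Nil [simp]: "wp [] = \<one>"
  by (simp add: word_prod_def)

lemma wp_Cons [simp]: "wp (i # xs) = s i \<cdot> wp xs"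
  by (simp add: word_prod_def)

lemma wp_closed [simp]: "xs \<in> lists I \<Longrightarrow> wp xs \<in> G"
  by (induction xs) auto

lemma wp_append: "xs \<in> lists I \<Longrightarrow> ys \<in> lists I \<Longrightarrow> wp (xs @ ys) = wp xs \<cdot> wp ys"
  by (induction xs) (auto simp: m_assoc)

lemma rev_lists: "xs \<in> lists A \<Longrightarrow> rev xs \<in> lists A"
  by (induction xs) auto

lemma wp_rev: "xs \<in> lists I \<Longrightarrow> wp (rev xs) = inv (wp xs)"
proof (induction xs)
  case (Cons i xs)
  hence "rev xs \<in> lists I" using rev_lists by auto
  thus ?case using Cons by (simp add: wp_append inv_mult_group)
qed simp

lemma wp_in_generate: "J \<subseteq> I \<Longrightarrow> xs \<in> lists J \<Longrightarrow> wp xs \<in> generate W (s ` J)"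
  by (induction xs) (auto intro: generate.intros)

lemma generate_word:
  assumes "J \<subseteq> I" "x \<in> generate W (s ` J)"
  shows "\<exists>xs\<in>lists J. wp xs = x"
  using assms(2)
proof (induction rule: generate.induct)
  case one
  thus ?case by (intro bexI[of _ "[]"]) auto
next
  case (incl h)
  then obtain j where "j \<in> J" "h = s j" by auto
  thus ?case using assms(1) by (intro bexI[of _ "[j]"]) auto
next
  case (inv h)
  then obtain j where "j \<in> J" "h = s j" by auto
  thus ?case using assms(1) by (intro bexI[of _ "[j]"]) auto
next
  case (eng h1 h2)
  then obtain xs ys where "xs \<in> lists J" "ys \<in> lists J" "wp xs = h1" "wp ys = h2" by auto
  moreover from this have "xs \<in> lists I" "ys \<in> lists I" using assms(1) lists_mono by blast+
  ultimately show ?case by (intro bexI[of _ "xs @ ys"]) (auto simp: wp_append)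
qed

lemma word_exists: "x \<in> G \<Longrightarrow> \<exists>xs\<in>lists I. wp xs = x"
  using generate_word[of I x] coxeter by (auto simp: coxeter_group_def)

text \<open>Conjugation is written as a right action, so that the letters of a word act in reading
  order (\<open>conj_mult\<close>).\<close>

definition conj :: "'w \<Rightarrow> 'w \<Rightarrow> 'w" where
  "conj x t = inv x \<cdot> t \<cdot> x"

lemma conj_closed [simp]: "x \<in> G \<Longrightarrow> t \<in> G \<Longrightarrow> conj x t \<in> G"
  by (simp add: conj_def)

lemma conj_mult: "x \<in> G \<Longrightarrow> y \<in> G \<Longrightarrow> t \<in> G \<Longrightarrow> conj (x \<cdot> y) t = conj y (conj x t)"
  by (simp add: conj_def inv_mult_group m_assoc)

lemma conj_one [simp]: "t \<in> G \<Longrightarrow> conj \<one> t = t"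
  by (simp add: conj_def)

lemma conj_inv [simp]: "x \<in> G \<Longrightarrow> t \<in> G \<Longrightarrow> conj x (conj (inv x) t) = t"
  by (simp add: conj_def m_assoc)

lemma conj_inv' [simp]: "x \<in> G \<Longrightarrow> t \<in> G \<Longrightarrow> conj (inv x) (conj x t) = t"
  by (simp add: conj_def m_assoc)

lemma conj_s: "i \<in> I \<Longrightarrow> conj (s i) t = s i \<cdot> t \<cdot> s i"
  by (simp add: conj_def)

lemma mult_conj: "x \<in> G \<Longrightarrow> t \<in> G \<Longrightarrow> x \<cdot> conj x t = t \<cdot> x"
  by (simp add: conj_def m_assoc)

lemma conj_eq_iff: "x \<in> G \<Longrightarrow> t \<in> G \<Longrightarrow> u \<in> G \<Longrightarrow> conj x t = u \<longleftrightarrow> t \<cdot> x = x \<cdot> u"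
  using left_cancel[of x "conj x t" u] by (simp add: mult_conj)

text \<open>
  Parity of the number of occurrences of \<open>t\<close> in the sequence of reflections
  \<open>i\<^sub>1, i\<^sub>1 i\<^sub>2 i\<^sub>1, \<dots>\<close> of a word. It depends only on the product of the word because it
  vanishes on the defining relations.
\<close>
fun odd_refl :: "'i list \<Rightarrow> 'w \<Rightarrow> bool" where
  "odd_refl [] t = False"
| "odd_refl (i # xs) t = ((t = s i) \<noteq> odd_refl xs (conj (s i) t))"

text \<open>The cocycle rule: the reflections contributed by the second word are those of that word
  alone, conjugated by the product of the first.\<close>

lemma odd_refl_append:
  "xs \<in> lists I \<Longrightarrow> ys \<in> lists I \<Longrightarrow> t \<in> G \<Longrightarrow>
     odd_refl (xs @ ys) t = (odd_refl xs t \<noteq> odd_refl ys (conj (wp xs) t))"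
  by (induction xs arbitrary: t) (auto simp: conj_mult)

text \<open>With r = s_i s_j, the reflections of the word (i j)^n are r^k s_i for k < 2n. Passing
  the first pair of letters conjugates by r, and this moves the list by two places.\<close>

lemma odd_refl_braid:
  assumes ij: "i \<in> I" "j \<in> I" and t: "t \<in> G"
  shows "odd_refl (concat (replicate n [i, j])) t =
    odd (card {k. k < 2 * n \<and> t = (s i \<cdot> s j) [^] k \<cdot> s i})"
  using t
proof (induction n arbitrary: t)
  case (Suc n)
  let ?r = "s i \<cdot> s j"
  let ?e = "\<lambda>k::nat. ?r [^] k \<cdot> s i"
  have r: "?r \<in> G" using ij by simp
  have sr: "inv ?r = s j \<cdot> s i" using ij by (simp add: inv_mult_group)
  \<comment> \<open>Since r s_i r = s_i, conjugating r^(k+2) s_i by r gives r^k s_i.\<close>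
  have shift: "conj ?r t = ?e k \<longleftrightarrow> t = ?e (Suc (Suc k))" for k
  proof -
    have "?r \<cdot> (s i \<cdot> ?r) = s i" using ij by (simp add: m_assoc)
    hence "?e (Suc (Suc k)) \<cdot> ?r = ?r [^] Suc k \<cdot> s i" using ij r by (simp add: m_assoc)
    also have "\<dots> = ?r \<cdot> ?e k" unfolding nat_pow_Suc2[OF r] using ij r by (simp add: m_assoc)
    finally have e: "?e (Suc (Suc k)) \<cdot> ?r = ?r \<cdot> ?e k" .
    have "conj ?r t = ?e k \<longleftrightarrow> t \<cdot> ?r = ?r \<cdot> ?e k" by (rule conj_eq_iff) (use ij Suc.prems in auto)
    also have "\<dots> \<longleftrightarrow> t = ?e (Suc (Suc k))"
      unfolding e[symmetric] by (rule right_cancel) (use ij r Suc.prems in auto)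
    finally show ?thesis .
  qed
  note c = card_shift2[of n t ?e]
  have e1: "?e 1 = s i \<cdot> (s j \<cdot> s i)" using ij by (simp add: m_assoc)
  have 2: "conj (s i) t = s j \<longleftrightarrow> t = ?e 1"
  proof -
    have "conj (s i) t = s j \<longleftrightarrow> t \<cdot> s i = s i \<cdot> s j" by (rule conj_eq_iff) (use ij Suc.prems in auto)
    also have "s i \<cdot> s j = ?e 1 \<cdot> s i" unfolding e1 using ij by (simp add: m_assoc)
    also have "t \<cdot> s i = ?e 1 \<cdot> s i \<longleftrightarrow> t = ?e 1" by (rule right_cancel) (use ij Suc.prems in auto)
    finally show ?thesis .
  qed
  have 3: "odd_refl (concat (replicate n [i, j])) (conj ?r t) =
     odd (card {k. k < 2 * n \<and> t = ?e (Suc (Suc k))})"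
    using Suc.IH[of "conj ?r t"] Suc.prems ij shift by simp
  have "odd_refl (concat (replicate (Suc n) [i, j])) t =
     ((t = ?e 0) \<noteq> ((t = ?e 1) \<noteq> odd (card {k. k < 2 * n \<and> t = ?e (Suc (Suc k))})))"
    using 3 ij Suc.prems 2 by (simp add: conj_mult)
  thus ?case unfolding c by simp
qed simp

text \<open>If m is the order of r = s_i s_j, the list r^k s_i, k < 2m, runs twice through the same
  m entries, so every reflection occurs an even number of times. For infinite order m is 0 and the
  word is empty.\<close>

lemma odd_refl_relation:
  assumes ij: "i \<in> I" "j \<in> I" and t: "t \<in> G"
  shows "\<not> odd_refl (concat (replicate (ord (s i \<cdot> s j)) [i, j])) t"
proof -
  let ?r = "s i \<cdot> s j" and ?m = "ord (s i \<cdot> s j)"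
  let ?S = "{k. k < ?m \<and> t = ?r [^] k \<cdot> s i}"
  have r: "?r \<in> G" using ij by simp
  have per: "?r [^] (k + ?m) = ?r [^] k" for k using r by (simp add: nat_pow_mult[symmetric])
  have "{k. k < 2 * ?m \<and> t = ?r [^] k \<cdot> s i} = ?S \<union> (\<lambda>k. k + ?m) ` ?S"
  proof (intro Set.set_eqI iffI, goal_cases)
    case (1 k)
    hence k: "k \<in> {k. k < 2 * ?m \<and> t = ?r [^] k \<cdot> s i}" .
    show "k \<in> ?S \<union> (\<lambda>k. k + ?m) ` ?S"
    proof (cases "k < ?m")
      case False
      hence "k = (k - ?m) + ?m" "k - ?m < ?m" using k by auto
      moreover have "?r [^] (k - ?m) = ?r [^] k" using per[of "k - ?m"] False by simp
      ultimately show ?thesis using k by (intro UnI2 image_eqI[of _ _ "k - ?m"]) auto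
    qed (use k in auto)
  qed (auto simp: per)
  moreover have "card (?S \<union> (\<lambda>k. k + ?m) ` ?S) = card ?S + card ((\<lambda>k. k + ?m) ` ?S)"
    by (rule card_Un_disjoint) auto
  moreover have "card ((\<lambda>k. k + ?m) ` ?S) = card ?S" by (rule card_image) (auto simp: inj_on_def)
  ultimately show ?thesis using odd_refl_braid[OF ij t] by simp
qed

lemma concat_replicate_lists: "i \<in> I \<Longrightarrow> j \<in> I \<Longrightarrow> concat (replicate n [i, j]) \<in> lists I"
  by (induction n) auto

lemma wp_relation:
  "i \<in> I \<Longrightarrow> j \<in> I \<Longrightarrow> wp (concat (replicate (ord (s i \<cdot> s j)) [i, j])) = \<one>"
proof -
  assume ij: "i \<in> I" "j \<in> I"
  have "wp (concat (replicate n [i, j])) = (s i \<cdot> s j) [^] n" for n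
  proof (induction n)
    case (Suc n)
    thus ?case using ij nat_pow_Suc2[of "s i \<cdot> s j" n] by (simp add: m_assoc del: nat_pow_Suc)
  qed simp
  thus ?thesis using ij by simp
qed

lemma odd_refl_cong:
  assumes "cox_cong I (\<lambda>i j. ord (s i \<cdot> s j)) xs ys" "t \<in> G"
  shows "odd_refl xs t = odd_refl ys t"
  using assms
proof (induction rule: cox_cong.induct)
  case (cong_rel xs ys i j)
  let ?u = "concat (replicate (ord (s i \<cdot> s j)) [i, j])"
  have u: "?u \<in> lists I" using cong_rel concat_replicate_lists by blast
  have "?u @ ys \<in> lists I" using u cong_rel by simp
  thus ?case using cong_rel u odd_refl_relation[OF cong_rel(3,4)]
    by (simp add: odd_refl_append wp_relation)
qed auto

lemma odd_refl_wp:
  assumes "xs \<in> lists I" "ys \<in> lists I" "wp xs = wp ys" "t \<in> G"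
  shows "odd_refl xs t = odd_refl ys t"
  using odd_refl_cong[of xs ys t] assms coxeter by (auto simp: coxeter_group_def)

text \<open>The inversion set of x, that is the reflections t with l(tx) < l(x) (see
  \<open>len_refl_less\<close>). The chosen word is irrelevant by \<open>N_wp\<close>, because the
  parity vanishes on the defining relations.\<close>

definition N :: "'w \<Rightarrow> 'w set" where
  "N x = {t \<in> G. odd_refl (SOME xs. xs \<in> lists I \<and> wp xs = x) t}"

lemma N_wp: "xs \<in> lists I \<Longrightarrow> N (wp xs) = {t \<in> G. odd_refl xs t}"
proof -
  assume xs: "xs \<in> lists I"
  let ?y = "SOME ys. ys \<in> lists I \<and> wp ys = wp xs"
  have "?y \<in> lists I \<and> wp ?y = wp xs" by (rule someI) (use xs in auto)
  thus ?thesis using odd_refl_wp[of ?y xs] xs by (auto simp: N_def)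
qed

lemma N_subset: "N x \<subseteq> G"
  by (auto simp: N_def)

text \<open>The cocycle at the level of group elements: N(xy) is the symmetric difference of N(x)
  and x N(y) x^{-1}. Facts on descents, weak order and blocks are read off from it below.\<close>

lemma N_mult:
  assumes "x \<in> G" "y \<in> G" "t \<in> G"
  shows "t \<in> N (x \<cdot> y) \<longleftrightarrow> (t \<in> N x) \<noteq> (conj x t \<in> N y)"
proof -
  obtain xs ys where xs: "xs \<in> lists I" "wp xs = x" and ys: "ys \<in> lists I" "wp ys = y"
    using word_exists assms by metis
  have xy: "xs @ ys \<in> lists I" using xs ys by auto
  have "t \<in> N (wp (xs @ ys)) \<longleftrightarrow> odd_refl xs t \<noteq> odd_refl ys (conj x t)"
    unfolding N_wp[OF xy] using odd_refl_append[OF xs(1) ys(1) assms(3)] xs(2) assms(3) by blast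
  moreover have "wp (xs @ ys) = x \<cdot> y" using wp_append[OF xs(1) ys(1)] xs ys by metis
  moreover have "t \<in> N x \<longleftrightarrow> odd_refl xs t" using N_wp[OF xs(1)] xs(2) assms(3) by blast
  moreover have "conj x t \<in> N y \<longleftrightarrow> odd_refl ys (conj x t)"
    using N_wp[OF ys(1)] ys(2) conj_closed[OF assms(1,3)] by blast
  ultimately show ?thesis by simp
qed

lemma N_one [simp]: "N \<one> = {}"
  using N_wp[of "[]"] by simp

lemma N_s [simp]: assumes "i \<in> I" shows "N (s i) = {s i}"
proof -
  have "[i] \<in> lists I" "wp [i] = s i" using assms by simp_all
  hence "N (s i) = {t \<in> G. t = s i}" using N_wp[of "[i]"] by simp
  moreover have "s i \<in> G" using assms by simp
  ultimately show ?thesis by blast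
qed

lemma N_inv: "x \<in> G \<Longrightarrow> t \<in> G \<Longrightarrow> t \<in> N (inv x) \<longleftrightarrow> conj (inv x) t \<in> N x"
  using N_mult[of "inv x" x t] by auto

definition refl :: "'w set" where
  "refl = {t. \<exists>a\<in>G. \<exists>i\<in>I. t = conj a (s i)}"

lemma refl_closed [simp]: "t \<in> refl \<Longrightarrow> t \<in> G"
  by (auto simp: refl_def)

lemma s_refl [simp]: "i \<in> I \<Longrightarrow> s i \<in> refl"
  unfolding refl_def by (force intro!: bexI[of _ \<one>] bexI[of _ i])

lemma refl_conj: "t \<in> refl \<Longrightarrow> x \<in> G \<Longrightarrow> conj x t \<in> refl"
  unfolding refl_def by (force simp: conj_mult[symmetric])

lemma reflE: assumes "t \<in> refl" obtains a i where "a \<in> G" "i \<in> I" "t = conj a (s i)"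
  using assms unfolding refl_def by blast

lemma refl_sq: assumes "t \<in> refl" shows "t \<cdot> t = \<one>"
proof -
  obtain a i where "a \<in> G" "i \<in> I" "t = conj a (s i)" using assms by (rule reflE)
  thus ?thesis by (simp add: conj_def m_assoc)
qed

lemma refl_cancel: "t \<in> refl \<Longrightarrow> x \<in> G \<Longrightarrow> t \<cdot> (t \<cdot> x) = x"
  by (metis refl_closed refl_sq m_assoc l_one)

text \<open>Write t = a^{-1} s_i a and expand N along this product. The contributions of a^{-1} and
  of a have the same parity and cancel; the middle letter s_i contributes exactly one.\<close>

lemma refl_self: "t \<in> refl \<Longrightarrow> t \<in> N t"
proof -
  assume "t \<in> refl"
  then obtain a i where a: "a \<in> G" "i \<in> I" and t: "t = conj a (s i)" by (rule reflE)
  have tc: "t \<in> G" using a t by simp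
  have "t = inv a \<cdot> (s i \<cdot> a)" using a t by (simp add: conj_def m_assoc)
  hence "t \<in> N t \<longleftrightarrow> (t \<in> N (inv a)) \<noteq> (conj (inv a) t \<in> N (s i \<cdot> a))"
    using N_mult[of "inv a" "s i \<cdot> a" t] a tc by simp
  moreover have "conj (inv a) t = s i" using a t by simp
  moreover have "s i \<in> N (s i \<cdot> a) \<longleftrightarrow> s i \<notin> N a"
    using N_mult[of "s i" a "s i"] a by (simp add: conj_s)
  moreover have "t \<in> N (inv a) \<longleftrightarrow> s i \<in> N a" using N_inv[OF a(1) tc] \<open>conj (inv a) t = s i\<close> by simp
  ultimately show ?thesis by simp
qed

lemma N_refl: assumes x: "x \<in> G" shows "N x \<subseteq> refl"
proof -
  have "odd_refl xs t \<Longrightarrow> xs \<in> lists I \<Longrightarrow> t \<in> G \<Longrightarrow> t \<in> refl" for xs t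
  proof (induction xs arbitrary: t)
    case (Cons i xs)
    thus ?case using refl_conj[of "conj (s i) t" "s i"] conj_inv'[of "s i" t]
      by (cases "t = s i") auto
  qed simp
  moreover obtain xs where "xs \<in> lists I" "wp xs = x" using word_exists[OF x] by blast
  ultimately show ?thesis using N_wp[of xs] by blast
qed

text \<open>The strong exchange property: an odd number of occurrences means at least one, and
  multiplying by the reflection found at a place of the word deletes the letter at that place. The
  word need not be reduced.\<close>

lemma exchange_word:
  "xs \<in> lists I \<Longrightarrow> t \<in> G \<Longrightarrow> odd_refl xs t \<Longrightarrow> \<exists>ys i zs. xs = ys @ i # zs \<and> t \<cdot> wp xs = wp (ys @ zs)"
proof (induction xs arbitrary: t)
  case (Cons i xs)
  show ?case
  proof (cases "t = s i")
    case True
    thus ?thesis using Cons.prems by (intro exI[of _ "[]"] exI[of _ i] exI[of _ xs]) auto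
  next
    case False
    hence "odd_refl xs (conj (s i) t)" using Cons.prems by auto
    then obtain ys k zs where *: "xs = ys @ k # zs" "conj (s i) t \<cdot> wp xs = wp (ys @ zs)"
      using Cons.IH[of "conj (s i) t"] Cons.prems by auto
    have "t \<cdot> wp (i # xs) = s i \<cdot> (conj (s i) t \<cdot> wp xs)"
      using Cons.prems by (simp add: conj_s m_assoc)
    thus ?thesis using * by (intro exI[of _ "i # ys"] exI[of _ k] exI[of _ zs]) auto
  qed
qed simp

lemma exchange:
  assumes "xs \<in> lists I" "t \<in> N (wp xs)"
  shows "\<exists>ys i zs. xs = ys @ i # zs \<and> t \<cdot> wp xs = wp (ys @ zs)"
  using exchange_word[of xs t] assms N_wp[of xs] by auto

section \<open>Length and reduced words\<close>

lemma len_le: "xs \<in> lists I \<Longrightarrow> l (wp xs) \<le> length xs"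
  unfolding cox_len_def by (rule Least_le) auto

lemma reduced_exists:
  assumes "x \<in> G" shows "\<exists>xs. red xs x"
proof -
  have "\<exists>n. \<exists>xs\<in>lists I. length xs = n \<and> wp xs = x" using word_exists[OF assms] by auto
  hence "\<exists>xs\<in>lists I. length xs = l x \<and> wp xs = x" unfolding cox_len_def by (rule LeastI_ex)
  thus ?thesis by (auto simp: reduced_word_def)
qed

lemma len_one [simp]: "l \<one> = 0"
  using len_le[of "[]"] by simp

lemma len_eq_0: "x \<in> G \<Longrightarrow> l x = 0 \<longleftrightarrow> x = \<one>"
  using reduced_exists[of x] by (auto simp: reduced_word_def)

lemma len_mult: "x \<in> G \<Longrightarrow> y \<in> G \<Longrightarrow> l (x \<cdot> y) \<le> l x + l y"
proof -
  assume "x \<in> G" "y \<in> G"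
  then obtain xs ys where "red xs x" "red ys y" using reduced_exists by metis
  thus ?thesis using len_le[of "xs @ ys"] by (auto simp: reduced_word_def wp_append)
qed

lemma len_inv [simp]: "x \<in> G \<Longrightarrow> l (inv x) = l x"
proof -
  have "l (inv x) \<le> l x" if x: "x \<in> G" for x
  proof -
    obtain xs where "red xs x" using reduced_exists x by metis
    moreover from this have "rev xs \<in> lists I" by (auto simp: reduced_word_def rev_lists)
    ultimately show ?thesis using len_le[of "rev xs"] by (auto simp: reduced_word_def wp_rev)
  qed
  from this[of x] this[of "inv x"] show "x \<in> G \<Longrightarrow> l (inv x) = l x" by simp
qed

text \<open>If t is in N(x), exchange deletes a letter of a reduced word of x. Otherwise t is in
  N(tx), because t is an inversion of itself, and the same argument applied to tx shows that x is
  shorter than tx.\<close>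

lemma len_refl_less:
  assumes "x \<in> G" "t \<in> refl"
  shows "l (t \<cdot> x) < l x \<longleftrightarrow> t \<in> N x"
proof -
  have dir: "l (t \<cdot> x) < l x" if x: "x \<in> G" "t \<in> N x" for x
  proof -
    obtain xs where xs: "xs \<in> lists I" "wp xs = x" "length xs = l x"
      using reduced_exists[OF x(1)] by (auto simp: reduced_word_def)
    obtain ys i zs where "xs = ys @ i # zs" "t \<cdot> x = wp (ys @ zs)"
      using exchange[of xs t] xs x(2) by metis
    thus ?thesis using len_le[of "ys @ zs"] xs by auto
  qed
  have tx: "t \<in> N (t \<cdot> x) \<longleftrightarrow> t \<notin> N x"
    using N_mult[of t x t] assms refl_self[OF assms(2)] by (simp add: conj_def m_assoc)
  show ?thesis using dir[OF assms(1)] dir[of "t \<cdot> x"] tx assms by (auto simp: refl_cancel)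
qed

lemma len_refl_neq: "x \<in> G \<Longrightarrow> t \<in> refl \<Longrightarrow> l (t \<cdot> x) \<noteq> l x"
  using len_refl_less[of x t] len_refl_less[of "t \<cdot> x" t] N_mult[of t x t] refl_self[of t]
  by (auto simp: refl_cancel conj_def m_assoc)

lemma len_s_left:
  assumes "x \<in> G" "i \<in> I"
  shows "l (s i \<cdot> x) = (if s i \<in> N x then l x - 1 else l x + 1)"
    and "s i \<in> N x \<Longrightarrow> l x > 0"
proof -
  have s1: "l (s i) \<le> 1" using len_le[of "[i]"] assms by simp
  have a: "l (s i \<cdot> x) \<le> l x + 1" using len_mult[of "s i" x] s1 assms by simp
  have b: "l x \<le> l (s i \<cdot> x) + 1" using len_mult[of "s i" "s i \<cdot> x"] s1 assms by simp
  show "l (s i \<cdot> x) = (if s i \<in> N x then l x - 1 else l x + 1)" "s i \<in> N x \<Longrightarrow> l x > 0"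
    using a b len_refl_less[of x "s i"] len_refl_neq[of x "s i"] assms by (auto split: if_splits)
qed

lemma len_s [simp]: "i \<in> I \<Longrightarrow> l (s i) = 1"
  using len_s_left[of \<one> i] by simp

definition ldes :: "'w \<Rightarrow> 'i set" where
  "ldes x = {i \<in> I. s i \<in> N x}"

lemma ldes_iff: "x \<in> G \<Longrightarrow> i \<in> I \<Longrightarrow> i \<in> ldes x \<longleftrightarrow> l (s i \<cdot> x) < l x"
  by (simp add: ldes_def len_refl_less)

lemma ldes_len: "x \<in> G \<Longrightarrow> i \<in> I \<Longrightarrow>
    (i \<in> ldes x \<longleftrightarrow> l x = Suc (l (s i \<cdot> x))) \<and> (i \<notin> ldes x \<longleftrightarrow> l (s i \<cdot> x) = Suc (l x))"
  using len_s_left[of x i] by (auto simp: ldes_def split: if_splits)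

lemma ldes_inv:
  "x \<in> G \<Longrightarrow> i \<in> I \<Longrightarrow> i \<in> ldes (inv x) \<longleftrightarrow> l (x \<cdot> s i) < l x"
  using ldes_iff[of "inv x" i] len_inv[of "x \<cdot> s i"] by (simp add: inv_mult_group)

lemma rdes_iff: "x \<in> G \<Longrightarrow> i \<in> I \<Longrightarrow> i \<in> rdes x \<longleftrightarrow> i \<in> ldes (inv x)"
  by (simp add: right_descents_def ldes_inv)

lemma rdes_len: "x \<in> G \<Longrightarrow> i \<in> I \<Longrightarrow> (i \<in> rdes x \<longleftrightarrow> l x = Suc (l (x \<cdot> s i))) \<and>
    (i \<notin> rdes x \<longleftrightarrow> l (x \<cdot> s i) = Suc (l x))"
  using ldes_len[of "inv x" i] rdes_iff[of x i] len_inv[of "x \<cdot> s i"]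
  by (auto simp: inv_mult_group)

lemma rdes_mult_s: "x \<in> G \<Longrightarrow> i \<in> I \<Longrightarrow> i \<in> rdes (x \<cdot> s i) \<longleftrightarrow> i \<notin> rdes x"
  using rdes_len[of x i] rdes_len[of "x \<cdot> s i" i] by auto

text \<open>This is the sign character; it supplies the signs of the alternating basis vectors of
  T_w.\<close>

lemma len_parity: "x \<in> G \<Longrightarrow> y \<in> G \<Longrightarrow> even (l (x \<cdot> y)) \<longleftrightarrow> even (l x + l y)"
proof -
  assume y: "y \<in> G"
  have "even (l (wp xs \<cdot> y)) = even (l (wp xs) + l y)" if "xs \<in> lists I" for xs using that
  proof (induction xs)
    case (Cons i xs)
    thus ?case using ldes_len[of "wp xs" i] ldes_len[of "wp xs \<cdot> y" i] y by (auto simp: m_assoc)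
  qed (use y in simp)
  thus "x \<in> G \<Longrightarrow> even (l (x \<cdot> y)) \<longleftrightarrow> even (l x + l y)" using word_exists by metis
qed

lemma len_refl_odd: assumes "t \<in> refl" shows "odd (l t)"
proof -
  obtain a i where "a \<in> G" "i \<in> I" "t = conj a (s i)" using assms by (rule reflE)
  thus ?thesis by (simp add: conj_def len_parity)
qed

lemma reduced_Cons:
  assumes "red (i # xs) x"
  shows "i \<in> I" "red xs (s i \<cdot> x)" "i \<in> ldes x" "l x = Suc (l (s i \<cdot> x))"
proof -
  have xs: "i \<in> I" "xs \<in> lists I" "s i \<cdot> wp xs = x" "Suc (length xs) = l x"
    using assms by (auto simp: reduced_word_def)
  hence x: "x \<in> G" "s i \<cdot> x = wp xs" by auto
  have "l x = Suc (l (s i \<cdot> x))" using len_le[of xs] ldes_len[OF x(1) xs(1)] x xs by auto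
  thus "i \<in> I" "red xs (s i \<cdot> x)" "i \<in> ldes x" "l x = Suc (l (s i \<cdot> x))"
    using x xs ldes_len[OF x(1) xs(1)] by (auto simp: reduced_word_def)
qed

lemma reduced_ConsI:
  assumes "red xs x" "i \<in> I" "i \<notin> ldes x"
  shows "red (i # xs) (s i \<cdot> x)"
  using assms ldes_len[of x i] by (auto simp: reduced_word_def)

lemma reduced_closed: "red xs x \<Longrightarrow> x \<in> G \<and> xs \<in> lists I \<and> wp xs = x"
  by (auto simp: reduced_word_def)

lemma reduced_append:
  assumes "red xs x" "red ys y" "l (x \<cdot> y) = l x + l y"
  shows "red (xs @ ys) (x \<cdot> y)"
  using assms by (auto simp: reduced_word_def wp_append)

lemma reduced_appendD:
  assumes "red (xs @ ys) x"
  shows "red xs (wp xs) \<and> red ys (wp ys) \<and> x = wp xs \<cdot> wp ys \<and> l x = l (wp xs) + l (wp ys)"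
proof -
  have xs: "xs \<in> lists I" "ys \<in> lists I" "wp xs \<cdot> wp ys = x" "length xs + length ys = l x"
    using assms by (auto simp: reduced_word_def wp_append)
  thus ?thesis
    using len_mult[of "wp xs" "wp ys"] len_le[of xs] len_le[of ys] by (auto simp: reduced_word_def)
qed

text \<open>Build the subword from the right. If the next letter i is a left descent of the product
  so far, exchange removes one letter from the reduced subword instead of adding i.\<close>

lemma reduced_subword:
  "xs \<in> lists I \<Longrightarrow> \<exists>ys. subseq ys xs \<and> red ys (wp xs)"
proof (induction xs)
  case Nil
  thus ?case by (intro exI[of _ "[]"]) (simp add: reduced_word_def)
next
  case (Cons i xs)
  then obtain ys where ys: "subseq ys xs" "red ys (wp xs)" by auto
  have i: "i \<in> I" "wp xs \<in> G" using Cons by auto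
  show ?case
  proof (cases "i \<in> ldes (wp xs)")
    case False
    hence "red (i # ys) (wp (i # xs))" using reduced_ConsI[OF ys(2) i(1)] by simp
    thus ?thesis using ys by (intro exI[of _ "i # ys"]) simp
  next
    case True
    hence "s i \<in> N (wp ys)" using ys by (auto simp: ldes_def reduced_word_def)
    then obtain as k bs where *: "ys = as @ k # bs" "s i \<cdot> wp ys = wp (as @ bs)"
      using exchange[of ys "s i"] ys by (auto simp: reduced_word_def)
    have "red (as @ bs) (wp (i # xs))"
      using * ys True ldes_len[OF i(2,1)] by (auto simp: reduced_word_def)
    moreover have "subseq (as @ bs) ys" unfolding * by (rule list_emb_append_mono) auto
    ultimately show ?thesis using ys by (meson list_emb_Cons subseq_order.trans)
  qed
qed

text \<open>Along a reduced word starting with i, N(x) consists of s_i and the conjugate of N(s_i x)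
  by s_i, and s_i itself is not in that conjugate. So each letter adds exactly one
  inversion.\<close>

lemma finite_N: "x \<in> G \<Longrightarrow> finite (N x)"
  and card_N: "x \<in> G \<Longrightarrow> card (N x) = l x"
proof -
  have "red xs x \<Longrightarrow> finite (N x) \<and> card (N x) = l x" for xs x
  proof (induction xs arbitrary: x)
    case Nil
    thus ?case by (auto simp: reduced_word_def)
  next
    case (Cons i xs)
    let ?y = "s i \<cdot> x"
    note r = reduced_Cons[OF Cons.prems]
    have x: "x \<in> G" using Cons.prems reduced_closed by blast
    have IH: "finite (N ?y)" "card (N ?y) = l ?y" using Cons.IH r by auto
    have i: "s i \<in> G" "conj (s i) (s i) = s i" using r by (simp_all add: conj_s)
    have b: "conj (s i) t \<in> N ?y \<longleftrightarrow> t \<in> conj (s i) ` N ?y" if t: "t \<in> G" for t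
    proof
      assume "conj (s i) t \<in> N ?y"
      thus "t \<in> conj (s i) ` N ?y"
        using conj_inv[of "s i" t] r t by (intro image_eqI[of _ _ "conj (s i) t"]) auto
    next
      assume "t \<in> conj (s i) ` N ?y"
      then obtain u where "u \<in> N ?y" "t = conj (s i) u" by blast
      thus "conj (s i) t \<in> N ?y" using conj_inv[of "s i" u] r(1) N_subset[of ?y] by auto
    qed
    have sub: "conj (s i) ` N ?y \<subseteq> G" using i N_subset[of ?y] by auto
    have "s i \<notin> N ?y" using r x ldes_len[of ?y i] by (auto simp: ldes_def)
    hence c: "s i \<notin> conj (s i) ` N ?y" using b[OF i(1)] i(2) by simp
    have a: "t \<in> N x \<longleftrightarrow> (t = s i) \<noteq> (conj (s i) t \<in> N ?y)" if "t \<in> G" for t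
      using N_mult[of "s i" "?y" t] that r x by simp
    have "N x = insert (s i) (conj (s i) ` N ?y)"
    proof (rule Set.set_eqI)
      fix t
      show "t \<in> N x \<longleftrightarrow> t \<in> insert (s i) (conj (s i) ` N ?y)"
      proof (cases "t \<in> G")
        case True
        thus ?thesis using a[OF True] b[OF True] c by (cases "t = s i") simp_all
      next
        case False
        thus ?thesis using N_subset[of x] sub i(1) by blast
      qed
    qed
    moreover note c
    moreover have "inj_on (conj (s i)) (N ?y)"
    proof (rule inj_on_inverseI)
      fix t assume "t \<in> N ?y"
      thus "conj (s i) (conj (s i) t) = t" using conj_inv[of "s i" t] r(1) N_subset[of ?y] by auto
    qed
    ultimately show ?case using IH r by (simp add: card_image)
  qed
  thus "x \<in> G \<Longrightarrow> finite (N x)" "x \<in> G \<Longrightarrow> card (N x) = l x" using reduced_exists by metis+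
qed


section \<open>Bruhat order and weak order\<close>

text \<open>The reflection form of Bruhat order; \<open>bruhat_iff\<close> identifies its closure
  \<open>br\<close> with the subword order. This form is better suited to lifting along
  multiplication by a simple reflection.\<close>

definition step :: "'w \<Rightarrow> 'w \<Rightarrow> bool" where
  "step x y \<longleftrightarrow> x \<in> G \<and> (\<exists>t\<in>refl. y = t \<cdot> x) \<and> l x < l y"

abbreviation br :: "'w \<Rightarrow> 'w \<Rightarrow> bool" where
  "br \<equiv> step\<^sup>*\<^sup>*"

lemma step_closed: "step x y \<Longrightarrow> x \<in> G \<and> y \<in> G"
  by (auto simp: step_def)

lemma br_closed: "br x y \<Longrightarrow> x \<in> G \<Longrightarrow> y \<in> G"
  by (induction rule: rtranclp_induct) (auto dest: step_closed)

lemma br_len: "br x y \<Longrightarrow> x = y \<or> l x < l y"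
  by (induction rule: rtranclp_induct) (auto simp: step_def)

lemma br_antisym: "br x y \<Longrightarrow> br y x \<Longrightarrow> x = y"
  by (metis br_len less_asym)

lemma step_mult_s:
  assumes "x \<in> G" "i \<in> I" "i \<notin> rdes x"
  shows "step x (x \<cdot> s i)"
proof -
  let ?t = "conj (inv x) (s i)"
  have "?t \<in> refl" using assms refl_conj[of "s i" "inv x"] by simp
  moreover have "?t \<cdot> x = x \<cdot> s i" using assms by (simp add: conj_def m_assoc)
  ultimately show ?thesis using assms rdes_len[of x i] by (force simp: step_def)
qed

lemma N_mult_s:
  assumes "x \<in> G" "i \<in> I" "t \<in> G"
  shows "t \<in> N (x \<cdot> s i) \<longleftrightarrow> (t \<in> N x) \<noteq> (t \<cdot> x = x \<cdot> s i)"
  using N_mult[of x "s i" t] conj_eq_iff[of x t "s i"] assms by simp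

text \<open>N(x) and N(x s_i) differ only in the reflection x s_i x^{-1}. If y = t x and t is not
  that reflection, t is still not an inversion of x s_i, so multiplying by t still
  lengthens.\<close>

lemma step_right:
  assumes "step x y" "i \<in> I"
  shows "y = x \<cdot> s i \<or> step (x \<cdot> s i) (y \<cdot> s i)"
proof -
  obtain t where t: "t \<in> refl" "y = t \<cdot> x" and x: "x \<in> G" "l x < l y"
    using assms(1) by (auto simp: step_def)
  have "t \<notin> N x" using len_refl_less[OF x(1) t(1)] x t by auto
  hence "y = x \<cdot> s i \<or> t \<notin> N (x \<cdot> s i)" using N_mult_s[of x i t] x t assms by simp
  moreover have "step (x \<cdot> s i) (y \<cdot> s i)" if "t \<notin> N (x \<cdot> s i)"
  proof -
    have xi: "x \<cdot> s i \<in> G" using x assms by simp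
    have y: "y \<cdot> s i = t \<cdot> (x \<cdot> s i)" using t x assms by (simp add: m_assoc)
    have "l (x \<cdot> s i) < l (y \<cdot> s i)"
      unfolding y using len_refl_less[OF xi t(1)] len_refl_neq[OF xi t(1)] that by linarith
    thus ?thesis using xi t(1) y by (auto simp: step_def)
  qed
  ultimately show ?thesis by blast
qed

section \<open>The lifting property: Demazure operators from the right and from the left\<close>

definition up :: "'i \<Rightarrow> 'w \<Rightarrow> 'w" where
  "up i x = (if i \<in> rdes x then x else x \<cdot> s i)"

definition down :: "'i \<Rightarrow> 'w \<Rightarrow> 'w" where
  "down i x = (if i \<in> rdes x then x \<cdot> s i else x)"

lemma up_closed [simp]: "x \<in> G \<Longrightarrow> i \<in> I \<Longrightarrow> up i x \<in> G"
  by (simp add: up_def)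

lemma down_closed [simp]: "x \<in> G \<Longrightarrow> i \<in> I \<Longrightarrow> down i x \<in> G"
  by (simp add: down_def)

lemma br_up1: "x \<in> G \<Longrightarrow> i \<in> I \<Longrightarrow> br x (up i x)"
  using step_mult_s[of x i] by (auto simp: up_def)

lemma br_down1: "x \<in> G \<Longrightarrow> i \<in> I \<Longrightarrow> br (down i x) x"
  using step_mult_s[of "x \<cdot> s i" i] rdes_mult_s[of x i] by (auto simp: down_def)

text \<open>The lifting property of Bruhat order for one covering step y < z. If i is a descent of
  both or of neither, \<open>step_right\<close> moves the step; in the mixed cases the inequalities
  down <= identity <= up fill the gap.\<close>

lemma br_up_down:
  assumes "br x y" "x \<in> G" "i \<in> I"
  shows "br (up i x) (up i y) \<and> br (down i x) (down i y)"
  using assms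
proof (induction rule: rtranclp_induct)
  case (step y z)
  have y: "y \<in> G" "z \<in> G" using step step_closed by auto
  have "br (up i y) (up i z) \<and> br (down i y) (down i z)"
  proof (cases "z = y \<cdot> s i")
    case True
    hence "i \<notin> rdes y" using step(2) rdes_len[OF y(1) step(5)] by (auto simp: step_def)
    thus ?thesis using True rdes_mult_s[OF y(1) step(5)] step(5) y by (simp add: up_def down_def)
  next
    case False
    hence st: "step (y \<cdot> s i) (z \<cdot> s i)" using step_right step by blast
    have d: "br (down i y) y" "br (down i z) z" "br y (up i y)" "br z (up i z)"
      using y step(5) br_down1 br_up1 by auto
    show ?thesis
    proof (cases "i \<in> rdes y"; cases "i \<in> rdes z")
      assume *: "i \<in> rdes y" "i \<in> rdes z"
      thus ?thesis using st step(2) by (auto simp: up_def down_def)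
    next
      assume *: "i \<notin> rdes y" "i \<notin> rdes z"
      thus ?thesis using st step(2) by (auto simp: up_def down_def)
    next
      assume *: "i \<in> rdes y" "i \<notin> rdes z"
      have "br (up i y) (up i z)"
        using d(4) step(2) * by (simp add: up_def converse_rtranclp_into_rtranclp)
      moreover have "br (down i y) (down i z)"
        using d(1) step(2) * by (simp add: down_def rtranclp.rtrancl_into_rtrancl)
      ultimately show ?thesis by simp
    next
      assume *: "i \<notin> rdes y" "i \<in> rdes z"
      have "br (up i y) (up i z)"
        using d(2) st * by (simp add: up_def down_def converse_rtranclp_into_rtranclp)
      moreover have "br (down i y) (down i z)"
        using d(3) st * by (simp add: up_def down_def rtranclp.rtrancl_into_rtrancl)
      ultimately show ?thesis by simp
    qed
  qed
  thus ?case using step by (meson rtranclp_trans)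
qed simp

lemma br_up: "br x y \<Longrightarrow> x \<in> G \<Longrightarrow> i \<in> I \<Longrightarrow> br (up i x) (up i y)"
  and br_down: "br x y \<Longrightarrow> x \<in> G \<Longrightarrow> i \<in> I \<Longrightarrow> br (down i x) (down i y)"
  using br_up_down by blast+

lemma step_inv: assumes "step x y" shows "step (inv x) (inv y)"
proof -
  obtain t where t: "t \<in> refl" "y = t \<cdot> x" and x: "x \<in> G" "l x < l y"
    using assms by (auto simp: step_def)
  have "inv t = t" using refl_sq[OF t(1)] t(1) by (simp add: inv_equality)
  hence "inv y = conj x t \<cdot> inv x" using t x by (simp add: conj_def inv_mult_group m_assoc)
  moreover have "y \<in> G" using t x by simp
  moreover from this have "l (inv x) < l (inv y)" using x by simp
  ultimately show ?thesis using refl_conj[OF t(1) x(1)] x(1) unfolding step_def by blast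
qed

lemma br_inv: "br x y \<Longrightarrow> br (inv x) (inv y)"
  by (induction rule: rtranclp_induct) (auto intro: rtranclp.rtrancl_into_rtrancl dest: step_inv)

definition lup :: "'i \<Rightarrow> 'w \<Rightarrow> 'w" where
  "lup j x = (if j \<in> ldes x then x else s j \<cdot> x)"

definition ldown :: "'i \<Rightarrow> 'w \<Rightarrow> 'w" where
  "ldown j x = (if j \<in> ldes x then s j \<cdot> x else x)"

lemma lup_closed [simp]: "x \<in> G \<Longrightarrow> j \<in> I \<Longrightarrow> lup j x \<in> G"
  by (simp add: lup_def)

lemma ldown_closed [simp]: "x \<in> G \<Longrightarrow> j \<in> I \<Longrightarrow> ldown j x \<in> G"
  by (simp add: ldown_def)

lemma lup_inv: "x \<in> G \<Longrightarrow> j \<in> I \<Longrightarrow> lup j x = inv (up j (inv x))"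
  by (simp add: lup_def up_def rdes_iff inv_mult_group)

lemma ldown_inv: "x \<in> G \<Longrightarrow> j \<in> I \<Longrightarrow> ldown j x = inv (down j (inv x))"
  by (simp add: ldown_def down_def rdes_iff inv_mult_group)

lemma br_lup: "br x y \<Longrightarrow> x \<in> G \<Longrightarrow> j \<in> I \<Longrightarrow> br (lup j x) (lup j y)"
  using br_inv[OF br_up[OF br_inv[of x y], of j]] br_closed[of x y] by (simp add: lup_inv)

lemma br_ldown: "br x y \<Longrightarrow> x \<in> G \<Longrightarrow> j \<in> I \<Longrightarrow> br (ldown j x) (ldown j y)"
  using br_inv[OF br_down[OF br_inv[of x y], of j]] br_closed[of x y] by (simp add: ldown_inv)

lemma br_lup1: "x \<in> G \<Longrightarrow> j \<in> I \<Longrightarrow> br x (lup j x)"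
  using br_inv[OF br_up1[of "inv x" j]] by (simp add: lup_inv)

lemma ldes_mult_s:
  assumes "x \<in> G" "i \<in> I" "j \<in> I" "s j \<cdot> x \<noteq> x \<cdot> s i"
  shows "j \<in> ldes (x \<cdot> s i) \<longleftrightarrow> j \<in> ldes x"
  using N_mult_s[of x i "s j"] assms by (simp add: ldes_def)

lemma s_mult_eq_inv:
  assumes "x \<in> G" "i \<in> I" "j \<in> I"
  shows "s i \<cdot> inv x = inv x \<cdot> s j \<longleftrightarrow> s j \<cdot> x = x \<cdot> s i"
proof -
  have "s i \<cdot> inv x = inv x \<cdot> s j \<longleftrightarrow> inv (x \<cdot> s i) = inv (s j \<cdot> x)"
    using assms by (simp add: inv_mult_group)
  also have "\<dots> \<longleftrightarrow> x \<cdot> s i = s j \<cdot> x" using assms by (metis inv_inv m_closed s_closed)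
  finally show ?thesis by auto
qed

lemma rdes_s_mult:
  assumes "x \<in> G" "i \<in> I" "j \<in> I" "s j \<cdot> x \<noteq> x \<cdot> s i"
  shows "i \<in> rdes (s j \<cdot> x) \<longleftrightarrow> i \<in> rdes x"
  using ldes_mult_s[of "inv x" j i] s_mult_eq_inv[of x i j] assms
  by (simp add: rdes_iff inv_mult_group)

lemma s_mult_eq_des:
  assumes "x \<in> G" "i \<in> I" "j \<in> I" "s j \<cdot> x = x \<cdot> s i"
  shows "i \<in> rdes x \<longleftrightarrow> j \<in> ldes x"
  using rdes_len[of x i] ldes_len[of x j] assms by auto

text \<open>Left and right Demazure operators commute. Multiplication by s_i on the right changes
  the status of a left letter j only if s_j x = x s_i, and in that case the two operators agree on
  x.\<close>

lemma lup_up: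
  assumes x: "x \<in> G" and ij: "i \<in> I" "j \<in> I"
  shows "lup j (up i x) = up i (lup j x)"
proof (cases "s j \<cdot> x = x \<cdot> s i")
  case True
  note d = s_mult_eq_des[OF x ij True]
  have "j \<in> ldes (x \<cdot> s i)" if "j \<notin> ldes x"
    using that ldes_len[of x j] ldes_len[of "s j \<cdot> x" j] x ij True[symmetric] by auto
  moreover have "i \<in> rdes (s j \<cdot> x)" if "i \<notin> rdes x"
    using that rdes_mult_s[of x i] x ij True by simp
  ultimately show ?thesis using d True by (auto simp: lup_def up_def)
next
  case False
  thus ?thesis using ldes_mult_s[OF x ij False] rdes_s_mult[OF x ij False] x ij
    by (auto simp: lup_def up_def m_assoc)
qed

lemma subseq_lists: "subseq ys xs \<Longrightarrow> xs \<in> lists A \<Longrightarrow> ys \<in> lists A"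
  by (induction rule: list_emb.induct) auto

text \<open>Induction on the reduced word i # ys. A subword that uses the letter i has product
  \<open>lup\<close> or \<open>ldown\<close> of the product of its tail, and both are below
  \<open>lup\<close> of that product, hence below v by monotonicity.\<close>

lemma br_subword:
  "red ys v \<Longrightarrow> subseq xs ys \<Longrightarrow> br (wp xs) v"
proof (induction ys arbitrary: v xs)
  case Nil
  thus ?case by (cases xs) (auto simp: reduced_word_def)
next
  case (Cons i ys)
  note r = reduced_Cons[OF Cons.prems(1)]
  have v: "v \<in> G" "i # ys \<in> lists I" using reduced_closed[OF Cons.prems(1)] by auto
  have low: "br (s i \<cdot> v) v" using br_lup1[of "s i \<cdot> v" i] r v ldes_len[of "s i \<cdot> v" i]
    by (auto simp: lup_def)
  show ?case
  proof (cases "subseq xs ys")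
    case True
    thus ?thesis using Cons.IH[OF r(2)] low by (meson rtranclp_trans)
  next
    case False
    then obtain xs' where xs': "xs = i # xs'" "subseq xs' ys"
      using Cons.prems(2) by (cases xs) (auto elim: list_emb.cases split: if_splits)
    have xs'I: "xs' \<in> lists I" using subseq_lists[OF xs'(2)] v by auto
    have b: "br (wp xs') (s i \<cdot> v)" using Cons.IH[OF r(2) xs'(2)] .
    have "br (wp xs) (lup i (wp xs')) \<or> wp xs = ldown i (wp xs')"
      using xs' by (auto simp: lup_def ldown_def)
    moreover have "br (ldown i (wp xs')) v"
    proof -
      have "br (ldown i (wp xs')) (lup i (wp xs'))"
        using br_lup1[of "wp xs'" i] br_lup1[of "s i \<cdot> wp xs'" i] xs'I r(1)
          ldes_len[of "wp xs'" i] ldes_len[of "s i \<cdot> wp xs'" i]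
        by (auto simp: lup_def ldown_def split: if_splits)
      moreover have "br (lup i (wp xs')) (lup i (s i \<cdot> v))" using br_lup[OF b] xs'I r(1) by simp
      moreover have "lup i (s i \<cdot> v) = v" using r v ldes_len[of "s i \<cdot> v" i] by (auto simp: lup_def)
      ultimately show ?thesis by (metis rtranclp_trans)
    qed
    moreover have "br (lup i (wp xs')) v"
      using br_lup[OF b, of i] xs'I r v ldes_len[of "s i \<cdot> v" i] by (auto simp: lup_def)
    ultimately show ?thesis by (metis rtranclp_trans)
  qed
qed

text \<open>Going down one reflection t means that t is an inversion of the upper element, so strong
  exchange deletes a letter from any word already found for it.\<close>

lemma br_subword_exists:
  "br u v \<Longrightarrow> ys \<in> lists I \<Longrightarrow> wp ys = v \<Longrightarrow> \<exists>xs. subseq xs ys \<and> wp xs = u"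
proof (induction rule: converse_rtranclp_induct)
  case base
  thus ?case by auto
next
  case (step u z)
  then obtain xs where xs: "subseq xs ys" "wp xs = z" by auto
  have xsI: "xs \<in> lists I" using xs step subseq_lists by blast
  obtain t where t: "t \<in> refl" "z = t \<cdot> u" and u: "u \<in> G" "l u < l z"
    using step(1) by (auto simp: step_def)
  have "t \<in> N z" using len_refl_less[of z t] refl_cancel[OF t(1) u(1)] t u by auto
  then obtain as k bs where *: "xs = as @ k # bs" "t \<cdot> wp xs = wp (as @ bs)"
    using exchange[OF xsI] xs by metis
  have "subseq (as @ bs) xs" unfolding * by (rule list_emb_append_mono) auto
  thus ?case using xs * refl_cancel[OF t(1) u(1)] t(2) by (metis subseq_order.trans)
qed

lemma bruhat_iff:
  assumes "u \<in> G" "v \<in> G"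
  shows "brle u v \<longleftrightarrow> br u v"
proof
  assume "brle u v"
  then obtain xs ys where "red xs u" "red ys v" "subseq xs ys" by (auto simp: bruhat_le_def)
  thus "br u v" using br_subword reduced_closed by metis
next
  assume b: "br u v"
  obtain ys where ys: "red ys v" using reduced_exists assms by metis
  obtain xs where xs: "subseq xs ys" "wp xs = u"
    using br_subword_exists[OF b] reduced_closed[OF ys] by blast
  have "xs \<in> lists I" using subseq_lists[OF xs(1)] reduced_closed[OF ys] by blast
  then obtain zs where "subseq zs xs" "red zs u" using reduced_subword xs by metis
  thus "brle u v" using ys xs unfolding bruhat_le_def by (meson subseq_order.trans)
qed

section \<open>Right weak order through lengths and inversion sets\<close>

lemma right_le_len:
  "rle u v \<longleftrightarrow> u \<in> G \<and> v \<in> G \<and> l v = l u + l (inv u \<cdot> v)"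
proof
  assume "rle u v"
  then obtain xs ys where xs: "red xs u" "red (xs @ ys) v" by (auto simp: right_le_def)
  have "wp xs = u" "wp ys \<in> G" "u \<in> G" "v \<in> G" using reduced_closed xs reduced_appendD by metis+
  thus "u \<in> G \<and> v \<in> G \<and> l v = l u + l (inv u \<cdot> v)" using reduced_appendD[OF xs(2)] by auto
next
  assume *: "u \<in> G \<and> v \<in> G \<and> l v = l u + l (inv u \<cdot> v)"
  obtain xs ys where "red xs u" "red ys (inv u \<cdot> v)"
    using * reduced_exists by (meson inv_closed m_closed)
  thus "rle u v" using reduced_append[of xs u ys "inv u \<cdot> v"] * by (auto simp: right_le_def)
qed

lemma right_le_mult:
  "u \<in> G \<Longrightarrow> y \<in> G \<Longrightarrow> rle u (u \<cdot> y) \<longleftrightarrow> l (u \<cdot> y) = l u + l y"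
  by (simp add: right_le_len)

lemma left_le_mult:
  assumes "x \<in> G" "y \<in> G" "l (x \<cdot> y) = l x + l y"
  shows "left_le W y (x \<cdot> y)"
proof -
  obtain xs ys where "red xs x" "red ys y" using assms reduced_exists by metis
  thus ?thesis using reduced_append assms unfolding left_le_def by blast
qed

text \<open>With v = u y, N(v) is the symmetric difference of N(u) and a conjugate C of N(y), and
  cardinalities are lengths. Lengths add exactly if N(u) and C are disjoint, which for a symmetric
  difference is the same as N(u) being contained in N(v).\<close>

lemma right_le_N:
  assumes u: "u \<in> G" and v: "v \<in> G"
  shows "rle u v \<longleftrightarrow> N u \<subseteq> N v"
proof -
  let ?y = "inv u \<cdot> v"
  have y: "?y \<in> G" "u \<cdot> ?y = v" using u v by auto
  have a: "t \<in> N v \<longleftrightarrow> (t \<in> N u) \<noteq> (conj u t \<in> N ?y)" if "t \<in> G" for t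
    using N_mult[of u ?y t] y u that by simp
  have inj: "inj_on (conj (inv u)) (N ?y)"
  proof (rule inj_on_inverseI)
    fix t assume "t \<in> N ?y"
    thus "conj u (conj (inv u) t) = t" using u N_subset[of ?y] conj_inv[of u t] by blast
  qed
  let ?C = "conj (inv u) ` N ?y"
  have C: "t \<in> ?C \<longleftrightarrow> conj u t \<in> N ?y" if t: "t \<in> G" for t
  proof
    assume "conj u t \<in> N ?y"
    thus "t \<in> ?C" using conj_inv'[OF u t] by (metis image_eqI)
  next
    assume "t \<in> ?C"
    then obtain r where "r \<in> N ?y" "t = conj (inv u) r" by blast
    thus "conj u t \<in> N ?y" using conj_inv[OF u, of r] N_subset[of ?y] by auto
  qed
  have Cc: "?C \<subseteq> G" using u N_subset[of ?y] by auto
  have Nv: "N v = (N u - ?C) \<union> (?C - N u)"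
  proof (rule Set.set_eqI)
    fix t
    show "t \<in> N v \<longleftrightarrow> t \<in> (N u - ?C) \<union> (?C - N u)"
    proof (cases "t \<in> G")
      case True
      thus ?thesis using a C by blast
    next
      case False
      thus ?thesis using N_subset[of v] N_subset[of u] Cc by blast
    qed
  qed
  have cC: "card ?C = l ?y" using card_image[OF inj] card_N y by simp
  have fin: "finite (N u)" "finite ?C" using finite_N u y by auto
  have "card (N v) + 2 * card (N u \<inter> ?C) = card (N u) + card ?C"
  proof -
    have "card (N v) = card (N u - ?C) + card (?C - N u)"
      unfolding Nv using fin by (intro card_Un_disjoint) auto
    moreover have "card (N u - ?C) + card (N u \<inter> ?C) = card (N u)"
      using card_Int_Diff[OF fin(1), of ?C] by linarith
    moreover have "card (?C - N u) + card (N u \<inter> ?C) = card ?C"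
      using card_Int_Diff[OF fin(2), of "N u"] by (simp add: Int_commute)
    ultimately show ?thesis by linarith
  qed
  hence "rle u v \<longleftrightarrow> card (N u \<inter> ?C) = 0" using right_le_len[of u v] card_N u v cC by auto
  also have "\<dots> \<longleftrightarrow> N u \<inter> ?C = {}" using fin by simp
  also have "\<dots> \<longleftrightarrow> N u \<subseteq> N v" unfolding Nv by blast
  finally show ?thesis .
qed

lemma right_le_refl: "u \<in> G \<Longrightarrow> rle u u"
  by (simp add: right_le_N)

lemma right_le_closed: "rle u v \<Longrightarrow> u \<in> G \<and> v \<in> G"
  by (simp add: right_le_len)

lemma right_le_trans: "rle u v \<Longrightarrow> rle v x \<Longrightarrow> rle u x"
  by (meson right_le_N right_le_closed subset_trans)

lemma right_le_antisym:
  assumes "rle u v" "rle v u" shows "u = v"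
proof -
  have c: "u \<in> G" "v \<in> G" "l (inv u \<cdot> v) = 0" using assms by (auto simp: right_le_len)
  hence "inv u \<cdot> v = \<one>" using len_eq_0[of "inv u \<cdot> v"] by simp
  thus ?thesis using c by (metis inv_cancel' r_one)
qed

lemma right_le_ldes: assumes "rle u v" shows "ldes u \<subseteq> ldes v"
proof -
  have "N u \<subseteq> N v" using assms right_le_N right_le_closed by blast
  thus ?thesis unfolding ldes_def by blast
qed

section \<open>Parabolic subgroups\<close>

lemma par_subgroup: "J \<subseteq> I \<Longrightarrow> subgroup (par J) W"
  unfolding parabolic_def by (rule generate_is_subgroup) auto

lemma par_closed: "J \<subseteq> I \<Longrightarrow> a \<in> par J \<Longrightarrow> a \<in> G"
  using par_subgroup subgroup.subset by blast

lemma par_mult: "J \<subseteq> I \<Longrightarrow> a \<in> par J \<Longrightarrow> b \<in> par J \<Longrightarrow> a \<cdot> b \<in> par J"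
  by (rule subgroup.m_closed[OF par_subgroup])

lemma par_inv: "J \<subseteq> I \<Longrightarrow> a \<in> par J \<Longrightarrow> inv a \<in> par J"
  by (rule subgroup.m_inv_closed[OF par_subgroup])

lemma par_one: "J \<subseteq> I \<Longrightarrow> \<one> \<in> par J"
  by (rule subgroup.one_closed[OF par_subgroup])

lemma par_s: "j \<in> J \<Longrightarrow> s j \<in> par J"
  unfolding parabolic_def by (rule generate.incl) auto

lemma par_mono: "J \<subseteq> J' \<Longrightarrow> par J \<subseteq> par J'"
  unfolding parabolic_def by (rule mono_generate) auto

lemma par_word: "J \<subseteq> I \<Longrightarrow> a \<in> par J \<longleftrightarrow> (\<exists>xs\<in>lists J. wp xs = a)"
  unfolding parabolic_def using generate_word wp_in_generate by blast

lemma par_reduced: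
  assumes "J \<subseteq> I" "a \<in> par J" shows "\<exists>xs\<in>lists J. red xs a"
proof -
  obtain xs where xs: "xs \<in> lists J" "wp xs = a" using par_word assms by blast
  hence "xs \<in> lists I" using assms lists_mono by blast
  then obtain ys where "subseq ys xs" "red ys a" using reduced_subword xs by metis
  thus ?thesis using subseq_lists xs by blast
qed

lemma par_s_iff: assumes "J \<subseteq> I" "i \<in> I" shows "s i \<in> par J \<longleftrightarrow> i \<in> J"
proof
  assume "s i \<in> par J"
  then obtain xs where xs: "xs \<in> lists J" "red xs (s i)" using par_reduced assms by blast
  hence "length xs = 1" using assms by (simp add: reduced_word_def)
  then obtain j where "xs = [j]" by (cases xs) auto
  hence "j \<in> J" "s j = s i" using xs assms by (auto simp: reduced_word_def)
  thus "i \<in> J" using s_inj assms by auto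
qed (simp add: par_s)

lemma par_N:
  assumes J: "J \<subseteq> I" and a: "a \<in> par J" shows "N a \<subseteq> par J"
proof -
  have "t \<in> par J" if "xs \<in> lists J" "t \<in> G" "odd_refl xs t" for xs t using that
  proof (induction xs arbitrary: t rule: list.induct)
    case (Cons i xs)
    have i: "i \<in> J" "i \<in> I" using Cons.prems J by auto
    show ?case
    proof (cases "t = s i")
      case False
      hence "conj (s i) t \<in> par J" using Cons i by simp
      hence "conj (s i) (conj (s i) t) \<in> par J"
        using i par_mult[OF J] par_s[OF i(1)] by (simp add: conj_s)
      thus ?thesis using conj_inv[of "s i" t] Cons.prems i by simp
    qed (use par_s i in auto)
  qed simp
  moreover obtain xs where "xs \<in> lists J" "wp xs = a" using par_word J a by blast
  moreover from this have "xs \<in> lists I" using J lists_mono by blast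
  ultimately show ?thesis using N_wp by blast
qed

text \<open>The first letter of a reduced word of a is in N(a), which lies in W_J by
  \<open>par_N\<close>; a simple reflection in W_J belongs to J. So the support does not depend on
  the reduced word.\<close>

lemma par_letters:
  assumes J: "J \<subseteq> I" shows "red xs a \<Longrightarrow> a \<in> par J \<Longrightarrow> xs \<in> lists J"
proof (induction xs arbitrary: a)
  case (Cons i xs)
  note r = reduced_Cons[OF Cons.prems(1)]
  have "s i \<in> N a" using r by (simp add: ldes_def)
  hence "s i \<in> par J" using par_N[OF J Cons.prems(2)] by blast
  hence "i \<in> J" using par_s_iff J r by blast
  moreover have "s i \<cdot> a \<in> par J" using par_mult[OF J] par_s[OF \<open>i \<in> J\<close>] Cons.prems by blast
  ultimately show ?case using Cons.IH[OF r(2)] by simp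
qed simp

text \<open>Minimality in W_J x is stated through descents only, which is easy to check and passes
  down the right weak order. That lengths then add over the whole coset is
  \<open>lmin_len\<close>.\<close>

definition lmin :: "'i set \<Rightarrow> 'w \<Rightarrow> bool" where
  "lmin J x \<longleftrightarrow> x \<in> G \<and> ldes x \<inter> J = {}"

definition rmin :: "'i set \<Rightarrow> 'w \<Rightarrow> bool" where
  "rmin K x \<longleftrightarrow> x \<in> G \<and> rdes x \<inter> K = {}"

lemma rmin_lmin: "x \<in> G \<Longrightarrow> K \<subseteq> I \<Longrightarrow> rmin K x \<longleftrightarrow> lmin K (inv x)"
  using rdes_iff[of x] unfolding rmin_def lmin_def by auto

text \<open>Reduce the concatenation of words for a and x to a subword z1 z2. The product of z2 lies
  again in W_J x, so minimality of x forces z2 to be the whole word of x; then z1 alone spells a and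
  has length at least l(a).\<close>

lemma coset_min_len:
  assumes J: "J \<subseteq> I" and a: "a \<in> par J" and x: "x \<in> G"
    and min: "\<And>b. b \<in> par J \<Longrightarrow> l x \<le> l (b \<cdot> x)"
  shows "l (a \<cdot> x) = l a + l x"
proof -
  obtain as where as: "as \<in> lists J" "red as a" using par_reduced J a by blast
  obtain xs where xs: "red xs x" using reduced_exists x by blast
  have ac: "a \<in> G" using par_closed J a by blast
  have w: "as @ xs \<in> lists I" "wp (as @ xs) = a \<cdot> x"
    using reduced_closed[OF as(2)] reduced_closed[OF xs] by (auto simp: wp_append)
  then obtain zs where zs: "subseq zs (as @ xs)" "red zs (a \<cdot> x)" using reduced_subword by metis
  obtain z1 z2 where z: "zs = z1 @ z2" "subseq z1 as" "subseq z2 xs"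
    using zs(1) subseq_appendE by metis
  have z1: "z1 \<in> lists J" "z1 \<in> lists I" and z2: "z2 \<in> lists I"
    using subseq_lists[OF z(2) as(1)] subseq_lists[OF z(2)] subseq_lists[OF z(3)]
      reduced_closed[OF as(2)] reduced_closed[OF xs] by auto
  have p1: "wp z1 \<in> par J" using par_word J z1 by blast
  have e: "wp z1 \<cdot> wp z2 = a \<cdot> x" using zs(2) z(1) z1 z2 by (auto simp: reduced_word_def wp_append)
  have "wp z2 = inv (wp z1) \<cdot> (wp z1 \<cdot> wp z2)" using z1 z2 by simp
  also have "\<dots> = (inv (wp z1) \<cdot> a) \<cdot> x" unfolding e using z1 ac x by (simp add: m_assoc)
  finally have "l x \<le> l (wp z2)"
    using min[of "inv (wp z1) \<cdot> a"] par_mult[OF J par_inv[OF J p1] a] by simp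
  also have "\<dots> \<le> length z2" using len_le z2 by blast
  finally have "length xs \<le> length z2" using xs by (simp add: reduced_word_def)
  hence "z2 = xs" using z(3) by (metis list_emb_length subseq_same_length le_antisym)
  hence "wp z1 \<cdot> x = a \<cdot> x" using e reduced_closed[OF xs] by simp
  hence "wp z1 = a" using right_cancel[OF x _ ac, of "wp z1"] z1 by simp
  hence "l a \<le> length z1" using len_le z1 by blast
  moreover have "l (a \<cdot> x) = length z1 + length z2" using zs z by (simp add: reduced_word_def)
  ultimately show ?thesis using len_mult[OF ac x] \<open>z2 = xs\<close> xs by (simp add: reduced_word_def)
qed

text \<open>From absence of simple descents to true minimality: let b x be a shortest element of the
  coset. If b were not the identity, the first letter of a reduced word of b^{-1} would be a left
  descent of x lying in J.\<close>

lemma lmin_len: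
  assumes J: "J \<subseteq> I" and a: "a \<in> par J" and x: "lmin J x"
  shows "l (a \<cdot> x) = l a + l x"
proof -
  have xc: "x \<in> G" using x by (simp add: lmin_def)
  let ?P = "\<lambda>b. b \<in> par J"
  obtain b where b: "?P b" "\<And>c. ?P c \<Longrightarrow> l (b \<cdot> x) \<le> l (c \<cdot> x)"
    using ex_has_least_nat[of ?P \<one> "\<lambda>b. l (b \<cdot> x)"] par_one[OF J] by blast
  have bc: "b \<in> G" using par_closed J b by blast
  let ?x0 = "b \<cdot> x"
  have x0: "?x0 \<in> G" using bc xc by simp
  have add: "l (c \<cdot> ?x0) = l c + l ?x0" if "c \<in> par J" for c
  proof (rule coset_min_len[OF J that x0])
    fix d assume "d \<in> par J"
    hence "l ?x0 \<le> l ((d \<cdot> b) \<cdot> x)" using b par_mult[OF J] by blast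
    thus "l ?x0 \<le> l (d \<cdot> ?x0)" using par_closed[OF J \<open>d \<in> _\<close>] bc xc by (simp add: m_assoc)
  qed
  have "b = \<one>"
  proof (rule ccontr)
    assume "b \<noteq> \<one>"
    have ib: "inv b \<in> par J" using par_inv J b by blast
    then obtain xs where xs: "xs \<in> lists J" "red xs (inv b)" using par_reduced J by blast
    have "xs \<noteq> []"
    proof
      assume "xs = []"
      hence "inv b = \<one>" using xs(2) by (auto simp: reduced_word_def)
      thus False using \<open>b \<noteq> \<one>\<close> bc by (metis inv_inv inv_one)
    qed
    then obtain j ys where j: "xs = j # ys" by (cases xs) auto
    have jJ: "j \<in> J" "j \<in> I" using xs j J by auto
    note r = reduced_Cons[OF xs(2)[unfolded j]]
    have sj: "s j \<cdot> inv b \<in> par J" using par_mult[OF J par_s[OF jJ(1)] ib] .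
    have "x = inv b \<cdot> ?x0" "s j \<cdot> x = (s j \<cdot> inv b) \<cdot> ?x0" using bc xc jJ by (simp_all add: m_assoc)
    hence "l (s j \<cdot> x) < l x" using add[OF ib] add[OF sj] r(4) by simp
    hence "j \<in> ldes x" using ldes_iff xc jJ by blast
    thus False using x jJ by (auto simp: lmin_def)
  qed
  thus ?thesis using add[OF a] xc by simp
qed

lemma rmin_len:
  assumes K: "K \<subseteq> I" and a: "a \<in> par K" and x: "rmin K x"
  shows "l (x \<cdot> a) = l x + l a"
proof -
  have xc: "x \<in> G" and ac: "a \<in> G" using x par_closed K a by (auto simp: rmin_def)
  have "l (inv a \<cdot> inv x) = l (inv a) + l (inv x)"
    using lmin_len[OF K par_inv[OF K a]] rmin_lmin[OF xc K] x by simp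
  thus ?thesis using xc ac len_inv[of "x \<cdot> a"] by (simp add: inv_mult_group)
qed

lemma lmin_exists:
  assumes J: "J \<subseteq> I" shows "x \<in> G \<Longrightarrow> \<exists>a\<in>par J. \<exists>y. lmin J y \<and> x = a \<cdot> y"
proof (induction "l x" arbitrary: x rule: less_induct)
  case less
  show ?case
  proof (cases "lmin J x")
    case True
    thus ?thesis using par_one[OF J] less by (intro bexI[of _ \<one>] exI[of _ x]) auto
  next
    case False
    then obtain j where j: "j \<in> J" "j \<in> ldes x" using less by (auto simp: lmin_def)
    hence "j \<in> I" using J by auto
    hence "l (s j \<cdot> x) < l x" "s j \<cdot> x \<in> G" using ldes_iff less.prems j by auto
    then obtain a y where a: "a \<in> par J" "lmin J y" "s j \<cdot> x = a \<cdot> y" using less.hyps by blast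
    have "x = (s j \<cdot> a) \<cdot> y" using a less.prems \<open>j \<in> I\<close> par_closed[OF J a(1)] s_cancel[of j x]
      by (simp add: m_assoc lmin_def)
    thus ?thesis using a par_mult[OF J par_s[OF j(1)] a(1)] by blast
  qed
qed

lemma lmin_mono: "lmin J x \<Longrightarrow> J' \<subseteq> J \<Longrightarrow> lmin J' x"
  by (auto simp: lmin_def)

lemma lmin_right_le: "lmin J v \<Longrightarrow> rle u v \<Longrightarrow> lmin J u"
  using right_le_ldes right_le_closed unfolding lmin_def by blast

lemma lmin_N: assumes "J \<subseteq> I" "lmin J x" shows "N x \<inter> par J = {}"
proof (rule ccontr)
  assume "N x \<inter> par J \<noteq> {}"
  then obtain t where t: "t \<in> N x" "t \<in> par J" by blast
  have x: "x \<in> G" using assms by (simp add: lmin_def)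
  hence "t \<in> refl" using N_refl t by blast
  hence "l (t \<cdot> x) < l x" using len_refl_less x t by blast
  thus False using lmin_len[OF assms(1) t(2) assms(2)] by simp
qed


section \<open>Blocks\<close>

lemma rcoset_par: "par_x \<in> par J #> x \<longleftrightarrow> (\<exists>a\<in>par J. par_x = a \<cdot> x)"
  by (auto simp: r_coset_def)

lemma lcoset_par: "par_x \<in> x <# par K \<longleftrightarrow> (\<exists>a\<in>par K. par_x = x \<cdot> a)"
  by (auto simp: l_coset_def)

text \<open>\<open>ARG_MIN\<close> only promises some element of least length; additivity over the
  coset shows that there is no other candidate than y.\<close>

lemma left_min_eq:
  assumes J: "J \<subseteq> I" and a: "a \<in> par J" and y: "lmin J y"
  shows "left_min W J (a \<cdot> y) = y"
proof -
  let ?x = "a \<cdot> y" and ?z = "left_min W J (a \<cdot> y)"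
  let ?P = "\<lambda>z. z \<in> par J #> ?x"
  have c: "a \<in> G" "y \<in> G" using a y par_closed J by (auto simp: lmin_def)
  have y': "?P y" unfolding rcoset_par using par_inv[OF J a] c by (intro bexI[of _ "inv a"]) auto
  have z: "?P ?z" "l ?z \<le> l y"
    unfolding left_min_def using arg_min_natI[of ?P y l] arg_min_nat_le[of ?P y l] y' by auto
  then obtain b where b: "b \<in> par J" "?z = b \<cdot> (a \<cdot> y)" unfolding rcoset_par by blast
  have ba: "b \<cdot> a \<in> par J" using par_mult[OF J b(1) a] .
  have z': "?z = (b \<cdot> a) \<cdot> y" using b c par_closed[OF J b(1)] by (simp add: m_assoc)
  hence "l (b \<cdot> a) = 0" using lmin_len[OF J ba y] z by simp
  hence "b \<cdot> a = \<one>" using len_eq_0 par_closed[OF J ba] by blast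
  thus ?thesis using z' c by simp
qed

lemma right_min_eq:
  assumes K: "K \<subseteq> I" and a: "a \<in> par K" and y: "rmin K y"
  shows "right_min W K (y \<cdot> a) = y"
proof -
  let ?x = "y \<cdot> a" and ?z = "right_min W K (y \<cdot> a)"
  let ?P = "\<lambda>z. z \<in> ?x <# par K"
  have c: "a \<in> G" "y \<in> G" using a y par_closed K by (auto simp: rmin_def)
  have y': "?P y" unfolding lcoset_par
    using par_inv[OF K a] c by (intro bexI[of _ "inv a"]) (auto simp: m_assoc)
  have z: "?P ?z" "l ?z \<le> l y"
    unfolding right_min_def using arg_min_natI[of ?P y l] arg_min_nat_le[of ?P y l] y' by auto
  then obtain b where b: "b \<in> par K" "?z = (y \<cdot> a) \<cdot> b" unfolding lcoset_par by blast
  have ab: "a \<cdot> b \<in> par K" using par_mult[OF K a b(1)] .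
  have z': "?z = y \<cdot> (a \<cdot> b)" using b c par_closed[OF K b(1)] by (simp add: m_assoc)
  hence "l (a \<cdot> b) = 0" using rmin_len[OF K ab y] z by simp
  hence "a \<cdot> b = \<one>" using len_eq_0 par_closed[OF K ab] by blast
  thus ?thesis using z' c by simp
qed

text \<open>The coset equation x W_K = W_J x rewritten as x^{-1} W_J x = W_K. In this form it is
  visibly unchanged when x is multiplied by W_J from the left, and inverting x exchanges J and
  K.\<close>

definition blk :: "'w \<Rightarrow> 'i set \<Rightarrow> 'i set \<Rightarrow> bool" where
  "blk x J K \<longleftrightarrow> J \<subseteq> I \<and> K \<subseteq> I \<and> (\<forall>a\<in>G. a \<in> par J \<longleftrightarrow> conj x a \<in> par K)"

lemma blkD:
  assumes "blk x J K"
  shows "J \<subseteq> I" "K \<subseteq> I"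
    "a \<in> G \<Longrightarrow> a \<in> par J \<longleftrightarrow> conj x a \<in> par K"
  using assms by (auto simp: blk_def)

lemma block_pair_blk:
  assumes x: "x \<in> G" shows "block_pair W x J K \<longleftrightarrow> blk x J K"
proof -
  have "x <# par K = par J #> x \<longleftrightarrow> (\<forall>a\<in>G. a \<in> par J \<longleftrightarrow> conj x a \<in> par K)"
    if JK: "J \<subseteq> I" "K \<subseteq> I"
  proof
    assume eq: "x <# par K = par J #> x"
    show "\<forall>a\<in>G. a \<in> par J \<longleftrightarrow> conj x a \<in> par K"
    proof
      fix a assume a: "a \<in> G"
      have "a \<in> par J \<longleftrightarrow> a \<cdot> x \<in> par J #> x"
        unfolding rcoset_par using right_cancel[OF x a] par_closed[OF JK(1)] by blast
      also have "\<dots> \<longleftrightarrow> a \<cdot> x \<in> x <# par K" unfolding eq ..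
      also have "\<dots> \<longleftrightarrow> (\<exists>c\<in>par K. conj x a = c)"
        unfolding lcoset_par using conj_eq_iff[OF x a] par_closed[OF JK(2)] by blast
      finally show "a \<in> par J \<longleftrightarrow> conj x a \<in> par K" by blast
    qed
  next
    assume R: "\<forall>a\<in>G. a \<in> par J \<longleftrightarrow> conj x a \<in> par K"
    show "x <# par K = par J #> x"
    proof (rule Set.set_eqI)
      fix y
      show "y \<in> x <# par K \<longleftrightarrow> y \<in> par J #> x"
      proof
        assume "y \<in> x <# par K"
        then obtain c where c: "c \<in> par K" "y = x \<cdot> c" unfolding lcoset_par by blast
        have cc: "c \<in> G" using par_closed JK c by blast
        let ?a = "conj (inv x) c"
        have "?a \<in> par J" using R c cc x by simp
        moreover have "y = ?a \<cdot> x" using mult_conj[of x ?a] c cc x by simp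
        ultimately show "y \<in> par J #> x" unfolding rcoset_par by blast
      next
        assume "y \<in> par J #> x"
        then obtain a where a: "a \<in> par J" "y = a \<cdot> x" unfolding rcoset_par by blast
        have ac: "a \<in> G" using par_closed JK a by blast
        have "conj x a \<in> par K" using R a ac by blast
        moreover have "y = x \<cdot> conj x a" using mult_conj[of x a] a ac x by simp
        ultimately show "y \<in> x <# par K" unfolding lcoset_par by blast
      qed
    qed
  qed
  thus ?thesis unfolding block_pair_def blk_def by blast
qed

lemma conj_par:
  assumes "J \<subseteq> I" "b \<in> par J" "a \<in> G"
  shows "conj b a \<in> par J \<longleftrightarrow> a \<in> par J"
proof -
  have bc: "b \<in> G" using par_closed assms by blast
  have "conj b a \<in> par J" if "a \<in> par J" "b \<in> par J" for a b
    unfolding conj_def using that par_mult par_inv assms(1) by metis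
  from this[of a b] this[of "conj b a" "inv b"] show ?thesis
    using assms bc par_inv[OF assms(1,2)] conj_inv'[OF bc assms(3)] by auto
qed

lemma blk_left_mult:
  assumes "b \<in> par J" "J \<subseteq> I" "x \<in> G"
  shows "blk (b \<cdot> x) J K \<longleftrightarrow> blk x J K"
proof -
  have bc: "b \<in> G" using par_closed assms by blast
  have 1: "a \<in> par J \<longleftrightarrow> conj b a \<in> par J" if "a \<in> G" for a using conj_par assms that by blast
  have 2: "conj (b \<cdot> x) a = conj x (conj b a)" if "a \<in> G" for a
    using conj_mult bc assms that by blast
  have "(\<forall>a\<in>G. a \<in> par J \<longleftrightarrow> conj (b \<cdot> x) a \<in> par K) \<longleftrightarrow>
    (\<forall>a\<in>G. conj b a \<in> par J \<longleftrightarrow> conj x (conj b a) \<in> par K)" using 1 2 by simp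
  also have "\<dots> \<longleftrightarrow> (\<forall>a\<in>G. a \<in> par J \<longleftrightarrow> conj x a \<in> par K)"
    using conj_inv[OF bc] conj_closed bc inv_closed by metis
  finally show ?thesis unfolding blk_def by blast
qed

lemma blk_rmin:
  assumes "blk v J K" "lmin J v" shows "rmin K v"
proof (rule ccontr)
  assume "\<not> rmin K v"
  moreover have v: "v \<in> G" using assms by (simp add: lmin_def)
  ultimately obtain k where k: "k \<in> K" "k \<in> rdes v" by (auto simp: rmin_def)
  note JK = blkD(1,2)[OF assms(1)]
  have kI: "k \<in> I" using k JK by blast
  let ?a = "conj (inv v) (s k)"
  have a: "?a \<in> par J" using blkD(3)[OF assms(1), of ?a] v kI par_s[OF k(1)] by simp
  have "?a \<cdot> v = v \<cdot> s k" using mult_conj[of v ?a] v kI by simp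
  thus False using lmin_len[OF JK(1) a assms(2)] rdes_len[OF v kI] k by simp
qed

text \<open>Since v is minimal for J on the left and for K on the right, conjugation by v preserves
  length on W_J; an element of length one in W_K is a simple reflection of K.\<close>

lemma blk_simple:
  assumes "blk v J K" "lmin J v" "j \<in> J" shows "\<exists>k\<in>K. s j \<cdot> v = v \<cdot> s k"
proof -
  note JK = blkD(1,2)[OF assms(1)]
  have v: "v \<in> G" using assms by (simp add: lmin_def)
  have jI: "j \<in> I" using assms JK by blast
  let ?c = "conj v (s j)"
  have cK: "?c \<in> par K" using blkD(3)[OF assms(1), of "s j"] par_s[OF assms(3)] jI by simp
  have e: "s j \<cdot> v = v \<cdot> ?c" using mult_conj[of v "s j"] v jI by simp
  have "l (s j \<cdot> v) = l v + 1" using lmin_len[OF JK(1) par_s[OF assms(3)] assms(2)] jI by simp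
  moreover have "l (v \<cdot> ?c) = l v + l ?c" using rmin_len[OF JK(2) cK blk_rmin[OF assms(1,2)]] .
  ultimately have "l ?c = 1" using e by simp
  obtain xs where xs: "xs \<in> lists K" "red xs ?c" using par_reduced[OF JK(2) cK] by blast
  hence "length xs = 1" using \<open>l ?c = 1\<close> by (simp add: reduced_word_def)
  then obtain k where k: "xs = [k]" by (cases xs) auto
  hence "k \<in> K" "?c = s k" using xs JK by (auto simp: reduced_word_def)
  thus ?thesis using e by auto
qed

lemma blk_inv: "x \<in> G \<Longrightarrow> blk x J K \<Longrightarrow> blk (inv x) K J"
  unfolding blk_def using conj_closed inv_closed conj_inv by metis

lemma blk_simple':
  assumes "blk v J K" "lmin J v" "k \<in> K" shows "\<exists>j\<in>J. s j \<cdot> v = v \<cdot> s k"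
proof -
  have v: "v \<in> G" using assms by (simp add: lmin_def)
  note JK = blkD(1,2)[OF assms(1)]
  have "lmin K (inv v)" using blk_rmin[OF assms(1,2)] rmin_lmin v JK by blast
  then obtain j where j: "j \<in> J" "s k \<cdot> inv v = inv v \<cdot> s j"
    using blk_simple[OF blk_inv[OF v assms(1)] _ assms(3)] by blast
  thus ?thesis using s_mult_eq_inv[of v k j] v JK assms(3) by blast
qed

lemma conj_par_image:
  assumes J: "J \<subseteq> I" and K: "K \<subseteq> I" and v: "v \<in> G"
    and h: "\<And>j. j \<in> J \<Longrightarrow> conj v (s j) \<in> par K"
    and a: "a \<in> par J"
  shows "conj v a \<in> par K"
proof -
  have "conj v (wp xs) \<in> par K" if "xs \<in> lists J" for xs using that
  proof (induction xs rule: list.induct)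
    case Nil
    thus ?case using par_one[OF K] v by (simp add: conj_def)
  next
    case (Cons i xs)
    have c: "s i \<in> G" "wp xs \<in> G" "i \<in> J" using Cons.prems J lists_mono[OF J] by auto
    have "conj v (s i \<cdot> wp xs) = conj v (s i) \<cdot> conj v (wp xs)"
      using c v by (simp add: conj_def m_assoc)
    thus ?case using Cons h[OF c(3)] par_mult[OF K] by simp
  qed
  moreover obtain xs where "xs \<in> lists J" "wp xs = a" using a par_word[OF J, of a] by auto
  ultimately show ?thesis by auto
qed

lemma blkI:
  assumes J: "J \<subseteq> I" and K: "K \<subseteq> I" and v: "v \<in> G"
    and 1: "\<And>j. j \<in> J \<Longrightarrow> \<exists>k\<in>K. s j \<cdot> v = v \<cdot> s k"
    and 2: "\<And>k. k \<in> K \<Longrightarrow> \<exists>j\<in>J. s j \<cdot> v = v \<cdot> s k"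
  shows "blk v J K"
proof -
  have e: "conj v (s j) = s k \<and> conj (inv v) (s k) = s j"
    if "s j \<cdot> v = v \<cdot> s k" "j \<in> I" "k \<in> I" for j k
    using conj_eq_iff[of v "s j" "s k"] conj_inv'[of v "s j"] that v by auto
  have A: "conj v a \<in> par K" if a: "a \<in> par J" for a
  proof (rule conj_par_image[OF J K v _ a])
    fix j assume j: "j \<in> J"
    then obtain k where k: "k \<in> K" "s j \<cdot> v = v \<cdot> s k" using 1 by blast
    hence "conj v (s j) = s k" using e j J K by blast
    thus "conj v (s j) \<in> par K" using par_s[OF k(1)] by simp
  qed
  have C: "conj (inv v) c \<in> par J" if c: "c \<in> par K" for c
  proof (rule conj_par_image[OF K J inv_closed[OF v] _ c])
    fix k assume k: "k \<in> K"
    then obtain j where j: "j \<in> J" "s j \<cdot> v = v \<cdot> s k" using 2 by blast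
    hence "conj (inv v) (s k) = s j" using e k J K by blast
    thus "conj (inv v) (s k) \<in> par J" using par_s[OF j(1)] by simp
  qed
  have "a \<in> par J \<longleftrightarrow> conj v a \<in> par K" if a: "a \<in> G" for a
    using A[of a] C[of "conj v a"] conj_inv'[OF v a] by auto
  thus ?thesis unfolding blk_def using J K by blast
qed

text \<open>The J'-minimal element of W_J' b v is m v with m in W_J, hence above v in left weak
  order, and it equals v exactly if b lies in W_J'. Reducedness of J thus means that b has full
  support J.\<close>

lemma left_reduced_iff:
  assumes J: "J \<subseteq> I" and b: "b \<in> par J" and v: "lmin J v"
  shows "left_reduced W (b \<cdot> v) J \<longleftrightarrow> (\<forall>J'. J' \<subset> J \<longrightarrow> b \<notin> par J')"
proof
  assume L: "left_reduced W (b \<cdot> v) J"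
  show "\<forall>J'. J' \<subset> J \<longrightarrow> b \<notin> par J'"
  proof (intro allI impI notI)
    fix J' assume J': "J' \<subset> J" "b \<in> par J'"
    hence "left_min W J' (b \<cdot> v) = v" using left_min_eq[of J' b v] J lmin_mono[OF v] by blast
    moreover have "left_min W J (b \<cdot> v) \<noteq> left_min W J' (b \<cdot> v)"
      using L J'(1) by (simp add: left_reduced_def)
    ultimately show False using left_min_eq[OF J b v] by simp
  qed
next
  assume R: "\<forall>J'. J' \<subset> J \<longrightarrow> b \<notin> par J'"
  have c: "b \<in> G" "v \<in> G" using par_closed J b v by (auto simp: lmin_def)
  show "left_reduced W (b \<cdot> v) J" unfolding left_reduced_def left_min_eq[OF J b v]
  proof (intro allI impI)
    fix J' assume J': "J' \<subset> J"
    hence J'I: "J' \<subseteq> I" using J by blast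
    obtain b' v' where b': "b' \<in> par J'" "lmin J' v'" "b \<cdot> v = b' \<cdot> v'"
      using lmin_exists[OF J'I, of "b \<cdot> v"] c by blast
    have c': "b' \<in> G" "v' \<in> G" using par_closed J'I b' by (auto simp: lmin_def)
    have lm: "left_min W J' (b \<cdot> v) = v'" using left_min_eq[OF J'I] b' by metis
    let ?m = "inv b' \<cdot> b"
    have b'J: "b' \<in> par J" using par_mono[of J' J] J' b' by blast
    have m: "?m \<in> par J" using par_mult[OF J par_inv[OF J b'J] b] .
    have "v' = inv b' \<cdot> (b' \<cdot> v')" using c' by simp
    hence v': "v' = ?m \<cdot> v" using b' c c' by (simp add: m_assoc)
    have "left_le W v v'" unfolding v' using left_le_mult[of ?m v] lmin_len[OF J m v] c c' by simp
    moreover have "v \<noteq> v'"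
    proof
      assume "v = v'"
      hence "b = b'" using b'(3) right_cancel c c' by blast
      thus False using R J' b' by blast
    qed
    ultimately show "left_le W v (left_min W J' (b \<cdot> v)) \<and> v \<noteq> left_min W J' (b \<cdot> v)"
      using lm by simp
  qed
qed

lemma right_reduced_iff:
  assumes K: "K \<subseteq> I" and b: "b \<in> par K" and v: "rmin K v"
  shows "right_reduced W (v \<cdot> b) K \<longleftrightarrow> (\<forall>K'. K' \<subset> K \<longrightarrow> b \<notin> par K')"
proof
  have mono: "rmin K' v" if "K' \<subseteq> K" for K' using v that by (auto simp: rmin_def)
  assume L: "right_reduced W (v \<cdot> b) K"
  show "\<forall>K'. K' \<subset> K \<longrightarrow> b \<notin> par K'"
  proof (intro allI impI notI)
    fix K' assume K': "K' \<subset> K" "b \<in> par K'"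
    hence "right_min W K' (v \<cdot> b) = v" using right_min_eq[of K' b v] K mono by blast
    moreover have "right_min W K (v \<cdot> b) \<noteq> right_min W K' (v \<cdot> b)"
      using L K'(1) by (simp add: right_reduced_def)
    ultimately show False using right_min_eq[OF K b v] by simp
  qed
next
  assume R: "\<forall>K'. K' \<subset> K \<longrightarrow> b \<notin> par K'"
  have c: "b \<in> G" "v \<in> G" using par_closed K b v by (auto simp: rmin_def)
  show "right_reduced W (v \<cdot> b) K" unfolding right_reduced_def right_min_eq[OF K b v]
  proof (intro allI impI)
    fix K' assume K': "K' \<subset> K"
    hence K'I: "K' \<subseteq> I" using K by blast
    obtain d y where d: "d \<in> par K'" "lmin K' y" "inv (v \<cdot> b) = d \<cdot> y"
      using lmin_exists[OF K'I, of "inv (v \<cdot> b)"] c by auto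
    have dc: "d \<in> G" "y \<in> G" using par_closed K'I d by (auto simp: lmin_def)
    let ?b' = "inv d" and ?v' = "inv y"
    have b': "?b' \<in> par K'" "rmin K' ?v'" using par_inv K'I d rmin_lmin[of ?v' K'] dc by auto
    have "inv (inv (v \<cdot> b)) = ?v' \<cdot> ?b'" unfolding d(3) using dc by (simp add: inv_mult_group)
    hence e: "v \<cdot> b = ?v' \<cdot> ?b'" using c by simp
    have lm: "right_min W K' (v \<cdot> b) = ?v'" using right_min_eq[OF K'I b'] e by simp
    let ?m = "b \<cdot> d"
    have dK: "d \<in> par K" using par_mono[of K' K] K' d by blast
    have m: "?m \<in> par K" using par_mult[OF K b dK] .
    have "?v' = (?v' \<cdot> ?b') \<cdot> d" using dc by (simp add: m_assoc)
    hence v': "?v' = v \<cdot> ?m" unfolding e[symmetric] using c dc by (simp add: m_assoc)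
    have "rle v ?v'" unfolding v' using right_le_mult[of v ?m] rmin_len[OF K m v] c dc by simp
    moreover have "v \<noteq> ?v'"
    proof
      assume "v = ?v'"
      hence "b = ?b'" using e left_cancel[of v b ?b'] c dc by auto
      thus False using R K' b' by metis
    qed
    ultimately show "rle v (right_min W K' (v \<cdot> b)) \<and> v \<noteq> right_min W K' (v \<cdot> b)" using lm by simp
  qed
qed

text \<open>Conjugation by v matches the simple reflections of J and K one to one, so K' consists of
  the partners of J'. The last clause keeps proper inclusions proper.\<close>

lemma sub_block:
  assumes B: "blk v J K" and v: "lmin J v" and J': "J' \<subseteq> J"
  shows "\<exists>K'\<subseteq>K. blk v J' K' \<and> (K' = K \<longrightarrow> J' = J)"
proof -
  note JK = blkD(1,2)[OF B]
  have vc: "v \<in> G" using v by (simp add: lmin_def)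
  let ?K = "{k \<in> K. \<exists>j\<in>J'. s j \<cdot> v = v \<cdot> s k}"
  have "blk v J' ?K"
  proof (rule blkI)
    fix j assume j: "j \<in> J'"
    then obtain k where "k \<in> K" "s j \<cdot> v = v \<cdot> s k" using blk_simple[OF B v] J' by blast
    thus "\<exists>k\<in>?K. s j \<cdot> v = v \<cdot> s k" using j by blast
  qed (use JK J' vc in auto)
  moreover have "J' = J" if "?K = K"
  proof -
    have "j \<in> J'" if j: "j \<in> J" for j
    proof -
      obtain k where k: "k \<in> K" "s j \<cdot> v = v \<cdot> s k" using blk_simple[OF B v j] by blast
      then obtain j' where j': "j' \<in> J'" "s j' \<cdot> v = v \<cdot> s k" using \<open>?K = K\<close> by blast
      have jI: "j \<in> I" "j' \<in> I" using j j' J' JK by auto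
      have "s j = s j'" using right_cancel[of v "s j" "s j'"] k j' vc jI by simp
      thus ?thesis using s_inj jI j' by blast
    qed
    thus ?thesis using J' by blast
  qed
  ultimately show ?thesis by (intro exI[of _ ?K]) blast
qed

text \<open>Both sides are full-support conditions, for b in J and for its conjugate by v in K; the
  bijection between simple reflections carries one support to the other.\<close>

lemma reduced_left_right:
  assumes B: "blk v J K" and v: "lmin J v" and b: "b \<in> par J"
  shows "left_reduced W (b \<cdot> v) J \<longleftrightarrow> right_reduced W (b \<cdot> v) K"
proof -
  note JK = blkD(1,2)[OF B]
  have vc: "v \<in> G" "b \<in> G" using v par_closed JK b by (auto simp: lmin_def)
  note r = blk_rmin[OF B v]
  let ?c = "conj v b"
  have c: "?c \<in> par K" using blkD(3)[OF B] vc b by blast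
  have e: "b \<cdot> v = v \<cdot> ?c" using mult_conj vc by simp
  have "(\<forall>J'. J' \<subset> J \<longrightarrow> b \<notin> par J') \<longleftrightarrow> (\<forall>K'. K' \<subset> K \<longrightarrow> ?c \<notin> par K')"
  proof
    assume L: "\<forall>J'. J' \<subset> J \<longrightarrow> b \<notin> par J'"
    show "\<forall>K'. K' \<subset> K \<longrightarrow> ?c \<notin> par K'"
    proof (intro allI impI notI)
      fix K' assume K': "K' \<subset> K" "?c \<in> par K'"
      have i: "blk (inv v) K J" "lmin K (inv v)"
        using blk_inv[OF vc(1) B] r rmin_lmin[of v K] vc JK by auto
      obtain J' where J': "J' \<subseteq> J" "blk (inv v) K' J'" "J' = J \<longrightarrow> K' = K"
        using sub_block[OF i, of K'] K' by blast
      have "blk v J' K'" using blk_inv[OF _ J'(2)] vc by simp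
      hence "b \<in> par J'" using blkD(3)[of v J' K' b] K' vc by simp
      thus False using L J' K' by blast
    qed
  next
    assume R: "\<forall>K'. K' \<subset> K \<longrightarrow> ?c \<notin> par K'"
    show "\<forall>J'. J' \<subset> J \<longrightarrow> b \<notin> par J'"
    proof (intro allI impI notI)
      fix J' assume J': "J' \<subset> J" "b \<in> par J'"
      obtain K' where K': "K' \<subseteq> K" "blk v J' K'" "K' = K \<longrightarrow> J' = J"
        using sub_block[OF B v, of J'] J' by blast
      hence "?c \<in> par K'" using blkD(3)[of v J' K' b] J' vc by simp
      thus False using R J' K' by blast
    qed
  qed
  thus ?thesis using left_reduced_iff[OF JK(1) b v] right_reduced_iff[OF JK(2) c r] e by simp
qed

end

section \<open>The interval below w: blocks, cutting points and descent classes\<close>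

locale coxeter_interval = coxeter_system W for W :: "('w, 'i) coxeter" (structure) +
  fixes w :: 'w
  assumes fin: "finite G" and w_closed [simp]: "w \<in> G"
begin

abbreviation "V \<equiv> right_interval W w"
abbreviation "RB \<equiv> reduced_left_blocks W w"
abbreviation cut :: "'i set \<Rightarrow> 'w" where "cut K \<equiv> left_min W K w"
abbreviation "JJ \<equiv> left_block_of W w"

lemma fin_I: "finite I"
proof -
  have "inj_on s I" using s_inj by (auto simp: inj_on_def)
  moreover have "finite (s ` I)" using fin by (rule finite_subset[rotated]) auto
  ultimately show ?thesis using finite_image_iff by blast
qed

lemma V_iff: "u \<in> V \<longleftrightarrow> rle u w"
  using right_le_closed by (auto simp: right_interval_def)

lemma V_closed: "u \<in> V \<Longrightarrow> u \<in> G"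
  by (simp add: right_interval_def)

lemma fin_V: "finite V"
  using fin by (simp add: right_interval_def)

lemma V_right_le: "v \<in> V \<Longrightarrow> rle u v \<Longrightarrow> u \<in> V"
  using V_iff right_le_trans by blast

lemma one_V: "\<one> \<in> V"
  by (simp add: V_iff right_le_N)

text \<open>Moving b past v turns it into an element of W_K, so w = b v = v c with c in W_K. Hence
  the left and the right minimal elements coincide, and v is a prefix of w.\<close>

lemma block_factor:
  assumes B: "blk w J K"
  obtains b where "b \<in> par J" "w = b \<cdot> cut J" "lmin J (cut J)" "blk (cut J) J K"
    "right_min W K w = cut J" "cut J \<in> V"
proof -
  note JK = blkD(1,2)[OF B]
  obtain b v where b: "b \<in> par J" "lmin J v" "w = b \<cdot> v"
    using lmin_exists[OF JK(1) w_closed] by metis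
  have c: "b \<in> G" "v \<in> G" using b par_closed JK by (auto simp: lmin_def)
  have v: "cut J = v" using left_min_eq[OF JK(1) b(1,2)] b(3) by simp
  have Bv: "blk v J K" using B blk_left_mult[OF b(1) JK(1) c(2)] b(3) by simp
  have k: "conj v b \<in> par K" using blkD(3)[OF Bv c(1)] b by blast
  have e: "w = v \<cdot> conj v b" using b(3) mult_conj c by simp
  have r: "right_min W K w = v" using right_min_eq[OF JK(2) k blk_rmin[OF Bv b(2)]] e by simp
  have "rle v w"
    using right_le_mult[of v "conj v b"] rmin_len[OF JK(2) k blk_rmin[OF Bv b(2)]] c e by simp
  hence "v \<in> V" using V_iff by blast
  thus thesis using that[of b] b Bv r unfolding v by blast
qed

text \<open>Compute N of a v = v (v^{-1} a v) in both orders. Outside W_J neither a nor its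
  conjugate in W_K contributes, so the inversions of v outside W_J are stable under conjugation by
  W_J.\<close>

lemma blk_conj_N:
  assumes B: "blk v J K" and v: "lmin J v" and a: "a \<in> par J"
    and t: "t \<in> G" "t \<notin> par J"
  shows "conj a t \<in> N v \<longleftrightarrow> t \<in> N v"
proof -
  note JK = blkD(1,2)[OF B]
  have c: "a \<in> G" "v \<in> G" using a v par_closed JK by (auto simp: lmin_def)
  have k: "conj v a \<in> par K" using blkD(3)[OF B c(1)] a by blast
  have "t \<in> N (a \<cdot> v) \<longleftrightarrow> conj a t \<in> N v" using N_mult[OF c t(1)] par_N[OF JK(1) a] t by blast
  moreover have "conj v t \<notin> N (conj v a)" using par_N[OF JK(2) k] blkD(3)[OF B t(1)] t by blast
  hence "t \<in> N (v \<cdot> conj v a) \<longleftrightarrow> t \<in> N v" using N_mult[OF c(2) _ t(1), of "conj v a"] c by simp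
  ultimately show ?thesis using mult_conj[OF c(2,1)] by simp
qed

text \<open>N(a) lies inside W_J, N(x) avoids W_J by minimality, and conjugation by a preserves W_J;
  so the two parts of the symmetric difference never meet.\<close>

lemma lmin_N_mult:
  assumes J: "J \<subseteq> I" and a: "a \<in> par J" and x: "lmin J x" and t: "t \<in> G"
  shows "t \<in> N (a \<cdot> x) \<longleftrightarrow> (if t \<in> par J then t \<in> N a else conj a t \<in> N x)"
proof -
  have c: "a \<in> G" "x \<in> G" using a x par_closed J by (auto simp: lmin_def)
  have "conj a t \<notin> N x" if "t \<in> par J" using that conj_par[OF J a t] lmin_N[OF J x] by blast
  moreover have "t \<notin> N a" if "t \<notin> par J" using that par_N[OF J a] by blast
  ultimately show ?thesis using N_mult[OF c t] by auto
qed

text \<open>The product structure of the interval along a block. Containment of inversion sets is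
  tested separately inside W_J, where only a and b matter, and outside, where
  \<open>blk_conj_N\<close> removes the twist by a and leaves x and the cutting point.\<close>

lemma V_factor:
  assumes B: "blk w J K" and a: "a \<in> par J" and x: "lmin J x"
    and b: "b \<in> par J" "w = b \<cdot> cut J"
  shows "a \<cdot> x \<in> V \<longleftrightarrow> rle a b \<and> rle x (cut J)"
proof -
  note JK = blkD(1,2)[OF B]
  let ?v = "cut J"
  have v: "lmin J ?v" "blk ?v J K" using block_factor[OF B] by metis+
  have c: "a \<in> G" "x \<in> G" "b \<in> G" "?v \<in> G" using a x b v par_closed JK by (auto simp: lmin_def)
  have Nw: "t \<in> N w \<longleftrightarrow> (if t \<in> par J then t \<in> N b else t \<in> N ?v)" if "t \<in> G" for t
    using lmin_N_mult[OF JK(1) b(1) v(1) that] b(2) blk_conj_N[OF v(2,1) b(1) that] by simp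
  have "a \<cdot> x \<in> V \<longleftrightarrow> N (a \<cdot> x) \<subseteq> N w" using V_iff right_le_N c by simp
  also have "\<dots> \<longleftrightarrow> N a \<subseteq> N b \<and> N x \<subseteq> N ?v"
  proof
    assume L: "N (a \<cdot> x) \<subseteq> N w"
    show "N a \<subseteq> N b \<and> N x \<subseteq> N ?v"
    proof (intro conjI subsetI)
      fix t assume "t \<in> N a"
      moreover from this have "t \<in> par J" "t \<in> G" using par_N[OF JK(1) a] N_subset by auto
      ultimately show "t \<in> N b" using L Nw[of t] lmin_N_mult[OF JK(1) a x, of t] by auto
    next
      fix r assume r: "r \<in> N x"
      hence rc: "r \<in> G" "r \<notin> par J" using N_subset lmin_N[OF JK(1) x] by auto
      \<comment> \<open>The inversion r of x appears in a x as its conjugate \<open>?t\<close>;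
        invariance of the inversions of the cutting point brings it back to r.\<close>
      let ?t = "conj (inv a) r"
      have tc: "?t \<in> G" using rc c by simp
      have ra: "conj a ?t = r" using rc c by simp
      have t: "?t \<notin> par J" using conj_par[OF JK(1) a tc] ra rc by simp
      hence "?t \<in> N (a \<cdot> x)" using lmin_N_mult[OF JK(1) a x tc] ra r by simp
      hence "?t \<in> N ?v" using L Nw[OF tc] t by auto
      thus "r \<in> N ?v" using blk_conj_N[OF v(2,1) a tc t] ra by simp
    qed
  next
    assume R: "N a \<subseteq> N b \<and> N x \<subseteq> N ?v"
    show "N (a \<cdot> x) \<subseteq> N w"
    proof
      fix t assume t: "t \<in> N (a \<cdot> x)"
      hence tc: "t \<in> G" using N_subset by blast
      show "t \<in> N w"
      proof (cases "t \<in> par J")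
        case True
        thus ?thesis using t lmin_N_mult[OF JK(1) a x tc] Nw[OF tc] R by auto
      next
        case False
        hence "conj a t \<in> N ?v" using t lmin_N_mult[OF JK(1) a x tc] R by auto
        thus ?thesis using False blk_conj_N[OF v(2,1) a tc] Nw[OF tc] by simp
      qed
    qed
  qed
  finally show ?thesis using right_le_N c by simp
qed

text \<open>The case a = 1 of the product structure. It translates the weak-order condition in the
  definition of the block of u into absence of left descents.\<close>

lemma right_le_cut:
  assumes B: "blk w J K"
  shows "rle u (cut J) \<longleftrightarrow> u \<in> V \<and> lmin J u"
proof -
  obtain b where b: "b \<in> par J" "w = b \<cdot> cut J" "lmin J (cut J)" "cut J \<in> V"
    using block_factor[OF B] by metis
  note JK = blkD(1,2)[OF B]
  have bc: "b \<in> G" using par_closed JK b by blast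
  show ?thesis
  proof
    assume "rle u (cut J)"
    thus "u \<in> V \<and> lmin J u" using V_right_le lmin_right_le b by blast
  next
    assume u: "u \<in> V \<and> lmin J u"
    hence "\<one> \<cdot> u \<in> V" using V_closed by simp
    thus "rle u (cut J)" using V_factor[OF B par_one[OF JK(1)] _ b(1,2), of u] u by blast
  qed
qed

lemma RB_iff: "J \<in> RB \<longleftrightarrow> (\<exists>K. blk w J K) \<and> left_reduced W w J"
  by (simp add: reduced_left_blocks_def block_pair_blk)

lemma RRB_iff: "K \<in> reduced_right_blocks W w \<longleftrightarrow> (\<exists>J\<in>RB. blk w J K)"
proof -
  have "left_reduced W w J \<longleftrightarrow> right_reduced W w K" if B: "blk w J K" for J
  proof -
    obtain b where "b \<in> par J" "w = b \<cdot> cut J" "lmin J (cut J)" "blk (cut J) J K"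
      using block_factor[OF B] by metis
    thus ?thesis using reduced_left_right by metis
  qed
  thus ?thesis
    unfolding Bex_def RB_iff reduced_right_blocks_def using block_pair_blk[OF w_closed] by blast
qed

lemma fin_RB: "finite RB"
proof (rule finite_subset)
  show "RB \<subseteq> Pow I" using RB_iff blkD(1) by blast
qed (simp add: fin_I)

lemma RB_reduced:
  assumes "J \<in> RB" "w = b \<cdot> v" "b \<in> par J" "lmin J v" "J' \<subset> J"
  shows "b \<notin> par J'"
  using assms RB_iff left_reduced_iff blkD(1) by metis

text \<open>Shrink J to a smallest J' with b in W_J', that is to the support of b. The cutting point
  does not change, conjugation by it still gives a block, and minimality is reducedness.\<close>

lemma block_reduce:
  assumes B: "blk w J K"
  shows "\<exists>J'\<in>RB. J' \<subseteq> J \<and> cut J' = cut J"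
proof -
  note JK = blkD(1,2)[OF B]
  obtain b where b: "b \<in> par J" "w = b \<cdot> cut J" "lmin J (cut J)" "blk (cut J) J K"
    using block_factor[OF B] by metis
  let ?P = "\<lambda>J'. J' \<subseteq> J \<and> b \<in> par J'"
  obtain J' where J': "?P J'" "\<And>J''. ?P J'' \<Longrightarrow> card J' \<le> card J''"
    using ex_has_least_nat[of ?P J card] b(1) by blast
  obtain K' where K': "blk (cut J) J' K'" using sub_block[OF b(4,3)] J' by blast
  have c: "cut J \<in> G" using b by (simp add: lmin_def)
  have lm: "lmin J' (cut J)" using lmin_mono b J' by blast
  have J'I: "J' \<subseteq> I" using J' JK by blast
  have e: "cut J' = cut J" using left_min_eq[OF J'I _ lm] J' b(2) by metis
  have "blk w J' K'" using K' blk_left_mult[of b J' "cut J"] J' J'I c b(2) by simp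
  moreover have "left_reduced W w J'"
  proof -
    have "b \<notin> par J''" if "J'' \<subset> J'" for J''
    proof
      assume "b \<in> par J''"
      hence "card J' \<le> card J''" using J'(2)[of J''] J' that by blast
      moreover have "card J'' < card J'"
        using that J'I fin_I by (meson finite_subset psubset_card_mono)
      ultimately show False by simp
    qed
    thus ?thesis using left_reduced_iff[OF J'I _ lm] J' b(2) by metis
  qed
  ultimately show ?thesis using RB_iff J' e by blast
qed

text \<open>This is what makes a largest reduced block for u exist. The union is a block because
  conjugation by w can be tested on generators; the work is to show that it is again
  reduced.\<close>

lemma RB_Un: assumes J1: "J1 \<in> RB" and J2: "J2 \<in> RB" shows "J1 \<union> J2 \<in> RB"
proof -
  obtain K1 K2 where K: "blk w J1 K1" "blk w J2 K2" using assms RB_iff by blast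
  let ?J = "J1 \<union> J2" and ?K = "K1 \<union> K2"
  have JK: "?J \<subseteq> I" "?K \<subseteq> I" using K blkD by blast+
  have "conj w a \<in> par ?K" if "a \<in> par ?J" for a
  proof (rule conj_par_image[OF JK w_closed _ that])
    fix j assume "j \<in> ?J"
    hence "conj w (s j) \<in> par K1 \<or> conj w (s j) \<in> par K2"
      using blkD(3)[OF K(1), of "s j"] blkD(3)[OF K(2), of "s j"] par_s[of j] JK by auto
    thus "conj w (s j) \<in> par ?K" using par_mono[of K1 ?K] par_mono[of K2 ?K] by blast
  qed
  moreover have "conj (inv w) c \<in> par ?J" if "c \<in> par ?K" for c
  proof (rule conj_par_image[OF JK(2,1) _ _ that])
    fix j assume "j \<in> ?K"
    hence "conj (inv w) (s j) \<in> par J1 \<or> conj (inv w) (s j) \<in> par J2"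
      using blkD(3)[OF blk_inv[OF w_closed K(1)], of "s j"]
        blkD(3)[OF blk_inv[OF w_closed K(2)], of "s j"] par_s[of j] JK by auto
    thus "conj (inv w) (s j) \<in> par ?J" using par_mono[of J1 ?J] par_mono[of J2 ?J] by blast
  qed simp
  ultimately have B: "blk w ?J ?K" unfolding blk_def using JK conj_inv' w_closed by metis
  obtain b where b: "b \<in> par ?J" "w = b \<cdot> cut ?J" "lmin ?J (cut ?J)"
    using block_factor[OF B] by metis
  have bc: "b \<in> G" "cut ?J \<in> G" using b par_closed[OF JK(1)] unfolding lmin_def by blast+
  \<comment> \<open>Let d be the W_J-part of w. Lengths add in both factorisations of w, so d is a
    prefix of b; if b lies in W_J', then d lies in the parabolic of J and J' together, and
    reducedness of J forces J to be contained in J'.\<close>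
  have *: "J \<subseteq> J'" if J': "b \<in> par J'" "J' \<subseteq> ?J" and J: "J \<in> RB" "J \<subseteq> ?J" for J J'
  proof (rule ccontr)
    assume "\<not> J \<subseteq> J'"
    obtain L where L: "blk w J L" using J RB_iff by blast
    have JI: "J \<subseteq> I" "J' \<subseteq> I" using J J' JK by blast+
    obtain d where d: "d \<in> par J" "w = d \<cdot> cut J" "lmin J (cut J)" using block_factor[OF L] by metis
    have dc: "d \<in> G" "cut J \<in> G" using d par_closed JI by (auto simp: lmin_def)
    have dJ: "d \<in> par ?J" using d par_mono J by blast
    let ?m = "inv d \<cdot> b"
    have m: "?m \<in> par ?J" using par_mult[OF JK(1) par_inv[OF JK(1) dJ] b(1)] .
    have "cut J = inv d \<cdot> w" using d dc by (metis inv_cancel)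
    also have "\<dots> = ?m \<cdot> cut ?J" by (subst b(2)) (use dc bc in \<open>simp add: m_assoc\<close>)
    finally have "l (cut J) = l ?m + l (cut ?J)" using lmin_len[OF JK(1) m b(3)] by simp
    moreover have "l w = l d + l (cut J)" using lmin_len[OF JI(1) d(1,3)] d(2) by simp
    moreover have "l w = l b + l (cut ?J)" using lmin_len[OF JK(1) b(1,3)] b(2) by simp
    ultimately have "l (d \<cdot> ?m) = l d + l ?m" using dc bc by simp
    moreover obtain xs ys where xs: "red xs d" "red ys ?m"
      using reduced_exists dc bc by (meson inv_closed m_closed)
    ultimately have "red (xs @ ys) b" using reduced_append dc bc by fastforce
    hence "xs @ ys \<in> lists J'" using par_letters JI J' by blast
    moreover have "xs \<in> lists J" using par_letters[OF JI(1) xs(1) d(1)] .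
    ultimately have "xs \<in> lists (J \<inter> J')" by auto
    hence "d \<in> par (J \<inter> J')" using par_word[of "J \<inter> J'" d] JI reduced_closed[OF xs(1)] by blast
    moreover have "J \<inter> J' \<subset> J" using \<open>\<not> J \<subseteq> J'\<close> by blast
    ultimately show False using RB_reduced[OF J(1) d(2,1,3)] by blast
  qed
  have "left_reduced W w ?J"
  proof -
    have "b \<notin> par J'" if "J' \<subset> ?J" for J' using *[of J' J1] *[of J' J2] J1 J2 that by blast
    thus ?thesis using left_reduced_iff[OF JK(1) b(1,3)] b(2) by simp
  qed
  thus ?thesis using B RB_iff by blast
qed

lemma RB_empty: "{} \<in> RB"
proof -
  have p: "par {} = {\<one>}" using par_word[of "{}"] by auto
  have "blk w {} {}" unfolding blk_def p using conj_eq_iff[of w _ \<one>] right_cancel[of w _ \<one>] by auto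
  then obtain J' where "J' \<in> RB" "J' \<subseteq> {}" using block_reduce by metis
  thus ?thesis by simp
qed

lemma blk_mono:
  assumes "blk w J K" "blk w J' K'" shows "J \<subseteq> J' \<longleftrightarrow> K \<subseteq> K'"
proof -
  have *: "K \<subseteq> K'" if "blk x J K" "blk x J' K'" "J \<subseteq> J'" "x \<in> G" for x J K J' K'
  proof
    fix k assume k: "k \<in> K"
    hence kI: "k \<in> I" using blkD(2)[OF that(1)] by blast
    let ?a = "conj (inv x) (s k)"
    have a: "?a \<in> G" "conj x ?a = s k" using kI that by auto
    hence "?a \<in> par J'" using blkD(3)[OF that(1) a(1)] par_s[OF k] par_mono[OF that(3)] by auto
    hence "s k \<in> par K'" using blkD(3)[OF that(2) a(1)] a by simp
    thus "k \<in> K'" using par_s_iff[OF blkD(2)[OF that(2)] kI] by simp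
  qed
  show ?thesis using *[of w J K J' K'] *[of "inv w" K J K' J'] assms blk_inv[OF w_closed] by auto
qed

text \<open>Reduced blocks J without left descents of u are closed under union, so one of largest
  size contains all others. The inclusion of left blocks agrees with that of right blocks, so its
  partner is the \<open>GREATEST\<close> right block.\<close>

lemma block_of:
  assumes u: "u \<in> V"
  shows "JJ u \<in> RB" "blk w (JJ u) (right_block_of W w u)"
    "J \<in> RB \<Longrightarrow> J \<subseteq> JJ u \<longleftrightarrow> lmin J u"
proof -
  let ?P = "\<lambda>J. J \<in> RB \<and> lmin J u"
  have uc: "u \<in> G" using V_closed u by blast
  have "?P {}" using RB_empty uc by (simp add: lmin_def)
  moreover have "\<forall>J. ?P J \<longrightarrow> card J < Suc (card I)"
    using RB_iff blkD(1) fin_I card_mono less_Suc_eq_le by meson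
  ultimately have "\<exists>J0. ?P J0 \<and> (\<forall>J. ?P J \<longrightarrow> card J \<le> card J0)" by (rule ex_has_greatest_nat)
  then obtain J0 where J0: "?P J0" "\<And>J. ?P J \<Longrightarrow> card J \<le> card J0" by blast
  obtain K0 where K0: "blk w J0 K0" using J0 RB_iff by blast
  have fJ: "finite J" if "J \<in> RB" for J using that RB_iff blkD(1) fin_I finite_subset by metis
  have max: "J \<subseteq> J0" if "?P J" for J
  proof -
    have P: "?P (J0 \<union> J)" using RB_Un J0(1) that by (auto simp: lmin_def)
    hence "card (J0 \<union> J) \<le> card J0" using J0(2) by blast
    hence "J0 \<union> J = J0" using card_seteq[of "J0 \<union> J" J0] fJ[of "J0 \<union> J"] P by auto
    thus ?thesis by blast
  qed
  let ?Q = "\<lambda>K. K \<in> reduced_right_blocks W w \<and> rle u (right_min W K w)"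
  have Q: "?Q K \<longleftrightarrow> (\<exists>J. ?P J \<and> blk w J K)" for K
  proof -
    have "rle u (right_min W K w) \<longleftrightarrow> lmin J u" if B: "blk w J K" for J
      using right_le_cut[OF B] block_factor[OF B] u by metis
    thus ?thesis using RRB_iff by blast
  qed
  have rb: "right_block_of W w u = K0" unfolding right_block_of_def
  proof (rule Greatest_equality)
    show "?Q K0" using Q[of K0] J0 K0 by metis
    show "K \<le> K0" if QK: "?Q K" for K
    proof -
      obtain J where "?P J" "blk w J K" using Q[of K] QK by metis
      thus ?thesis using blk_mono[OF _ K0] max by metis
    qed
  qed
  have lb: "JJ u = J0" unfolding left_block_of_def rb
  proof (rule the_equality)
    show "block_pair W w J0 K0" using K0 block_pair_blk by simp
    show "J = J0" if "block_pair W w J K0" for J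
      using that blk_mono[OF K0, of J K0] blk_mono[OF _ K0, of J K0] block_pair_blk by auto
  qed
  show "JJ u \<in> RB" "blk w (JJ u) (right_block_of W w u)" using lb rb J0 K0 by auto
  show "J \<in> RB \<Longrightarrow> J \<subseteq> JJ u \<longleftrightarrow> lmin J u" using lb max J0 lmin_mono by metis
qed

lemma right_block_of_mono:
  "u \<in> V \<Longrightarrow> v \<in> V \<Longrightarrow> right_block_of W w u \<subseteq> right_block_of W w v \<longleftrightarrow> JJ u \<subseteq> JJ v"
  using blk_mono block_of(2) by blast

lemma RB_cut:
  assumes "J \<in> RB" shows "cut J \<in> V" "lmin J (cut J)" "rle u (cut J) \<longleftrightarrow> u \<in> V \<and> lmin J u"
    "J \<subseteq> I"
proof -
  obtain K where B: "blk w J K" using assms RB_iff by blast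
  show "cut J \<in> V" "lmin J (cut J)" using block_factor[OF B] by metis+
  show "rle u (cut J) \<longleftrightarrow> u \<in> V \<and> lmin J u" using right_le_cut[OF B] .
  show "J \<subseteq> I" using blkD[OF B] by blast
qed

lemma JJ_right_le: assumes "rle u v" "v \<in> V" shows "JJ v \<subseteq> JJ u"
proof -
  have "u \<in> V" using V_right_le assms by blast
  moreover have "lmin (JJ v) v" using block_of[OF assms(2)] by blast
  hence "lmin (JJ v) u" using lmin_right_le assms by blast
  ultimately show ?thesis using block_of assms by blast
qed

text \<open>J and the block of its cutting point have the same cutting point, hence the same factor
  b. As b lies in W_J, reducedness of the larger block leaves no room for a proper
  inclusion.\<close>

lemma JJ_cut: assumes J: "J \<in> RB" shows "JJ (cut J) = J"
proof -
  let ?J0 = "JJ (cut J)"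
  note c = RB_cut[OF J]
  have J0: "?J0 \<in> RB" "J \<subseteq> ?J0" using block_of[OF c(1)] J c(2) by auto
  note c0 = RB_cut[OF J0(1)]
  have "lmin ?J0 (cut J)" using block_of[OF c(1)] by blast
  hence 1: "rle (cut J) (cut ?J0)" using c0(3) c by blast
  have "rle (cut ?J0) (cut J)" using c(3) c0(1,2) lmin_mono J0(2) by blast
  hence e: "cut ?J0 = cut J" using 1 right_le_antisym by blast
  obtain K K0 where B: "blk w J K" "blk w ?J0 K0" using J J0 RB_iff by blast
  obtain b where b: "b \<in> par J" "w = b \<cdot> cut J" using block_factor[OF B(1)] by metis
  have "b \<in> par ?J0" using par_mono[OF J0(2)] b by blast
  hence "\<not> J \<subset> ?J0" using RB_reduced[OF J0(1), of b "cut J" J] b e c0 by metis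
  thus ?thesis using J0 by blast
qed

lemma cut_interval_eq: "cut_interval W w = cut ` RB"
proof -
  have "cutting_point W v w \<longleftrightarrow> (\<exists>J K. blk w J K \<and> v = cut J)" for v
    unfolding cutting_point_def using block_factor block_pair_blk w_closed by metis
  moreover have "(\<exists>J K. blk w J K \<and> v = cut J) \<longleftrightarrow> (\<exists>J\<in>RB. v = cut J)" for v
    using block_reduce RB_iff by metis
  ultimately show ?thesis unfolding cut_interval_def by blast
qed

text \<open>A cutting point of \<open>cut J1\<close> is below it in right weak order, and larger
  elements have smaller blocks. Conversely W_J2 (cut J1) = W_J2 w if J1 is contained in J2, so J2 is
  also a block of \<open>cut J1\<close> with the same minimal element.\<close>

lemma cutting_point_cut:
  assumes J1: "J1 \<in> RB" and J2: "J2 \<in> RB"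
  shows "cutting_point W (cut J2) (cut J1) \<longleftrightarrow> J1 \<subseteq> J2"
proof
  have c1: "cut J1 \<in> G" using RB_cut(1)[OF J1] V_closed by blast
  assume "cutting_point W (cut J2) (cut J1)"
  then obtain J K where B: "blk (cut J1) J K" "cut J2 = left_min W J (cut J1)"
    unfolding cutting_point_def using block_pair_blk c1 by blast
  note JK = blkD(1,2)[OF B(1)]
  obtain b v where b: "b \<in> par J" "lmin J v" "cut J1 = b \<cdot> v"
    using lmin_exists[OF JK(1) c1] by blast
  have v: "v = cut J2" using left_min_eq[OF JK(1) b(1,2)] b(3) B(2) by simp
  have vc: "v \<in> G" "b \<in> G" using b par_closed JK by (auto simp: lmin_def)
  have Bv: "blk v J K" using blk_left_mult[OF b(1) JK(1) vc(1)] B(1) b(3) by simp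
  have k: "conj v b \<in> par K" using blkD(3)[OF Bv] b vc by blast
  have "rle v (cut J1)"
    using right_le_mult[of v "conj v b"] rmin_len[OF JK(2) k blk_rmin[OF Bv b(2)]] vc
      mult_conj[OF vc] b(3) by simp
  hence "JJ (cut J1) \<subseteq> JJ (cut J2)" using JJ_right_le RB_cut(1)[OF J1] v by blast
  thus "J1 \<subseteq> J2" using JJ_cut J1 J2 by simp
next
  assume sub: "J1 \<subseteq> J2"
  obtain K1 K2 where B: "blk w J1 K1" "blk w J2 K2" using J1 J2 RB_iff by blast
  obtain b1 where b1: "b1 \<in> par J1" "w = b1 \<cdot> cut J1" "lmin J1 (cut J1)"
    using block_factor[OF B(1)] by metis
  obtain b2 where b2: "b2 \<in> par J2" "w = b2 \<cdot> cut J2" "lmin J2 (cut J2)" "blk (cut J2) J2 K2"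
    using block_factor[OF B(2)] by metis
  note JK = blkD(1,2)[OF B(2)]
  have b1J: "b1 \<in> par J2" using par_mono[OF sub] b1 by blast
  have c: "b1 \<in> G" "cut J1 \<in> G" "b2 \<in> G" "cut J2 \<in> G"
    using par_closed[OF JK(1)] b1J b2 b1 by (auto simp: lmin_def)
  let ?m = "inv b1 \<cdot> b2"
  have m: "?m \<in> par J2" using par_mult[OF JK(1) par_inv[OF JK(1) b1J] b2(1)] .
  have "cut J1 = inv b1 \<cdot> w" using b1(2) c by (metis inv_cancel)
  also have "\<dots> = ?m \<cdot> cut J2" by (subst b2(2)) (use c in \<open>simp add: m_assoc\<close>)
  finally have e: "cut J1 = ?m \<cdot> cut J2" .
  have "blk (cut J1) J2 K2" unfolding e using blk_left_mult[OF m JK(1) c(4)] b2(4) by simp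
  moreover have "left_min W J2 (cut J1) = cut J2" unfolding e by (rule left_min_eq[OF JK(1) m b2(3)])
  moreover have "right_min W K2 (cut J1) = cut J2"
  proof -
    have k: "conj (cut J2) ?m \<in> par K2" using blkD(3)[OF b2(4), of ?m] m c by simp
    have "cut J1 = cut J2 \<cdot> conj (cut J2) ?m" unfolding e using mult_conj[of "cut J2" ?m] c by simp
    thus ?thesis using right_min_eq[OF JK(2) k blk_rmin[OF b2(4,3)]] by simp
  qed
  ultimately show "cutting_point W (cut J2) (cut J1)"
    unfolding cutting_point_def using block_pair_blk c(2) by metis
qed

lemma G_edge:
  assumes "rle u (u \<cdot> s i)" "i \<in> I" "u \<cdot> s i \<in> V"
  shows "(u \<cdot> s i, u) \<in> G_edges W w" "JJ u = JJ (u \<cdot> s i) \<Longrightarrow> (u, u \<cdot> s i) \<in> G_edges W w"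
proof -
  have u: "u \<in> V" using V_right_le assms by blast
  hence "u = (u \<cdot> s i) \<cdot> s i" using assms V_closed by simp
  thus "(u \<cdot> s i, u) \<in> G_edges W w" "JJ u = JJ (u \<cdot> s i) \<Longrightarrow> (u, u \<cdot> s i) \<in> G_edges W w"
    using assms u JJ_right_le[OF assms(1,3)] unfolding G_edges_def by blast+
qed

text \<open>Descending induction along a reduced word of u^{-1} v: the claim is transported from x
  s_i down to x.\<close>

lemma right_le_induct:
  assumes "rle u v" "v \<in> V" "P v"
    and "\<And>x i. rle u x \<Longrightarrow> rle x (x \<cdot> s i) \<Longrightarrow> rle (x \<cdot> s i) v \<Longrightarrow> i \<in> I \<Longrightarrow>
      i \<notin> rdes x \<Longrightarrow> P (x \<cdot> s i) \<Longrightarrow> P x"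
  shows "P u"
proof -
  have u: "u \<in> G" and v: "v \<in> G" using assms right_le_closed by auto
  have *: "P x" if "red ys (inv x \<cdot> v)" "rle u x" "rle x v" for ys x using that
  proof (induction ys arbitrary: x)
    case Nil
    hence x: "x \<in> G" "inv x \<cdot> v = \<one>" using right_le_closed by (auto simp: reduced_word_def)
    hence "x = v" using v by (metis inv_cancel' r_one)
    thus ?case using assms(3) by simp
  next
    case (Cons i ys)
    note r = reduced_Cons[OF Cons.prems(1)]
    have x: "x \<in> G" using Cons.prems right_le_closed by blast
    have xi: "inv (x \<cdot> s i) \<cdot> v = s i \<cdot> (inv x \<cdot> v)" using x v r by (simp add: inv_mult_group m_assoc)
    have len: "l v = l x + l (inv x \<cdot> v)" using Cons.prems(3) right_le_len by blast
    have le: "l v \<le> l (x \<cdot> s i) + l (inv (x \<cdot> s i) \<cdot> v)"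
      using len_mult[of "x \<cdot> s i" "inv (x \<cdot> s i) \<cdot> v"] x v r by simp
    have i: "i \<notin> rdes x" using rdes_len[OF x r(1)] le len r(4) xi by auto
    have lx: "l (x \<cdot> s i) = Suc (l x)" using i rdes_len[OF x r(1)] by blast
    have a: "rle x (x \<cdot> s i)" using right_le_mult[OF x s_closed[OF r(1)]] lx r(1) by simp
    have b: "rle (x \<cdot> s i) v" unfolding right_le_len xi using x v r(1,4) lx len by simp
    have "P (x \<cdot> s i)" using Cons.IH[of "x \<cdot> s i"] r(2) xi a b Cons.prems(2) right_le_trans by metis
    thus ?case using assms(4) Cons.prems(2) a b r(1) i by blast
  qed
  obtain ys where "red ys (inv u \<cdot> v)" using reduced_exists u v by (meson inv_closed m_closed)
  thus ?thesis using * assms(1) right_le_refl[OF u] by blast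
qed

text \<open>The path runs through the cutting point of the block of u. Climbing from u to it stays
  in one descent class, because the block is squeezed between equal ends; descending from it to v
  only enlarges blocks.\<close>

lemma G_paths:
  assumes "u \<in> V" "v \<in> V"
  shows "(u, v) \<in> (G_edges W w)\<^sup>* \<longleftrightarrow> JJ u \<subseteq> JJ v"
proof
  assume "(u, v) \<in> (G_edges W w)\<^sup>*"
  thus "JJ u \<subseteq> JJ v" by (induction rule: rtrancl_induct) (auto simp: G_edges_def)
next
  assume sub: "JJ u \<subseteq> JJ v"
  let ?c = "cut (JJ u)"
  have J: "JJ u \<in> RB" "lmin (JJ u) u" using block_of[OF assms(1)] by auto
  note c = RB_cut[OF J(1)]
  have uc: "rle u ?c" using c(3) assms J by blast
  have vc: "rle v ?c" using c(3) assms block_of(3)[OF assms(2) J(1)] sub by blast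
  have "(u, ?c) \<in> (G_edges W w)\<^sup>*" using uc c(1)
  proof (rule right_le_induct[where P = "\<lambda>x. (x, ?c) \<in> (G_edges W w)\<^sup>*"])
    fix x i assume x: "rle u x" "rle x (x \<cdot> s i)" "rle (x \<cdot> s i) ?c" "i \<in> I"
      "(x \<cdot> s i, ?c) \<in> (G_edges W w)\<^sup>*"
    have V: "x \<cdot> s i \<in> V" "x \<in> V" using x c(1) V_right_le by blast+
    have "JJ ?c \<subseteq> JJ (x \<cdot> s i)" "JJ (x \<cdot> s i) \<subseteq> JJ x" "JJ x \<subseteq> JJ u"
      using JJ_right_le x V c(1) by blast+
    hence "JJ x = JJ (x \<cdot> s i)" using JJ_cut[OF J(1)] by blast
    thus "(x, ?c) \<in> (G_edges W w)\<^sup>*"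
      using G_edge(2)[OF x(2,4) V(1)] x(5) by (meson converse_rtrancl_into_rtrancl)
  qed simp
  moreover have "(?c, v) \<in> (G_edges W w)\<^sup>*" using vc c(1)
  proof (rule right_le_induct[where P = "\<lambda>x. (?c, x) \<in> (G_edges W w)\<^sup>*"])
    fix x i assume x: "rle v x" "rle x (x \<cdot> s i)" "rle (x \<cdot> s i) ?c" "i \<in> I"
      "(?c, x \<cdot> s i) \<in> (G_edges W w)\<^sup>*"
    have V: "x \<cdot> s i \<in> V" using x c(1) V_right_le by blast
    thus "(?c, x) \<in> (G_edges W w)\<^sup>*"
      using G_edge(1)[OF x(2,4) V(1)] x(5) by (meson rtrancl_into_rtrancl)
  qed simp
  ultimately show "(u, v) \<in> (G_edges W w)\<^sup>*" by (rule rtrancl_trans)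
qed


section \<open>Bruhat-triangular partial maps\<close>

definition upw :: "'i list \<Rightarrow> 'w \<Rightarrow> 'w" where "upw xs = fold up xs"
definition downw :: "'i list \<Rightarrow> 'w \<Rightarrow> 'w" where "downw xs = fold down xs"
definition lupw :: "'i list \<Rightarrow> 'w \<Rightarrow> 'w" where "lupw xs = foldr lup xs"

lemma upw_simps [simp]: "upw [] x = x" "upw (i # xs) x = upw xs (up i x)"
  by (simp_all add: upw_def)

lemma downw_simps [simp]: "downw [] x = x" "downw (i # xs) x = downw xs (down i x)"
  by (simp_all add: downw_def)

lemma downw_append: "downw (xs @ ys) x = downw ys (downw xs x)"
  by (simp add: downw_def)

lemma lupw_simps [simp]: "lupw [] x = x" "lupw (i # xs) x = lup i (lupw xs x)"
  by (simp_all add: lupw_def)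

lemma upw_closed [simp]: "xs \<in> lists I \<Longrightarrow> x \<in> G \<Longrightarrow> upw xs x \<in> G"
  by (induction xs arbitrary: x rule: list.induct) auto

lemma lupw_closed [simp]: "xs \<in> lists I \<Longrightarrow> x \<in> G \<Longrightarrow> lupw xs x \<in> G"
  by (induction xs rule: list.induct) auto

lemma br_upw: "xs \<in> lists I \<Longrightarrow> br x y \<Longrightarrow> x \<in> G \<Longrightarrow> br (upw xs x) (upw xs y)"
proof (induction xs arbitrary: x y rule: list.induct)
  case (Cons i xs)
  thus ?case using Cons.IH[of "up i x" "up i y"] br_up[of x y i] by simp
qed simp

lemma br_downw: "xs \<in> lists I \<Longrightarrow> br x y \<Longrightarrow> x \<in> G \<Longrightarrow> br (downw xs x) (downw xs y)"
proof (induction xs arbitrary: x y rule: list.induct)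
  case (Cons i xs)
  thus ?case using Cons.IH[of "down i x" "down i y"] br_down[of x y i] by simp
qed simp

lemma lup_upw: "j \<in> I \<Longrightarrow> xs \<in> lists I \<Longrightarrow> x \<in> G \<Longrightarrow> lup j (upw xs x) = upw xs (lup j x)"
proof (induction xs arbitrary: x rule: list.induct)
  case (Cons i xs)
  thus ?case using Cons.IH[of "up i x"] lup_up[of x i j] by simp
qed simp

lemma lupw_upw:
  "zs \<in> lists I \<Longrightarrow> xs \<in> lists I \<Longrightarrow> x \<in> G \<Longrightarrow> lupw zs (upw xs x) = upw xs (lupw zs x)"
proof (induction zs rule: list.induct)
  case (Cons i zs)
  thus ?case using lup_upw[of i xs "lupw zs x"] by simp
qed simp

lemma lupw_reduced: "red zs z \<Longrightarrow> lupw zs \<one> = z"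
proof (induction zs arbitrary: z)
  case (Cons i zs)
  note r = reduced_Cons[OF Cons.prems]
  have z: "z \<in> G" using reduced_closed Cons.prems by blast
  have "i \<notin> ldes (s i \<cdot> z)" using ldes_len[of "s i \<cdot> z" i] r z by simp
  thus ?case using Cons.IH[OF r(2)] r z by (simp add: lup_def)
qed (simp add: reduced_word_def)

lemma upw_mult:
  "xs \<in> lists I \<Longrightarrow> x \<in> G \<Longrightarrow> l (x \<cdot> wp xs) = l x + length xs \<Longrightarrow> upw xs x = x \<cdot> wp xs"
proof (induction xs arbitrary: x rule: list.induct)
  case (Cons i xs)
  have i: "i \<in> I" "xs \<in> lists I" using Cons.prems by auto
  have "l (x \<cdot> s i \<cdot> wp xs) \<le> l (x \<cdot> s i) + length xs"
    using len_mult[of "x \<cdot> s i" "wp xs"] len_le[OF i(2)] i Cons.prems by simp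
  hence "Suc (l x) \<le> l (x \<cdot> s i)" using Cons.prems i by (simp add: m_assoc)
  hence "i \<notin> rdes x" "l (x \<cdot> s i) = Suc (l x)" using rdes_len[of x i] Cons.prems i by auto
  thus ?case using Cons.IH[of "x \<cdot> s i"] Cons.prems i by (simp add: up_def m_assoc)
qed simp

lemma downw_mult:
  "xs \<in> lists I \<Longrightarrow> x \<in> G \<Longrightarrow> l (x \<cdot> wp xs) = l x + length xs \<Longrightarrow> downw (rev xs) (x \<cdot> wp xs) = x"
proof (induction xs arbitrary: x rule: list.induct)
  case (Cons i xs)
  have i: "i \<in> I" "xs \<in> lists I" using Cons.prems by auto
  have "l (x \<cdot> s i \<cdot> wp xs) \<le> l (x \<cdot> s i) + length xs"
    using len_mult[of "x \<cdot> s i" "wp xs"] len_le[OF i(2)] i Cons.prems by simp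
  hence "Suc (l x) \<le> l (x \<cdot> s i)" using Cons.prems i by (simp add: m_assoc)
  hence "i \<in> rdes (x \<cdot> s i)" "l (x \<cdot> s i) = Suc (l x)"
    using rdes_len[of x i] rdes_mult_s[of x i] Cons.prems i by auto
  thus ?case using Cons.IH[of "x \<cdot> s i"] Cons.prems i by (simp add: downw_append down_def m_assoc)
qed simp

text \<open>Both sides are the Demazure product of z and v, since the left action of
  \<open>zs\<close> commutes with the right action of \<open>vs\<close> and both are started at the
  identity.\<close>

lemma upw_lupw:
  assumes "red vs v" "red zs z"
  shows "upw vs z = lupw zs v"
proof -
  have c: "vs \<in> lists I" "zs \<in> lists I" "wp vs = v" "length vs = l v"
    using assms by (auto simp: reduced_word_def)
  moreover from this have "v \<in> G" using wp_closed by blast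
  ultimately have "upw vs \<one> = v" using upw_mult[of vs \<one>] by simp
  thus ?thesis using lupw_upw[of zs vs \<one>] lupw_reduced[OF assms(2)] c by simp
qed

text \<open>Each left Demazure step either does nothing or lengthens by one, so the Demazure product
  of z and v has v as a right factor with additive lengths.\<close>

lemma lupw_additive:
  "zs \<in> lists I \<Longrightarrow> v \<in> G \<Longrightarrow> \<exists>c\<in>G. lupw zs v = c \<cdot> v \<and> l (lupw zs v) = l c + l v"
proof (induction zs rule: list.induct)
  case Nil
  thus ?case by (intro bexI[of _ \<one>]) auto
next
  case (Cons i zs)
  then obtain c where c: "c \<in> G" "lupw zs v = c \<cdot> v" "l (lupw zs v) = l c + l v" by auto
  have i: "i \<in> I" using Cons.prems by simp
  show ?case
  proof (cases "i \<in> ldes (c \<cdot> v)")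
    case True
    thus ?thesis using c by (intro bexI[of _ c]) (auto simp: lup_def)
  next
    case False
    have "l (s i \<cdot> c) \<le> Suc (l c)" using ldes_len[of c i] c i by (cases "i \<in> ldes c") auto
    moreover have "l (s i \<cdot> (c \<cdot> v)) = Suc (l (c \<cdot> v))"
      using False ldes_len[of "c \<cdot> v" i] c(1) i Cons.prems by auto
    moreover have "l ((s i \<cdot> c) \<cdot> v) \<le> l (s i \<cdot> c) + l v"
      using len_mult[of "s i \<cdot> c" v] c i Cons.prems by simp
    ultimately show ?thesis using False c i Cons.prems
      by (intro bexI[of _ "s i \<cdot> c"]) (auto simp: lup_def m_assoc)
  qed
qed

text \<open>Lengths never decrease along the word, so ending at v forces every single step to fix
  v.\<close>

lemma lupw_fixed:
  assumes "zs \<in> lists I" "v \<in> G"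
  shows "lupw zs v = v \<longleftrightarrow> set zs \<subseteq> ldes v"
  using assms
proof (induction zs rule: list.induct)
  case (Cons j zs)
  have j: "j \<in> I" "zs \<in> lists I" using Cons.prems by auto
  obtain c where c: "c \<in> G" "lupw zs v = c \<cdot> v" "l (lupw zs v) = l c + l v"
    using lupw_additive[OF j(2) Cons.prems(2)] by blast
  have "lupw zs v = v" if "lupw (j # zs) v = v"
  proof -
    have "l (lupw zs v) \<le> l (lupw (j # zs) v)"
      using ldes_len[of "lupw zs v" j] j Cons.prems by (cases "j \<in> ldes (lupw zs v)") (auto simp: lup_def)
    hence "l c = 0" using that c by simp
    thus ?thesis using len_eq_0[OF c(1)] c(2) Cons.prems by simp
  qed
  moreover have "lup j v = v \<longleftrightarrow> j \<in> ldes v"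
    using ldes_len[of v j] j Cons.prems by (auto simp: lup_def)
  ultimately show ?case using Cons j by (auto simp del: lupw_simps(2)) (auto simp: lupw_simps(2))
qed simp

lemma br_one: "z \<in> G \<Longrightarrow> br \<one> z"
  using reduced_exists[of z] br_subword[of _ z "[]"] by auto

end

section \<open>Partial maps on the interval and their triangularity\<close>

context coxeter_interval
begin

text \<open>
  Up to signs, the operators \<open>s\<^sub>i\<close> and \<open>\<pi>\<^sub>i\<close> act on the basis as the map \<open>sfun i\<close> and the
  partial map \<open>pfun i\<close>.
\<close>

definition sfun :: "'i \<Rightarrow> 'w \<Rightarrow> 'w" where
  "sfun i x = (if x \<cdot> s i \<in> V then x \<cdot> s i else x)"

definition pfun :: "'i \<Rightarrow> 'w \<Rightarrow> 'w option" where
  "pfun i x = (if i \<in> rdes x then Some x else if x \<cdot> s i \<in> V then Some (x \<cdot> s i) else None)"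

definition sword :: "'i list \<Rightarrow> 'w \<Rightarrow> 'w" where "sword xs = fold sfun xs"

fun pword :: "'i list \<Rightarrow> 'w \<Rightarrow> 'w option" where
  "pword [] x = Some x"
| "pword (i # xs) x = Option.bind (pfun i x) (pword xs)"

text \<open>Partial maps generated by the shadows of the s_i and pi_i. Working here keeps signs out
  of all Bruhat arguments; \<open>pmap_represented\<close> lifts a map back to an element of
  F.\<close>

inductive pmap :: "('w \<Rightarrow> 'w option) \<Rightarrow> bool" where
  pmap_id: "pmap Some"
| pmap_s: "i \<in> I \<Longrightarrow> pmap (\<lambda>x. Some (sfun i x))"
| pmap_p: "i \<in> I \<Longrightarrow> pmap (pfun i)"
| pmap_comp: "pmap p \<Longrightarrow> pmap q \<Longrightarrow> pmap (\<lambda>x. Option.bind (p x) q)"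

text \<open>Triangularity with v least in the image and u greatest in the fibre, instead of unique
  minimal and unique maximal. In this form it survives composition
  (\<open>tri_comp\<close>).\<close>

definition tri :: "'w \<Rightarrow> 'w \<Rightarrow> ('w \<Rightarrow> 'w option) \<Rightarrow> bool" where
  "tri u v p \<longleftrightarrow> p u = Some v \<and> (\<forall>x\<in>V. \<forall>y. p x = Some y \<longrightarrow> br v y \<and> (y = v \<longrightarrow> br x u))"

lemma sword_simps [simp]: "sword [] x = x" "sword (i # xs) x = sword xs (sfun i x)"
  by (simp_all add: sword_def)

lemma sword_append: "sword (xs @ ys) x = sword ys (sword xs x)"
  by (simp add: sword_def)

lemma sfun_V: "x \<in> V \<Longrightarrow> sfun i x \<in> V"
  by (simp add: sfun_def)

lemma sword_V: "x \<in> V \<Longrightarrow> sword xs x \<in> V"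
  by (induction xs arbitrary: x) (auto simp: sfun_V)

lemma sfun_invol: "x \<in> V \<Longrightarrow> i \<in> I \<Longrightarrow> sfun i (sfun i x) = x"
  by (simp add: sfun_def V_closed)

lemma sword_rev: "xs \<in> lists I \<Longrightarrow> x \<in> V \<Longrightarrow> sword (rev xs) (sword xs x) = x"
  by (induction xs arbitrary: x rule: list.induct) (auto simp: sword_append sfun_V sfun_invol)

lemma sword_rev': "xs \<in> lists I \<Longrightarrow> x \<in> V \<Longrightarrow> sword xs (sword (rev xs) x) = x"
  using sword_rev[of "rev xs" x] rev_lists by auto

lemma pmap_V: "pmap p \<Longrightarrow> x \<in> V \<Longrightarrow> p x = Some y \<Longrightarrow> y \<in> V"
proof (induction arbitrary: x y rule: pmap.induct)
  case (pmap_s i)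
  thus ?case using sfun_V by auto
next
  case (pmap_p i)
  thus ?case unfolding pfun_def by (metis option.distinct(1) option.inject)
next
  case (pmap_comp p q)
  from pmap_comp.prems(2) obtain t where "p x = Some t" "q t = Some y" by (cases "p x") simp_all
  thus ?case using pmap_comp.IH pmap_comp.prems(1) by blast
qed simp

lemma pmap_sword: "xs \<in> lists I \<Longrightarrow> pmap (\<lambda>x. Some (sword xs x))"
proof (induction xs rule: list.induct)
  case Nil
  thus ?case using pmap_id by simp
next
  case (Cons i xs)
  thus ?case using pmap_comp[OF pmap_s[of i], of "\<lambda>x. Some (sword xs x)"] by simp
qed

lemma pmap_pword: "xs \<in> lists I \<Longrightarrow> pmap (pword xs)"
proof (induction xs rule: list.induct)
  case Nil
  thus ?case using pmap_id by (simp add: fun_eq_iff[symmetric] pword.simps(1)[abs_def])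
next
  case (Cons i xs)
  thus ?case using pmap_comp[OF pmap_p[of i], of "pword xs"] by (simp add: pword.simps(2)[abs_def])
qed

lemma prefix_V:
  assumes "xs \<in> lists I" "x \<in> G" "i \<in> I" "l (x \<cdot> wp (i # xs)) = l x + length (i # xs)"
    "x \<cdot> wp (i # xs) \<in> V"
  shows "x \<cdot> s i \<in> V" "i \<notin> rdes x" "x \<in> V"
    "l (x \<cdot> s i \<cdot> wp xs) = l (x \<cdot> s i) + length xs" "x \<cdot> s i \<cdot> wp xs \<in> V"
proof -
  have a: "x \<cdot> wp (i # xs) = x \<cdot> s i \<cdot> wp xs" using assms by (simp add: m_assoc)
  have "l (x \<cdot> s i \<cdot> wp xs) \<le> l (x \<cdot> s i) + l (wp xs)"
    using len_mult[of "x \<cdot> s i" "wp xs"] assms by simp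
  moreover have "l (x \<cdot> s i) \<le> Suc (l x)" using len_mult[of x "s i"] assms by simp
  ultimately have e: "l (x \<cdot> s i) = Suc (l x)" "l (wp xs) = length xs"
    using len_le[OF assms(1)] assms(4) a by auto
  show "l (x \<cdot> s i \<cdot> wp xs) = l (x \<cdot> s i) + length xs" "x \<cdot> s i \<cdot> wp xs \<in> V"
    using a assms(4,5) e by simp_all
  hence "rle (x \<cdot> s i) (x \<cdot> s i \<cdot> wp xs)" using right_le_mult[of "x \<cdot> s i" "wp xs"] e assms by simp
  thus "x \<cdot> s i \<in> V" using V_right_le \<open>x \<cdot> s i \<cdot> wp xs \<in> V\<close> by blast
  moreover have "rle x (x \<cdot> s i)" using right_le_mult[of x "s i"] e assms by simp
  ultimately show "x \<in> V" using V_right_le by blast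
  show "i \<notin> rdes x" using rdes_len[OF assms(2,3)] e by simp
qed

lemma sword_mult:
  "xs \<in> lists I \<Longrightarrow> x \<in> G \<Longrightarrow> l (x \<cdot> wp xs) = l x + length xs \<Longrightarrow> x \<cdot> wp xs \<in> V \<Longrightarrow>
     sword xs x = x \<cdot> wp xs"
proof (induction xs arbitrary: x rule: list.induct)
  case (Cons i xs)
  have i: "i \<in> I" "xs \<in> lists I" using Cons.prems by auto
  note p = prefix_V[OF i(2) Cons.prems(2) i(1) Cons.prems(3,4)]
  show ?case using Cons.IH[of "x \<cdot> s i"] p i Cons.prems by (simp add: sfun_def m_assoc)
qed simp

lemma pword_mult:
  "xs \<in> lists I \<Longrightarrow> x \<in> G \<Longrightarrow> l (x \<cdot> wp xs) = l x + length xs \<Longrightarrow> x \<cdot> wp xs \<in> V \<Longrightarrow>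
     pword xs x = Some (x \<cdot> wp xs)"
proof (induction xs arbitrary: x rule: list.induct)
  case (Cons i xs)
  have i: "i \<in> I" "xs \<in> lists I" using Cons.prems by auto
  note p = prefix_V[OF i(2) Cons.prems(2) i(1) Cons.prems(3,4)]
  show ?case using Cons.IH[of "x \<cdot> s i"] p i Cons.prems by (simp add: pfun_def m_assoc)
qed simp

lemma pfun_up: "pfun i x = Some y \<Longrightarrow> y = up i x"
  by (auto simp: pfun_def up_def split: if_splits)

lemma pword_up: "pword xs x = Some y \<Longrightarrow> y = upw xs x"
proof (induction xs arbitrary: x)
  case (Cons i xs)
  then obtain z where "pfun i x = Some z" "pword xs z = Some y" by (cases "pfun i x") auto
  thus ?case using Cons.IH[of z] pfun_up by auto
qed simp

lemma sfun_bounds: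
  assumes "x \<in> V" "i \<in> I" shows "br (down i x) (sfun i x)" "br (sfun i x) (up i x)"
proof -
  have x: "x \<in> G" using V_closed assms by blast
  have 1: "br (down i x) x" "br x (up i x)" using br_down1 br_up1 x assms by auto
  hence 2: "br (down i x) (up i x)" by (meson rtranclp_trans)
  show "br (down i x) (sfun i x)" "br (sfun i x) (up i x)"
    using 1 2 by (auto simp: sfun_def up_def down_def split: if_splits)
qed

text \<open>Each \<open>sfun i\<close> lies between \<open>down i\<close> and \<open>up i\<close>,
  and these two are Bruhat monotone, so the sandwich iterates along a word. Since
  \<open>sfun\<close> itself need not be monotone, its Bruhat comparisons are made through these
  bounds.\<close>

lemma sword_bounds:
  "xs \<in> lists I \<Longrightarrow> x \<in> V \<Longrightarrow> br (downw xs x) (sword xs x) \<and> br (sword xs x) (upw xs x)"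
proof (induction xs arbitrary: x rule: list.induct)
  case (Cons i xs)
  have i: "i \<in> I" "xs \<in> lists I" using Cons.prems by auto
  have x: "x \<in> G" "sfun i x \<in> G" using V_closed Cons.prems sfun_V by auto
  note b = sfun_bounds[OF Cons.prems(2) i(1)]
  have "br (downw xs (down i x)) (downw xs (sfun i x))" "br (upw xs (sfun i x)) (upw xs (up i x))"
    using br_downw[OF i(2) b(1)] br_upw[OF i(2) b(2)] x i by auto
  thus ?case using Cons.IH[OF i(2), of "sfun i x"] sfun_V[OF Cons.prems(2)]
    by (auto intro: rtranclp_trans)
qed simp

lemma sword_coset:
  "K \<subseteq> I \<Longrightarrow> xs \<in> lists K \<Longrightarrow> x \<in> G \<Longrightarrow> \<exists>a\<in>par K. sword xs x = x \<cdot> a"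
proof (induction xs arbitrary: x rule: list.induct)
  case Nil
  thus ?case using par_one by (intro bexI[of _ \<one>]) auto
next
  case (Cons i xs)
  have i: "i \<in> K" "i \<in> I" "xs \<in> lists K" using Cons.prems by auto
  have "sfun i x = x \<or> sfun i x = x \<cdot> s i" by (simp add: sfun_def)
  then obtain b where b: "b \<in> par K" "sfun i x = x \<cdot> b"
    using par_one[OF Cons.prems(1)] par_s[OF i(1)] Cons.prems(3) by (metis r_one)
  have bc: "b \<in> G" using par_closed Cons.prems(1) b by blast
  then obtain a where a: "a \<in> par K" "sword xs (sfun i x) = (x \<cdot> b) \<cdot> a"
    using Cons.IH[OF Cons.prems(1) i(3), of "x \<cdot> b"] Cons.prems(3) b by auto
  have "a \<in> G" using par_closed Cons.prems(1) a by blast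
  thus ?case using a bc par_mult[OF Cons.prems(1) b(1) a(1)] Cons.prems(3)
    by (intro bexI[of _ "b \<cdot> a"]) (auto simp: m_assoc)
qed

text \<open>If z ends at x after passing through t, then t <= v because v is greatest in the fibre
  of q over x, and v <= t because v is least in the image of p. So t = v.\<close>

lemma tri_comp:
  assumes "pmap p" "tri u v p" "tri v x q"
  shows "tri u x (\<lambda>z. Option.bind (p z) q)"
  unfolding tri_def
proof (intro conjI ballI allI impI)
  show "Option.bind (p u) q = Some x" using assms by (simp add: tri_def)
next
  fix z y assume z: "z \<in> V" "Option.bind (p z) q = Some y"
  then obtain t where t: "p z = Some t" "q t = Some y" by (cases "p z") auto
  have tV: "t \<in> V" using pmap_V assms(1) z(1) t(1) by blast
  show "br x y" using assms(3) tV t by (auto simp: tri_def)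
  assume "y = x"
  hence "br t v" using assms(3) tV t by (auto simp: tri_def)
  moreover have "br v t" using assms(2) z t by (auto simp: tri_def)
  ultimately have "t = v" using br_antisym by blast
  thus "br z u" using assms(2) z t by (auto simp: tri_def)
qed

text \<open>The map undoes u with the s_i, which sends u to the identity, and then climbs to v with
  the pi_i. A general element arrives at some z and is sent, if not annihilated, to the Demazure
  product of z and v. The last clause records the shape of the image for
  \<open>tri_climb\<close>.\<close>

lemma tri_ldes:
  assumes u: "u \<in> V" and v: "v \<in> V" and D: "ldes v \<subseteq> ldes u"
  shows "\<exists>p. pmap p \<and> tri u v p \<and> (\<forall>x\<in>V. \<forall>y. p x = Some y \<longrightarrow> (\<exists>c\<in>G. y = c \<cdot> v \<and> l y = l c + l v))"
proof -
  have c: "u \<in> G" "v \<in> G" using u v V_closed by auto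
  obtain us vs where us: "red us u" and vs: "red vs v" using reduced_exists c by metis
  have w: "us \<in> lists I" "wp us = u" "length us = l u" "vs \<in> lists I" "wp vs = v" "length vs = l v"
    using us vs by (auto simp: reduced_word_def)
  let ?g = "\<lambda>x. sword (rev us) x"
  let ?p = "\<lambda>x. Option.bind (Some (?g x)) (pword vs)"
  have "sword us \<one> = u" using sword_mult[of us \<one>] w u c by simp
  hence gu: "?g u = \<one>" using sword_rev[OF w(1) one_V] by simp
  have "pword vs \<one> = Some v" using pword_mult[of vs \<one>] w v c by simp
  hence pu: "?p u = Some v" using gu by simp
  have im: "br v y \<and> (y = v \<longrightarrow> br x u) \<and> (\<exists>c\<in>G. y = c \<cdot> v \<and> l y = l c + l v)"
    if x: "x \<in> V" "?p x = Some y" for x y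
  proof -
    let ?z = "?g x"
    have zV: "?z \<in> V" using sword_V x by blast
    hence zc: "?z \<in> G" using V_closed by blast
    obtain zs where zs: "red zs ?z" using reduced_exists zc by blast
    have zsI: "zs \<in> lists I" using reduced_closed zs by blast
    have y: "y = upw vs ?z" using pword_up x by simp
    have y': "y = lupw zs v" using y upw_lupw[OF vs zs] by simp
    have "upw vs \<one> = v" using upw_mult[of vs \<one>] w c by simp
    hence 1: "br v y" using br_upw[OF w(4) br_one[OF zc]] y by simp
    \<comment> \<open>If the product of z and v is v, all letters of z are left descents of v, hence
      of u, so the Demazure product of z and u is u. This product bounds x from above, as x is
      obtained from z by the s_i along a word of u.\<close>
    have 2: "br x u" if "y = v"
    proof -
      have "set zs \<subseteq> ldes u" using lupw_fixed[OF zsI c(2)] y' that D by auto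
      hence "upw us ?z = u" using lupw_fixed[OF zsI c(1)] upw_lupw[OF us zs] by simp
      thus ?thesis using sword_bounds[OF w(1) zV] sword_rev'[OF w(1) x(1)] by simp
    qed
    show ?thesis using 1 2 lupw_additive[OF zsI c(2)] y' by blast
  qed
  have "pmap ?p" using pmap_comp[OF pmap_sword[of "rev us"] pmap_pword[of vs]] w rev_lists by blast
  moreover have "tri u v ?p" unfolding tri_def using pu im by blast
  ultimately show ?thesis using im by blast
qed

text \<open>Descend from u to v by the s_i. They permute the interval, so no fibre changes, and the
  lower bound by \<open>downw\<close> keeps v least: \<open>downw\<close> is monotone and sends u to
  v.\<close>

lemma tri_down:
  assumes p: "pmap p" "tri a u p" and a: "a \<in> V" and vu: "rle v u"
  shows "\<exists>q. pmap q \<and> tri a v q"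
proof -
  have u: "u \<in> V" using pmap_V[OF p(1) a, of u] p(2) by (simp add: tri_def)
  have c: "u \<in> G" "v \<in> G" using right_le_closed vu by auto
  have vV: "v \<in> V" using V_right_le u vu by blast
  obtain xs where xs: "red xs (inv v \<cdot> u)" using reduced_exists c by (meson inv_closed m_closed)
  have w: "xs \<in> lists I" "wp xs = inv v \<cdot> u" "length xs = l (inv v \<cdot> u)"
    using xs by (auto simp: reduced_word_def)
  have len: "l u = l v + length xs" using vu right_le_len w by simp
  have vx: "v \<cdot> wp xs = u" using w c by simp
  have su: "sword xs v = u" using sword_mult[OF w(1) c(2)] vx len u by simp
  have rI: "rev xs \<in> lists I" using rev_lists w by blast
  let ?q = "\<lambda>x. Option.bind (p x) (\<lambda>y. Some (sword (rev xs) y))"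
  have "pmap ?q" using pmap_comp[OF p(1) pmap_sword[OF rI]] .
  moreover have "tri a v ?q" unfolding tri_def
  proof (intro conjI ballI allI impI)
    show "?q a = Some v" using p(2) su sword_rev[OF w(1) vV] by (simp add: tri_def)
  next
    fix x z assume x: "x \<in> V" "?q x = Some z"
    then obtain y where y: "p x = Some y" "z = sword (rev xs) y" by (cases "p x") auto
    have yV: "y \<in> V" using pmap_V p(1) x(1) y(1) by blast
    have uy: "br u y" using p(2) x y by (auto simp: tri_def)
    have "downw (rev xs) u = v" using downw_mult[OF w(1) c(2)] vx len by simp
    hence "br v (downw (rev xs) y)" using br_downw[OF rI uy c(1)] by simp
    thus "br v z" using sword_bounds[OF rI yV] y(2) by (meson rtranclp_trans)
    assume "z = v"
    hence "y = u" using sword_rev'[OF w(1) yV] y(2) su by simp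
    thus "br x a" using p(2) x y by (auto simp: tri_def)
  qed
  ultimately show ?thesis by blast
qed

text \<open>
  If all ascents of \<open>x\<close> in the interval come from left multiplication by a simple reflection,
  either \<open>x\<close> is a cutting point, or one can climb through \<open>x W\<^sub>K = W\<^sub>J x\<close> to the closest
  element that has an ascent \<open>i \<notin> K\<close>; then \<open>\<pi>\<^sub>i\<close> annihilates all other elements of the coset.
\<close>

lemma tri_climb:
  assumes x: "x \<in> V"
    and asc: "\<And>i. i \<in> I \<Longrightarrow> i \<notin> rdes x \<Longrightarrow> x \<cdot> s i \<in> V \<Longrightarrow> \<exists>j\<in>I - ldes x. s j \<cdot> x = x \<cdot> s i"
  shows "(\<exists>J\<in>RB. x = cut J) \<or> (\<exists>y p. y \<in> V \<and> rle x y \<and> x \<noteq> y \<and> pmap p \<and> tri x y p)"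
proof -
  have xc: "x \<in> G" using V_closed x by blast
  \<comment> \<open>E is the set of left ascents. J and K collect the left and right letters matched
    by s_j x = x s_i, so that x conjugates W_J to W_K and W_J x = x W_K is the coset to be
    left.\<close>
  define E where "E = I - ldes x"
  define K where "K = {i\<in>I. \<exists>j\<in>E. s j \<cdot> x = x \<cdot> s i}"
  define J where "J = {j\<in>E. \<exists>i\<in>I. s j \<cdot> x = x \<cdot> s i}"
  have JK: "J \<subseteq> I" "K \<subseteq> I" by (auto simp: J_def K_def E_def)
  have B: "blk x J K" by (rule blkI) (use JK xc in \<open>auto simp: J_def K_def E_def\<close>)
  have lJ: "lmin J x" using xc by (auto simp: lmin_def J_def E_def)
  have rK: "rmin K x" using blk_rmin[OF B lJ] .
  have swap: "conj x c \<in> par K \<and> c \<cdot> x = x \<cdot> conj x c \<and> l (conj x c) = l c"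
    if c: "c \<in> par J" for c
  proof -
    have cc: "c \<in> G" using par_closed JK c by blast
    hence k: "conj x c \<in> par K" using blkD(3)[OF B] c by blast
    have e: "c \<cdot> x = x \<cdot> conj x c" using mult_conj xc cc by simp
    show ?thesis using k e lmin_len[OF JK(1) c lJ] rmin_len[OF JK(2) k rK] by simp
  qed
  have swap': "\<exists>c\<in>par J. x \<cdot> a = c \<cdot> x \<and> l c = l a" if a: "a \<in> par K" for a
  proof -
    have ac: "a \<in> G" using par_closed JK a by blast
    let ?c = "conj (inv x) a"
    have "?c \<in> par J" using blkD(3)[OF B, of ?c] a ac xc by simp
    moreover from this have "?c \<cdot> x = x \<cdot> a \<and> l a = l ?c" using swap[of ?c] ac xc by simp
    ultimately show ?thesis by metis
  qed
  show ?thesis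
  proof (cases "inv x \<cdot> w \<in> par K")
    case True
    then obtain b where b: "b \<in> par J" "x \<cdot> (inv x \<cdot> w) = b \<cdot> x" using swap' by blast
    have wb: "w = b \<cdot> x" using b xc by simp
    have "blk w J K" unfolding wb using blk_left_mult[OF b(1) JK(1) xc] B by simp
    then obtain J' where "J' \<in> RB" "cut J' = cut J" using block_reduce by blast
    moreover have "cut J = x" using left_min_eq[OF JK(1) b(1) lJ] wb by simp
    ultimately show ?thesis by metis
  next
    case False
    \<comment> \<open>\<open>?Q i a\<close> says that the coset can be left at x a through the
      letter i, inside the interval and with additive length. A reduced word of x^{-1} w has a first
      letter outside K, and this letter gives such an exit.\<close>
    let ?Q = "\<lambda>i a. a \<in> par K \<and> x \<cdot> a \<cdot> s i \<in> V \<and> l (x \<cdot> a \<cdot> s i) = Suc (l x + l a)"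
    have "\<exists>i\<in>I - K. \<exists>a. ?Q i a"
    proof -
      obtain ys where ys: "red ys (inv x \<cdot> w)"
        using reduced_exists xc by (meson inv_closed m_closed w_closed)
      have ysI: "ys \<in> lists I" "wp ys = inv x \<cdot> w" using ys by (auto simp: reduced_word_def)
      have "\<not> set ys \<subseteq> K"
      proof
        assume "set ys \<subseteq> K"
        hence "ys \<in> lists K" by (simp add: lists_eq_set)
        thus False using False par_word[OF JK(2), of "inv x \<cdot> w"] ysI by blast
      qed
      then obtain as i bs where sp: "ys = as @ i # bs" "i \<notin> K" "\<forall>k\<in>set as. \<not> k \<notin> K"
        using split_list_first_prop[of ys "\<lambda>k. k \<notin> K"] by blast
      have asK: "as \<in> lists K" using sp(3) by (simp add: lists_eq_set subset_iff)
      have I': "as \<in> lists I" "i \<in> I" "bs \<in> lists I" using ysI sp by auto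
      let ?a = "wp as"
      have a: "?a \<in> par K" using par_word[OF JK(2)] asK by blast
      have ac: "?a \<in> G" "wp bs \<in> G" using I' by auto
      have r: "red ((as @ [i]) @ bs) (inv x \<cdot> w)" using ys sp by simp
      have wpi: "wp (as @ [i]) = ?a \<cdot> s i" using I' wp_append[of as "[i]"] by simp
      have e: "inv x \<cdot> w = (?a \<cdot> s i) \<cdot> wp bs" "l (inv x \<cdot> w) = l (?a \<cdot> s i) + l (wp bs)"
        using reduced_appendD[OF r] unfolding wpi by blast+
      have "red (as @ [i]) (?a \<cdot> s i)" using reduced_appendD[OF r] unfolding wpi by blast
      hence la: "l (?a \<cdot> s i) = Suc (length as)" by (simp add: reduced_word_def)
      have "red as ?a" using reduced_appendD[of as "[i]"] reduced_appendD[OF r] by blast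
      hence la': "l (?a \<cdot> s i) = Suc (l ?a)" using la by (simp add: reduced_word_def)
      have ww: "w = x \<cdot> ?a \<cdot> s i \<cdot> wp bs"
      proof -
        have "x \<cdot> (inv x \<cdot> w) = x \<cdot> ((?a \<cdot> s i) \<cdot> wp bs)" by (simp only: e(1))
        thus ?thesis using xc ac I' by (simp add: m_assoc)
      qed
      have lw: "l w = l x + (Suc (l ?a) + l (wp bs))"
        using x V_iff right_le_len[of x w] e(2) la' by simp
      have "l w \<le> l (x \<cdot> ?a \<cdot> s i) + l (wp bs)"
        using len_mult[of "x \<cdot> ?a \<cdot> s i" "wp bs"] ww xc ac I' by simp
      moreover have "l (x \<cdot> ?a \<cdot> s i) \<le> l x + Suc (l ?a)"
        using len_mult[of x "?a \<cdot> s i"] la' xc ac I' by (simp add: m_assoc)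
      ultimately have lxa: "l (x \<cdot> ?a \<cdot> s i) = Suc (l x + l ?a)" using lw by simp
      hence "rle (x \<cdot> ?a \<cdot> s i) w"
        using right_le_mult[of "x \<cdot> ?a \<cdot> s i" "wp bs"] lw ww xc ac I' by simp
      thus ?thesis using V_iff a lxa I' sp(2) by blast
    qed
    then obtain i a0 where i: "i \<in> I" "i \<notin> K" and a0: "?Q i a0" by blast
    \<comment> \<open>For the fixed letter i a shortest exit is taken; its minimality is used at the
      end to exclude all other elements of the coset.\<close>
    obtain a where a: "a \<in> par K" "x \<cdot> a \<cdot> s i \<in> V" "l (x \<cdot> a \<cdot> s i) = Suc (l x + l a)"
      and amin: "\<And>a'. ?Q i a' \<Longrightarrow> l a \<le> l a'" using ex_has_least_nat[of "?Q i" a0 l] a0 by blast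
    define y where "y = x \<cdot> a \<cdot> s i"
    have ac: "a \<in> G" using par_closed JK a by blast
    obtain b where b: "b \<in> par J" "x \<cdot> a = b \<cdot> x" "l b = l a" using swap' a(1) by blast
    have bc: "b \<in> G" using par_closed JK b by blast
    have yV: "y \<in> V" and yc: "y \<in> G" using a(2) V_closed by (auto simp: y_def)
    have yb: "y = b \<cdot> (x \<cdot> s i)" unfolding y_def b(2) using bc xc i by (simp add: m_assoc)
    have nK: "s j \<cdot> x \<noteq> x \<cdot> s i" if "j \<in> E" for j using that i by (auto simp: K_def)
    \<comment> \<open>A new left descent in J after multiplying by s_i would mean s_j x = x s_i,
      putting i into K. So lengths also add in W_J (x s_i).\<close>
    have lJi: "lmin J (x \<cdot> s i)"
    proof -
      have "j \<notin> ldes (x \<cdot> s i)" if "j \<in> J" for j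
        using ldes_mult_s[OF xc i(1), of j] nK[of j] that by (auto simp: J_def E_def)
      thus ?thesis using xc i by (auto simp: lmin_def)
    qed
    have ix: "i \<notin> rdes x"
    proof
      assume "i \<in> rdes x"
      hence "l x = Suc (l (x \<cdot> s i))" using rdes_len[OF xc i(1)] by blast
      moreover have "l y = l b + l (x \<cdot> s i)" unfolding yb by (rule lmin_len[OF JK(1) b(1) lJi])
      ultimately show False using a(3) b(3) by (simp add: y_def)
    qed
    have lxi: "l (x \<cdot> s i) = Suc (l x)" using ix rdes_len[OF xc i(1)] by blast
    obtain as where as: "as \<in> lists K" "red as a" using par_reduced[OF JK(2) a(1)] by blast
    have asI: "as \<in> lists I" "wp as = a" "length as = l a" using as(2) by (auto simp: reduced_word_def)
    have lxa: "l (x \<cdot> a) = l x + l a" using rmin_len[OF JK(2) a(1) rK] .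
    have ia: "i \<notin> rdes (x \<cdot> a)" using rdes_len[of "x \<cdot> a" i] a(3) lxa xc ac i by simp
    have "rle (x \<cdot> a) y" unfolding y_def
      using right_le_mult[of "x \<cdot> a" "s i"] a(3) lxa xc ac i by simp
    hence xaV: "x \<cdot> a \<in> V" using V_right_le yV by blast
    have sx: "sword as x = x \<cdot> a" using sword_mult[of as x] asI lxa xaV xc by simp
    have xy: "rle x y"
      using right_le_mult[of x "a \<cdot> s i"] a(3) xc ac i len_mult[of x "a \<cdot> s i"] len_mult[of a "s i"]
      by (simp add: y_def m_assoc)
    have ly: "l y = Suc (l x + l a)" using a(3) by (simp add: y_def)
    \<comment> \<open>The map is a composition: \<open>p1\<close> lands in the elements c x with
      additive lengths, the word \<open>as\<close> carries x to x a, pi_i crosses to y, and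
      \<open>p2\<close> lands above y while sending to y only elements below y.\<close>
    obtain p1 where p1: "pmap p1" "tri x x p1"
      "\<And>z t. z \<in> V \<Longrightarrow> p1 z = Some t \<Longrightarrow> \<exists>c\<in>G. t = c \<cdot> x \<and> l t = l c + l x"
      using tri_ldes[OF x x] by blast
    obtain p2 where p2: "pmap p2" "tri y y p2" using tri_ldes[OF yV yV] by blast
    let ?q = "\<lambda>z. Option.bind (Some (sword as z)) (pfun i)"
    let ?r = "\<lambda>z. Option.bind (?q z) p2"
    let ?p = "\<lambda>z. Option.bind (p1 z) ?r"
    have pm: "pmap ?p" using p1(1) p2(1) by (intro pmap_comp pmap_sword pmap_p asI(1) i(1))
    \<comment> \<open>The core of the argument: among the t in the image of \<open>p1\<close>, only
      x can be carried to an r below y.\<close>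
    have key: "t = x" if t: "t \<in> V" "c \<in> G" "t = c \<cdot> x" "l t = l c + l x"
      and r: "pfun i (sword as t) = Some r" "br r y" for t c r
    proof -
      let ?q = "sword as t"
      have qV: "?q \<in> V" using sword_V t by blast
      have qc: "?q \<in> G" "t \<in> G" using V_closed qV t by auto
      have rq: "r = up i ?q" using pfun_up r by simp
      obtain a' where a': "a' \<in> par K" "?q = t \<cdot> a'" using sword_coset[OF JK(2) as(1) qc(2)] by blast
      have a'c: "a' \<in> G" using par_closed JK a' by blast
      have cJ: "c \<in> par J"
      proof (rule ccontr)
        assume nc: "c \<notin> par J"
        \<comment> \<open>Split c = d c2 with c2 in W_J and d as short as possible. The last letter
          e of d is then outside J, and s_e x is a subword of t, hence a Bruhat lower bound for
          it.\<close>
        let ?P = "\<lambda>d. d \<in> G \<and> (\<exists>e\<in>par J. c = d \<cdot> e \<and> l c = l d + l e)"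
        have "?P c" using t(2) par_one[OF JK(1)] by (auto intro!: bexI[of _ \<one>])
        then obtain d where d: "?P d" "\<And>d'. ?P d' \<Longrightarrow> l d \<le> l d'"
          using ex_has_least_nat[of ?P c l] by blast
        obtain c2 where c2: "c2 \<in> par J" "c = d \<cdot> c2" "l c = l d + l c2" using d(1) by blast
        have dc: "d \<in> G" "c2 \<in> G" using d(1) par_closed[OF JK(1) c2(1)] by auto
        have "d \<noteq> \<one>" using c2 nc dc by auto
        obtain ds where ds: "red ds d" using reduced_exists dc by blast
        have "ds \<noteq> []" using ds \<open>d \<noteq> \<one>\<close> by (auto simp: reduced_word_def)
        then obtain gs e where ge: "ds = gs @ [e]" by (metis rev_exhaust)
        let ?g = "wp gs"
        have g: "gs \<in> lists I" "e \<in> I" "red gs ?g" "d = ?g \<cdot> s e" "l d = Suc (l ?g)"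
          using reduced_appendD[of gs "[e]" d] ds reduced_closed[OF ds] by (auto simp: ge)
        have gc: "?g \<in> G" using g by simp
        have eJ: "e \<notin> J"
        proof
          assume e: "e \<in> J"
          have "l (s e \<cdot> c2) \<le> Suc (l c2)" using len_mult[of "s e" c2] g dc by simp
          moreover have cg: "c = ?g \<cdot> (s e \<cdot> c2)" using c2 g dc gc by (simp add: m_assoc)
          moreover have "l (?g \<cdot> (s e \<cdot> c2)) \<le> l ?g + l (s e \<cdot> c2)"
            using len_mult[of ?g "s e \<cdot> c2"] gc g dc by simp
          ultimately have "l c = l ?g + l (s e \<cdot> c2)" using c2(3) g(5) by simp
          hence "?P ?g" using par_mult[OF JK(1) par_s[OF e] c2(1)] cg gc by blast
          thus False using d(2)[of ?g] g(5) by simp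
        qed
        let ?a2 = "conj x c2"
        have a2: "?a2 \<in> par K" "c2 \<cdot> x = x \<cdot> ?a2" "l ?a2 = l c2" using swap[OF c2(1)] by auto
        have a2c: "?a2 \<in> G" using dc xc by simp
        have "t = d \<cdot> (c2 \<cdot> x)" using t(3) c2(2) dc xc by (simp add: m_assoc)
        also have "\<dots> = ?g \<cdot> ((s e \<cdot> x) \<cdot> ?a2)"
          unfolding a2(2) g(4) using gc g xc a2c by (simp add: m_assoc)
        finally have tt: "t = ?g \<cdot> ((s e \<cdot> x) \<cdot> ?a2)" .
        have sec: "s e \<cdot> x \<in> G" using g xc by simp
        have l1: "l t \<le> l ?g + l ((s e \<cdot> x) \<cdot> ?a2)" "l ((s e \<cdot> x) \<cdot> ?a2) \<le> l (s e \<cdot> x) + l ?a2"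
          using len_mult[of ?g "(s e \<cdot> x) \<cdot> ?a2"] len_mult[of "s e \<cdot> x" ?a2] tt gc sec a2c by auto
        have lse: "l (s e \<cdot> x) \<le> Suc (l x)" using len_mult[of "s e" x] g xc by simp
        have l2: "l t = l ?g + Suc (l x) + l ?a2" using t(4) c2(3) g(5) a2(3) by simp
        have l3: "l (s e \<cdot> x) = Suc (l x)" "l ((s e \<cdot> x) \<cdot> ?a2) = l (s e \<cdot> x) + l ?a2"
          using l1 l2 lse by auto
        have eE: "e \<in> E" using l3(1) ldes_len[OF xc g(2)] g(2) by (auto simp: E_def)
        obtain ms ns where ms: "red ms (s e \<cdot> x)" and ns: "red ns ?a2"
          using reduced_exists sec a2c by metis
        have "red (ms @ ns) ((s e \<cdot> x) \<cdot> ?a2)" using reduced_append[OF ms ns l3(2)] .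
        hence "red (gs @ ms @ ns) t" unfolding tt using reduced_append[OF g(3)] l2 l3 tt by simp
        moreover have "subseq ms (gs @ ms @ ns)"
          by (rule sublist_imp_subseq) (auto simp: sublist_def)
        ultimately have "br (wp ms) t" by (rule br_subword)
        hence b1: "br (s e \<cdot> x) t" using ms by (simp add: reduced_word_def)
        \<comment> \<open>No letter of K is a right descent of s_e x, so moving t along
          \<open>as\<close> cannot push it below s_e x. The bound therefore survives up to
          y.\<close>
        have "k \<notin> rdes (s e \<cdot> x)" if k: "k \<in> K" for k
        proof -
          obtain j where j: "j \<in> J" "s j \<cdot> x = x \<cdot> s k" using blk_simple'[OF B lJ k] by blast
          have "s e \<cdot> x \<noteq> x \<cdot> s k"
            using j right_cancel[of x "s e" "s j"] s_inj[of e j] eJ g(2) JK xc by auto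
          hence "k \<in> rdes (s e \<cdot> x) \<longleftrightarrow> k \<in> rdes x" using rdes_s_mult[OF xc _ g(2)] k JK by blast
          thus ?thesis using rK k by (auto simp: rmin_def)
        qed
        hence "downw bs (s e \<cdot> x) = s e \<cdot> x" if "bs \<in> lists K" for bs
          using that by (induction bs rule: list.induct) (auto simp: down_def)
        hence "br (s e \<cdot> x) (downw as t)" using br_downw[OF asI(1) b1 sec] as(1) by simp
        hence "br (s e \<cdot> x) ?q" using sword_bounds[OF asI(1) t(1)] by (meson rtranclp_trans)
        moreover have "br ?q r" unfolding rq using br_up1 qc i by blast
        ultimately have b2: "br (s e \<cdot> x) y" using r(2) by (meson rtranclp_trans)
        \<comment> \<open>Otherwise s_e s_j s_e would be an inversion of x in the parabolic of j and
          e, for which x has no left descents.\<close>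
        have jd: "j \<notin> ldes (s e \<cdot> x)" if j: "j \<in> J" for j
        proof -
          have jI: "j \<in> I" "j \<noteq> e" using j JK eJ by auto
          have je: "{j, e} \<subseteq> I" "lmin {j, e} x"
            using jI g(2) eE j xc by (auto simp: lmin_def E_def J_def)
          have "conj (s e) (s j) \<in> par {j, e}"
            unfolding conj_s[OF g(2)] using par_mult[OF je(1)] par_s by (metis insertI1 insertI2)
          hence "conj (s e) (s j) \<notin> N x" using lmin_N[OF je] by blast
          moreover have "s j \<notin> N (s e)" using s_inj jI g(2) by simp
          ultimately show ?thesis using N_mult[of "s e" x "s j"] jI g(2) xc by (simp add: ldes_def)
        qed
        \<comment> \<open>Strip the letters of b from y = b x s_i by \<open>ldown\<close>, which
          fixes s_e x. What remains, s_e x <= x s_i, is an equality because the lengths agree, and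
          this would put i into K.\<close>
        have "br (s e \<cdot> x) (x \<cdot> s i)"
          if "bs \<in> lists J" "red bs d" "d \<in> par J" "br (s e \<cdot> x) (d \<cdot> (x \<cdot> s i))" for bs d
          using that
        proof (induction bs arbitrary: d rule: list.induct)
          case Nil
          hence "d = \<one>" by (simp add: reduced_word_def)
          thus ?case using Nil xc i by simp
        next
          case (Cons j bs)
          note r = reduced_Cons[OF Cons.prems(2)]
          have j: "j \<in> J" "bs \<in> lists J" using Cons.prems by auto
          have dc: "d \<in> G" using par_closed JK Cons.prems by blast
          have d': "s j \<cdot> d \<in> par J" using par_mult[OF JK(1) par_s[OF j(1)] Cons.prems(3)] .
          have xi: "x \<cdot> s i \<in> G" using xc i by simp
          have "l (s j \<cdot> (d \<cdot> (x \<cdot> s i))) < l (d \<cdot> (x \<cdot> s i))"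
            using lmin_len[OF JK(1) Cons.prems(3) lJi] lmin_len[OF JK(1) d' lJi] r dc xi by (simp add: m_assoc)
          hence "j \<in> ldes (d \<cdot> (x \<cdot> s i))" using ldes_iff r dc xi by simp
          hence "ldown j (d \<cdot> (x \<cdot> s i)) = (s j \<cdot> d) \<cdot> (x \<cdot> s i)"
            using r dc xi by (simp add: ldown_def m_assoc)
          moreover have "ldown j (s e \<cdot> x) = s e \<cdot> x" using jd[OF j(1)] by (simp add: ldown_def)
          ultimately have "br (s e \<cdot> x) ((s j \<cdot> d) \<cdot> (x \<cdot> s i))"
            using br_ldown[OF Cons.prems(4) sec r(1)] by simp
          thus ?case using Cons.IH[OF j(2) r(2) d'] by blast
        qed
        hence "br (s e \<cdot> x) (x \<cdot> s i)" using par_reduced[OF JK(1) b(1)] b(1) b2 yb by blast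
        hence "s e \<cdot> x = x \<cdot> s i" using br_len[of "s e \<cdot> x" "x \<cdot> s i"] l3(1) lxi by simp
        thus False using nK eE by blast
      qed
      \<comment> \<open>Now t lies in W_J x, so \<open>sword as t\<close> is x a'' with a'' in W_K.
        Not being annihilated by pi_i makes a'' an exit through i, so r is at least as long as y;
        lying below y it equals y, and the injectivity of \<open>sword\<close> returns t =
        x.\<close>
      let ?a'' = "conj x c \<cdot> a'"
      have k: "conj x c \<in> par K" "c \<cdot> x = x \<cdot> conj x c" using swap[OF cJ] by auto
      have a'': "?a'' \<in> par K" using par_mult[OF JK(2) k(1) a'(1)] .
      have a''c: "?a'' \<in> G" using par_closed JK a'' by blast
      have "t \<cdot> a' = x \<cdot> ?a''" unfolding t(3) k(2) using xc t(2) a'c by (simp add: m_assoc)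
      hence qa: "?q = x \<cdot> ?a''" using a'(2) by simp
      obtain b' where b': "b' \<in> par J" "x \<cdot> ?a'' = b' \<cdot> x" "l b' = l ?a''" using swap'[OF a''] by blast
      have b'c: "b' \<in> G" using par_closed JK b' by blast
      have lq: "l ?q = l x + l ?a''" using rmin_len[OF JK(2) a'' rK] qa by simp
      have "?q \<cdot> s i = b' \<cdot> (x \<cdot> s i)" unfolding qa b'(2) using b'c xc i by (simp add: m_assoc)
      hence lqi: "l (?q \<cdot> s i) = Suc (l x + l ?a'')"
        using lmin_len[OF JK(1) b'(1) lJi] lxi b'(3) by simp
      hence "i \<notin> rdes ?q" using rdes_len[OF qc(1) i(1)] lq by simp
      hence ri: "r = ?q \<cdot> s i" "?q \<cdot> s i \<in> V" using r(1) by (auto simp: pfun_def split: if_splits)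
      have "?Q i ?a''" using a'' ri lqi qa by simp
      hence "l a \<le> l ?a''" using amin by blast
      hence "\<not> l r < l y" using ri lqi ly by simp
      hence "r = y" using br_len r(2) by blast
      hence "?q \<cdot> s i = x \<cdot> a \<cdot> s i" using ri by (simp add: y_def)
      hence "?q = x \<cdot> a" using right_cancel[of "s i" ?q "x \<cdot> a"] qc xc ac i by simp
      hence "sword (rev as) (sword as t) = sword (rev as) (sword as x)" using sx by simp
      thus "t = x" using sword_rev[OF asI(1)] t(1) x by simp
    qed
    have "tri x y ?p" unfolding tri_def
    proof (intro conjI ballI allI impI)
      have "pfun i (x \<cdot> a) = Some y" using ia a(2) by (simp add: pfun_def y_def)
      thus "?p x = Some y" using p1(2) p2(2) sx by (simp add: tri_def)
    next
      fix z y' assume z: "z \<in> V" "?p z = Some y'"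
      then obtain t where t: "p1 z = Some t" "?r t = Some y'" by (cases "p1 z") auto
      then obtain r where r: "pfun i (sword as t) = Some r" "p2 r = Some y'"
        by (cases "pfun i (sword as t)") auto
      have tV: "t \<in> V" using pmap_V[OF p1(1) z(1) t(1)] .
      have rV: "r \<in> V" using pmap_V[OF pmap_p[OF i(1)] sword_V[OF tV] r(1)] .
      show "br y y'" using p2(2) rV r(2) by (auto simp: tri_def)
      assume "y' = y"
      hence "br r y" using p2(2) rV r(2) by (auto simp: tri_def)
      moreover obtain c where "c \<in> G" "t = c \<cdot> x" "l t = l c + l x"
        using p1(3)[OF z(1) t(1)] by blast
      ultimately have "t = x" using key tV r(1) by blast
      thus "br z x" using p1(2) z(1) t(1) by (auto simp: tri_def)
    qed
    moreover have "x \<noteq> y" using ly by auto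
    ultimately show ?thesis using yV xy pm by blast
  qed
qed

text \<open>Induction on the distance to w. An ascent that adds no left descent is taken by
  \<open>tri_ldes\<close>; if there is none, \<open>tri_climb\<close> either recognises a cutting
  point or supplies a longer jump.\<close>

lemma tri_to_cut:
  "u \<in> V \<Longrightarrow> \<exists>J\<in>RB. rle u (cut J) \<and> (\<exists>p. pmap p \<and> tri u (cut J) p)"
proof (induction "l w - l u" arbitrary: u rule: less_induct)
  case less
  have uc: "u \<in> G" using V_closed less.prems by blast
  have go: ?case if v: "v \<in> V" "rle u v" "u \<noteq> v" "pmap p" "tri u v p" for v p
  proof -
    have vc: "v \<in> G" using V_closed v by blast
    have "l v \<noteq> l u"
    proof
      assume "l v = l u"
      hence "inv u \<cdot> v = \<one>" using v(2) right_le_len[of u v] len_eq_0[of "inv u \<cdot> v"] by simp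
      thus False using v(3) uc vc by (metis inv_cancel' r_one)
    qed
    hence "l u < l v" using v(2) right_le_len[of u v] by linarith
    moreover have "l v \<le> l w" using v(1) V_iff right_le_len[of v w] by simp
    ultimately have "l w - l v < l w - l u" by linarith
    then obtain J q where J: "J \<in> RB" "rle v (cut J)" "pmap q" "tri v (cut J) q"
      using less.hyps[of v] v(1) by blast
    thus ?case
      using right_le_trans[OF v(2) J(2)] pmap_comp[OF v(4) J(3)] tri_comp[OF v(4,5) J(4)] by blast
  qed
  show ?case
  proof (cases "\<exists>i\<in>I. i \<notin> rdes u \<and> u \<cdot> s i \<in> V \<and> ldes (u \<cdot> s i) \<subseteq> ldes u")
    case True
    then obtain i where i: "i \<in> I" "i \<notin> rdes u" "u \<cdot> s i \<in> V" "ldes (u \<cdot> s i) \<subseteq> ldes u" by blast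
    obtain p where p: "pmap p" "tri u (u \<cdot> s i) p" using tri_ldes[OF less.prems i(3,4)] by blast
    have "l (u \<cdot> s i) = Suc (l u)" using rdes_len[OF uc i(1)] i(2) by blast
    hence "rle u (u \<cdot> s i)" "u \<noteq> u \<cdot> s i" using right_le_mult[of u "s i"] uc i by auto
    thus ?thesis using go i(3) p by blast
  next
    case False
    \<comment> \<open>A right ascent creates a left descent j only through the equation s_j u = u
      s_i.\<close>
    have "\<exists>j\<in>I - ldes u. s j \<cdot> u = u \<cdot> s i"
      if i: "i \<in> I" "i \<notin> rdes u" "u \<cdot> s i \<in> V" for i
    proof -
      obtain j where j: "j \<in> ldes (u \<cdot> s i)" "j \<notin> ldes u" using False i by blast
      hence "j \<in> I" by (simp add: ldes_def)
      thus ?thesis using ldes_mult_s[OF uc i(1), of j] j by blast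
    qed
    then consider J where "J \<in> RB" "u = cut J" | y p where "y \<in> V" "rle u y" "u \<noteq> y" "pmap p" "tri u y p"
      using tri_climb[OF less.prems] by blast
    thus ?thesis
    proof cases
      case 1
      thus ?thesis using tri_ldes[OF less.prems less.prems] right_le_refl[OF uc] by blast
    next
      case 2
      thus ?thesis using go by blast
    qed
  qed
qed

text \<open>Climb from u to a cutting point above it and descend to v. The inclusion of blocks says
  precisely that v has no left descent in the block J reached, so v lies below the same cutting
  point.\<close>

theorem tri_exists:
  assumes u: "u \<in> V" and v: "v \<in> V" and uv: "JJ u \<subseteq> JJ v"
  shows "\<exists>p. pmap p \<and> tri u v p"
proof -
  obtain J p where J: "J \<in> RB" "rle u (cut J)" "pmap p" "tri u (cut J) p"
    using tri_to_cut[OF u] by blast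
  have "lmin J u" using RB_cut(3)[OF J(1)] J(2) by blast
  hence "lmin J v" using block_of(3)[OF u J(1)] block_of(3)[OF v J(1)] uv by blast
  hence "rle v (cut J)" using RB_cut(3)[OF J(1)] v by blast
  thus ?thesis using tri_down[OF J(3,4) u] by blast
qed

end

section \<open>Right modules\<close>

context right_module
begin

lemma act_zero_left: "x \<in> carrier M \<Longrightarrow> \<zero> \<odot>\<^bsub>M\<^esub> x = \<zero>\<^bsub>M\<^esub>"
proof -
  assume x: "x \<in> carrier M"
  have "\<zero> \<odot>\<^bsub>M\<^esub> x \<oplus>\<^bsub>M\<^esub> \<zero> \<odot>\<^bsub>M\<^esub> x = \<zero> \<odot>\<^bsub>M\<^esub> x" using act_add_left[of "\<zero>" "\<zero>" x] x by simp
  thus ?thesis using act_closed[of "\<zero>" x] x by simp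
qed

lemma act_zero_right: "a \<in> carrier A \<Longrightarrow> a \<odot>\<^bsub>M\<^esub> \<zero>\<^bsub>M\<^esub> = \<zero>\<^bsub>M\<^esub>"
proof -
  assume a: "a \<in> carrier A"
  have "a \<odot>\<^bsub>M\<^esub> \<zero>\<^bsub>M\<^esub> \<oplus>\<^bsub>M\<^esub> a \<odot>\<^bsub>M\<^esub> \<zero>\<^bsub>M\<^esub> = a \<odot>\<^bsub>M\<^esub> \<zero>\<^bsub>M\<^esub>"
    using act_add_right[of a "\<zero>\<^bsub>M\<^esub>" "\<zero>\<^bsub>M\<^esub>"] a by simp
  thus ?thesis using act_closed[of a "\<zero>\<^bsub>M\<^esub>"] a by simp
qed

lemma act_minus: "a \<in> carrier A \<Longrightarrow> x \<in> carrier M \<Longrightarrow> a \<odot>\<^bsub>M\<^esub> (\<ominus>\<^bsub>M\<^esub> x) = \<ominus>\<^bsub>M\<^esub> (a \<odot>\<^bsub>M\<^esub> x)"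
proof -
  assume a: "a \<in> carrier A" and x: "x \<in> carrier M"
  have "a \<odot>\<^bsub>M\<^esub> (\<ominus>\<^bsub>M\<^esub> x) \<oplus>\<^bsub>M\<^esub> a \<odot>\<^bsub>M\<^esub> x = \<zero>\<^bsub>M\<^esub>"
    using act_add_right[of a "\<ominus>\<^bsub>M\<^esub> x" x] act_zero_right[OF a] a x by (simp add: M.l_neg)
  thus ?thesis using M.minus_equality[of "a \<odot>\<^bsub>M\<^esub> (\<ominus>\<^bsub>M\<^esub> x)" "a \<odot>\<^bsub>M\<^esub> x"] act_closed a x by simp
qed

lemma act_finsum_left:
  "f \<in> S \<rightarrow> carrier A \<Longrightarrow> x \<in> carrier M \<Longrightarrow> finsum A f S \<odot>\<^bsub>M\<^esub> x = finsum M (\<lambda>s. f s \<odot>\<^bsub>M\<^esub> x) S"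
proof (induction S rule: infinite_finite_induct)
  case (insert s S)
  have f: "f \<in> S \<rightarrow> carrier A" "f s \<in> carrier A" using insert.prems by auto
  have "(\<lambda>s. f s \<odot>\<^bsub>M\<^esub> x) \<in> S \<rightarrow> carrier M" using f act_closed insert.prems by auto
  thus ?case using insert f act_add_left[of "f s" "finsum A f S" x] act_closed by simp
qed (auto simp: act_zero_left A.finsum_infinite M.finsum_infinite)

lemma act_finsum_right:
  "a \<in> carrier A \<Longrightarrow> f \<in> S \<rightarrow> carrier M \<Longrightarrow> a \<odot>\<^bsub>M\<^esub> finsum M f S = finsum M (\<lambda>s. a \<odot>\<^bsub>M\<^esub> f s) S"
proof (induction S rule: infinite_finite_induct)
  case (insert s S)
  have f: "f \<in> S \<rightarrow> carrier M" "f s \<in> carrier M" using insert.prems by auto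
  have "(\<lambda>s. a \<odot>\<^bsub>M\<^esub> f s) \<in> S \<rightarrow> carrier M" using f act_closed insert.prems by auto
  thus ?case using insert f act_add_right[of a "f s" "finsum M f S"] act_closed by simp
qed (auto simp: act_zero_right M.finsum_infinite)

lemma submodule_right_module:
  assumes "Module.submodule X A M" shows "right_module A (M\<lparr>carrier := X\<rparr>)"
proof -
  interpret X: Module.submodule X A M by fact
  have sub: "X \<subseteq> carrier M" using X.subset by simp
  have neg: "\<ominus>\<^bsub>M\<^esub> x \<in> X" if "x \<in> X" for x using X.m_inv_closed[of x] that by (simp add: a_inv_def)
  have "abelian_group (M\<lparr>carrier := X\<rparr>)"
  proof (rule abelian_groupI, goal_cases)
    case (6 x)
    thus ?case using neg[of x] sub by (intro bexI[of _ "\<ominus>\<^bsub>M\<^esub> x"]) (auto simp: M.l_neg subset_iff)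
  qed (use sub X.m_closed X.one_closed M.a_assoc M.a_comm in \<open>auto simp: subset_iff\<close>)
  thus ?thesis unfolding right_module_def right_module_axioms_def
    using A.ring_axioms sub X.smult_closed act_add_left act_add_right act_mult act_one
    by (auto simp: subset_iff)
qed

lemma submoduleI:
  assumes "X \<subseteq> carrier M" "\<zero>\<^bsub>M\<^esub> \<in> X" "\<And>x y. x \<in> X \<Longrightarrow> y \<in> X \<Longrightarrow> x \<oplus>\<^bsub>M\<^esub> y \<in> X"
    "\<And>a x. a \<in> carrier A \<Longrightarrow> x \<in> X \<Longrightarrow> a \<odot>\<^bsub>M\<^esub> x \<in> X"
  shows "Module.submodule X A M"
proof -
  have neg: "\<ominus>\<^bsub>M\<^esub> x \<in> X" if x: "x \<in> X" for x
  proof -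
    have xc: "x \<in> carrier M" using assms(1) x by blast
    have "(\<ominus> \<one>) \<odot>\<^bsub>M\<^esub> x \<oplus>\<^bsub>M\<^esub> \<one> \<odot>\<^bsub>M\<^esub> x = \<zero>\<^bsub>M\<^esub>"
      using act_add_left[of "\<ominus> \<one>" "\<one>" x] xc by (simp add: A.l_neg act_zero_left)
    hence "(\<ominus> \<one>) \<odot>\<^bsub>M\<^esub> x = \<ominus>\<^bsub>M\<^esub> x"
      using M.minus_equality[of "(\<ominus> \<one>) \<odot>\<^bsub>M\<^esub> x" x] act_closed xc by (simp add: act_one)
    thus ?thesis using assms(4)[of "\<ominus> \<one>" x] x by simp
  qed
  show ?thesis
  proof (intro Module.submodule.intro subgroup.intro submodule_axioms.intro)
    show "inv\<^bsub>add_monoid M\<^esub> x \<in> X" if "x \<in> X" for x using neg[OF that] by (simp add: a_inv_def)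
  qed (use assms in auto)
qed

lemma submoduleD:
  assumes "Module.submodule X A M"
  shows "X \<subseteq> carrier M" "\<zero>\<^bsub>M\<^esub> \<in> X" "x \<in> X \<Longrightarrow> y \<in> X \<Longrightarrow> x \<oplus>\<^bsub>M\<^esub> y \<in> X"
    "a \<in> carrier A \<Longrightarrow> x \<in> X \<Longrightarrow> a \<odot>\<^bsub>M\<^esub> x \<in> X" "x \<in> X \<Longrightarrow> \<ominus>\<^bsub>M\<^esub> x \<in> X"
proof -
  interpret X: Module.submodule X A M by fact
  show "X \<subseteq> carrier M" "\<zero>\<^bsub>M\<^esub> \<in> X" "x \<in> X \<Longrightarrow> y \<in> X \<Longrightarrow> x \<oplus>\<^bsub>M\<^esub> y \<in> X"
    "a \<in> carrier A \<Longrightarrow> x \<in> X \<Longrightarrow> a \<odot>\<^bsub>M\<^esub> x \<in> X"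
    using X.subset X.one_closed X.m_closed X.smult_closed by auto
  show "x \<in> X \<Longrightarrow> \<ominus>\<^bsub>M\<^esub> x \<in> X" using X.m_inv_closed[of x] by (simp add: a_inv_def)
qed

lemma act_mult': "a \<in> carrier A \<Longrightarrow> b \<in> carrier A \<Longrightarrow> x \<in> carrier M \<Longrightarrow>
    (a \<otimes> b) \<odot>\<^bsub>M\<^esub> x = b \<odot>\<^bsub>M\<^esub> (a \<odot>\<^bsub>M\<^esub> x)"
  by (simp add: act_mult)

end

lemma rmod_homD:
  assumes "h \<in> rmod_hom A M N"
  shows "h \<in> carrier M \<rightarrow>\<^sub>E carrier N" "x \<in> carrier M \<Longrightarrow> h x \<in> carrier N"
    "x \<in> carrier M \<Longrightarrow> y \<in> carrier M \<Longrightarrow> h (x \<oplus>\<^bsub>M\<^esub> y) = h x \<oplus>\<^bsub>N\<^esub> h y"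
    "a \<in> carrier A \<Longrightarrow> x \<in> carrier M \<Longrightarrow> h (a \<odot>\<^bsub>M\<^esub> x) = a \<odot>\<^bsub>N\<^esub> h x"
  using assms by (auto simp: rmod_hom_def PiE_def Pi_def)

lemma additive_zero:
  assumes "abelian_group M" "abelian_group N"
    and h: "\<And>x. x \<in> carrier M \<Longrightarrow> h x \<in> carrier N"
    and add: "\<And>x y. x \<in> carrier M \<Longrightarrow> y \<in> carrier M \<Longrightarrow> h (x \<oplus>\<^bsub>M\<^esub> y) = h x \<oplus>\<^bsub>N\<^esub> h y"
  shows "h \<zero>\<^bsub>M\<^esub> = \<zero>\<^bsub>N\<^esub>"
proof -
  interpret M: abelian_group M by fact
  interpret N: abelian_group N by fact
  show ?thesis using add[of "\<zero>\<^bsub>M\<^esub>" "\<zero>\<^bsub>M\<^esub>"] h[of "\<zero>\<^bsub>M\<^esub>"] by simp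
qed

lemma rmod_hom_zero:
  assumes "right_module A M" "right_module A N" "h \<in> rmod_hom A M N"
  shows "h \<zero>\<^bsub>M\<^esub> = \<zero>\<^bsub>N\<^esub>"
proof -
  interpret M: right_module A M by fact
  interpret N: right_module A N by fact
  show ?thesis by (rule additive_zero[OF M.M.abelian_group_axioms N.M.abelian_group_axioms])
      (rule rmod_homD[OF assms(3)]; assumption)+
qed

lemma additive_finsum:
  assumes M: "abelian_group M" and N: "abelian_group N"
    and h: "\<And>x. x \<in> carrier M \<Longrightarrow> h x \<in> carrier N"
    and add: "\<And>x y. x \<in> carrier M \<Longrightarrow> y \<in> carrier M \<Longrightarrow> h (x \<oplus>\<^bsub>M\<^esub> y) = h x \<oplus>\<^bsub>N\<^esub> h y"
  shows "f \<in> S \<rightarrow> carrier M \<Longrightarrow> h (finsum M f S) = finsum N (\<lambda>s. h (f s)) S"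
proof -
  interpret M: abelian_group M by fact
  interpret N: abelian_group N by fact
  have h0: "h \<zero>\<^bsub>M\<^esub> = \<zero>\<^bsub>N\<^esub>" by (rule additive_zero[OF M N h add])
  show "f \<in> S \<rightarrow> carrier M \<Longrightarrow> h (finsum M f S) = finsum N (\<lambda>s. h (f s)) S"
  proof (induction S rule: infinite_finite_induct)
    case (insert s S)
    have f: "f \<in> S \<rightarrow> carrier M" "f s \<in> carrier M" using insert.prems by auto
    have "(\<lambda>s. h (f s)) \<in> S \<rightarrow> carrier N" using f h by auto
    thus ?case using insert f h add by simp
  qed (auto simp: h0)
qed

lemma rmod_hom_minus:
  assumes "right_module A M" "right_module A N" "h \<in> rmod_hom A M N" "x \<in> carrier M"
  shows "h (\<ominus>\<^bsub>M\<^esub> x) = \<ominus>\<^bsub>N\<^esub> h x"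
proof -
  interpret M: right_module A M by fact
  interpret N: right_module A N by fact
  have "h (\<ominus>\<^bsub>M\<^esub> x) \<oplus>\<^bsub>N\<^esub> h x = \<zero>\<^bsub>N\<^esub>"
    using rmod_homD(3)[OF assms(3), of "\<ominus>\<^bsub>M\<^esub> x" x] assms(4) rmod_hom_zero[OF assms(1-3)]
    by (simp add: M.M.l_neg)
  thus ?thesis
    using N.M.minus_equality[of "h (\<ominus>\<^bsub>M\<^esub> x)" "h x"] rmod_homD(2)[OF assms(3)] assms(4) by simp
qed

lemma rmod_hom_inj:
  assumes M: "right_module A M" and N: "right_module A N" and h: "h \<in> rmod_hom A M N"
    and ker: "\<And>x. x \<in> carrier M \<Longrightarrow> h x = \<zero>\<^bsub>N\<^esub> \<Longrightarrow> x = \<zero>\<^bsub>M\<^esub>"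
  shows "inj_on h (carrier M)"
proof (rule inj_onI)
  interpret M: right_module A M by fact
  interpret N: right_module A N by fact
  fix x y assume xy: "x \<in> carrier M" "y \<in> carrier M" "h x = h y"
  have "h (x \<oplus>\<^bsub>M\<^esub> (\<ominus>\<^bsub>M\<^esub> y)) = \<zero>\<^bsub>N\<^esub>"
    using rmod_homD(2,3)[OF h] rmod_hom_minus[OF M N h] xy by (simp add: N.M.r_neg)
  hence "x \<oplus>\<^bsub>M\<^esub> (\<ominus>\<^bsub>M\<^esub> y) = \<zero>\<^bsub>M\<^esub>" using ker xy by simp
  thus "x = y" using xy M.M.minus_equality[of x "\<ominus>\<^bsub>M\<^esub> y"] by simp
qed

lemma rmod_iso_sym:
  assumes M: "right_module A M" and N: "right_module A N" and iso: "rmod_iso A M N"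
  shows "rmod_iso A N M"
proof -
  interpret M: right_module A M by fact
  interpret N: right_module A N by fact
  obtain h where h: "h \<in> rmod_hom A M N" "bij_betw h (carrier M) (carrier N)"
    using iso by (auto simp: rmod_iso_def)
  let ?g = "\<lambda>y\<in>carrier N. inv_into (carrier M) h y"
  have g: "?g y \<in> carrier M" "h (?g y) = y" if "y \<in> carrier N" for y
    using that h(2) by (auto simp: bij_betw_def f_inv_into_f inv_into_into)
  have gh: "?g (h x) = x" if "x \<in> carrier M" for x
    using that h by (auto simp: bij_betw_def rmod_homD(2)[OF h(1)])
  have "?g \<in> rmod_hom A N M" unfolding rmod_hom_def
  proof (intro CollectI conjI ballI)
    show "?g \<in> carrier N \<rightarrow>\<^sub>E carrier M" using g by auto
  next
    fix x y assume xy: "x \<in> carrier N" "y \<in> carrier N"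
    have "h (?g x \<oplus>\<^bsub>M\<^esub> ?g y) = x \<oplus>\<^bsub>N\<^esub> y" using rmod_homD(3)[OF h(1) g(1) g(1)] g xy by simp
    thus "?g (x \<oplus>\<^bsub>N\<^esub> y) = ?g x \<oplus>\<^bsub>M\<^esub> ?g y"
      using gh[of "?g x \<oplus>\<^bsub>M\<^esub> ?g y"] g[OF xy(1)] g[OF xy(2)] by simp
  next
    fix a x assume ax: "a \<in> carrier A" "x \<in> carrier N"
    have "h (a \<odot>\<^bsub>M\<^esub> ?g x) = a \<odot>\<^bsub>N\<^esub> x" using rmod_homD(4)[OF h(1) ax(1) g(1)] g ax by simp
    thus "?g (a \<odot>\<^bsub>N\<^esub> x) = a \<odot>\<^bsub>M\<^esub> ?g x"
      using gh[of "a \<odot>\<^bsub>M\<^esub> ?g x"] g[OF ax(2)] ax(1) M.act_closed by simp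
  qed
  moreover have "bij_betw ?g (carrier N) (carrier M)"
    by (rule bij_betw_byWitness[where f' = h]) (use g gh rmod_homD(2)[OF h(1)] in auto)
  ultimately show ?thesis unfolding rmod_iso_def by blast
qed

lemma hom_image_submodule:
  assumes M: "right_module A M" and P: "right_module A P" and h: "h \<in> rmod_hom A P M"
  shows "Module.submodule (h ` carrier P) A M"
proof -
  interpret M: right_module A M by (rule M)
  interpret P: right_module A P by (rule P)
  note hD = rmod_homD[OF h]
  show ?thesis
  proof (rule M.submoduleI)
    show "\<zero>\<^bsub>M\<^esub> \<in> h ` carrier P"
      using rmod_hom_zero[OF P M h] by (intro image_eqI[of _ _ "\<zero>\<^bsub>P\<^esub>"]) simp_all
    show "y \<oplus>\<^bsub>M\<^esub> z \<in> h ` carrier P" if "y \<in> h ` carrier P" "z \<in> h ` carrier P" for y z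
      using that hD(3)[symmetric] by auto
    show "a \<odot>\<^bsub>M\<^esub> y \<in> h ` carrier P" if "a \<in> carrier A" "y \<in> h ` carrier P" for a y
      using that hD(4)[symmetric] P.act_closed by auto
  qed (use hD(2) in auto)
qed

text \<open>The splitting is n = h(k n) + (n - h(k n)). Both classifications of projectives use it:
  to embed P into a free module and to split P off an indecomposable module.\<close>

lemma retract_summand:
  assumes M: "right_module A M" and P: "right_module A P" and k: "k \<in> rmod_hom A M P"
    and h: "h \<in> rmod_hom A P M" and kh: "\<And>q. q \<in> carrier P \<Longrightarrow> k (h q) = q"
  shows "direct_sum_decomp A M (h ` carrier P) {n \<in> carrier M. k n = \<zero>\<^bsub>P\<^esub>}"
    "rmod_iso A P (M\<lparr>carrier := h ` carrier P\<rparr>)"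
proof -
  interpret M: right_module A M by (rule M)
  interpret P: right_module A P by (rule P)
  note hD = rmod_homD[OF h] and kD = rmod_homD[OF k]
  let ?X = "h ` carrier P" and ?Y = "{n \<in> carrier M. k n = \<zero>\<^bsub>P\<^esub>}"
  have X: "Module.submodule ?X A M" by (rule hom_image_submodule[OF M P h])
  have Y: "Module.submodule ?Y A M" by (rule M.submoduleI)
      (use rmod_hom_zero[OF M P k] kD(3,4) M.act_closed P.act_zero_right in auto)
  have "n \<in> ?X <+>\<^bsub>M\<^esub> ?Y" if n: "n \<in> carrier M" for n
  proof -
    let ?u = "h (k n)"
    let ?v = "n \<oplus>\<^bsub>M\<^esub> (\<ominus>\<^bsub>M\<^esub> ?u)"
    have u: "?u \<in> carrier M" "?u \<in> ?X" using hD(2) kD(2) n by auto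
    have "k ?v = k n \<oplus>\<^bsub>P\<^esub> (\<ominus>\<^bsub>P\<^esub> k ?u)"
      using kD(3)[OF n M.M.a_inv_closed[OF u(1)]] rmod_hom_minus[OF M P k u(1)] by simp
    hence "?v \<in> ?Y" using kh[OF kD(2)[OF n]] kD(2)[OF n] n u(1) by (simp add: P.M.r_neg)
    moreover have "n = ?u \<oplus>\<^bsub>M\<^esub> ?v" using n u(1) by (simp add: M.a_lcomm M.M.r_neg)
    ultimately show ?thesis unfolding set_add_def' using u(2) by blast
  qed
  moreover have "?X <+>\<^bsub>M\<^esub> ?Y \<subseteq> carrier M" unfolding set_add_def' using hD(2) by auto
  moreover have "n = \<zero>\<^bsub>M\<^esub>" if "n \<in> ?X" "n \<in> ?Y" for n using that kh rmod_hom_zero[OF P M h] by auto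
  moreover have "\<zero>\<^bsub>M\<^esub> \<in> ?X \<inter> ?Y" using M.submoduleD(2)[OF X] M.submoduleD(2)[OF Y] by blast
  ultimately show "direct_sum_decomp A M ?X ?Y" unfolding direct_sum_decomp_def using X Y by blast
  have "h \<in> rmod_hom A P (M\<lparr>carrier := ?X\<rparr>)"
    unfolding rmod_hom_def using hD(1,3,4) by (auto simp: PiE_def)
  moreover have "bij_betw h (carrier P) ?X" by (rule bij_betw_imageI) (metis inj_onI kh, rule refl)
  ultimately show "rmod_iso A P (M\<lparr>carrier := ?X\<rparr>)" unfolding rmod_iso_def by auto
qed

section \<open>Quotient modules\<close>

context
  fixes A :: "('k, 'a) module" and P :: "('a, 'm) module" and N :: "'m set"
  assumes P: "right_module A P" and N: "Module.submodule N A P"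
begin

interpretation P: right_module A P by (rule P)

lemma quot_subgroup: "abelian_subgroup N P"
proof -
  have "additive_subgroup N P"
    using N unfolding Module.submodule_def by (simp add: additive_subgroup.intro)
  thus ?thesis using abelian_subgroupI3 P.M.abelian_group_axioms by blast
qed

interpretation N: abelian_subgroup N P by (rule quot_subgroup)

lemma quot_eq_iff:
  assumes "x \<in> carrier P" "y \<in> carrier P"
  shows "N +>\<^bsub>P\<^esub> x = N +>\<^bsub>P\<^esub> y \<longleftrightarrow> x \<oplus>\<^bsub>P\<^esub> (\<ominus>\<^bsub>P\<^esub> y) \<in> N"
  using N.a_rcos_module[OF assms(2,1)] N.a_repr_independence'[of x y] N.a_rcos_self[OF assms(1)]
    assms by (metis N.a_repr_independence')

lemma quot_carrier: "carrier (quotient_rmod P N) = (\<lambda>x. N +>\<^bsub>P\<^esub> x) ` carrier P"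
  by (auto simp: quotient_rmod_def A_RCOSETS_def')

lemma quot_add: "x \<in> carrier P \<Longrightarrow> y \<in> carrier P \<Longrightarrow>
    (N +>\<^bsub>P\<^esub> x) \<oplus>\<^bsub>quotient_rmod P N\<^esub> (N +>\<^bsub>P\<^esub> y) = N +>\<^bsub>P\<^esub> (x \<oplus>\<^bsub>P\<^esub> y)"
  by (simp add: quotient_rmod_def N.a_rcos_sum)

lemma quot_zero: "\<zero>\<^bsub>quotient_rmod P N\<^esub> = N +>\<^bsub>P\<^esub> \<zero>\<^bsub>P\<^esub>"
  using P.submoduleD(1)[OF N] by (simp add: quotient_rmod_def)

lemma quot_zero_iff: "x \<in> carrier P \<Longrightarrow> N +>\<^bsub>P\<^esub> x = \<zero>\<^bsub>quotient_rmod P N\<^esub> \<longleftrightarrow> x \<in> N"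
  unfolding quot_zero using quot_eq_iff[of x "\<zero>\<^bsub>P\<^esub>"] P.M.minus_equality[of "\<zero>\<^bsub>P\<^esub>" "\<zero>\<^bsub>P\<^esub>"]
  by simp

text \<open>The union in \<open>quotient_rmod\<close> runs over representatives of a coset;
  stability of N makes all its members the same coset.\<close>

lemma quot_act:
  assumes a: "a \<in> carrier A" and x: "x \<in> carrier P"
  shows "a \<odot>\<^bsub>quotient_rmod P N\<^esub> (N +>\<^bsub>P\<^esub> x) = N +>\<^bsub>P\<^esub> (a \<odot>\<^bsub>P\<^esub> x)"
proof -
  have "N +>\<^bsub>P\<^esub> (a \<odot>\<^bsub>P\<^esub> y) = N +>\<^bsub>P\<^esub> (a \<odot>\<^bsub>P\<^esub> x)" if y: "y \<in> N +>\<^bsub>P\<^esub> x" for y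
  proof -
    have yc: "y \<in> carrier P" using N.a_elemrcos_carrier[OF x y] .
    have "y \<oplus>\<^bsub>P\<^esub> (\<ominus>\<^bsub>P\<^esub> x) \<in> N" using N.a_rcos_module[OF x yc] y by simp
    hence "a \<odot>\<^bsub>P\<^esub> (y \<oplus>\<^bsub>P\<^esub> (\<ominus>\<^bsub>P\<^esub> x)) \<in> N" using P.submoduleD(4)[OF N a] by blast
    hence "a \<odot>\<^bsub>P\<^esub> y \<oplus>\<^bsub>P\<^esub> (\<ominus>\<^bsub>P\<^esub> (a \<odot>\<^bsub>P\<^esub> x)) \<in> N"
      using P.act_add_right[OF a yc, of "\<ominus>\<^bsub>P\<^esub> x"] P.act_minus[OF a x] x by simp
    thus ?thesis using quot_eq_iff P.act_closed a x yc by blast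
  qed
  moreover have "N +>\<^bsub>P\<^esub> x \<noteq> {}" using N.a_rcos_self[OF x] by blast
  ultimately have "(\<Union>y\<in>N +>\<^bsub>P\<^esub> x. N +>\<^bsub>P\<^esub> (a \<odot>\<^bsub>P\<^esub> y)) = N +>\<^bsub>P\<^esub> (a \<odot>\<^bsub>P\<^esub> x)"
    by (intro SUP_eq_const) auto
  thus ?thesis by (simp add: quotient_rmod_def)
qed

lemma quot_right_module: "right_module A (quotient_rmod P N)"
proof -
  have "abelian_group (quotient_rmod P N)"
  proof (rule abelian_groupI)
    fix X assume "X \<in> carrier (quotient_rmod P N)"
    then obtain x where x: "x \<in> carrier P" "X = N +>\<^bsub>P\<^esub> x" unfolding quot_carrier by blast
    hence "(N +>\<^bsub>P\<^esub> (\<ominus>\<^bsub>P\<^esub> x)) \<oplus>\<^bsub>quotient_rmod P N\<^esub> X = \<zero>\<^bsub>quotient_rmod P N\<^esub>"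
      using quot_add[of "\<ominus>\<^bsub>P\<^esub> x" x] by (simp add: P.M.l_neg quot_zero)
    moreover have "N +>\<^bsub>P\<^esub> (\<ominus>\<^bsub>P\<^esub> x) \<in> carrier (quotient_rmod P N)" using x quot_carrier by auto
    ultimately show "\<exists>Y\<in>carrier (quotient_rmod P N). Y \<oplus>\<^bsub>quotient_rmod P N\<^esub> X = \<zero>\<^bsub>quotient_rmod P N\<^esub>"
      by blast
  qed (auto simp: quot_carrier quot_add quot_zero P.M.a_ac)
  thus ?thesis unfolding right_module_def right_module_axioms_def using P.A.ring_axioms
    by (auto simp: quot_carrier quot_act quot_add P.act_closed P.act_add_left P.act_add_right
        P.act_mult P.act_one)
qed

text \<open>The first isomorphism theorem. The map is evaluated on a chosen representative, and two
  representatives differ by an element of N, which h kills.\<close>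

lemma quot_iso:
  assumes M: "right_module A M" and h: "h \<in> rmod_hom A P M" and surj: "h ` carrier P = carrier M"
    and ker: "\<And>x. x \<in> carrier P \<Longrightarrow> h x = \<zero>\<^bsub>M\<^esub> \<longleftrightarrow> x \<in> N"
  shows "rmod_iso A (quotient_rmod P N) M"
proof -
  let ?Q = "quotient_rmod P N"
  interpret M: right_module A M by (rule M)
  let ?g = "\<lambda>X\<in>carrier ?Q. h (SOME x. x \<in> carrier P \<and> X = N +>\<^bsub>P\<^esub> x)"
  have g: "?g (N +>\<^bsub>P\<^esub> x) = h x" if x: "x \<in> carrier P" for x
  proof -
    let ?y = "SOME y. y \<in> carrier P \<and> N +>\<^bsub>P\<^esub> x = N +>\<^bsub>P\<^esub> y"
    have y: "?y \<in> carrier P" "N +>\<^bsub>P\<^esub> x = N +>\<^bsub>P\<^esub> ?y"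
      using someI[of "\<lambda>y. y \<in> carrier P \<and> N +>\<^bsub>P\<^esub> x = N +>\<^bsub>P\<^esub> y" x] x by auto
    hence "x \<oplus>\<^bsub>P\<^esub> (\<ominus>\<^bsub>P\<^esub> ?y) \<in> N" using quot_eq_iff x by blast
    hence "h (x \<oplus>\<^bsub>P\<^esub> (\<ominus>\<^bsub>P\<^esub> ?y)) = \<zero>\<^bsub>M\<^esub>" using ker x y by simp
    hence "h x \<oplus>\<^bsub>M\<^esub> (\<ominus>\<^bsub>M\<^esub> h ?y) = \<zero>\<^bsub>M\<^esub>"
      using rmod_homD(3)[OF h] rmod_hom_minus[OF P M h] x y by simp
    hence "h x = h ?y" using M.M.minus_equality[of "h x" "\<ominus>\<^bsub>M\<^esub> h ?y"] rmod_homD(2)[OF h] x y by simp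
    thus ?thesis using x quot_carrier by auto
  qed
  have "?g \<in> rmod_hom A ?Q M" unfolding rmod_hom_def
  proof (intro CollectI conjI ballI)
    show "?g \<in> carrier ?Q \<rightarrow>\<^sub>E carrier M"
      using g rmod_homD(2)[OF h] by (auto simp: quot_carrier simp del: restrict_apply)
        (simp add: quot_carrier)
  next
    fix X Y assume "X \<in> carrier ?Q" "Y \<in> carrier ?Q"
    thus "?g (X \<oplus>\<^bsub>?Q\<^esub> Y) = ?g X \<oplus>\<^bsub>M\<^esub> ?g Y"
      using g rmod_homD(3)[OF h] by (auto simp: quot_carrier quot_add simp del: restrict_apply)
  next
    fix a X assume "a \<in> carrier A" "X \<in> carrier ?Q"
    thus "?g (a \<odot>\<^bsub>?Q\<^esub> X) = a \<odot>\<^bsub>M\<^esub> ?g X" using g rmod_homD(4)[OF h] P.act_closed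
      by (auto simp: quot_carrier quot_act simp del: restrict_apply)
  qed
  moreover from this have "inj_on ?g (carrier ?Q)"
  proof (rule rmod_hom_inj[OF quot_right_module M])
    fix X assume "X \<in> carrier ?Q" "?g X = \<zero>\<^bsub>M\<^esub>"
    then obtain x where x: "x \<in> carrier P" "X = N +>\<^bsub>P\<^esub> x" unfolding quot_carrier by blast
    hence "h x = \<zero>\<^bsub>M\<^esub>" using \<open>?g X = \<zero>\<^bsub>M\<^esub>\<close> g[OF x(1)] by (simp del: restrict_apply)
    hence "x \<in> N" using ker x by blast
    thus "X = \<zero>\<^bsub>?Q\<^esub>" using quot_zero_iff[OF x(1)] x by simp
  qed
  moreover have "?g ` carrier ?Q = carrier M"
  proof -
    have "G ` f ` C = k ` C" if "\<And>x. x \<in> C \<Longrightarrow> G (f x) = k x"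
      for G :: "'m set \<Rightarrow> 'c" and f :: "'m \<Rightarrow> 'm set" and k C using that by force
    from this[of "carrier P" ?g "\<lambda>x. N +>\<^bsub>P\<^esub> x" h] g
    have "?g ` (\<lambda>x. N +>\<^bsub>P\<^esub> x) ` carrier P = carrier M" unfolding surj by blast
    thus ?thesis by (simp only: quot_carrier)
  qed
  ultimately show ?thesis unfolding rmod_iso_def bij_betw_def by blast
qed

end

section \<open>Algebras of finite preorders\<close>

lemma pair_algebra_mult:
  fixes f g :: "'v \<times> 'v \<Rightarrow> 'k::field"
  assumes V: "finite V" "R \<subseteq> V \<times> V"
    and fg: "f \<in> carrier (pair_algebra R)" "g \<in> carrier (pair_algebra R)"
  shows "(f \<otimes>\<^bsub>pair_algebra R\<^esub> g) (u, x) = (\<Sum>v\<in>V. f (u, v) * g (v, x))"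
proof -
  have "(\<Sum>v\<in>V. f (u, v) * g (v, x)) = (\<Sum>v | (u, v) \<in> R \<and> (v, x) \<in> R. f (u, v) * g (v, x))"
  proof (rule sum.mono_neutral_right[OF V(1)])
    show "{v. (u, v) \<in> R \<and> (v, x) \<in> R} \<subseteq> V" using V(2) by auto
    show "\<forall>v\<in>V - {v. (u, v) \<in> R \<and> (v, x) \<in> R}. f (u, v) * g (v, x) = 0"
    proof
      fix v assume "v \<in> V - {v. (u, v) \<in> R \<and> (v, x) \<in> R}"
      hence "(u, v) \<notin> R \<or> (v, x) \<notin> R" by blast
      thus "f (u, v) * g (v, x) = 0" using fg by (cases "(u, v) \<in> R") (auto simp: pair_algebra_def)
    qed
  qed
  thus ?thesis by (simp add: pair_algebra_def)
qed

text \<open>An algebra given by coordinates as the matrices supported on a finite preorder. Keeping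
  the coordinate map \<open>\<phi>\<close> as a parameter allows one theory for the operator
  algebra, with \<open>mat\<close>, and for a poset algebra itself, with the identity.\<close>

locale preorder_algebra =
  fixes A :: "('k::field, 'a) module" (structure)
    and V :: "'v set" and R :: "('v \<times> 'v) set" and \<phi> :: "'a \<Rightarrow> 'v \<times> 'v \<Rightarrow> 'k"
  assumes fin_V: "finite V" and R_V: "R \<subseteq> V \<times> V" and R_refl: "u \<in> V \<Longrightarrow> (u, u) \<in> R"
    and R_trans: "(u, v) \<in> R \<Longrightarrow> (v, x) \<in> R \<Longrightarrow> (u, x) \<in> R"
    and ring_A: "ring A" and smult_closed: "a \<in> carrier A \<Longrightarrow> c \<odot> a \<in> carrier A"
    and \<phi>_iso: "\<phi> \<in> ring_iso A (pair_algebra R)"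
    and \<phi>_smult: "a \<in> carrier A \<Longrightarrow> \<phi> (c \<odot> a) = (\<lambda>p. c * \<phi> a p)"
begin

sublocale ring A by (rule ring_A)

lemma fin_R: "finite R"
  using R_V fin_V by (meson finite_SigmaI finite_subset)

lemma \<phi>_bij: "bij_betw \<phi> (carrier A) (carrier (pair_algebra R))"
  using \<phi>_iso by (simp add: ring_iso_def)

lemma \<phi>_eq: "a \<in> carrier A \<Longrightarrow> b \<in> carrier A \<Longrightarrow> (\<And>u v. (u, v) \<in> R \<Longrightarrow> \<phi> a (u, v) = \<phi> b (u, v)) \<Longrightarrow> a = b"
proof -
  assume ab: "a \<in> carrier A" "b \<in> carrier A" and eq: "\<And>u v. (u, v) \<in> R \<Longrightarrow> \<phi> a (u, v) = \<phi> b (u, v)"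
  have "\<phi> a \<in> carrier (pair_algebra R)" "\<phi> b \<in> carrier (pair_algebra R)"
    using \<phi>_bij ab by (auto simp: bij_betw_def)
  hence "\<phi> a = \<phi> b" using eq by (auto simp: pair_algebra_def fun_eq_iff) metis
  thus "a = b" using \<phi>_bij ab by (auto simp: bij_betw_def inj_on_def)
qed

lemma \<phi>_out: assumes "a \<in> carrier A" "p \<notin> R" shows "\<phi> a p = 0"
proof -
  have "\<phi> a \<in> carrier (pair_algebra R)" using \<phi>_bij assms by (auto simp: bij_betw_def)
  thus ?thesis using assms by (cases p) (simp add: pair_algebra_def)
qed

lemma \<phi>_add: "a \<in> carrier A \<Longrightarrow> b \<in> carrier A \<Longrightarrow> \<phi> (a \<oplus> b) p = \<phi> a p + \<phi> b p"
  using \<phi>_iso by (simp add: ring_iso_def Ring.ring_hom_def pair_algebra_def)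

lemma \<phi>_zero: "\<phi> \<zero> p = 0"
  using \<phi>_add[of \<zero> \<zero> p] by (metis add_cancel_right_right l_zero zero_closed)

lemma \<phi>_one: "\<phi> \<one> (u, v) = (if u = v \<and> u \<in> V then 1 else 0)"
proof -
  have "\<phi> \<one> = \<one>\<^bsub>pair_algebra R\<^esub>" using \<phi>_iso by (simp add: ring_iso_def Ring.ring_hom_def)
  thus ?thesis using R_refl R_V by (auto simp: pair_algebra_def)
qed

lemma \<phi>_mult:
  assumes ab: "a \<in> carrier A" "b \<in> carrier A"
  shows "\<phi> (a \<otimes> b) (u, x) = (\<Sum>v\<in>V. \<phi> a (u, v) * \<phi> b (v, x))"
proof -
  have "\<phi> (a \<otimes> b) = \<phi> a \<otimes>\<^bsub>pair_algebra R\<^esub> \<phi> b"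
    using \<phi>_iso ab by (simp add: ring_iso_def Ring.ring_hom_def)
  thus ?thesis using pair_algebra_mult[OF fin_V R_V bij_betwE[OF \<phi>_bij, rule_format, OF ab(1)]
      bij_betwE[OF \<phi>_bij, rule_format, OF ab(2)]] by simp
qed

lemma \<phi>_finsum: "f \<in> S \<rightarrow> carrier A \<Longrightarrow> \<phi> (finsum A f S) p = (\<Sum>s\<in>S. \<phi> (f s) p)"
proof (induction S rule: infinite_finite_induct)
  case (insert s S)
  thus ?case using \<phi>_add[of "f s" "finsum A f S"] by auto
qed (auto simp: \<phi>_zero finsum_infinite)

text \<open>Matrix units. On a right module, \<open>E u u\<close> projects to the component at u and
  \<open>E u v\<close> carries this component into the one at v.\<close>

definition E :: "'v \<Rightarrow> 'v \<Rightarrow> 'a" where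
  "E u v = inv_into (carrier A) \<phi> (\<lambda>p. if p = (u, v) then 1 else 0)"

lemma E_closed [simp]: "(u, v) \<in> R \<Longrightarrow> E u v \<in> carrier A"
  and \<phi>_E: "(u, v) \<in> R \<Longrightarrow> \<phi> (E u v) p = (if p = (u, v) then 1 else 0)"
proof -
  assume "(u, v) \<in> R"
  hence "(\<lambda>p. if p = (u, v) then 1 else 0) \<in> carrier (pair_algebra R)"
    by (auto simp: pair_algebra_def)
  hence *: "(\<lambda>p. if p = (u, v) then 1 else 0) \<in> \<phi> ` carrier A"
    using \<phi>_bij by (simp add: bij_betw_def)
  show "E u v \<in> carrier A" unfolding E_def by (rule inv_into_into[OF *])
  show "\<phi> (E u v) p = (if p = (u, v) then 1 else 0)" unfolding E_def f_inv_into_f[OF *] by simp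
qed

lemma E_mult_left: "(u, v) \<in> R \<Longrightarrow> a \<in> carrier A \<Longrightarrow>
    \<phi> (E u v \<otimes> a) (u', x) = (if u' = u then \<phi> a (v, x) else 0)"
proof -
  assume uv: "(u, v) \<in> R" "a \<in> carrier A"
  have "\<phi> (E u v \<otimes> a) (u', x) = (\<Sum>v'\<in>V. if v' = v then (if u' = u then \<phi> a (v, x) else 0) else 0)"
    using \<phi>_mult[of "E u v" a u' x] uv by (auto simp: \<phi>_E intro!: sum.cong)
  thus ?thesis using uv R_V fin_V by auto
qed

lemma E_mult_right: "(u, v) \<in> R \<Longrightarrow> a \<in> carrier A \<Longrightarrow>
    \<phi> (a \<otimes> E u v) (x, v') = (if v' = v then \<phi> a (x, u) else 0)"
proof -
  assume uv: "(u, v) \<in> R" "a \<in> carrier A"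
  have "\<phi> (a \<otimes> E u v) (x, v') = (\<Sum>u'\<in>V. if u' = u then (if v' = v then \<phi> a (x, u) else 0) else 0)"
    using \<phi>_mult[of a "E u v" x v'] uv by (auto simp: \<phi>_E intro!: sum.cong)
  thus ?thesis using uv R_V fin_V by auto
qed

lemma E_mult: "(u, v) \<in> R \<Longrightarrow> (v', x) \<in> R \<Longrightarrow> E u v \<otimes> E v' x = (if v = v' then E u x else \<zero>)"
proof (rule \<phi>_eq)
  assume R: "(u, v) \<in> R" "(v', x) \<in> R"
  have ux: "(u, x) \<in> R" if "v = v'" using R that R_trans by blast
  show "E u v \<otimes> E v' x \<in> carrier A" "(if v = v' then E u x else \<zero>) \<in> carrier A" using R ux by auto
  fix u' x' assume "(u', x') \<in> R"
  show "\<phi> (E u v \<otimes> E v' x) (u', x') = \<phi> (if v = v' then E u x else \<zero>) (u', x')"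
    using R ux by (auto simp: E_mult_left \<phi>_E \<phi>_zero)
qed

abbreviation scal :: "'k \<Rightarrow> 'a" where "scal c \<equiv> c \<odot> \<one>"

lemma scal_closed [simp]: "scal c \<in> carrier A"
  by (simp add: smult_closed)

lemma scal_mult: assumes a: "a \<in> carrier A" shows "scal c \<otimes> a = c \<odot> a"
proof (rule \<phi>_eq)
  fix u v assume uv: "(u, v) \<in> R"
  have "\<phi> (scal c \<otimes> a) (u, v) = (\<Sum>x\<in>V. if x = u then c * \<phi> a (u, v) else 0)"
    using a R_V uv by (auto simp: \<phi>_mult \<phi>_smult \<phi>_one smult_closed intro!: sum.cong)
  thus "\<phi> (scal c \<otimes> a) (u, v) = \<phi> (c \<odot> a) (u, v)" using uv R_V fin_V a by (auto simp: \<phi>_smult)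
qed (use a smult_closed in auto)

lemma mult_scal: assumes a: "a \<in> carrier A" shows "a \<otimes> scal c = c \<odot> a"
proof (rule \<phi>_eq)
  fix u v assume uv: "(u, v) \<in> R"
  have "\<phi> (a \<otimes> scal c) (u, v) = (\<Sum>x\<in>V. if x = v then c * \<phi> a (u, v) else 0)"
    using a R_V uv by (auto simp: \<phi>_mult \<phi>_smult \<phi>_one smult_closed intro!: sum.cong)
  thus "\<phi> (a \<otimes> scal c) (u, v) = \<phi> (c \<odot> a) (u, v)" using uv R_V fin_V a by (auto simp: \<phi>_smult)
qed (use a smult_closed in auto)

lemma E_sandwich: "(x, u) \<in> R \<Longrightarrow> (v, y) \<in> R \<Longrightarrow> a \<in> carrier A \<Longrightarrow> (x, y) \<in> R \<Longrightarrow>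
    E x u \<otimes> a \<otimes> E v y = \<phi> a (u, v) \<odot> E x y"
  by (rule \<phi>_eq) (auto simp: E_mult_right E_mult_left smult_closed \<phi>_smult \<phi>_E)

lemma E_sandwich_zero: "(x, u) \<in> R \<Longrightarrow> (v, y) \<in> R \<Longrightarrow> a \<in> carrier A \<Longrightarrow> \<phi> a (u, v) = 0 \<Longrightarrow>
    E x u \<otimes> a \<otimes> E v y = \<zero>"
  by (rule \<phi>_eq) (auto simp: E_mult_right E_mult_left \<phi>_zero)

lemma expand: "a \<in> carrier A \<Longrightarrow> a = finsum A (\<lambda>p. E (fst p) (snd p) \<otimes> scal (\<phi> a p)) R"
proof (rule \<phi>_eq)
  assume a: "a \<in> carrier A"
  have *: "(\<lambda>p. E (fst p) (snd p) \<otimes> scal (\<phi> a p)) \<in> R \<rightarrow> carrier A" by auto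
  thus "finsum A (\<lambda>p. E (fst p) (snd p) \<otimes> scal (\<phi> a p)) R \<in> carrier A" by (rule finsum_closed)
  fix u v assume uv: "(u, v) \<in> R"
  have "(\<Sum>p\<in>R. \<phi> (E (fst p) (snd p) \<otimes> scal (\<phi> a p)) (u, v)) = (\<Sum>p\<in>R. if p = (u, v) then \<phi> a p else 0)"
    by (rule sum.cong) (auto simp: mult_scal \<phi>_smult \<phi>_E)
  thus "\<phi> a (u, v) = \<phi> (finsum A (\<lambda>p. E (fst p) (snd p) \<otimes> scal (\<phi> a p)) R) (u, v)"
    using \<phi>_finsum[OF *] uv fin_R by simp
qed

lemma one_expand: "\<one> = finsum A (\<lambda>u. E u u) V"
proof (rule \<phi>_eq)
  have *: "(\<lambda>u. E u u) \<in> V \<rightarrow> carrier A" using R_refl by auto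
  thus "finsum A (\<lambda>u. E u u) V \<in> carrier A" by (rule finsum_closed)
  fix u v assume uv: "(u, v) \<in> R"
  have "(\<Sum>x\<in>V. \<phi> (E x x) (u, v)) = (\<Sum>x\<in>V. if x = u then (if u = v then 1 else 0) else 0)"
    by (rule sum.cong) (auto simp: R_refl \<phi>_E)
  thus "\<phi> \<one> (u, v) = \<phi> (finsum A (\<lambda>u. E u u) V) (u, v)"
    using \<phi>_finsum[OF *] fin_V uv R_V by (auto simp: \<phi>_one)
qed auto

abbreviation act :: "('a, 'm) module \<Rightarrow> 'a \<Rightarrow> 'm \<Rightarrow> 'm" where
  "act M a x \<equiv> a \<odot>\<^bsub>M\<^esub> x"

definition eqv :: "'v \<Rightarrow> 'v \<Rightarrow> bool" where
  "eqv u v \<longleftrightarrow> (u, v) \<in> R \<and> (v, u) \<in> R"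

lemma eqv_V: "eqv u v \<Longrightarrow> u \<in> V \<and> v \<in> V"
  using R_V by (auto simp: eqv_def)

lemma eqv_sym: "eqv u v \<Longrightarrow> eqv v u"
  by (auto simp: eqv_def)

lemma E_act:
  assumes "right_module A M" "(u, v) \<in> R" "(v', x) \<in> R" "m \<in> carrier M"
  shows "E v' x \<odot>\<^bsub>M\<^esub> (E u v \<odot>\<^bsub>M\<^esub> m) = (if v = v' then E u x \<odot>\<^bsub>M\<^esub> m else \<zero>\<^bsub>M\<^esub>)"
proof -
  interpret M: right_module A M by fact
  show ?thesis using assms by (simp add: M.act_mult E_mult M.act_zero_left)
qed

lemma act_expand:
  assumes "right_module A M" "a \<in> carrier A" "m \<in> carrier M"
  shows "a \<odot>\<^bsub>M\<^esub> m = finsum M (\<lambda>p. scal (\<phi> a p) \<odot>\<^bsub>M\<^esub> (E (fst p) (snd p) \<odot>\<^bsub>M\<^esub> m)) R"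
proof -
  interpret M: right_module A M by fact
  have *: "(\<lambda>p. E (fst p) (snd p) \<otimes> scal (\<phi> a p)) \<in> R \<rightarrow> carrier A" by auto
  have "a \<odot>\<^bsub>M\<^esub> m = finsum M (\<lambda>p. (E (fst p) (snd p) \<otimes> scal (\<phi> a p)) \<odot>\<^bsub>M\<^esub> m) R"
    by (subst expand[OF assms(2)]) (rule M.act_finsum_left[OF * assms(3)])
  also have "\<dots> = finsum M (\<lambda>p. scal (\<phi> a p) \<odot>\<^bsub>M\<^esub> (E (fst p) (snd p) \<odot>\<^bsub>M\<^esub> m)) R"
    by (rule M.finsum_cong') (use assms M.act_closed in \<open>auto simp: M.act_mult\<close>)
  finally show ?thesis .
qed

lemma act_decompose:
  assumes "right_module A M" "m \<in> carrier M"
  shows "m = finsum M (\<lambda>u. E u u \<odot>\<^bsub>M\<^esub> m) V"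
proof -
  interpret M: right_module A M by fact
  have *: "(\<lambda>u. E u u) \<in> V \<rightarrow> carrier A" using R_refl by auto
  have "m = \<one> \<odot>\<^bsub>M\<^esub> m" using M.act_one assms by simp
  also have "\<dots> = finsum M (\<lambda>u. E u u \<odot>\<^bsub>M\<^esub> m) V"
    by (subst one_expand) (rule M.act_finsum_left[OF * assms(2)])
  finally show ?thesis .
qed

lemma act_zeroI:
  assumes "right_module A M" "m \<in> carrier M" "\<And>u. u \<in> V \<Longrightarrow> E u u \<odot>\<^bsub>M\<^esub> m = \<zero>\<^bsub>M\<^esub>"
  shows "m = \<zero>\<^bsub>M\<^esub>"
proof -
  interpret M: right_module A M by fact
  have "finsum M (\<lambda>u. E u u \<odot>\<^bsub>M\<^esub> m) V = finsum M (\<lambda>u. \<zero>\<^bsub>M\<^esub>) V"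
    by (rule M.finsum_cong') (use assms in auto)
  thus ?thesis using act_decompose[OF assms(1,2)] by simp
qed

lemma act_vanish:
  assumes "right_module A M" "a \<in> carrier A" "m \<in> carrier M"
    and "\<And>u v. (u, v) \<in> R \<Longrightarrow> \<phi> a (u, v) \<noteq> 0 \<Longrightarrow> E u v \<odot>\<^bsub>M\<^esub> m = \<zero>\<^bsub>M\<^esub>"
  shows "a \<odot>\<^bsub>M\<^esub> m = \<zero>\<^bsub>M\<^esub>"
proof -
  interpret M: right_module A M by fact
  have z: "\<phi> a p = 0 \<Longrightarrow> scal (\<phi> a p) = \<zero>" for p by (rule \<phi>_eq) (auto simp: \<phi>_smult \<phi>_zero)
  have "finsum M (\<lambda>p. scal (\<phi> a p) \<odot>\<^bsub>M\<^esub> (E (fst p) (snd p) \<odot>\<^bsub>M\<^esub> m)) R = finsum M (\<lambda>p. \<zero>\<^bsub>M\<^esub>) R"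
  proof (rule M.finsum_cong')
    fix p assume p: "p \<in> R"
    show "scal (\<phi> a p) \<odot>\<^bsub>M\<^esub> (E (fst p) (snd p) \<odot>\<^bsub>M\<^esub> m) = \<zero>\<^bsub>M\<^esub>"
    proof (cases "\<phi> a p = 0")
      case True
      show ?thesis unfolding z[OF True]
        by (rule M.act_zero_left) (use p assms M.act_closed in \<open>auto simp: E_closed\<close>)
    next
      case False
      thus ?thesis using assms(4)[of "fst p" "snd p"] p M.act_zero_right by simp
    qed
  qed auto
  thus ?thesis using act_expand[OF assms(1-3)] by simp
qed

text \<open>Every element is a sum of matrix units times scalars, so compatibility with these is
  enough for an additive map.\<close>

lemma hom_check:
  assumes M: "right_module A M" and N: "right_module A N"
    and h: "\<And>x. x \<in> carrier M \<Longrightarrow> h x \<in> carrier N"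
    and add: "\<And>x y. x \<in> carrier M \<Longrightarrow> y \<in> carrier M \<Longrightarrow> h (x \<oplus>\<^bsub>M\<^esub> y) = h x \<oplus>\<^bsub>N\<^esub> h y"
    and sc: "\<And>c x. x \<in> carrier M \<Longrightarrow> h (scal c \<odot>\<^bsub>M\<^esub> x) = scal c \<odot>\<^bsub>N\<^esub> h x"
    and EE: "\<And>u v x. (u, v) \<in> R \<Longrightarrow> x \<in> carrier M \<Longrightarrow> h (E u v \<odot>\<^bsub>M\<^esub> x) = E u v \<odot>\<^bsub>N\<^esub> h x"
    and a: "a \<in> carrier A" and x: "x \<in> carrier M"
  shows "h (a \<odot>\<^bsub>M\<^esub> x) = a \<odot>\<^bsub>N\<^esub> h x"
proof -
  interpret M: right_module A M by fact
  interpret N: right_module A N by fact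
  have 1: "(\<lambda>p. scal (\<phi> a p) \<odot>\<^bsub>M\<^esub> (E (fst p) (snd p) \<odot>\<^bsub>M\<^esub> x)) \<in> R \<rightarrow> carrier M"
    using M.act_closed x by auto
  have "h (a \<odot>\<^bsub>M\<^esub> x) = finsum N (\<lambda>p. h (scal (\<phi> a p) \<odot>\<^bsub>M\<^esub> (E (fst p) (snd p) \<odot>\<^bsub>M\<^esub> x))) R"
    unfolding act_expand[OF M a x]
    by (rule additive_finsum[OF M.M.abelian_group_axioms N.M.abelian_group_axioms h add 1])
  also have "\<dots> = finsum N (\<lambda>p. scal (\<phi> a p) \<odot>\<^bsub>N\<^esub> (E (fst p) (snd p) \<odot>\<^bsub>N\<^esub> h x)) R"
    by (rule N.finsum_cong') (use M.act_closed N.act_closed x h sc EE in auto)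
  also have "\<dots> = a \<odot>\<^bsub>N\<^esub> h x" using act_expand[OF N a h[OF x]] by simp
  finally show ?thesis .
qed

end

lemma direct_sum_decompD:
  assumes "direct_sum_decomp A M X Y" "x \<in> carrier M"
  obtains y z where "y \<in> X" "z \<in> Y" "x = y \<oplus>\<^bsub>M\<^esub> z"
proof -
  have "x \<in> X <+>\<^bsub>M\<^esub> Y" using assms by (simp add: direct_sum_decomp_def)
  thus ?thesis using that by (auto simp: set_add_def')
qed

lemma free_right_module:
  fixes A :: "('k, 'a) module" and B :: "'b set"
  assumes A: "ring A" shows "right_module A (free_rmod A B)"
proof -
  interpret A: ring A by fact
  let ?F = "free_rmod A B"
  have fin: "finite {x. f x \<oplus>\<^bsub>A\<^esub> g x \<noteq> \<zero>\<^bsub>A\<^esub>}"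
    if "finite {x. f x \<noteq> \<zero>\<^bsub>A\<^esub>}" "finite {x. g x \<noteq> \<zero>\<^bsub>A\<^esub>}" for f g :: "'b \<Rightarrow> 'a"
    by (rule finite_subset[OF _ finite_UnI[OF that]]) auto
  have fin': "finite {x. k (f x) \<noteq> \<zero>\<^bsub>A\<^esub>}"
    if "finite {x. f x \<noteq> \<zero>\<^bsub>A\<^esub>}" "k \<zero>\<^bsub>A\<^esub> = \<zero>\<^bsub>A\<^esub>" for f :: "'b \<Rightarrow> 'a" and k
    by (rule finite_subset[OF _ that(1)]) (use that in auto)
  have "abelian_group ?F"
  proof (rule abelian_groupI)
    fix f assume f: "f \<in> carrier ?F"
    have "(\<lambda>x. \<ominus>\<^bsub>A\<^esub> f x) \<in> carrier ?F" using f fin'[of f "\<lambda>a. \<ominus>\<^bsub>A\<^esub> a"] by (auto simp: free_rmod_def)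
    moreover have "(\<lambda>x. \<ominus>\<^bsub>A\<^esub> f x) \<oplus>\<^bsub>?F\<^esub> f = \<zero>\<^bsub>?F\<^esub>" using f by (auto simp: free_rmod_def A.l_neg)
    ultimately show "\<exists>g\<in>carrier ?F. g \<oplus>\<^bsub>?F\<^esub> f = \<zero>\<^bsub>?F\<^esub>" by blast
  qed (use fin in \<open>auto simp: free_rmod_def A.a_ac\<close>)
  moreover have "finite {x. f x \<otimes>\<^bsub>A\<^esub> a \<noteq> \<zero>\<^bsub>A\<^esub>}"
    if "finite {x. f x \<noteq> \<zero>\<^bsub>A\<^esub>}" "a \<in> carrier A" for f :: "'b \<Rightarrow> 'a" and a
    using fin'[of f "\<lambda>b. b \<otimes>\<^bsub>A\<^esub> a"] that by simp
  ultimately show ?thesis unfolding right_module_def right_module_axioms_def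
    using A by (auto simp: free_rmod_def A.l_distr A.r_distr A.m_assoc)
qed

section \<open>Indecomposable projective and simple modules of a preorder algebra\<close>

context preorder_algebra
begin

lemma scal_one: "scal 1 = \<one>"
  by (rule \<phi>_eq) (auto simp: smult_closed \<phi>_smult)

lemma scal_scal: "scal c \<otimes> scal d = scal (c * d)"
  unfolding scal_mult[OF scal_closed]
  by (rule \<phi>_eq) (auto simp: smult_closed \<phi>_smult mult.assoc)

lemma scal_zero: "scal 0 = \<zero>"
  by (rule \<phi>_eq) (auto simp: smult_closed \<phi>_smult \<phi>_zero)

lemma scal_act:
  assumes "right_module A M" "m \<in> carrier M"
  shows "scal d \<odot>\<^bsub>M\<^esub> (scal c \<odot>\<^bsub>M\<^esub> m) = scal (c * d) \<odot>\<^bsub>M\<^esub> m"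
proof -
  interpret M: right_module A M by fact
  show ?thesis using assms by (simp add: M.act_mult scal_scal)
qed

lemma scal_act_inv:
  assumes "right_module A M" "m \<in> carrier M" "c \<noteq> 0"
  shows "scal (1 / c) \<odot>\<^bsub>M\<^esub> (scal c \<odot>\<^bsub>M\<^esub> m) = m"
proof -
  interpret M: right_module A M by fact
  show ?thesis using assms by (simp add: scal_act scal_one M.act_one)
qed

lemma scal_act_zero:
  assumes M: "right_module A M" "m \<in> carrier M" and z: "scal c \<odot>\<^bsub>M\<^esub> m = \<zero>\<^bsub>M\<^esub>"
  shows "c = 0 \<or> m = \<zero>\<^bsub>M\<^esub>"
proof -
  interpret M: right_module A M by fact
  show ?thesis using scal_act_inv[OF M, of c] z M.act_zero_right[of "scal (1 / c)"] by auto
qed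

lemma act_scal_comm:
  assumes "right_module A M" "m \<in> carrier M" "a \<in> carrier A"
  shows "a \<odot>\<^bsub>M\<^esub> (scal c \<odot>\<^bsub>M\<^esub> m) = scal c \<odot>\<^bsub>M\<^esub> (a \<odot>\<^bsub>M\<^esub> m)"
proof -
  interpret M: right_module A M by fact
  show ?thesis using assms by (simp add: M.act_mult scal_mult mult_scal)
qed

text \<open>Sandwiching a between matrix units leaves the single entry at (x, v). A vector
  concentrated at x is thus recovered up to this scalar from a r, which is how submodules are shown
  to be everything.\<close>

lemma gen_rel:
  assumes M: "right_module A M" "r \<in> carrier M" and x: "E x x \<odot>\<^bsub>M\<^esub> r = r"
    and vx: "(v, x) \<in> R" and a: "a \<in> carrier A"
  shows "E v x \<odot>\<^bsub>M\<^esub> (a \<odot>\<^bsub>M\<^esub> r) = scal (\<phi> a (x, v)) \<odot>\<^bsub>M\<^esub> r"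
proof -
  interpret M: right_module A M by fact
  have xx: "(x, x) \<in> R" using vx R_V R_refl by blast
  have "E v x \<odot>\<^bsub>M\<^esub> (a \<odot>\<^bsub>M\<^esub> r) = E v x \<odot>\<^bsub>M\<^esub> (a \<odot>\<^bsub>M\<^esub> (E x x \<odot>\<^bsub>M\<^esub> r))" using x by simp
  also have "\<dots> = (E x x \<otimes> a \<otimes> E v x) \<odot>\<^bsub>M\<^esub> r"
    using M.act_closed xx vx a M(2) by (simp add: M.act_mult m_assoc)
  also have "\<dots> = (E x x \<otimes> scal (\<phi> a (x, v))) \<odot>\<^bsub>M\<^esub> r"
    using xx vx a by (simp add: E_sandwich mult_scal)
  also have "\<dots> = scal (\<phi> a (x, v)) \<odot>\<^bsub>M\<^esub> r" using xx M(2) x M.act_mult[symmetric] by simp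
  finally show ?thesis .
qed

lemma gen_rel_zero:
  assumes M: "right_module A M" "r \<in> carrier M" and x: "E x x \<odot>\<^bsub>M\<^esub> r = r" "x \<in> V"
    and v: "v \<in> V" "\<phi> a (x, v) = 0" and a: "a \<in> carrier A"
  shows "E v v \<odot>\<^bsub>M\<^esub> (a \<odot>\<^bsub>M\<^esub> r) = \<zero>\<^bsub>M\<^esub>"
proof -
  interpret M: right_module A M by fact
  have xx: "(x, x) \<in> R" "(v, v) \<in> R" using x v R_refl by auto
  have "E v v \<odot>\<^bsub>M\<^esub> (a \<odot>\<^bsub>M\<^esub> r) = E v v \<odot>\<^bsub>M\<^esub> (a \<odot>\<^bsub>M\<^esub> (E x x \<odot>\<^bsub>M\<^esub> r))" using x by simp
  also have "\<dots> = (E x x \<otimes> a \<otimes> E v v) \<odot>\<^bsub>M\<^esub> r"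
    using M.act_closed xx a M(2) by (simp add: M.act_mult m_assoc)
  also have "\<dots> = \<zero>\<^bsub>M\<^esub>" using E_sandwich_zero[OF xx(1,2) a v(2)] M.act_zero_left M(2) by simp
  finally show ?thesis .
qed

text \<open>\<open>P\<close> is a copy of the right ideal \<open>E x x A\<close>, with generator \<open>p\<close>.\<close>

definition proj_at :: "'v \<Rightarrow> ('a, 'm) module \<Rightarrow> 'm \<Rightarrow> bool" where
  "proj_at x P p \<longleftrightarrow> right_module A P \<and> x \<in> V \<and> p \<in> carrier P \<and> E x x \<odot>\<^bsub>P\<^esub> p = p \<and>
     (\<forall>q\<in>carrier P. \<exists>a\<in>carrier A. q = a \<odot>\<^bsub>P\<^esub> p) \<and> (\<forall>a\<in>carrier A. a \<odot>\<^bsub>P\<^esub> p = \<zero>\<^bsub>P\<^esub> \<longrightarrow> E x x \<otimes> a = \<zero>)"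

lemma proj_atD:
  assumes "proj_at x P p"
  shows "right_module A P" "x \<in> V" "p \<in> carrier P" "E x x \<odot>\<^bsub>P\<^esub> p = p" "(x, x) \<in> R"
    "q \<in> carrier P \<Longrightarrow> \<exists>a\<in>carrier A. q = a \<odot>\<^bsub>P\<^esub> p"
    "a \<in> carrier A \<Longrightarrow> a \<odot>\<^bsub>P\<^esub> p = \<zero>\<^bsub>P\<^esub> \<Longrightarrow> E x x \<otimes> a = \<zero>"
  using assms R_refl by (auto simp: proj_at_def)

lemma proj_at_nonzero: assumes "proj_at x P p" shows "p \<noteq> \<zero>\<^bsub>P\<^esub>"
proof
  note D = proj_atD[OF assms]
  interpret P: right_module A P by (rule D)
  assume "p = \<zero>\<^bsub>P\<^esub>"
  hence "\<one> \<odot>\<^bsub>P\<^esub> p = \<zero>\<^bsub>P\<^esub>" using P.act_one[OF D(3)] by simp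
  hence "E x x = \<zero>" using D(7)[of \<one>] D(5) by simp
  thus False using \<phi>_E[OF D(5), of "(x, x)"] \<phi>_zero by simp
qed

lemma proj_at_submodule:
  assumes P: "proj_at x P p" and X: "Module.submodule X A P" "p \<in> X"
  shows "X = carrier P"
proof -
  note D = proj_atD[OF P]
  interpret P: right_module A P by (rule D)
  show ?thesis
  proof
    show "X \<subseteq> carrier P" by (rule P.submoduleD(1)[OF X(1)])
    show "carrier P \<subseteq> X"
    proof
      fix q assume "q \<in> carrier P"
      then obtain a where "a \<in> carrier A" "q = a \<odot>\<^bsub>P\<^esub> p" using D(6) by metis
      thus "q \<in> X" using P.submoduleD(4)[OF X(1) _ X(2)] by simp
    qed
  qed
qed

text \<open>Write p = y + z along a decomposition. The part of y at x is a scalar multiple of p;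
  according to whether the scalar vanishes, p lies in one summand or in the other.\<close>

lemma proj_at_indecomposable:
  assumes P: "proj_at x P p" shows "indecomposable_rmod A P"
proof -
  note D = proj_atD[OF P]
  interpret P: right_module A P by (rule D)
  have "X = {\<zero>\<^bsub>P\<^esub>} \<or> Y = {\<zero>\<^bsub>P\<^esub>}" if d: "direct_sum_decomp A P X Y" for X Y
  proof -
    have X: "Module.submodule X A P" and Y: "Module.submodule Y A P" and XY: "X \<inter> Y = {\<zero>\<^bsub>P\<^esub>}"
      using d by (auto simp: direct_sum_decomp_def)
    note SX = P.submoduleD[OF X] and SY = P.submoduleD[OF Y]
    obtain y z where yz: "y \<in> X" "z \<in> Y" "p = y \<oplus>\<^bsub>P\<^esub> z" using direct_sum_decompD[OF d D(3)] .
    obtain a where a: "a \<in> carrier A" "y = a \<odot>\<^bsub>P\<^esub> p" using D(6) SX(1) yz by blast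
    have y': "E x x \<odot>\<^bsub>P\<^esub> y \<in> X" "E x x \<odot>\<^bsub>P\<^esub> z \<in> Y" using SX(4) SY(4) yz D(5) by auto
    have e: "E x x \<odot>\<^bsub>P\<^esub> y = scal (\<phi> a (x, x)) \<odot>\<^bsub>P\<^esub> p"
      unfolding a(2) by (rule gen_rel[OF D(1,3,4,5) a(1)])
    have pe: "p = E x x \<odot>\<^bsub>P\<^esub> y \<oplus>\<^bsub>P\<^esub> E x x \<odot>\<^bsub>P\<^esub> z"
      using P.act_add_right[of "E x x" y z] D(4,5) yz SX(1) SY(1) by auto
    show ?thesis
    proof (cases "\<phi> a (x, x) = 0")
      case True
      hence "p = E x x \<odot>\<^bsub>P\<^esub> z" using pe e P.act_zero_left D(3) y' SY(1) by (auto simp: scal_zero)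
      hence "Y = carrier P" using proj_at_submodule[OF P Y] y' by simp
      thus ?thesis using XY SX(1) by blast
    next
      case False
      hence "p = scal (1 / \<phi> a (x, x)) \<odot>\<^bsub>P\<^esub> (E x x \<odot>\<^bsub>P\<^esub> y)" using scal_act_inv[OF D(1,3)] e by simp
      hence "p \<in> X" using SX(4)[OF scal_closed] y' by metis
      hence "X = carrier P" using proj_at_submodule[OF P X] by simp
      thus ?thesis using XY SY(1) by blast
    qed
  qed
  moreover have "carrier P \<noteq> {\<zero>\<^bsub>P\<^esub>}" using proj_at_nonzero[OF P] D(3) by blast
  ultimately show ?thesis using D(1) by (simp add: indecomposable_rmod_def)
qed

text \<open>The universal property of the right ideal: homomorphisms to M correspond to vectors
  concentrated at x. Writing q = a p is ambiguous only up to elements b with \<open>E x x\<close> b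
  = 0, and these kill m.\<close>

lemma proj_at_map:
  assumes P: "proj_at x P p" and M: "right_module A M" and m: "m \<in> carrier M" "E x x \<odot>\<^bsub>M\<^esub> m = m"
  shows "\<exists>h\<in>rmod_hom A P M. \<forall>a\<in>carrier A. h (a \<odot>\<^bsub>P\<^esub> p) = a \<odot>\<^bsub>M\<^esub> m"
proof -
  note D = proj_atD[OF P]
  interpret P: right_module A P by (rule D)
  interpret M: right_module A M by (rule M)
  have Ea: "(E x x \<otimes> a) \<odot>\<^bsub>M\<^esub> m = a \<odot>\<^bsub>M\<^esub> m" if "a \<in> carrier A" for a
    using M.act_mult[OF E_closed[OF D(5)] that m(1)] m(2) by simp
  let ?h = "\<lambda>q\<in>carrier P. (SOME a. a \<in> carrier A \<and> q = a \<odot>\<^bsub>P\<^esub> p) \<odot>\<^bsub>M\<^esub> m"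
  have h: "?h (a \<odot>\<^bsub>P\<^esub> p) = a \<odot>\<^bsub>M\<^esub> m" if a: "a \<in> carrier A" for a
  proof -
    let ?b = "SOME b. b \<in> carrier A \<and> a \<odot>\<^bsub>P\<^esub> p = b \<odot>\<^bsub>P\<^esub> p"
    have b: "?b \<in> carrier A" "a \<odot>\<^bsub>P\<^esub> p = ?b \<odot>\<^bsub>P\<^esub> p"
      using someI[of "\<lambda>b. b \<in> carrier A \<and> a \<odot>\<^bsub>P\<^esub> p = b \<odot>\<^bsub>P\<^esub> p" a] a by auto
    have "(a \<ominus> ?b) \<odot>\<^bsub>P\<^esub> p \<oplus>\<^bsub>P\<^esub> ?b \<odot>\<^bsub>P\<^esub> p = a \<odot>\<^bsub>P\<^esub> p"
      using P.act_add_left[of "a \<ominus> ?b" ?b p] a b(1) D(3) by (simp add: minus_eq a_assoc l_neg)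
    hence "(a \<ominus> ?b) \<odot>\<^bsub>P\<^esub> p = \<zero>\<^bsub>P\<^esub>" using b P.M.add.l_cancel_one[of "a \<odot>\<^bsub>P\<^esub> p" "(a \<ominus> ?b) \<odot>\<^bsub>P\<^esub> p"]
        P.act_closed[OF a D(3)] P.act_closed[OF _ D(3), of "a \<ominus> ?b"] a by (simp add: P.M.a_comm)
    hence "E x x \<otimes> (a \<ominus> ?b) = \<zero>" using D(7) a b(1) by simp
    hence z: "(a \<ominus> ?b) \<odot>\<^bsub>M\<^esub> m = \<zero>\<^bsub>M\<^esub>" using Ea[of "a \<ominus> ?b"] a b(1) M.act_zero_left m(1) by simp
    have "(a \<ominus> ?b) \<odot>\<^bsub>M\<^esub> m \<oplus>\<^bsub>M\<^esub> ?b \<odot>\<^bsub>M\<^esub> m = a \<odot>\<^bsub>M\<^esub> m"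
      using M.act_add_left[of "a \<ominus> ?b" ?b m] a b(1) m(1) by (simp add: minus_eq a_assoc l_neg)
    thus ?thesis using z M.act_closed[OF b(1) m(1)] P.act_closed[OF a D(3)] by simp
  qed
  have hh: "?h \<in> rmod_hom A P M" unfolding rmod_hom_def
  proof (intro CollectI conjI ballI)
    have "?h q \<in> carrier M" if q: "q \<in> carrier P" for q
    proof -
      obtain a where "a \<in> carrier A" "q = a \<odot>\<^bsub>P\<^esub> p" using D(6) q by blast
      thus ?thesis using h M.act_closed m(1) by (simp del: restrict_apply)
    qed
    thus "?h \<in> carrier P \<rightarrow>\<^sub>E carrier M" by (simp add: PiE_def Pi_def)
  next
    fix q q' assume "q \<in> carrier P" "q' \<in> carrier P"
    then obtain a a' where a: "a \<in> carrier A" "q = a \<odot>\<^bsub>P\<^esub> p" "a' \<in> carrier A" "q' = a' \<odot>\<^bsub>P\<^esub> p"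
      using D(6) by blast
    have "q \<oplus>\<^bsub>P\<^esub> q' = (a \<oplus> a') \<odot>\<^bsub>P\<^esub> p" using P.act_add_left a D(3) by simp
    thus "?h (q \<oplus>\<^bsub>P\<^esub> q') = ?h q \<oplus>\<^bsub>M\<^esub> ?h q'"
      using h[of a] h[of a'] h[of "a \<oplus> a'"] a M.act_add_left m(1) by (simp del: restrict_apply)
  next
    fix b q assume b: "b \<in> carrier A" and "q \<in> carrier P"
    then obtain a where a: "a \<in> carrier A" "q = a \<odot>\<^bsub>P\<^esub> p" using D(6) by blast
    have "b \<odot>\<^bsub>P\<^esub> q = (a \<otimes> b) \<odot>\<^bsub>P\<^esub> p" using P.act_mult a b D(3) by simp
    thus "?h (b \<odot>\<^bsub>P\<^esub> q) = b \<odot>\<^bsub>M\<^esub> ?h q"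
      using h[of a] h[of "a \<otimes> b"] a b M.act_mult m(1) by (simp del: restrict_apply)
  qed
  show ?thesis by (rule bexI[OF _ hh]) (use h in blast)
qed

text \<open>P is a retract of the regular module by p -> \<open>E x x\<close>. The free module is
  indexed by a single arbitrary element of the type of P.\<close>

lemma proj_at_projective:
  fixes P :: "('a, 'm) module"
  assumes P: "proj_at x P p" shows "projective_rmod A P"
proof -
  note D = proj_atD[OF P]
  interpret P: right_module A P by (rule D)
  let ?b = "undefined :: 'm"
  let ?F = "free_rmod A {?b}"
  have F: "right_module A ?F" by (rule free_right_module[OF ring_A])
  let ?d = "\<lambda>t. if t = ?b then E x x else \<zero>"
  have d: "?d \<in> carrier ?F" "E x x \<odot>\<^bsub>?F\<^esub> ?d = ?d"
    using D(5) E_mult[OF D(5) D(5)] by (auto simp: free_rmod_def)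
  obtain h where h: "h \<in> rmod_hom A P ?F" "\<And>a. a \<in> carrier A \<Longrightarrow> h (a \<odot>\<^bsub>P\<^esub> p) = a \<odot>\<^bsub>?F\<^esub> ?d"
    using proj_at_map[OF P F d] by blast
  let ?k = "\<lambda>f\<in>carrier ?F. f ?b \<odot>\<^bsub>P\<^esub> p"
  have Fc: "f t \<in> carrier A" if "f \<in> carrier ?F" for f t using that by (simp add: free_rmod_def)
  interpret F: right_module A ?F by (rule F)
  have k: "?k \<in> rmod_hom A ?F P" unfolding rmod_hom_def
  proof (intro CollectI conjI ballI)
    show "?k (f \<oplus>\<^bsub>?F\<^esub> g) = ?k f \<oplus>\<^bsub>P\<^esub> ?k g" if fg: "f \<in> carrier ?F" "g \<in> carrier ?F" for f g
    proof -
      have "(f \<oplus>\<^bsub>?F\<^esub> g) ?b = f ?b \<oplus> g ?b" by (simp add: free_rmod_def)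
      thus ?thesis using fg P.act_add_left[OF Fc[OF fg(1)] Fc[OF fg(2)] D(3)] by simp
    qed
    show "?k (a \<odot>\<^bsub>?F\<^esub> f) = a \<odot>\<^bsub>P\<^esub> ?k f" if af: "a \<in> carrier A" "f \<in> carrier ?F" for a f
    proof -
      have "(a \<odot>\<^bsub>?F\<^esub> f) ?b = f ?b \<otimes> a" by (simp add: free_rmod_def)
      thus ?thesis using af P.act_mult[OF Fc[OF af(2)] af(1) D(3)] F.act_closed[OF af] by simp
    qed
  qed (use P.act_closed D(3) Fc in auto)
  have kh: "?k (h q) = q" if q: "q \<in> carrier P" for q
  proof -
    obtain a where a: "a \<in> carrier A" "q = a \<odot>\<^bsub>P\<^esub> p" using D(6) q by blast
    have "(a \<odot>\<^bsub>?F\<^esub> ?d) ?b = E x x \<otimes> a" by (simp add: free_rmod_def)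
    thus ?thesis
      unfolding a(2) h(2)[OF a(1)] using F.act_closed[OF a(1) d(1)] P.act_mult' a(1) D(3,4,5) by simp
  qed
  show ?thesis
    unfolding projective_rmod_def using D(1) retract_summand[where k = ?k and h = h, OF F D(1) k h(1) kh] by blast
qed

text \<open>The image of p is concentrated at x and has the form a q, so it is governed by the entry
  of a at (y, x), which is zero off the preorder.\<close>

lemma proj_at_hom:
  assumes P: "proj_at x P p" and Q: "proj_at y Q q" and h: "h \<in> rmod_hom A P Q"
    and nz: "h p \<noteq> \<zero>\<^bsub>Q\<^esub>"
  shows "(y, x) \<in> R"
proof (rule ccontr)
  note D = proj_atD[OF P] and G = proj_atD[OF Q]
  interpret Q: right_module A Q by (rule G)
  assume n: "(y, x) \<notin> R"
  have hp: "h p \<in> carrier Q" using rmod_homD(2)[OF h D(3)] .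
  obtain a where a: "a \<in> carrier A" "h p = a \<odot>\<^bsub>Q\<^esub> q" using G(6)[OF hp] by blast
  have "h p = E x x \<odot>\<^bsub>Q\<^esub> h p" using rmod_homD(4)[OF h E_closed[OF D(5)] D(3)] D(4) by simp
  also have "\<dots> = \<zero>\<^bsub>Q\<^esub>" unfolding a(2) using gen_rel_zero[OF G(1,3,4,2) D(2) \<phi>_out[OF a(1) n] a(1)] .
  finally show False using nz by simp
qed

lemma proj_at_iso:
  assumes P: "proj_at x P p" and Q: "proj_at y Q q" and iso: "rmod_iso A P Q"
  shows "eqv x y"
proof -
  have *: "(y, x) \<in> R" if P: "proj_at x P p" and Q: "proj_at y Q q" and iso: "rmod_iso A P Q"
    for x y and P :: "('a, 'x) module" and Q :: "('a, 'y) module" and p q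
  proof -
    note D = proj_atD[OF P] and G = proj_atD[OF Q]
    obtain h where h: "h \<in> rmod_hom A P Q" "bij_betw h (carrier P) (carrier Q)"
      using iso by (auto simp: rmod_iso_def)
    interpret P: right_module A P by (rule D)
    have "h p \<noteq> \<zero>\<^bsub>Q\<^esub>" using h(2) rmod_hom_zero[OF D(1) G(1) h(1)] proj_at_nonzero[OF P] D(3)
      by (metis P.M.zero_closed bij_betw_imp_inj_on inj_on_eq_iff)
    thus ?thesis using proj_at_hom[OF P Q h(1)] by blast
  qed
  show ?thesis unfolding eqv_def
    using *[OF P Q iso] *[OF Q P rmod_iso_sym[OF proj_atD(1)[OF P] proj_atD(1)[OF Q] iso]] by blast
qed

text \<open>Among the vertices where M is nonzero take one with the fewest predecessors for S. The
  parameter S gives minimal vertices for projective modules and maximal ones for simple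
  modules.\<close>

lemma extremal_vertex:
  assumes M: "right_module A M" and nz: "carrier M \<noteq> {\<zero>\<^bsub>M\<^esub>}" and S: "S = R \<or> S = R\<inverse>"
  obtains x m where "x \<in> V" "m \<in> carrier M" "E x x \<odot>\<^bsub>M\<^esub> m = m" "m \<noteq> \<zero>\<^bsub>M\<^esub>"
    "\<And>y n. (y, x) \<in> S \<Longrightarrow> (x, y) \<notin> S \<Longrightarrow> n \<in> carrier M \<Longrightarrow> E y y \<odot>\<^bsub>M\<^esub> n = \<zero>\<^bsub>M\<^esub>"
proof -
  interpret M: right_module A M by fact
  let ?Q = "\<lambda>x. x \<in> V \<and> (\<exists>m\<in>carrier M. E x x \<odot>\<^bsub>M\<^esub> m \<noteq> \<zero>\<^bsub>M\<^esub>)"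
  obtain m where "m \<in> carrier M" "m \<noteq> \<zero>\<^bsub>M\<^esub>" using nz M.M.zero_closed by blast
  then obtain x0 where "?Q x0" using act_zeroI[OF M] by blast
  then obtain x where x: "?Q x"
    and min: "\<And>y. ?Q y \<Longrightarrow> card {z. (z, x) \<in> S} \<le> card {z. (z, y) \<in> S}"
    using ex_has_least_nat[of ?Q x0 "\<lambda>x. card {z. (z, x) \<in> S}"] by blast
  obtain m where m: "m \<in> carrier M" "E x x \<odot>\<^bsub>M\<^esub> m \<noteq> \<zero>\<^bsub>M\<^esub>" using x by blast
  have xx: "(x, x) \<in> R" "(x, x) \<in> S" using x R_refl S by auto
  have SV: "S \<subseteq> V \<times> V" and S_trans: "trans S" using S R_V R_trans by (auto simp: trans_def)
  have "E y y \<odot>\<^bsub>M\<^esub> n = \<zero>\<^bsub>M\<^esub>" if y: "(y, x) \<in> S" "(x, y) \<notin> S" and n: "n \<in> carrier M" for y n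
  proof (rule ccontr)
    assume "E y y \<odot>\<^bsub>M\<^esub> n \<noteq> \<zero>\<^bsub>M\<^esub>"
    hence "card {z. (z, x) \<in> S} \<le> card {z. (z, y) \<in> S}" using min[of y] n y SV by blast
    moreover have "{z. (z, y) \<in> S} \<subset> {z. (z, x) \<in> S}" using y xx(2) transD[OF S_trans] by blast
    moreover have "finite {z. (z, x) \<in> S}" by (rule finite_subset[OF _ fin_V]) (use SV in auto)
    ultimately show False using psubset_card_mono by (metis leD)
  qed
  moreover have "E x x \<odot>\<^bsub>M\<^esub> (E x x \<odot>\<^bsub>M\<^esub> m) = E x x \<odot>\<^bsub>M\<^esub> m" using E_act[OF M xx(1) xx(1) m(1)] by simp
  ultimately show ?thesis
    using that[of x "E x x \<odot>\<^bsub>M\<^esub> m"] x m M.act_closed[OF E_closed[OF xx(1)] m(1)] by blast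
qed

text \<open>
  If every coordinate of \<open>f\<close> at a vertex equivalent to \<open>x\<close> vanished, then \<open>f\<close>, being a combination
  of the projections of the basis vectors of the free module, would be zero.
\<close>

lemma free_summand_coordinate:
  assumes d: "direct_sum_decomp A (free_rmod A B) X Y" and f: "f \<in> X" "f \<noteq> \<zero>\<^bsub>free_rmod A B\<^esub>"
    and fx: "E x x \<odot>\<^bsub>free_rmod A B\<^esub> f = f" and x: "x \<in> V"
    and min: "\<And>y g. (y, x) \<in> R \<Longrightarrow> (x, y) \<notin> R \<Longrightarrow> g \<in> X \<Longrightarrow> E y y \<odot>\<^bsub>free_rmod A B\<^esub> g = \<zero>\<^bsub>free_rmod A B\<^esub>"
  shows "\<exists>b y. eqv y x \<and> \<phi> (f b) (y, x) \<noteq> 0"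
proof (rule ccontr)
  let ?F = "free_rmod A B"
  interpret F: right_module A ?F by (rule free_right_module[OF ring_A])
  assume n: "\<not> ?thesis"
  have X: "Module.submodule X A ?F" and Y: "Module.submodule Y A ?F" and XY: "X \<inter> Y = {\<zero>\<^bsub>?F\<^esub>}"
    using d by (auto simp: direct_sum_decomp_def)
  note SX = F.submoduleD[OF X] and SY = F.submoduleD[OF Y]
  have xx: "(x, x) \<in> R" using R_refl x by blast
  have fF: "f \<in> carrier ?F" using f SX by blast
  hence fc: "f b \<in> carrier A" for b by (simp add: free_rmod_def)
  let ?S = "{b. f b \<noteq> \<zero>}"
  have S: "finite ?S" "?S \<subseteq> B" using fF by (auto simp: free_rmod_def)
  \<comment> \<open>The basis vectors of the free module; f is the sum of the f b times
    \<open>?d b\<close>, and each \<open>?d b\<close> is split into its X part and its Y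
    part.\<close>
  let ?d = "\<lambda>b t. if t = b then \<one> else \<zero>"
  have dF: "?d b \<in> carrier ?F" if "b \<in> B" for b using that by (auto simp: free_rmod_def)
  have ex: "\<forall>b\<in>?S. \<exists>yz. fst yz \<in> X \<and> snd yz \<in> Y \<and> ?d b = fst yz \<oplus>\<^bsub>?F\<^esub> snd yz"
  proof
    fix b assume "b \<in> ?S"
    hence "?d b \<in> carrier ?F" using dF S by blast
    thus "\<exists>yz. fst yz \<in> X \<and> snd yz \<in> Y \<and> ?d b = fst yz \<oplus>\<^bsub>?F\<^esub> snd yz"
      using direct_sum_decompD[OF d] by (metis fst_conv snd_conv)
  qed
  obtain yz where yz: "\<And>b. b \<in> ?S \<Longrightarrow>
      fst (yz b) \<in> X \<and> snd (yz b) \<in> Y \<and> ?d b = fst (yz b) \<oplus>\<^bsub>?F\<^esub> snd (yz b)"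
    using bchoice[OF ex] by blast
  \<comment> \<open>The entries of f b are concentrated at pairs (u, x) with u strictly below x, and
    there X vanishes by minimality. So f b kills X, only the Y part of \<open>?d b\<close> is left,
    and f ends up in Y.\<close>
  have Xz: "f b \<odot>\<^bsub>?F\<^esub> g = \<zero>\<^bsub>?F\<^esub>" if g: "g \<in> X" for b g
  proof (rule act_vanish[OF _ fc])
    show "right_module A ?F" by (rule free_right_module[OF ring_A])
    show gF: "g \<in> carrier ?F" using g SX by blast
    fix u v assume uv: "(u, v) \<in> R" "\<phi> (f b) (u, v) \<noteq> 0"
    have "f b \<otimes> E x x = f b" using fx by (simp add: free_rmod_def fun_eq_iff)
    hence vx: "v = x" using E_mult_right[OF xx fc, of b u v] uv(2) by (auto split: if_splits)
    hence ux: "(x, u) \<notin> R" using n uv by (auto simp: eqv_def)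
    have uu: "(u, u) \<in> R" using uv R_V R_refl by blast
    have "E u v \<odot>\<^bsub>?F\<^esub> g = E u v \<odot>\<^bsub>?F\<^esub> (E u u \<odot>\<^bsub>?F\<^esub> g)"
      using E_act[OF free_right_module[OF ring_A] uu uv(1) gF] by simp
    also have "\<dots> = \<zero>\<^bsub>?F\<^esub>" using min[of u g] uv vx ux g F.act_zero_right[OF E_closed[OF uv(1)]] by simp
    finally show "E u v \<odot>\<^bsub>?F\<^esub> g = \<zero>\<^bsub>?F\<^esub>" .
  qed
  have dy: "f b \<odot>\<^bsub>?F\<^esub> ?d b \<in> Y" if b: "b \<in> ?S" for b
  proof -
    have c: "fst (yz b) \<in> carrier ?F" "snd (yz b) \<in> carrier ?F" using yz[OF b] SX(1) SY(1) by auto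
    have "f b \<odot>\<^bsub>?F\<^esub> ?d b = f b \<odot>\<^bsub>?F\<^esub> fst (yz b) \<oplus>\<^bsub>?F\<^esub> f b \<odot>\<^bsub>?F\<^esub> snd (yz b)"
      using F.act_add_right[OF fc c, of b] yz[OF b] by simp
    also have "\<dots> = f b \<odot>\<^bsub>?F\<^esub> snd (yz b)" using Xz yz[OF b] F.act_closed[OF fc c(2)] by simp
    finally show ?thesis using SY(4)[OF fc] yz[OF b] by simp
  qed
  have sumY: "finsum ?F (\<lambda>b. f b \<odot>\<^bsub>?F\<^esub> ?d b) T \<in> Y \<and>
      finsum ?F (\<lambda>b. f b \<odot>\<^bsub>?F\<^esub> ?d b) T = (\<lambda>t. if t \<in> T then f t else \<zero>)"
    if "T \<subseteq> ?S" for T using finite_subset[OF that S(1)] that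
  proof (induction T rule: finite_induct)
    case empty
    have "finsum ?F (\<lambda>b. f b \<odot>\<^bsub>?F\<^esub> ?d b) {} = \<zero>\<^bsub>?F\<^esub>" by simp
    moreover have "\<zero>\<^bsub>?F\<^esub> = (\<lambda>t. \<zero>)" by (simp add: free_rmod_def)
    ultimately show ?case using SY(2) by simp
  next
    case (insert b T)
    have c: "(\<lambda>b. f b \<odot>\<^bsub>?F\<^esub> ?d b) \<in> T \<rightarrow> carrier ?F" "f b \<odot>\<^bsub>?F\<^esub> ?d b \<in> carrier ?F" "f b \<odot>\<^bsub>?F\<^esub> ?d b \<in> Y"
      using dy insert.prems SY(1) by blast+
    have s: "finsum ?F (\<lambda>b. f b \<odot>\<^bsub>?F\<^esub> ?d b) (insert b T) =
      f b \<odot>\<^bsub>?F\<^esub> ?d b \<oplus>\<^bsub>?F\<^esub> finsum ?F (\<lambda>b. f b \<odot>\<^bsub>?F\<^esub> ?d b) T" using insert c by simp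
    have IH: "finsum ?F (\<lambda>b. f b \<odot>\<^bsub>?F\<^esub> ?d b) T \<in> Y"
      "finsum ?F (\<lambda>b. f b \<odot>\<^bsub>?F\<^esub> ?d b) T = (\<lambda>t. if t \<in> T then f t else \<zero>)" using insert by auto
    show ?case unfolding s using SY(3)[OF c(3) IH(1)] IH(2) insert.hyps fc
      by (auto simp: free_rmod_def fun_eq_iff)
  qed
  have "(\<lambda>t. if t \<in> ?S then f t else \<zero>) = f" by (rule ext) simp
  hence "f \<in> Y" using conjunct1[OF sumY[OF subset_refl]]
    unfolding conjunct2[OF sumY[OF subset_refl]] by (simp only:)
  thus False using f XY by blast
qed

text \<open>Embed M in a free module and take m at a minimal vertex x of M. Some coordinate of m has
  a nonzero entry at a vertex equivalent to x; this coordinate maps M onto P and splits, and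
  indecomposability removes the complement.\<close>

lemma projective_indecomposable:
  fixes M :: "('a, 'm) module"
  assumes ind: "indecomposable_rmod A M" and proj: "projective_rmod A M"
  shows "\<exists>x\<in>V. \<forall>(P :: ('a, 'n) module) p. proj_at x P p \<longrightarrow> rmod_iso A M P"
proof -
  have M: "right_module A M" and nz: "carrier M \<noteq> {\<zero>\<^bsub>M\<^esub>}"
    using ind by (auto simp: indecomposable_rmod_def)
  interpret M: right_module A M by (rule M)
  obtain B :: "'m set" and X Y where d: "direct_sum_decomp A (free_rmod A B) X Y"
    and iso: "rmod_iso A M ((free_rmod A B)\<lparr>carrier := X\<rparr>)"
    using proj by (auto simp: projective_rmod_def)
  let ?F = "free_rmod A B"
  interpret F: right_module A ?F by (rule free_right_module[OF ring_A])
  have X: "Module.submodule X A ?F" using d by (auto simp: direct_sum_decomp_def)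
  note SX = F.submoduleD[OF X]
  note FX = F.submodule_right_module[OF X]
  obtain g where g: "g \<in> rmod_hom A M (?F\<lparr>carrier := X\<rparr>)" "bij_betw g (carrier M) X"
    using iso by (auto simp: rmod_iso_def)
  have gD: "g n \<in> X" "g n b \<in> carrier A" if "n \<in> carrier M" for n b
    using rmod_homD(2)[OF g(1) that] SX(1) by (auto simp: free_rmod_def)
  have g_add: "g (m \<oplus>\<^bsub>M\<^esub> n) b = g m b \<oplus> g n b" if "m \<in> carrier M" "n \<in> carrier M" for m n b
    using rmod_homD(3)[OF g(1) that] by (simp add: free_rmod_def)
  have g_act: "g (a \<odot>\<^bsub>M\<^esub> n) = a \<odot>\<^bsub>?F\<^esub> g n" if "a \<in> carrier A" "n \<in> carrier M" for a n
    using rmod_homD(4)[OF g(1) that] by simp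
  have g_zero: "g \<zero>\<^bsub>M\<^esub> = \<zero>\<^bsub>?F\<^esub>" using rmod_hom_zero[OF M FX g(1)] by simp
  obtain x m where x: "x \<in> V" and m: "m \<in> carrier M" "E x x \<odot>\<^bsub>M\<^esub> m = m" "m \<noteq> \<zero>\<^bsub>M\<^esub>"
    and min: "\<And>y n. (y, x) \<in> R \<Longrightarrow> (x, y) \<notin> R \<Longrightarrow> n \<in> carrier M \<Longrightarrow> E y y \<odot>\<^bsub>M\<^esub> n = \<zero>\<^bsub>M\<^esub>"
    using extremal_vertex[OF M nz disjI1[OF refl]] by blast
  have xx: "(x, x) \<in> R" using R_refl x by blast
  have gm: "E x x \<odot>\<^bsub>?F\<^esub> g m = g m" using g_act[OF E_closed[OF xx] m(1)] m(2) by simp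
  have "g m \<noteq> \<zero>\<^bsub>?F\<^esub>"
    using g(2) g_zero m by (metis M.M.zero_closed bij_betw_imp_inj_on inj_on_eq_iff)
  moreover have "E y y \<odot>\<^bsub>?F\<^esub> f = \<zero>\<^bsub>?F\<^esub>" if y: "(y, x) \<in> R" "(x, y) \<notin> R" and f: "f \<in> X" for y f
  proof -
    obtain n where n: "n \<in> carrier M" "f = g n" using g(2) f by (auto simp: bij_betw_def)
    have yy: "(y, y) \<in> R" using y R_V R_refl by blast
    show ?thesis using g_act[OF E_closed[OF yy] n(1)] min[OF y n(1)] g_zero n(2) by simp
  qed
  ultimately obtain b y where cy: "eqv y x" "\<phi> (g m b) (y, x) \<noteq> 0"
    using free_summand_coordinate[OF d gD(1)[OF m(1)] _ gm x] by blast
  have yx: "(y, x) \<in> R" "(x, y) \<in> R" using cy by (auto simp: eqv_def)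
  let ?c = "\<phi> (g m b) (y, x)"
  \<comment> \<open>The coordinate b of m, brought back from y to x, is a nonzero multiple of the
    idempotent at x.\<close>
  have Exy: "E x y \<otimes> g m b = E x x \<otimes> scal ?c"
  proof -
    have e: "g m b = g m b \<otimes> E x x" using gm by (simp add: free_rmod_def fun_eq_iff)
    have "E x y \<otimes> g m b = E x y \<otimes> g m b \<otimes> E x x"
      by (subst e) (use yx xx gD(2)[OF m(1)] in \<open>simp add: m_assoc\<close>)
    thus ?thesis using E_sandwich[OF yx(2) xx gD(2)[OF m(1)] xx] xx by (simp add: mult_scal)
  qed
  have "rmod_iso A M P" if P: "proj_at x P p" for P :: "('a, 'n) module" and p
  proof -
    note D = proj_atD[OF P]
    interpret P: right_module A P by (rule D)
    let ?\<beta> = "\<lambda>n\<in>carrier M. (E x y \<otimes> g n b) \<odot>\<^bsub>P\<^esub> p"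
    have \<beta>: "?\<beta> \<in> rmod_hom A M P" unfolding rmod_hom_def
    proof (intro CollectI conjI ballI)
      show "?\<beta> \<in> carrier M \<rightarrow>\<^sub>E carrier P" using P.act_closed D(3) gD yx by auto
    next
      fix n n' assume n: "n \<in> carrier M" "n' \<in> carrier M"
      thus "?\<beta> (n \<oplus>\<^bsub>M\<^esub> n') = ?\<beta> n \<oplus>\<^bsub>P\<^esub> ?\<beta> n'"
        using g_add[OF n] gD(2) yx D(3) P.act_add_left by (simp add: r_distr)
    next
      fix a n assume an: "a \<in> carrier A" "n \<in> carrier M"
      have "g (a \<odot>\<^bsub>M\<^esub> n) b = g n b \<otimes> a" using g_act[OF an] by (simp add: free_rmod_def)
      thus "?\<beta> (a \<odot>\<^bsub>M\<^esub> n) = a \<odot>\<^bsub>P\<^esub> ?\<beta> n"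
        using an gD(2) yx D(3) M.act_closed P.act_mult by (simp add: m_assoc)
    qed
    have \<beta>m: "?\<beta> m = scal ?c \<odot>\<^bsub>P\<^esub> p"
    proof -
      have "?\<beta> m = (E x x \<otimes> scal ?c) \<odot>\<^bsub>P\<^esub> p" using m(1) Exy by simp
      also have "\<dots> = scal ?c \<odot>\<^bsub>P\<^esub> (E x x \<odot>\<^bsub>P\<^esub> p)" using P.act_mult' xx D(3) by simp
      finally show ?thesis using D(4) by simp
    qed
    \<comment> \<open>Rescaled so that its image under \<open>?\<beta>\<close> is the generator p
      itself; then sending p to it is a section.\<close>
    let ?m = "scal (1 / ?c) \<odot>\<^bsub>M\<^esub> m"
    have m': "?m \<in> carrier M" "E x x \<odot>\<^bsub>M\<^esub> ?m = ?m"
      using M.act_closed m act_scal_comm[OF M m(1) E_closed[OF xx]] by simp_all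
    have \<beta>m': "?\<beta> ?m = p"
      using rmod_homD(4)[OF \<beta> scal_closed m(1), of "1 / ?c"] \<beta>m scal_act_inv[OF D(1,3) cy(2)]
      by (simp del: restrict_apply)
    obtain h where h: "h \<in> rmod_hom A P M" "\<And>a. a \<in> carrier A \<Longrightarrow> h (a \<odot>\<^bsub>P\<^esub> p) = a \<odot>\<^bsub>M\<^esub> ?m"
      using proj_at_map[OF P M m'] by blast
    have \<beta>h: "?\<beta> (h q) = q" if q: "q \<in> carrier P" for q
    proof -
      obtain a where a: "a \<in> carrier A" "q = a \<odot>\<^bsub>P\<^esub> p" using D(6) q by blast
      show ?thesis unfolding a(2) h(2)[OF a(1)] rmod_homD(4)[OF \<beta> a(1) m'(1)] \<beta>m' ..
    qed
    note ret = retract_summand[where k = ?\<beta> and h = h, OF M D(1) \<beta> h(1) \<beta>h]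
    have "h p \<noteq> \<zero>\<^bsub>M\<^esub>" using \<beta>h[OF D(3)] rmod_hom_zero[OF M D(1) \<beta>] proj_at_nonzero[OF P] by metis
    hence "h ` carrier P \<noteq> {\<zero>\<^bsub>M\<^esub>}" using D(3) by blast
    hence Y0: "{n \<in> carrier M. ?\<beta> n = \<zero>\<^bsub>P\<^esub>} = {\<zero>\<^bsub>M\<^esub>}"
      using ind ret(1) unfolding indecomposable_rmod_def by blast
    have "n \<in> h ` carrier P" if n: "n \<in> carrier M" for n
    proof -
      obtain y z where yz: "y \<in> h ` carrier P" "z \<in> {n \<in> carrier M. ?\<beta> n = \<zero>\<^bsub>P\<^esub>}" "n = y \<oplus>\<^bsub>M\<^esub> z"
        using direct_sum_decompD[OF ret(1) n] .
      thus ?thesis unfolding Y0 using rmod_homD(2)[OF h(1)] by auto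
    qed
    hence "h ` carrier P = carrier M" using rmod_homD(2)[OF h(1)] by blast
    hence "rmod_iso A P M" using ret(2) by simp
    thus ?thesis by (rule rmod_iso_sym[OF D(1) M])
  qed
  thus ?thesis using x by blast
qed

text \<open>The elements without components at vertices equivalent to x.
  \<open>simple_quotient\<close> shows that the quotient is simple, so this plays the part of the
  radical of P.\<close>

definition rad_at :: "'v \<Rightarrow> ('a, 'm) module \<Rightarrow> 'm set" where
  "rad_at x P = {q \<in> carrier P. \<forall>v. eqv x v \<longrightarrow> E v v \<odot>\<^bsub>P\<^esub> q = \<zero>\<^bsub>P\<^esub>}"

lemma rad_at_iff:
  assumes P: "proj_at x P p" and a: "a \<in> carrier A"
  shows "a \<odot>\<^bsub>P\<^esub> p \<in> rad_at x P \<longleftrightarrow> (\<forall>v. eqv x v \<longrightarrow> \<phi> a (x, v) = 0)"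
proof -
  note D = proj_atD[OF P]
  interpret P: right_module A P by (rule D)
  have "E v v \<odot>\<^bsub>P\<^esub> (a \<odot>\<^bsub>P\<^esub> p) = \<zero>\<^bsub>P\<^esub> \<longleftrightarrow> \<phi> a (x, v) = 0" if v: "eqv x v" for v
  proof
    have vx: "(v, x) \<in> R" "(v, v) \<in> R" "v \<in> V" using v R_V R_refl by (auto simp: eqv_def)
    show "E v v \<odot>\<^bsub>P\<^esub> (a \<odot>\<^bsub>P\<^esub> p) = \<zero>\<^bsub>P\<^esub>" if "\<phi> a (x, v) = 0"
      using gen_rel_zero[OF D(1,3,4,2) vx(3) that a] .
    assume z: "E v v \<odot>\<^bsub>P\<^esub> (a \<odot>\<^bsub>P\<^esub> p) = \<zero>\<^bsub>P\<^esub>"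
    have "scal (\<phi> a (x, v)) \<odot>\<^bsub>P\<^esub> p = E v x \<odot>\<^bsub>P\<^esub> (a \<odot>\<^bsub>P\<^esub> p)"
      using gen_rel[OF D(1,3,4) vx(1) a] by simp
    also have "\<dots> = E v x \<odot>\<^bsub>P\<^esub> (E v v \<odot>\<^bsub>P\<^esub> (a \<odot>\<^bsub>P\<^esub> p))"
      using E_act[OF D(1) vx(2,1) P.act_closed[OF a D(3)]] by simp
    also have "\<dots> = \<zero>\<^bsub>P\<^esub>" using z P.act_zero_right vx by simp
    finally show "\<phi> a (x, v) = 0" using scal_act_zero[OF D(1,3)] proj_at_nonzero[OF P] by blast
  qed
  thus ?thesis using P.act_closed[OF a D(3)] by (auto simp: rad_at_def)
qed

text \<open>If x <= u <= v and v is equivalent to x, then so is u. Hence a path that has left the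
  class of x never returns, and multiplication cannot refill the vanishing components.\<close>

lemma rad_at_submodule:
  assumes P: "proj_at x P p" shows "Module.submodule (rad_at x P) A P"
proof -
  note D = proj_atD[OF P]
  interpret P: right_module A P by (rule D)
  have Evv: "E v v \<in> carrier A" if "eqv x v" for v using that R_refl eqv_V by auto
  show ?thesis
  proof (rule P.submoduleI)
    show "\<zero>\<^bsub>P\<^esub> \<in> rad_at x P" using Evv P.act_zero_right by (auto simp: rad_at_def)
    show "y \<oplus>\<^bsub>P\<^esub> z \<in> rad_at x P" if "y \<in> rad_at x P" "z \<in> rad_at x P" for y z
      using that Evv P.act_add_right by (auto simp: rad_at_def)
    show "b \<odot>\<^bsub>P\<^esub> y \<in> rad_at x P" if b: "b \<in> carrier A" and y: "y \<in> rad_at x P" for b y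
    proof -
      have yc: "y \<in> carrier P" using y by (simp add: rad_at_def)
      obtain a where a: "a \<in> carrier A" "y = a \<odot>\<^bsub>P\<^esub> p" using D(6)[OF yc] by blast
      have a0: "\<phi> a (x, v) = 0" if "eqv x v" for v using rad_at_iff[OF P a(1)] a(2) y that by blast
      have "(\<Sum>u\<in>V. \<phi> a (x, u) * \<phi> b (u, v)) = 0" if v: "eqv x v" for v
      proof (rule sum.neutral, rule ballI)
        fix u assume "u \<in> V"
        show "\<phi> a (x, u) * \<phi> b (u, v) = 0"
        proof (cases "(x, u) \<in> R \<and> (u, v) \<in> R")
          case True
          hence "eqv x u" using v R_trans by (auto simp: eqv_def)
          thus ?thesis using a0 by simp
        next
          case False
          thus ?thesis using \<phi>_out a(1) b by auto
        qed
      qed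
      hence "\<phi> (a \<otimes> b) (x, v) = 0" if "eqv x v" for v using that \<phi>_mult[OF a(1) b] by simp
      hence "(a \<otimes> b) \<odot>\<^bsub>P\<^esub> p \<in> rad_at x P" using rad_at_iff[OF P] a b by simp
      thus ?thesis using P.act_mult[OF a(1) b D(3)] a(2) by simp
    qed
  qed (auto simp: rad_at_def)
qed

text \<open>An element outside the radical has a nonzero entry at some v equivalent to x.
  \<open>E v x\<close> brings it back to a nonzero multiple of the generator, so it generates the
  quotient.\<close>

lemma simple_quotient:
  assumes P: "proj_at x P p" shows "simple_rmod A (quotient_rmod P (rad_at x P))"
proof -
  note D = proj_atD[OF P]
  let ?N = "rad_at x P"
  let ?Q = "quotient_rmod P ?N"
  note N = rad_at_submodule[OF P]
  interpret P: right_module A P by (rule D)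
  have Q: "right_module A ?Q" by (rule quot_right_module[OF D(1) N])
  interpret Q: right_module A ?Q by (rule Q)
  note qc = quot_carrier[OF D(1) N] and qa = quot_act[OF D(1) N] and qz = quot_zero_iff[OF D(1) N]
  have pN: "p \<notin> ?N" using D(4) proj_at_nonzero[OF P] D(5) by (auto simp: rad_at_def eqv_def)
  have "carrier ?Q \<noteq> {\<zero>\<^bsub>?Q\<^esub>}" using pN qz[OF D(3)] qc D(3) by auto
  moreover have "X = carrier ?Q" if X: "Module.submodule X A ?Q" "X \<noteq> {\<zero>\<^bsub>?Q\<^esub>}" for X
  proof -
    note SX = Q.submoduleD[OF X(1)]
    obtain z where z: "z \<in> X" "z \<noteq> \<zero>\<^bsub>?Q\<^esub>" using X(2) SX(2) by blast
    then obtain q where q: "q \<in> carrier P" "z = ?N +>\<^bsub>P\<^esub> q" using SX(1) qc by blast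
    have qN: "q \<notin> ?N" using qz[OF q(1)] q z by blast
    obtain a where a: "a \<in> carrier A" "q = a \<odot>\<^bsub>P\<^esub> p" using D(6) q by blast
    obtain v where v: "eqv x v" "\<phi> a (x, v) \<noteq> 0" using rad_at_iff[OF P a(1)] qN a by blast
    have vx: "(v, x) \<in> R" using v by (simp add: eqv_def)
    have "p = scal (1 / \<phi> a (x, v)) \<odot>\<^bsub>P\<^esub> (E v x \<odot>\<^bsub>P\<^esub> q)"
      unfolding a(2) gen_rel[OF D(1,3,4) vx a(1)] using scal_act_inv[OF D(1,3) v(2)] by simp
    hence "?N +>\<^bsub>P\<^esub> p = scal (1 / \<phi> a (x, v)) \<odot>\<^bsub>?Q\<^esub> (E v x \<odot>\<^bsub>?Q\<^esub> z)"
      using qa q vx P.act_closed by simp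
    hence pX: "?N +>\<^bsub>P\<^esub> p \<in> X" using SX(4)[OF scal_closed SX(4)[OF E_closed[OF vx] z(1)]] by simp
    have "y \<in> X" if y: "y \<in> carrier ?Q" for y
    proof -
      obtain r where r: "r \<in> carrier P" "y = ?N +>\<^bsub>P\<^esub> r" using y unfolding qc by blast
      obtain c where c: "c \<in> carrier A" "r = c \<odot>\<^bsub>P\<^esub> p" using D(6) r by blast
      have "y = c \<odot>\<^bsub>?Q\<^esub> (?N +>\<^bsub>P\<^esub> p)" using qa[OF c(1) D(3)] c r by simp
      thus ?thesis using SX(4)[OF c(1) pX] by simp
    qed
    thus ?thesis using SX(1) by blast
  qed
  ultimately show ?thesis unfolding simple_rmod_def using Q by blast
qed

text \<open>The class of p is concentrated at x and nonzero, and so is its image; but in the second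
  quotient only components at vertices equivalent to y survive.\<close>

lemma simple_quotient_iso:
  assumes P: "proj_at x P p" and P': "proj_at y P' p'"
    and iso: "rmod_iso A (quotient_rmod P (rad_at x P)) (quotient_rmod P' (rad_at y P'))"
  shows "eqv x y"
proof -
  note D = proj_atD[OF P] and D' = proj_atD[OF P']
  note N = rad_at_submodule[OF P] and N' = rad_at_submodule[OF P']
  let ?Q = "quotient_rmod P (rad_at x P)" and ?Q' = "quotient_rmod P' (rad_at y P')"
  interpret P': right_module A P' by (rule D')
  interpret Q: right_module A ?Q by (rule quot_right_module[OF D(1) N])
  obtain h where h: "h \<in> rmod_hom A ?Q ?Q'" "bij_betw h (carrier ?Q) (carrier ?Q')"
    using iso by (auto simp: rmod_iso_def)
  let ?z = "rad_at x P +>\<^bsub>P\<^esub> p"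
  have z: "?z \<in> carrier ?Q" using quot_carrier[OF D(1) N] D(3) by blast
  have pN: "p \<notin> rad_at x P" using D(4) proj_at_nonzero[OF P] D(5) by (auto simp: rad_at_def eqv_def)
  hence "?z \<noteq> \<zero>\<^bsub>?Q\<^esub>" using quot_zero_iff[OF D(1) N D(3)] by blast
  hence hz: "h ?z \<noteq> \<zero>\<^bsub>?Q'\<^esub>"
    using h(2) z rmod_hom_zero[OF quot_right_module[OF D(1) N] quot_right_module[OF D'(1) N'] h(1)]
    by (metis Q.M.zero_closed bij_betw_imp_inj_on inj_on_eq_iff)
  have "h ?z \<in> carrier ?Q'" using rmod_homD(2)[OF h(1) z] .
  then obtain q where q: "q \<in> carrier P'" "h ?z = rad_at y P' +>\<^bsub>P'\<^esub> q"
    using quot_carrier[OF D'(1) N'] by blast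
  have "E x x \<odot>\<^bsub>?Q\<^esub> ?z = ?z" using quot_act[OF D(1) N E_closed[OF D(5)] D(3)] D(4) by simp
  hence "h ?z = E x x \<odot>\<^bsub>?Q'\<^esub> h ?z" using rmod_homD(4)[OF h(1) E_closed[OF D(5)] z] by simp
  hence "h ?z = rad_at y P' +>\<^bsub>P'\<^esub> (E x x \<odot>\<^bsub>P'\<^esub> q)"
    using quot_act[OF D'(1) N' E_closed[OF D(5)] q(1)] q(2) by simp
  hence "E x x \<odot>\<^bsub>P'\<^esub> q \<notin> rad_at y P'"
    using hz quot_zero_iff[OF D'(1) N' P'.act_closed[OF E_closed[OF D(5)] q(1)]] by simp
  then obtain v where v: "eqv y v" "E v v \<odot>\<^bsub>P'\<^esub> (E x x \<odot>\<^bsub>P'\<^esub> q) \<noteq> \<zero>\<^bsub>P'\<^esub>"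
    using P'.act_closed[OF E_closed[OF D(5)] q(1)] by (auto simp: rad_at_def)
  have vv: "(v, v) \<in> R" using eqv_V[OF v(1)] R_refl by blast
  have "v = x" using v(2) E_act[OF D'(1,5)] E_act[OF D'(1) D(5) vv q(1)] by (auto split: if_splits)
  thus ?thesis using v(1) eqv_sym by blast
qed

text \<open>Take m at a maximal vertex x of M. Simplicity makes the map from P onto M surjective; it
  kills everything strictly above x by maximality, and an entry at a vertex equivalent to x can be
  brought back to m.\<close>

lemma simple_classification:
  fixes M :: "('a, 'm) module"
  assumes simple: "simple_rmod A M"
  shows "\<exists>x\<in>V. \<forall>(P :: ('a, 'n) module) p. proj_at x P p \<longrightarrow> rmod_iso A M (quotient_rmod P (rad_at x P))"
proof -
  have M: "right_module A M" and nz: "carrier M \<noteq> {\<zero>\<^bsub>M\<^esub>}"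
    using simple by (auto simp: simple_rmod_def)
  interpret M: right_module A M by (rule M)
  obtain x m where x: "x \<in> V" and m: "m \<in> carrier M" "E x x \<odot>\<^bsub>M\<^esub> m = m" "m \<noteq> \<zero>\<^bsub>M\<^esub>"
    and max: "\<And>y n. (x, y) \<in> R \<Longrightarrow> (y, x) \<notin> R \<Longrightarrow> n \<in> carrier M \<Longrightarrow> E y y \<odot>\<^bsub>M\<^esub> n = \<zero>\<^bsub>M\<^esub>"
    using extremal_vertex[OF M nz disjI2[OF refl], unfolded converse_iff] by blast
  have xx: "(x, x) \<in> R" using R_refl x by blast
  have "rmod_iso A M (quotient_rmod P (rad_at x P))" if P: "proj_at x P p" for P :: "('a, 'n) module" and p
  proof -
    note D = proj_atD[OF P]
    interpret P: right_module A P by (rule D)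
    obtain h where h: "h \<in> rmod_hom A P M" "\<And>a. a \<in> carrier A \<Longrightarrow> h (a \<odot>\<^bsub>P\<^esub> p) = a \<odot>\<^bsub>M\<^esub> m"
      using proj_at_map[OF P M m(1,2)] by blast
    have "m = h p" using h(2)[of \<one>] P.act_one[OF D(3)] M.act_one[OF m(1)] by simp
    hence "m \<in> h ` carrier P" using D(3) by blast
    hence surj: "h ` carrier P = carrier M"
      using hom_image_submodule[OF M D(1) h(1)] simple m(3) unfolding simple_rmod_def by blast
    have "h q = \<zero>\<^bsub>M\<^esub> \<longleftrightarrow> q \<in> rad_at x P" if q: "q \<in> carrier P" for q
    proof -
      obtain a where a: "a \<in> carrier A" "q = a \<odot>\<^bsub>P\<^esub> p" using D(6) q by blast
      have "a \<odot>\<^bsub>M\<^esub> m = \<zero>\<^bsub>M\<^esub> \<longleftrightarrow> (\<forall>v. eqv x v \<longrightarrow> \<phi> a (x, v) = 0)"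
      proof
        assume z: "a \<odot>\<^bsub>M\<^esub> m = \<zero>\<^bsub>M\<^esub>"
        show "\<forall>v. eqv x v \<longrightarrow> \<phi> a (x, v) = 0"
        proof (intro allI impI)
          fix v assume "eqv x v"
          hence vx: "(v, x) \<in> R" by (simp add: eqv_def)
          have "scal (\<phi> a (x, v)) \<odot>\<^bsub>M\<^esub> m = \<zero>\<^bsub>M\<^esub>"
            using gen_rel[OF M m(1,2) vx a(1)] z M.act_zero_right vx by simp
          thus "\<phi> a (x, v) = 0" using scal_act_zero[OF M m(1)] m(3) by blast
        qed
      next
        assume z: "\<forall>v. eqv x v \<longrightarrow> \<phi> a (x, v) = 0"
        have "(E x x \<otimes> a) \<odot>\<^bsub>M\<^esub> m = \<zero>\<^bsub>M\<^esub>"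
        proof (rule act_vanish[OF M _ m(1)])
          show "E x x \<otimes> a \<in> carrier A" using xx a by simp
          fix u v assume uv: "(u, v) \<in> R" "\<phi> (E x x \<otimes> a) (u, v) \<noteq> 0"
          hence ux: "u = x" "\<phi> a (x, v) \<noteq> 0" using E_mult_left[OF xx a(1)] by (auto split: if_splits)
          hence nv: "(v, x) \<notin> R" using z uv by (auto simp: eqv_def)
          have vv: "(v, v) \<in> R" using uv R_V R_refl by blast
          have "E u v \<odot>\<^bsub>M\<^esub> m = E v v \<odot>\<^bsub>M\<^esub> (E u v \<odot>\<^bsub>M\<^esub> m)" using E_act[OF M uv(1) vv m(1)] by simp
          also have "\<dots> = \<zero>\<^bsub>M\<^esub>" using max[of v] uv ux nv M.act_closed[OF E_closed[OF uv(1)] m(1)] by simp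
          finally show "E u v \<odot>\<^bsub>M\<^esub> m = \<zero>\<^bsub>M\<^esub>" .
        qed
        thus "a \<odot>\<^bsub>M\<^esub> m = \<zero>\<^bsub>M\<^esub>" using M.act_mult'[OF E_closed[OF xx] a(1) m(1)] m(2) by simp
      qed
      thus ?thesis using h(2)[OF a(1)] rad_at_iff[OF P a(1)] a(2) by simp
    qed
    hence "rmod_iso A (quotient_rmod P (rad_at x P)) M"
      by (rule quot_iso[OF D(1) rad_at_submodule[OF P] M h(1) surj])
    thus ?thesis by (rule rmod_iso_sym[OF quot_right_module[OF D(1) rad_at_submodule[OF P]] M])
  qed
  thus ?thesis using x by blast
qed

end

section \<open>Morita equivalence\<close>

lemma (in abelian_monoid) finsum_swap:
  assumes "finite S" "finite T" "\<And>s t. s \<in> S \<Longrightarrow> t \<in> T \<Longrightarrow> f s t \<in> carrier G"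
  shows "finsum G (\<lambda>s. finsum G (\<lambda>t. f s t) T) S = finsum G (\<lambda>t. finsum G (\<lambda>s. f s t) S) T"
  using assms(1,3)
proof (induction S rule: finite_induct)
  case empty
  thus ?case by simp
next
  case (insert x S)
  have c: "(\<lambda>t. f x t) \<in> T \<rightarrow> carrier G" "(\<lambda>t. finsum G (\<lambda>s. f s t) S) \<in> T \<rightarrow> carrier G"
    "(\<lambda>s. finsum G (\<lambda>t. f s t) T) \<in> S \<rightarrow> carrier G"
    using insert.prems by (auto intro!: finsum_closed)
  have "finsum G (\<lambda>s. finsum G (\<lambda>t. f s t) T) (insert x S) =
      finsum G (\<lambda>t. f x t) T \<oplus> finsum G (\<lambda>t. finsum G (\<lambda>s. f s t) S) T" using insert c by simp
  also have "\<dots> = finsum G (\<lambda>t. f x t \<oplus> finsum G (\<lambda>s. f s t) S) T"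
    by (rule finsum_addf[OF c(1,2), symmetric])
  also have "\<dots> = finsum G (\<lambda>t. finsum G (\<lambda>s. f s t) (insert x S)) T"
    by (rule finsum_cong') (use insert in \<open>auto intro!: finsum_closed\<close>)
  finally show ?case .
qed

lemma (in abelian_monoid) finsum_only:
  assumes "finite S" "i \<in> S" "f i \<in> carrier G" "\<And>j. j \<in> S \<Longrightarrow> j \<noteq> i \<Longrightarrow> f j = \<zero>"
  shows "finsum G f S = f i"
proof -
  have "finsum G f S = finsum G (\<lambda>j. if i = j then f j else \<zero>) S"
    by (rule finsum_cong') (use assms in auto)
  also have "\<dots> = finsum G (\<lambda>j. if i = j then f i else \<zero>) S"
    by (rule finsum_cong') (use assms in auto)
  also have "\<dots> = f i" using finsum_singleton[OF assms(2,1), of "\<lambda>_. f i"] assms(3) by simp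
  finally show ?thesis .
qed

text \<open>Functors have to stay inside one universe of elements, while the equivalence produces
  modules of tuples. An infinite type is equinumerous with its square, so finite tuples fit into
  it.\<close>

lemma tuple_code:
  assumes "finite S"
  shows "\<exists>enc :: ('v \<Rightarrow> 'u::infinite) \<Rightarrow> 'u. inj_on enc (extensional S)"
  using assms
proof (induction S rule: finite_induct)
  case empty
  thus ?case by (auto simp: inj_on_def)
next
  case (insert v S)
  then obtain enc :: "('v \<Rightarrow> 'u) \<Rightarrow> 'u" where enc: "inj_on enc (extensional S)" by blast
  have "(card_of (UNIV \<times> UNIV :: ('u \<times> 'u) set), card_of (UNIV :: 'u set)) \<in> ordIso"
    by (rule card_of_Times_same_infinite) (rule infinite_UNIV)
  then obtain pr :: "'u \<times> 'u \<Rightarrow> 'u" where pr: "inj pr"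
    unfolding card_of_ordIso[symmetric] bij_betw_def by auto
  let ?enc = "\<lambda>n. pr (n v, enc (restrict n S))"
  have "inj_on ?enc (extensional (insert v S))"
  proof (rule inj_onI)
    fix m n :: "'v \<Rightarrow> 'u"
    assume mn: "m \<in> extensional (insert v S)" "n \<in> extensional (insert v S)" "?enc m = ?enc n"
    hence "(m v, enc (restrict m S)) = (n v, enc (restrict n S))" using injD[OF pr] by metis
    hence "m v = n v" "enc (restrict m S) = enc (restrict n S)" by simp_all
    moreover from this(2) have r: "restrict m S = restrict n S" by (rule inj_onD[OF enc]) auto
    ultimately show "m = n"
    proof (intro ext)
      fix x show "m x = n x"
      proof (cases "x \<in> insert v S")
        case True
        thus ?thesis using \<open>m v = n v\<close> fun_cong[OF r, of x] by (auto split: if_splits)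
      next
        case False
        thus ?thesis using mn by (simp add: extensional_def)
      qed
    qed
  qed
  thus ?case by blast
qed

text \<open>
  Along a map \<open>r\<close> of preorders, an \<open>A\<close>-module \<open>M\<close> gives the \<open>B\<close>-module of tuples in the product
  of the \<open>M \<cdot> E (r v) (r v)\<close>; \<open>enc\<close> codes these tuples as elements of the universe of \<open>M\<close>.
\<close>

locale preorder_map =
  A: preorder_algebra A V R \<phi> + B: preorder_algebra B V' R' \<phi>'
  for A :: "('k::field, 'a) module" and V :: "'v set" and R \<phi>
    and B :: "('k, 'b) module" and V' :: "'w set" and R' \<phi>' +
  fixes r :: "'w \<Rightarrow> 'v" and enc :: "('w \<Rightarrow> 'u) \<Rightarrow> 'u"
  assumes r_V: "v \<in> V' \<Longrightarrow> r v \<in> V" and r_R: "(u, v) \<in> R' \<Longrightarrow> (r u, r v) \<in> R"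
    and enc_inj: "inj_on enc (extensional V')"
begin

definition dec :: "'u \<Rightarrow> 'w \<Rightarrow> 'u" where
  "dec = inv_into (extensional V') enc"

lemma dec_enc [simp]: "n \<in> extensional V' \<Longrightarrow> dec (enc n) = n"
  using enc_inj by (simp add: dec_def)

text \<open>The element b as a matrix over A: its entry at (u, v), a scalar, becomes that multiple
  of the matrix unit from r u to r v, and so maps the u-th component of a tuple to the v-th.\<close>

definition T :: "'b \<Rightarrow> 'w \<Rightarrow> 'w \<Rightarrow> 'a" where
  "T b u v = (if (u, v) \<in> R' then \<phi>' b (u, v) \<odot>\<^bsub>A\<^esub> A.E (r u) (r v) else \<zero>\<^bsub>A\<^esub>)"

definition tuples :: "('a, 'u) module \<Rightarrow> ('w \<Rightarrow> 'u) set" where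
  "tuples M = {n \<in> extensional V'. \<forall>v\<in>V'. n v \<in> carrier M \<and> A.E (r v) (r v) \<odot>\<^bsub>M\<^esub> n v = n v}"

definition obj :: "('a, 'u) module \<Rightarrow> ('b, 'u) module" where
  "obj M = \<lparr>carrier = enc ` tuples M, mult = undefined, one = undefined,
     zero = enc (\<lambda>v\<in>V'. \<zero>\<^bsub>M\<^esub>), add = (\<lambda>x y. enc (\<lambda>v\<in>V'. dec x v \<oplus>\<^bsub>M\<^esub> dec y v)),
     smult = (\<lambda>b x. enc (\<lambda>v\<in>V'. finsum M (\<lambda>u. T b u v \<odot>\<^bsub>M\<^esub> dec x u) V'))\<rparr>"

definition mor :: "('a, 'u) module \<Rightarrow> ('a, 'u) module \<Rightarrow> ('u \<Rightarrow> 'u) \<Rightarrow> ('u \<Rightarrow> 'u)" where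
  "mor M N f = (\<lambda>x\<in>carrier (obj M). enc (\<lambda>v\<in>V'. f (dec x v)))"

abbreviation act_at :: "('a, 'u) module \<Rightarrow> 'b \<Rightarrow> ('w \<Rightarrow> 'u) \<Rightarrow> 'w \<Rightarrow> 'u" where
  "act_at M b n v \<equiv> finsum M (\<lambda>u. T b u v \<odot>\<^bsub>M\<^esub> n u) V'"

lemma rr: "v \<in> V' \<Longrightarrow> (r v, r v) \<in> R"
  using r_V A.R_refl by blast

lemma T_closed [simp]: "T b u v \<in> carrier A"
  using r_R by (simp add: T_def A.smult_closed)

lemma \<phi>_T: "\<phi> (T b u v) p = (if (u, v) \<in> R' \<and> p = (r u, r v) then \<phi>' b (u, v) else 0)"
  using r_R by (auto simp: T_def A.\<phi>_smult A.\<phi>_E A.\<phi>_zero)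

lemma T_add: "b \<in> carrier B \<Longrightarrow> b' \<in> carrier B \<Longrightarrow> T (b \<oplus>\<^bsub>B\<^esub> b') u v = T b u v \<oplus>\<^bsub>A\<^esub> T b' u v"
  by (rule A.\<phi>_eq) (auto simp: A.\<phi>_add \<phi>_T B.\<phi>_add)

lemma T_E: "v \<in> V' \<Longrightarrow> T b u v \<otimes>\<^bsub>A\<^esub> A.E (r v) (r v) = T b u v"
  using rr[of v] by (intro A.\<phi>_eq) (auto simp: A.E_mult_right \<phi>_T)

text \<open>The product in B turns into the matrix product over A. Monotonicity of r ensures that
  the intermediate matrix units exist and compose; since the indices are those of V', r need not be
  injective.\<close>

lemma T_mult:
  assumes b: "b \<in> carrier B" "b' \<in> carrier B" and t: "t \<in> V'" "v \<in> V'"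
  shows "T (b \<otimes>\<^bsub>B\<^esub> b') t v = finsum A (\<lambda>u. T b t u \<otimes>\<^bsub>A\<^esub> T b' u v) V'"
proof (rule A.\<phi>_eq)
  have c: "(\<lambda>u. T b t u \<otimes>\<^bsub>A\<^esub> T b' u v) \<in> V' \<rightarrow> carrier A" by auto
  thus "finsum A (\<lambda>u. T b t u \<otimes>\<^bsub>A\<^esub> T b' u v) V' \<in> carrier A" by (rule A.finsum_closed)
  fix x y assume xy: "(x, y) \<in> R"
  have "\<phi> (T b t u \<otimes>\<^bsub>A\<^esub> T b' u v) (x, y) =
      (if x = r t \<and> y = r v then \<phi>' b (t, u) * \<phi>' b' (u, v) else 0)" if u: "u \<in> V'" for u
  proof -
    have "\<phi> (T b t u \<otimes>\<^bsub>A\<^esub> T b' u v) (x, y) =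
      (\<Sum>z\<in>V. if z = r u then (if x = r t \<and> y = r v then \<phi>' b (t, u) * \<phi>' b' (u, v) else 0) else 0)"
      using B.\<phi>_out b by (auto simp: A.\<phi>_mult \<phi>_T intro!: sum.cong)
    thus ?thesis using r_V[OF u] A.fin_V by simp
  qed
  hence "(\<Sum>u\<in>V'. \<phi> (T b t u \<otimes>\<^bsub>A\<^esub> T b' u v) (x, y)) =
      (if x = r t \<and> y = r v then \<phi>' (b \<otimes>\<^bsub>B\<^esub> b') (t, v) else 0)"
    using B.\<phi>_mult[OF b] by (cases "x = r t \<and> y = r v") auto
  also have "\<dots> = \<phi> (T (b \<otimes>\<^bsub>B\<^esub> b') t v) (x, y)"
    using B.\<phi>_out[OF B.m_closed[OF b]] by (auto simp: \<phi>_T)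
  finally show "\<phi> (T (b \<otimes>\<^bsub>B\<^esub> b') t v) (x, y) = \<phi> (finsum A (\<lambda>u. T b t u \<otimes>\<^bsub>A\<^esub> T b' u v) V') (x, y)"
    using A.\<phi>_finsum[OF c] by simp
qed simp

lemma T_scal: "u \<in> V' \<Longrightarrow> v \<in> V' \<Longrightarrow>
    T (c \<odot>\<^bsub>B\<^esub> \<one>\<^bsub>B\<^esub>) u v = (if u = v then c \<odot>\<^bsub>A\<^esub> A.E (r v) (r v) else \<zero>\<^bsub>A\<^esub>)"
  using B.R_refl by (auto simp: T_def B.\<phi>_smult B.\<phi>_one intro!: A.\<phi>_eq A.smult_closed)
    (auto simp: A.\<phi>_smult A.\<phi>_zero r_R A.smult_closed)

lemma tuplesD: "n \<in> tuples M \<Longrightarrow> n \<in> extensional V'"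
  "n \<in> tuples M \<Longrightarrow> v \<in> V' \<Longrightarrow> n v \<in> carrier M"
  "n \<in> tuples M \<Longrightarrow> v \<in> V' \<Longrightarrow> A.E (r v) (r v) \<odot>\<^bsub>M\<^esub> n v = n v"
  by (auto simp: tuples_def)

lemma obj_carrier: "carrier (obj M) = enc ` tuples M"
  by (simp add: obj_def)

lemma obj_zero: "\<zero>\<^bsub>obj M\<^esub> = enc (\<lambda>v\<in>V'. \<zero>\<^bsub>M\<^esub>)"
  by (simp add: obj_def)

lemma obj_add: "n \<in> tuples M \<Longrightarrow> n' \<in> tuples M \<Longrightarrow> enc n \<oplus>\<^bsub>obj M\<^esub> enc n' = enc (\<lambda>v\<in>V'. n v \<oplus>\<^bsub>M\<^esub> n' v)"
  by (simp add: obj_def tuplesD)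

lemma obj_act: "n \<in> tuples M \<Longrightarrow> b \<odot>\<^bsub>obj M\<^esub> enc n = enc (\<lambda>v\<in>V'. act_at M b n v)"
  by (simp add: obj_def tuplesD)

lemma enc_cong: "(\<And>v. v \<in> V' \<Longrightarrow> f v = g v) \<Longrightarrow> enc (\<lambda>v\<in>V'. f v) = enc (\<lambda>v\<in>V'. g v)"
  by (rule arg_cong[of _ _ enc]) (auto simp: restrict_def)

lemma enc_eqI: "n \<in> tuples M \<Longrightarrow> (\<And>v. v \<in> V' \<Longrightarrow> f v = n v) \<Longrightarrow> enc (\<lambda>v\<in>V'. f v) = enc n"
  by (rule arg_cong[of _ _ enc]) (auto simp: tuples_def extensional_def restrict_def)

context
  fixes M :: "('a, 'u) module" assumes M: "right_module A M"
begin

interpretation M: right_module A M by (rule M)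

lemma zero_tuple: "(\<lambda>v\<in>V'. \<zero>\<^bsub>M\<^esub>) \<in> tuples M"
  using rr by (auto simp: tuples_def M.act_zero_right)

lemma add_tuple: "n \<in> tuples M \<Longrightarrow> n' \<in> tuples M \<Longrightarrow> (\<lambda>v\<in>V'. n v \<oplus>\<^bsub>M\<^esub> n' v) \<in> tuples M"
  using rr by (auto simp: tuples_def M.act_add_right)

lemma neg_tuple: "n \<in> tuples M \<Longrightarrow> (\<lambda>v\<in>V'. \<ominus>\<^bsub>M\<^esub> n v) \<in> tuples M"
  using rr by (auto simp: tuples_def M.act_minus)

lemma T_act: "n \<in> tuples M \<Longrightarrow> (\<lambda>u. T b u v \<odot>\<^bsub>M\<^esub> n u) \<in> V' \<rightarrow> carrier M"
  using M.act_closed by (auto simp: tuples_def)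

lemma act_tuple: "n \<in> tuples M \<Longrightarrow> (\<lambda>v\<in>V'. act_at M b n v) \<in> tuples M"
proof -
  assume n: "n \<in> tuples M"
  have "A.E (r v) (r v) \<odot>\<^bsub>M\<^esub> act_at M b n v = act_at M b n v"
    if v: "v \<in> V'" for v
  proof -
    have e: "A.E (r v) (r v) \<in> carrier A" using rr[OF v] by simp
    have "A.E (r v) (r v) \<odot>\<^bsub>M\<^esub> act_at M b n v =
      finsum M (\<lambda>u. A.E (r v) (r v) \<odot>\<^bsub>M\<^esub> (T b u v \<odot>\<^bsub>M\<^esub> n u)) V'"
      by (rule M.act_finsum_right[OF e T_act[OF n]])
    also have "\<dots> = act_at M b n v"
    proof (rule M.finsum_cong'[OF refl T_act[OF n]])
      fix u assume u: "u \<in> V'"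
      show "A.E (r v) (r v) \<odot>\<^bsub>M\<^esub> (T b u v \<odot>\<^bsub>M\<^esub> n u) = T b u v \<odot>\<^bsub>M\<^esub> n u"
        using M.act_mult[OF T_closed e tuplesD(2)[OF n u]] T_E[OF v] by simp
    qed
    finally show ?thesis .
  qed
  moreover have "act_at M b n v \<in> carrier M" for v by (rule M.finsum_closed[OF T_act[OF n]])
  ultimately show ?thesis by (simp add: tuples_def)
qed

lemma scal_act_tuple:
  assumes n: "n \<in> tuples M"
  shows "(c \<odot>\<^bsub>B\<^esub> \<one>\<^bsub>B\<^esub>) \<odot>\<^bsub>obj M\<^esub> enc n = enc (\<lambda>v\<in>V'. (c \<odot>\<^bsub>A\<^esub> \<one>\<^bsub>A\<^esub>) \<odot>\<^bsub>M\<^esub> n v)"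
  unfolding obj_act[OF n]
proof (rule enc_cong)
  fix v assume v: "v \<in> V'"
  have "act_at M (c \<odot>\<^bsub>B\<^esub> \<one>\<^bsub>B\<^esub>) n v = T (c \<odot>\<^bsub>B\<^esub> \<one>\<^bsub>B\<^esub>) v v \<odot>\<^bsub>M\<^esub> n v"
    by (rule M.finsum_only) (use B.fin_V v n M.act_closed M.act_zero_left in
      \<open>auto simp: T_scal tuplesD A.smult_closed rr\<close>)
  also have "\<dots> = (A.E (r v) (r v) \<otimes>\<^bsub>A\<^esub> (c \<odot>\<^bsub>A\<^esub> \<one>\<^bsub>A\<^esub>)) \<odot>\<^bsub>M\<^esub> n v"
    using v rr by (simp add: T_scal A.mult_scal)
  also have "\<dots> = (c \<odot>\<^bsub>A\<^esub> \<one>\<^bsub>A\<^esub>) \<odot>\<^bsub>M\<^esub> (A.E (r v) (r v) \<odot>\<^bsub>M\<^esub> n v)"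
    by (rule M.act_mult') (use v rr n in \<open>auto simp: tuplesD\<close>)
  finally show "act_at M (c \<odot>\<^bsub>B\<^esub> \<one>\<^bsub>B\<^esub>) n v = (c \<odot>\<^bsub>A\<^esub> \<one>\<^bsub>A\<^esub>) \<odot>\<^bsub>M\<^esub> n v"
    using n v by (simp add: tuplesD)
qed

lemma E_act_tuple:
  assumes n: "n \<in> tuples M" and uv: "(u, v) \<in> R'"
  shows "B.E u v \<odot>\<^bsub>obj M\<^esub> enc n = enc (\<lambda>x\<in>V'. if x = v then A.E (r u) (r v) \<odot>\<^bsub>M\<^esub> n u else \<zero>\<^bsub>M\<^esub>)"
  unfolding obj_act[OF n]
proof (rule enc_cong)
  fix x assume x: "x \<in> V'"
  have u: "u \<in> V'" "v \<in> V'" using uv B.R_V by auto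
  have T: "T (B.E u v) t x = (if t = u \<and> x = v then A.E (r u) (r v) else \<zero>\<^bsub>A\<^esub>)" if "t \<in> V'" for t
    using uv r_R by (auto simp: T_def B.\<phi>_E intro!: A.\<phi>_eq A.smult_closed)
      (auto simp: A.\<phi>_smult A.\<phi>_zero A.smult_closed)
  show "finsum M (\<lambda>t. T (B.E u v) t x \<odot>\<^bsub>M\<^esub> n t) V' = (if x = v then A.E (r u) (r v) \<odot>\<^bsub>M\<^esub> n u else \<zero>\<^bsub>M\<^esub>)"
  proof (cases "x = v")
    case True
    have "finsum M (\<lambda>t. T (B.E u v) t x \<odot>\<^bsub>M\<^esub> n t) V' = T (B.E u v) u x \<odot>\<^bsub>M\<^esub> n u"
      by (rule M.finsum_only) (use B.fin_V u n True r_R[OF uv] M.act_closed M.act_zero_left in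
        \<open>auto simp: T[unfolded True] tuplesD\<close>)
    thus ?thesis using True T[OF u(1)] by simp
  next
    case False
    have "finsum M (\<lambda>t. T (B.E u v) t x \<odot>\<^bsub>M\<^esub> n t) V' = finsum M (\<lambda>t. \<zero>\<^bsub>M\<^esub>) V'"
      by (rule M.finsum_cong') (use False n M.act_zero_left in \<open>auto simp: T tuplesD\<close>)
    thus ?thesis using False by simp
  qed
qed

lemma obj_right_module: "right_module B (obj M)"
proof -
  have "abelian_group (obj M)"
  proof (rule abelian_groupI)
    fix x assume "x \<in> carrier (obj M)"
    then obtain n where n: "n \<in> tuples M" "x = enc n" by (auto simp: obj_carrier)
    have "enc (\<lambda>v\<in>V'. \<ominus>\<^bsub>M\<^esub> n v) \<oplus>\<^bsub>obj M\<^esub> x = \<zero>\<^bsub>obj M\<^esub>"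
      unfolding n(2) obj_add[OF neg_tuple[OF n(1)] n(1)] obj_zero
      by (rule enc_cong) (use n in \<open>simp add: tuplesD M.M.l_neg\<close>)
    thus "\<exists>y\<in>carrier (obj M). y \<oplus>\<^bsub>obj M\<^esub> x = \<zero>\<^bsub>obj M\<^esub>"
      using neg_tuple[OF n(1)] by (auto simp: obj_carrier)
  qed (auto simp: obj_carrier obj_add obj_zero add_tuple zero_tuple tuplesD M.a_ac intro!: enc_cong enc_eqI)
  moreover have "right_module_axioms B (obj M)"
  proof
    fix b x assume b: "b \<in> carrier B" and "x \<in> carrier (obj M)"
    then obtain n where n: "n \<in> tuples M" "x = enc n" by (auto simp: obj_carrier)
    show "b \<odot>\<^bsub>obj M\<^esub> x \<in> carrier (obj M)"
      unfolding n(2) obj_act[OF n(1)] using act_tuple[OF n(1)] by (auto simp: obj_carrier)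
  next
    fix b c x assume b: "b \<in> carrier B" "c \<in> carrier B" and "x \<in> carrier (obj M)"
    then obtain n where n: "n \<in> tuples M" "x = enc n" by (auto simp: obj_carrier)
    show "(b \<oplus>\<^bsub>B\<^esub> c) \<odot>\<^bsub>obj M\<^esub> x = b \<odot>\<^bsub>obj M\<^esub> x \<oplus>\<^bsub>obj M\<^esub> c \<odot>\<^bsub>obj M\<^esub> x"
      unfolding n(2) obj_act[OF n(1)] obj_add[OF act_tuple[OF n(1)] act_tuple[OF n(1)]]
    proof (rule enc_cong)
      fix v assume v: "v \<in> V'"
      have "act_at M (b \<oplus>\<^bsub>B\<^esub> c) n v = finsum M (\<lambda>u. T b u v \<odot>\<^bsub>M\<^esub> n u \<oplus>\<^bsub>M\<^esub> T c u v \<odot>\<^bsub>M\<^esub> n u) V'"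
        by (rule M.finsum_cong') (use b n M.act_closed in \<open>auto simp: T_add M.act_add_left tuplesD\<close>)
      also have "\<dots> = act_at M b n v \<oplus>\<^bsub>M\<^esub> act_at M c n v"
        by (rule M.finsum_addf[OF T_act[OF n(1)] T_act[OF n(1)]])
      finally show "act_at M (b \<oplus>\<^bsub>B\<^esub> c) n v = (\<lambda>v\<in>V'. act_at M b n v) v \<oplus>\<^bsub>M\<^esub>
        (\<lambda>v\<in>V'. act_at M c n v) v" using v by simp
    qed
  next
    fix b x y assume b: "b \<in> carrier B" and "x \<in> carrier (obj M)" "y \<in> carrier (obj M)"
    then obtain m n where n: "m \<in> tuples M" "x = enc m" "n \<in> tuples M" "y = enc n"
      by (auto simp: obj_carrier)
    show "b \<odot>\<^bsub>obj M\<^esub> (x \<oplus>\<^bsub>obj M\<^esub> y) = b \<odot>\<^bsub>obj M\<^esub> x \<oplus>\<^bsub>obj M\<^esub> b \<odot>\<^bsub>obj M\<^esub> y"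
      unfolding n(2,4) obj_add[OF n(1,3)] obj_act[OF n(1)] obj_act[OF n(3)]
        obj_act[OF add_tuple[OF n(1,3)]] obj_add[OF act_tuple[OF n(1)] act_tuple[OF n(3)]]
    proof (rule enc_cong)
      fix v assume v: "v \<in> V'"
      have "act_at M b (\<lambda>v\<in>V'. m v \<oplus>\<^bsub>M\<^esub> n v) v =
        finsum M (\<lambda>u. T b u v \<odot>\<^bsub>M\<^esub> m u \<oplus>\<^bsub>M\<^esub> T b u v \<odot>\<^bsub>M\<^esub> n u) V'"
        by (rule M.finsum_cong') (use b n M.act_closed in \<open>auto simp: M.act_add_right tuplesD\<close>)
      also have "\<dots> = act_at M b m v \<oplus>\<^bsub>M\<^esub> act_at M b n v"
        by (rule M.finsum_addf[OF T_act[OF n(1)] T_act[OF n(3)]])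
      finally show "act_at M b (\<lambda>v\<in>V'. m v \<oplus>\<^bsub>M\<^esub> n v) v = (\<lambda>v\<in>V'. act_at M b m v) v \<oplus>\<^bsub>M\<^esub>
        (\<lambda>v\<in>V'. act_at M b n v) v" using v by simp
    qed
  next
    fix b c x assume b: "b \<in> carrier B" "c \<in> carrier B" and "x \<in> carrier (obj M)"
    then obtain n where n: "n \<in> tuples M" "x = enc n" by (auto simp: obj_carrier)
    show "c \<odot>\<^bsub>obj M\<^esub> (b \<odot>\<^bsub>obj M\<^esub> x) = (b \<otimes>\<^bsub>B\<^esub> c) \<odot>\<^bsub>obj M\<^esub> x"
      unfolding n(2) obj_act[OF n(1)] obj_act[OF act_tuple[OF n(1)]]
    proof (rule enc_cong)
      fix v assume v: "v \<in> V'"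
      have nc: "n t \<in> carrier M" if "t \<in> V'" for t using n that by (simp add: tuplesD)
      have "finsum M (\<lambda>u. T c u v \<odot>\<^bsub>M\<^esub> (\<lambda>v\<in>V'. finsum M (\<lambda>t. T b t v \<odot>\<^bsub>M\<^esub> n t) V') u) V' =
        finsum M (\<lambda>u. finsum M (\<lambda>t. (T b t u \<otimes>\<^bsub>A\<^esub> T c u v) \<odot>\<^bsub>M\<^esub> n t) V') V'"
      proof (rule M.finsum_cong'[OF refl])
        show "(\<lambda>u. finsum M (\<lambda>t. (T b t u \<otimes>\<^bsub>A\<^esub> T c u v) \<odot>\<^bsub>M\<^esub> n t) V') \<in> V' \<rightarrow> carrier M"
          using M.act_closed nc by (auto intro!: M.finsum_closed)
        fix u assume u: "u \<in> V'"
        have "T c u v \<odot>\<^bsub>M\<^esub> finsum M (\<lambda>t. T b t u \<odot>\<^bsub>M\<^esub> n t) V' =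
          finsum M (\<lambda>t. T c u v \<odot>\<^bsub>M\<^esub> (T b t u \<odot>\<^bsub>M\<^esub> n t)) V'"
          by (rule M.act_finsum_right[OF T_closed T_act[OF n(1)]])
        also have "\<dots> = finsum M (\<lambda>t. (T b t u \<otimes>\<^bsub>A\<^esub> T c u v) \<odot>\<^bsub>M\<^esub> n t) V'"
          by (rule M.finsum_cong') (use M.act_closed nc in \<open>auto simp: M.act_mult\<close>)
        finally show "T c u v \<odot>\<^bsub>M\<^esub> (\<lambda>v\<in>V'. finsum M (\<lambda>t. T b t v \<odot>\<^bsub>M\<^esub> n t) V') u =
          finsum M (\<lambda>t. (T b t u \<otimes>\<^bsub>A\<^esub> T c u v) \<odot>\<^bsub>M\<^esub> n t) V'" using u by simp
      qed
      \<comment> \<open>After exchanging the sums, the inner one is the matrix product and collapses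
        by \<open>T_mult\<close>.\<close>
      also have "\<dots> = finsum M (\<lambda>t. finsum M (\<lambda>u. (T b t u \<otimes>\<^bsub>A\<^esub> T c u v) \<odot>\<^bsub>M\<^esub> n t) V') V'"
        by (rule M.finsum_swap) (use B.fin_V M.act_closed nc in auto)
      also have "\<dots> = finsum M (\<lambda>t. T (b \<otimes>\<^bsub>B\<^esub> c) t v \<odot>\<^bsub>M\<^esub> n t) V'"
      proof (rule M.finsum_cong'[OF refl T_act[OF n(1)]])
        fix t assume t: "t \<in> V'"
        show "finsum M (\<lambda>u. (T b t u \<otimes>\<^bsub>A\<^esub> T c u v) \<odot>\<^bsub>M\<^esub> n t) V' = T (b \<otimes>\<^bsub>B\<^esub> c) t v \<odot>\<^bsub>M\<^esub> n t"
          unfolding T_mult[OF b t v] by (rule M.act_finsum_left[symmetric]) (use nc t in auto)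
      qed
      finally show "finsum M (\<lambda>u. T c u v \<odot>\<^bsub>M\<^esub> (\<lambda>v\<in>V'. finsum M (\<lambda>t. T b t v \<odot>\<^bsub>M\<^esub> n t) V') u) V' =
        finsum M (\<lambda>t. T (b \<otimes>\<^bsub>B\<^esub> c) t v \<odot>\<^bsub>M\<^esub> n t) V'" .
    qed
  next
    fix x assume "x \<in> carrier (obj M)"
    then obtain n where n: "n \<in> tuples M" "x = enc n" by (auto simp: obj_carrier)
    have "(1 \<odot>\<^bsub>B\<^esub> \<one>\<^bsub>B\<^esub>) \<odot>\<^bsub>obj M\<^esub> x = x" unfolding n(2) scal_act_tuple[OF n(1)]
      by (rule enc_eqI[OF n(1)]) (use n in \<open>simp add: A.scal_one M.act_one tuplesD\<close>)
    thus "\<one>\<^bsub>B\<^esub> \<odot>\<^bsub>obj M\<^esub> x = x" by (simp add: B.scal_one)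
  qed
  ultimately show ?thesis unfolding right_module_def using B.ring_axioms by simp
qed

end

lemma mor_tuple:
  assumes f: "f \<in> rmod_hom A M N" and n: "n \<in> tuples M"
  shows "(\<lambda>v\<in>V'. f (n v)) \<in> tuples N" "mor M N f (enc n) = enc (\<lambda>v\<in>V'. f (n v))"
proof -
  have "A.E (r v) (r v) \<odot>\<^bsub>N\<^esub> f (n v) = f (n v)" if v: "v \<in> V'" for v
    using rmod_homD(4)[OF f A.E_closed[OF rr[OF v]] tuplesD(2)[OF n v]] tuplesD(3)[OF n v] by simp
  thus "(\<lambda>v\<in>V'. f (n v)) \<in> tuples N"
    using rmod_homD(2)[OF f] tuplesD(2)[OF n] by (simp add: tuples_def)
  show "mor M N f (enc n) = enc (\<lambda>v\<in>V'. f (n v))" using n by (simp add: mor_def obj_carrier tuplesD)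
qed

lemma mor_hom:
  assumes M: "right_module A M" and N: "right_module A N" and f: "f \<in> rmod_hom A M N"
  shows "mor M N f \<in> rmod_hom B (obj M) (obj N)"
proof -
  interpret M: right_module A M by (rule M)
  interpret N: right_module A N by (rule N)
  note t = mor_tuple[OF f]
  show ?thesis unfolding rmod_hom_def
  proof (intro CollectI conjI ballI)
    have "mor M N f x \<in> carrier (obj N)" if "x \<in> carrier (obj M)" for x
      using that t by (auto simp: obj_carrier)
    thus "mor M N f \<in> carrier (obj M) \<rightarrow>\<^sub>E carrier (obj N)" by (simp add: mor_def)
  next
    fix x y assume "x \<in> carrier (obj M)" "y \<in> carrier (obj M)"
    then obtain m n where n: "m \<in> tuples M" "x = enc m" "n \<in> tuples M" "y = enc n"
      by (auto simp: obj_carrier)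
    show "mor M N f (x \<oplus>\<^bsub>obj M\<^esub> y) = mor M N f x \<oplus>\<^bsub>obj N\<^esub> mor M N f y"
      unfolding n(2,4) obj_add[OF n(1,3)] t(2)[OF n(1)] t(2)[OF n(3)]
        t(2)[OF add_tuple[OF M n(1,3)]] obj_add[OF t(1)[OF n(1)] t(1)[OF n(3)]]
      by (rule enc_cong) (use n in \<open>simp add: rmod_homD(3)[OF f] tuplesD\<close>)
  next
    fix b x assume b: "b \<in> carrier B" and "x \<in> carrier (obj M)"
    then obtain n where n: "n \<in> tuples M" "x = enc n" by (auto simp: obj_carrier)
    show "mor M N f (b \<odot>\<^bsub>obj M\<^esub> x) = b \<odot>\<^bsub>obj N\<^esub> mor M N f x"
      unfolding n(2) obj_act[OF n(1)] t(2)[OF n(1)] t(2)[OF act_tuple[OF M n(1)]]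
        obj_act[OF t(1)[OF n(1)]]
    proof (rule enc_cong)
      fix v assume v: "v \<in> V'"
      have "f (act_at M b n v) = finsum N (\<lambda>u. f (T b u v \<odot>\<^bsub>M\<^esub> n u)) V'"
        by (rule additive_finsum[OF M.M.abelian_group_axioms N.M.abelian_group_axioms
          rmod_homD(2)[OF f] rmod_homD(3)[OF f] T_act[OF M n(1)]])
      also have "\<dots> = finsum N (\<lambda>u. T b u v \<odot>\<^bsub>N\<^esub> (\<lambda>v\<in>V'. f (n v)) u) V'"
        by (rule N.finsum_cong'[OF refl T_act[OF N t(1)[OF n(1)]]])
          (use n in \<open>simp add: rmod_homD(4)[OF f T_closed] tuplesD\<close>)
      finally show "f ((\<lambda>v\<in>V'. act_at M b n v) v) =
        finsum N (\<lambda>u. T b u v \<odot>\<^bsub>N\<^esub> (\<lambda>v\<in>V'. f (n v)) u) V'" using v by simp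
    qed
  qed
qed

lemma mor_ext: "(\<And>n. n \<in> tuples M \<Longrightarrow> mor M N f (enc n) = g (enc n)) \<Longrightarrow>
    g \<in> extensional (carrier (obj M)) \<Longrightarrow> mor M N f = g"
  by (rule extensionalityI[of _ "carrier (obj M)"]) (auto simp: mor_def obj_carrier)

lemma comp_hom:
  assumes L: "right_module A L" and f: "f \<in> rmod_hom A L M" and g: "g \<in> rmod_hom A M N"
  shows "compose (carrier L) g f \<in> rmod_hom A L N"
proof -
  interpret L: right_module A L by (rule L)
  show ?thesis unfolding rmod_hom_def using rmod_homD[OF f] rmod_homD[OF g] L.act_closed
    by (auto simp: compose_def)
qed

definition mod_map :: "('a, 'b, 'u) rmod_map" where
  "mod_map = \<lparr>fobj = obj, fmor = mor\<rparr>"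

lemma linear_functor_mod_map: "linear_functor A B mod_map"
  unfolding linear_functor_def mod_map_def rmod_map.simps
proof (intro conjI allI impI)
  fix M :: "('a, 'u) module" assume "right_module A M"
  thus "right_module B (obj M)" by (rule obj_right_module)
next
  fix M N :: "('a, 'u) module" and f assume "right_module A M" "right_module A N" "f \<in> rmod_hom A M N"
  thus "mor M N f \<in> rmod_hom B (obj M) (obj N)" by (rule mor_hom)
next
  fix M :: "('a, 'u) module" assume M: "right_module A M"
  have "(\<lambda>x\<in>carrier M. x) \<in> rmod_hom A M M"
  proof -
    interpret M: right_module A M by (rule M)
    show ?thesis unfolding rmod_hom_def using M.act_closed by auto
  qed
  from mor_tuple[OF this] show "mor M M (\<lambda>x\<in>carrier M. x) = (\<lambda>x\<in>carrier (obj M). x)"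
    by (intro mor_ext) (auto simp: obj_carrier tuplesD intro!: enc_eqI)
next
  fix L M N :: "('a, 'u) module" and f g
  assume L: "right_module A L" and M: "right_module A M" and N: "right_module A N"
    and f: "f \<in> rmod_hom A L M" and g: "g \<in> rmod_hom A M N"
  show "mor L N (compose (carrier L) g f) = compose (carrier (obj L)) (mor M N g) (mor L M f)"
  proof (rule mor_ext)
    fix n assume n: "n \<in> tuples L"
    have "compose (carrier (obj L)) (mor M N g) (mor L M f) (enc n) = enc (\<lambda>v\<in>V'. g ((\<lambda>v\<in>V'. f (n v)) v))"
      using mor_tuple[OF f n] mor_tuple(2)[OF g] n by (simp add: compose_def obj_carrier)
    also have "\<dots> = enc (\<lambda>v\<in>V'. compose (carrier L) g f (n v))"
      by (rule enc_cong) (use n in \<open>simp add: compose_def tuplesD\<close>)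
    finally show "mor L N (compose (carrier L) g f) (enc n) =
      compose (carrier (obj L)) (mor M N g) (mor L M f) (enc n)"
      using mor_tuple(2)[OF comp_hom[OF L f g] n] by simp
  qed (simp add: compose_def)
next
  fix M N :: "('a, 'u) module" and f g
  assume M: "right_module A M" and N: "right_module A N"
    and f: "f \<in> rmod_hom A M N" and g: "g \<in> rmod_hom A M N"
  show "mor M N (\<lambda>x\<in>carrier M. f x \<oplus>\<^bsub>N\<^esub> g x) =
      (\<lambda>x\<in>carrier (obj M). mor M N f x \<oplus>\<^bsub>obj N\<^esub> mor M N g x)"
  proof (rule mor_ext)
    fix n assume n: "n \<in> tuples M"
    show "mor M N (\<lambda>x\<in>carrier M. f x \<oplus>\<^bsub>N\<^esub> g x) (enc n) =
      (\<lambda>x\<in>carrier (obj M). mor M N f x \<oplus>\<^bsub>obj N\<^esub> mor M N g x) (enc n)"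
      using n mor_tuple[OF f n] mor_tuple[OF g n]
      by (simp add: mor_def obj_carrier obj_add tuplesD cong: restrict_cong)
  qed simp
next
  fix M N :: "('a, 'u) module" and f c assume M: "right_module A M" and N: "right_module A N" and f: "f \<in> rmod_hom A M N"
  show "mor M N (\<lambda>x\<in>carrier M. (c \<odot>\<^bsub>A\<^esub> \<one>\<^bsub>A\<^esub>) \<odot>\<^bsub>N\<^esub> f x) =
      (\<lambda>x\<in>carrier (obj M). (c \<odot>\<^bsub>B\<^esub> \<one>\<^bsub>B\<^esub>) \<odot>\<^bsub>obj N\<^esub> mor M N f x)"
  proof (rule mor_ext)
    fix n assume n: "n \<in> tuples M"
    show "mor M N (\<lambda>x\<in>carrier M. (c \<odot>\<^bsub>A\<^esub> \<one>\<^bsub>A\<^esub>) \<odot>\<^bsub>N\<^esub> f x) (enc n) =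
      (\<lambda>x\<in>carrier (obj M). (c \<odot>\<^bsub>B\<^esub> \<one>\<^bsub>B\<^esub>) \<odot>\<^bsub>obj N\<^esub> mor M N f x) (enc n)"
      using n mor_tuple[OF f n] scal_act_tuple[OF N mor_tuple(1)[OF f n], of c]
      by (simp add: mor_def obj_carrier tuplesD cong: restrict_cong)
  qed simp
qed

end

text \<open>Two monotone maps whose composition on V is equivalent to the identity. The other
  composition is covered by interpreting the locale with the roles exchanged.\<close>

locale preorder_equivalence =
  F: preorder_map A V R \<phi> B V' R' \<phi>' r enc + G: preorder_map B V' R' \<phi>' A V R \<phi> r' enc'
  for A :: "('k::field, 'a) module" and V :: "'v set" and R \<phi>
    and B :: "('k, 'b) module" and V' :: "'w set" and R' \<phi>'
    and r :: "'w \<Rightarrow> 'v" and enc :: "('w \<Rightarrow> 'u) \<Rightarrow> 'u"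
    and r' :: "'v \<Rightarrow> 'w" and enc' :: "('v \<Rightarrow> 'u) \<Rightarrow> 'u" +
  assumes r_r': "v \<in> V \<Longrightarrow> F.A.eqv (r (r' v)) v"
begin

abbreviation "E \<equiv> F.A.E"

lemma r_r'_R: assumes "v \<in> V"
  shows "(r (r' v), v) \<in> R" "(v, r (r' v)) \<in> R" "(v, v) \<in> R" "(r (r' v), r (r' v)) \<in> R" "r' v \<in> V'"
  using r_r'[OF assms] G.r_V[OF assms] F.A.R_refl assms F.r_V by (auto simp: F.A.eqv_def)

text \<open>A decoded element is a tuple of tuples. Its entry at v can be nonzero only in position
  r' v (\<open>inner_tuple_eq\<close>), and this entry is kept.\<close>

definition component :: "'u \<Rightarrow> 'v \<Rightarrow> 'u" where
  "component x v = F.dec (G.dec x v) (r' v)"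

text \<open>The component for v lies in M at the vertex r (r' v), which is equivalent to v; the
  invertible matrix unit between the two moves it to v, and the sum reassembles an element of
  M.\<close>

definition counit :: "('a, 'u) module \<Rightarrow> 'u \<Rightarrow> 'u" where
  "counit M = (\<lambda>x\<in>carrier (G.obj (F.obj M)). finsum M (\<lambda>v. E (r (r' v)) v \<odot>\<^bsub>M\<^esub> component x v) V)"

context
  fixes M :: "('a, 'u) module" assumes M: "right_module A M"
begin

interpretation M: right_module A M by (rule M)
interpretation FM: right_module B "F.obj M" by (rule F.obj_right_module[OF M])
interpretation GFM: right_module A "G.obj (F.obj M)"
  by (rule G.obj_right_module[OF F.obj_right_module[OF M]])

abbreviation tup :: "'u \<Rightarrow> 'v \<Rightarrow> 'w \<Rightarrow> 'u" where
  "tup x v \<equiv> F.dec (G.dec x v)"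

lemma outer_tuple:
  assumes "x \<in> carrier (G.obj (F.obj M))"
  shows "G.dec x \<in> G.tuples (F.obj M)" "enc' (G.dec x) = x"
proof -
  obtain n where n: "n \<in> G.tuples (F.obj M)" "x = enc' n" using assms by (auto simp: G.obj_carrier)
  hence "G.dec x = n" using G.dec_enc[OF G.tuplesD(1)[OF n(1)]] by simp
  thus "G.dec x \<in> G.tuples (F.obj M)" "enc' (G.dec x) = x" using n by simp_all
qed

lemma inner_tuple:
  assumes "x \<in> carrier (G.obj (F.obj M))" "v \<in> V"
  shows "tup x v \<in> F.tuples M" "enc (tup x v) = G.dec x v"
proof -
  have "G.dec x v \<in> carrier (F.obj M)" using G.tuplesD(2)[OF outer_tuple(1)[OF assms(1)] assms(2)] .
  then obtain k where k: "k \<in> F.tuples M" "G.dec x v = enc k" by (auto simp: F.obj_carrier)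
  hence "tup x v = k" using F.dec_enc[OF F.tuplesD(1)[OF k(1)]] by simp
  thus "tup x v \<in> F.tuples M" "enc (tup x v) = G.dec x v" using k by simp_all
qed

lemma component_closed:
  assumes "x \<in> carrier (G.obj (F.obj M))" "v \<in> V"
  shows "component x v \<in> carrier M" "E (r (r' v)) (r (r' v)) \<odot>\<^bsub>M\<^esub> component x v = component x v"
  unfolding component_def
  using F.tuplesD(2,3)[OF inner_tuple(1)[OF assms] r_r'_R(5)[OF assms(2)]] by auto

text \<open>As an entry of a tuple, it is fixed by the idempotent of B at r' v, and this idempotent
  erases every other position.\<close>

lemma inner_tuple_eq:
  assumes x: "x \<in> carrier (G.obj (F.obj M))" and v: "v \<in> V"
  shows "tup x v = (\<lambda>y\<in>V'. if y = r' v then component x v else \<zero>\<^bsub>M\<^esub>)"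
proof -
  note rv = r_r'_R[OF v] and k = inner_tuple[OF x v]
  have rr: "(r' v, r' v) \<in> R'" using rv(5) F.B.R_refl by blast
  have "enc (tup x v) = F.B.E (r' v) (r' v) \<odot>\<^bsub>F.obj M\<^esub> enc (tup x v)"
    using G.tuplesD(3)[OF outer_tuple(1)[OF x] v] k(2) by simp
  also have "\<dots> = enc (\<lambda>y\<in>V'. if y = r' v then E (r (r' v)) (r (r' v)) \<odot>\<^bsub>M\<^esub> tup x v (r' v) else \<zero>\<^bsub>M\<^esub>)"
    by (rule F.E_act_tuple[OF M k(1) rr])
  also have "E (r (r' v)) (r (r' v)) \<odot>\<^bsub>M\<^esub> tup x v (r' v) = component x v"
    using component_closed(2)[OF x v] by (simp add: component_def)
  finally have "F.dec (enc (tup x v)) = F.dec (enc (\<lambda>y\<in>V'. if y = r' v then component x v else \<zero>\<^bsub>M\<^esub>))"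
    by (rule arg_cong)
  thus ?thesis by (simp only: F.dec_enc[OF F.tuplesD(1)[OF k(1)]] F.dec_enc[OF restrict_extensional])
qed

lemma counit_terms:
  "x \<in> carrier (G.obj (F.obj M)) \<Longrightarrow> (\<lambda>v. E (r (r' v)) v \<odot>\<^bsub>M\<^esub> component x v) \<in> V \<rightarrow> carrier M"
  using component_closed M.act_closed r_r'_R(1) by auto

lemma component_add:
  assumes "v \<in> V"
  shows "component (x \<oplus>\<^bsub>G.obj (F.obj M)\<^esub> y) v = component x v \<oplus>\<^bsub>M\<^esub> component y v"
  using assms r_r'_R(5)[OF assms] by (simp add: component_def G.obj_def F.obj_def)

lemma component_scal:
  assumes x: "x \<in> carrier (G.obj (F.obj M))" and v: "v \<in> V"
  shows "component ((c \<odot>\<^bsub>A\<^esub> \<one>\<^bsub>A\<^esub>) \<odot>\<^bsub>G.obj (F.obj M)\<^esub> x) v = (c \<odot>\<^bsub>A\<^esub> \<one>\<^bsub>A\<^esub>) \<odot>\<^bsub>M\<^esub> component x v"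
proof -
  have "(c \<odot>\<^bsub>A\<^esub> \<one>\<^bsub>A\<^esub>) \<odot>\<^bsub>G.obj (F.obj M)\<^esub> x = enc' (\<lambda>v\<in>V. (c \<odot>\<^bsub>B\<^esub> \<one>\<^bsub>B\<^esub>) \<odot>\<^bsub>F.obj M\<^esub> G.dec x v)"
    using G.scal_act_tuple[OF F.obj_right_module[OF M] outer_tuple(1)[OF x], of c]
    unfolding outer_tuple(2)[OF x] .
  moreover have "(c \<odot>\<^bsub>B\<^esub> \<one>\<^bsub>B\<^esub>) \<odot>\<^bsub>F.obj M\<^esub> G.dec x v = enc (\<lambda>y\<in>V'. (c \<odot>\<^bsub>A\<^esub> \<one>\<^bsub>A\<^esub>) \<odot>\<^bsub>M\<^esub> tup x v y)"
    using F.scal_act_tuple[OF M inner_tuple(1)[OF x v], of c] unfolding inner_tuple(2)[OF x v] .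
  ultimately show ?thesis using v r_r'_R(5)[OF v] by (simp add: component_def)
qed

lemma component_E:
  assumes x: "x \<in> carrier (G.obj (F.obj M))" and v: "v \<in> V" and st: "(s, t) \<in> R"
  shows "component (E s t \<odot>\<^bsub>G.obj (F.obj M)\<^esub> x) v =
    (if v = t then E (r (r' s)) (r (r' t)) \<odot>\<^bsub>M\<^esub> component x s else \<zero>\<^bsub>M\<^esub>)"
proof -
  have s: "s \<in> V" "t \<in> V" using st F.A.R_V by auto
  have "E s t \<odot>\<^bsub>G.obj (F.obj M)\<^esub> x =
      enc' (\<lambda>v\<in>V. if v = t then F.B.E (r' s) (r' t) \<odot>\<^bsub>F.obj M\<^esub> G.dec x s else \<zero>\<^bsub>F.obj M\<^esub>)"
    using G.E_act_tuple[OF F.obj_right_module[OF M] outer_tuple(1)[OF x] st]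
    unfolding outer_tuple(2)[OF x] .
  moreover have "F.B.E (r' s) (r' t) \<odot>\<^bsub>F.obj M\<^esub> G.dec x s =
      enc (\<lambda>y\<in>V'. if y = r' t then E (r (r' s)) (r (r' t)) \<odot>\<^bsub>M\<^esub> tup x s (r' s) else \<zero>\<^bsub>M\<^esub>)"
    using F.E_act_tuple[OF M inner_tuple(1)[OF x s(1)] G.r_R[OF st]] unfolding inner_tuple(2)[OF x s(1)] .
  ultimately show ?thesis
    using v r_r'_R(5)[OF v] r_r'_R(5)[OF s(2)] by (auto simp: component_def F.obj_zero)
qed

text \<open>Only scalars and matrix units have to be checked. For \<open>E s t\<close> both sides
  have a single surviving summand, and each reduces to \<open>E (r (r' s)) t\<close> applied to the
  component at s.\<close>

lemma counit_hom: "counit M \<in> rmod_hom A (G.obj (F.obj M)) M"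
proof -
  let ?X = "G.obj (F.obj M)"
  let ?t = "\<lambda>x v. E (r (r' v)) v \<odot>\<^bsub>M\<^esub> component x v"
  have c: "counit M x = finsum M (?t x) V" if "x \<in> carrier ?X" for x using that by (simp add: counit_def)
  have closed: "counit M x \<in> carrier M" if "x \<in> carrier ?X" for x
    using M.finsum_closed[OF counit_terms[OF that]] c[OF that] by simp
  have add: "counit M (x \<oplus>\<^bsub>?X\<^esub> y) = counit M x \<oplus>\<^bsub>M\<^esub> counit M y"
    if xy: "x \<in> carrier ?X" "y \<in> carrier ?X" for x y
  proof -
    have "finsum M (?t (x \<oplus>\<^bsub>?X\<^esub> y)) V = finsum M (\<lambda>v. ?t x v \<oplus>\<^bsub>M\<^esub> ?t y v) V"
      by (rule M.finsum_cong') (use xy component_closed r_r'_R(1) M.act_closed in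
        \<open>auto simp: component_add M.act_add_right\<close>)
    also have "\<dots> = finsum M (?t x) V \<oplus>\<^bsub>M\<^esub> finsum M (?t y) V"
      by (rule M.finsum_addf[OF counit_terms[OF xy(1)] counit_terms[OF xy(2)]])
    finally show ?thesis using c xy by simp
  qed
  have sc: "counit M ((d \<odot>\<^bsub>A\<^esub> \<one>\<^bsub>A\<^esub>) \<odot>\<^bsub>?X\<^esub> x) = (d \<odot>\<^bsub>A\<^esub> \<one>\<^bsub>A\<^esub>) \<odot>\<^bsub>M\<^esub> counit M x"
    if x: "x \<in> carrier ?X" for d x
  proof -
    have sx: "(d \<odot>\<^bsub>A\<^esub> \<one>\<^bsub>A\<^esub>) \<odot>\<^bsub>?X\<^esub> x \<in> carrier ?X" using GFM.act_closed x by simp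
    have "finsum M (?t ((d \<odot>\<^bsub>A\<^esub> \<one>\<^bsub>A\<^esub>) \<odot>\<^bsub>?X\<^esub> x)) V = finsum M (\<lambda>v. (d \<odot>\<^bsub>A\<^esub> \<one>\<^bsub>A\<^esub>) \<odot>\<^bsub>M\<^esub> ?t x v) V"
    proof (rule M.finsum_cong'[OF refl])
      show "(\<lambda>v. (d \<odot>\<^bsub>A\<^esub> \<one>\<^bsub>A\<^esub>) \<odot>\<^bsub>M\<^esub> ?t x v) \<in> V \<rightarrow> carrier M"
        by (rule Pi_I) (rule M.act_closed[OF F.A.scal_closed funcset_mem[OF counit_terms[OF x]]])
      fix v assume v: "v \<in> V"
      show "?t ((d \<odot>\<^bsub>A\<^esub> \<one>\<^bsub>A\<^esub>) \<odot>\<^bsub>?X\<^esub> x) v = (d \<odot>\<^bsub>A\<^esub> \<one>\<^bsub>A\<^esub>) \<odot>\<^bsub>M\<^esub> ?t x v"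
        unfolding component_scal[OF x v]
        by (rule F.A.act_scal_comm[OF M component_closed(1)[OF x v]]) (use r_r'_R(1)[OF v] in simp)
    qed
    also have "\<dots> = (d \<odot>\<^bsub>A\<^esub> \<one>\<^bsub>A\<^esub>) \<odot>\<^bsub>M\<^esub> finsum M (?t x) V"
      by (rule M.act_finsum_right[OF F.A.scal_closed counit_terms[OF x], symmetric])
    finally show ?thesis using c x sx by simp
  qed
  have EE: "counit M (E s t \<odot>\<^bsub>?X\<^esub> x) = E s t \<odot>\<^bsub>M\<^esub> counit M x"
    if st: "(s, t) \<in> R" and x: "x \<in> carrier ?X" for s t x
  proof -
    have s: "s \<in> V" "t \<in> V" using st F.A.R_V by auto
    have sx: "E s t \<odot>\<^bsub>?X\<^esub> x \<in> carrier ?X" using GFM.act_closed x st by simp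
    have rst: "(r (r' s), r (r' t)) \<in> R" using F.r_R G.r_R st by blast
    have rs: "(r (r' s), t) \<in> R" using F.A.R_trans r_r'_R(1)[OF s(1)] st by blast
    note cs = component_closed(1)[OF x s(1)]
    have "finsum M (?t (E s t \<odot>\<^bsub>?X\<^esub> x)) V = ?t (E s t \<odot>\<^bsub>?X\<^esub> x) t"
    proof (rule M.finsum_only[OF F.A.fin_V s(2)])
      show "?t (E s t \<odot>\<^bsub>?X\<^esub> x) t \<in> carrier M" using counit_terms[OF sx] s by auto
      fix v assume v: "v \<in> V" "v \<noteq> t"
      thus "?t (E s t \<odot>\<^bsub>?X\<^esub> x) v = \<zero>\<^bsub>M\<^esub>"
        using component_E[OF x v(1) st] M.act_zero_right r_r'_R(1) by simp
    qed
    also have "\<dots> = E (r (r' s)) t \<odot>\<^bsub>M\<^esub> component x s"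
      using component_E[OF x s(2) st] F.A.E_act[OF M rst r_r'_R(1)[OF s(2)] cs] by simp
    also have "\<dots> = E s t \<odot>\<^bsub>M\<^esub> ?t x s" using F.A.E_act[OF M r_r'_R(1)[OF s(1)] st cs] by simp
    also have "\<dots> = finsum M (\<lambda>v. E s t \<odot>\<^bsub>M\<^esub> ?t x v) V"
    proof (rule M.finsum_only[OF F.A.fin_V s(1), symmetric])
      show "E s t \<odot>\<^bsub>M\<^esub> ?t x s \<in> carrier M"
        by (rule M.act_closed[OF F.A.E_closed[OF st] funcset_mem[OF counit_terms[OF x] s(1)]])
      fix v assume v: "v \<in> V" "v \<noteq> s"
      thus "E s t \<odot>\<^bsub>M\<^esub> ?t x v = \<zero>\<^bsub>M\<^esub>"
        using F.A.E_act[OF M r_r'_R(1)[OF v(1)] st component_closed(1)[OF x v(1)]] by simp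
    qed
    also have "\<dots> = E s t \<odot>\<^bsub>M\<^esub> finsum M (?t x) V"
      by (rule M.act_finsum_right[OF F.A.E_closed[OF st] counit_terms[OF x], symmetric])
    finally show ?thesis using c x sx by simp
  qed
  show ?thesis unfolding rmod_hom_def
  proof (intro CollectI conjI ballI)
    show "counit M \<in> carrier ?X \<rightarrow>\<^sub>E carrier M" using closed by (auto simp: counit_def)
  next
    fix a x assume ax: "a \<in> carrier A" "x \<in> carrier ?X"
    show "counit M (a \<odot>\<^bsub>?X\<^esub> x) = a \<odot>\<^bsub>M\<^esub> counit M x"
      by (rule F.A.hom_check[OF GFM.right_module_axioms M closed add sc EE ax])
  qed (rule add)
qed

lemma counit_bij: "bij_betw (counit M) (carrier (G.obj (F.obj M))) (carrier M)"
proof -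
  let ?X = "G.obj (F.obj M)"
  have "inj_on (counit M) (carrier ?X)"
  proof (rule rmod_hom_inj[OF GFM.right_module_axioms M counit_hom])
    fix x assume x: "x \<in> carrier ?X" "counit M x = \<zero>\<^bsub>M\<^esub>"
    have "component x v = \<zero>\<^bsub>M\<^esub>" if v: "v \<in> V" for v
    proof -
      note rv = r_r'_R[OF v] and cv = component_closed[OF x(1) v]
      have "\<zero>\<^bsub>M\<^esub> = E v v \<odot>\<^bsub>M\<^esub> counit M x" using x(2) M.act_zero_right rv by simp
      also have "\<dots> = finsum M (\<lambda>u. E v v \<odot>\<^bsub>M\<^esub> (E (r (r' u)) u \<odot>\<^bsub>M\<^esub> component x u)) V"
        using M.act_finsum_right[OF F.A.E_closed[OF rv(3)] counit_terms[OF x(1)]] x(1)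
        by (simp add: counit_def)
      also have "\<dots> = E v v \<odot>\<^bsub>M\<^esub> (E (r (r' v)) v \<odot>\<^bsub>M\<^esub> component x v)"
      proof (rule M.finsum_only[OF F.A.fin_V v])
        show "E v v \<odot>\<^bsub>M\<^esub> (E (r (r' v)) v \<odot>\<^bsub>M\<^esub> component x v) \<in> carrier M"
          using M.act_closed rv cv by simp
        fix u assume u: "u \<in> V" "u \<noteq> v"
        thus "E v v \<odot>\<^bsub>M\<^esub> (E (r (r' u)) u \<odot>\<^bsub>M\<^esub> component x u) = \<zero>\<^bsub>M\<^esub>"
          using F.A.E_act[OF M r_r'_R(1)[OF u(1)] rv(3) component_closed(1)[OF x(1) u(1)]] by simp
      qed
      also have "\<dots> = E (r (r' v)) v \<odot>\<^bsub>M\<^esub> component x v" using F.A.E_act[OF M rv(1,3) cv(1)] by simp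
      \<comment> \<open>The idempotent at v isolates one summand; the inverse matrix unit then
        recovers the component itself.\<close>
      finally have "E v (r (r' v)) \<odot>\<^bsub>M\<^esub> (E (r (r' v)) v \<odot>\<^bsub>M\<^esub> component x v) = \<zero>\<^bsub>M\<^esub>"
        using M.act_zero_right rv by (metis F.A.E_closed)
      thus ?thesis using F.A.E_act[OF M rv(1,2) cv(1)] cv(2) by simp
    qed
    hence z: "(\<lambda>y\<in>V'. if y = r' v then component x v else \<zero>\<^bsub>M\<^esub>) = (\<lambda>y\<in>V'. \<zero>\<^bsub>M\<^esub>)" if "v \<in> V" for v
      using that by (auto simp: restrict_def)
    have "G.dec x v = \<zero>\<^bsub>F.obj M\<^esub>" if v: "v \<in> V" for v
      using inner_tuple(2)[OF x(1) v] unfolding inner_tuple_eq[OF x(1) v] z[OF v] F.obj_zero by simp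
    hence "enc' (\<lambda>v\<in>V. \<zero>\<^bsub>F.obj M\<^esub>) = enc' (G.dec x)"
      by (intro G.enc_eqI[OF outer_tuple(1)[OF x(1)]]) simp
    thus "x = \<zero>\<^bsub>?X\<^esub>" using outer_tuple(2)[OF x(1)] G.obj_zero by simp
  qed
  moreover have "m \<in> counit M ` carrier ?X" if m: "m \<in> carrier M" for m
  proof -
    \<comment> \<open>The preimage of m: its part at v is moved to the equivalent vertex r (r' v)
      and placed in position r' v.\<close>
    let ?k = "\<lambda>v. \<lambda>y\<in>V'. if y = r' v then E v (r (r' v)) \<odot>\<^bsub>M\<^esub> m else \<zero>\<^bsub>M\<^esub>"
    have Ev: "E v (r (r' v)) \<odot>\<^bsub>M\<^esub> m \<in> carrier M" if "v \<in> V" for v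
      using M.act_closed m r_r'_R(2)[OF that] by simp
    have Evr: "E (r (r' v)) (r (r' v)) \<odot>\<^bsub>M\<^esub> (E v (r (r' v)) \<odot>\<^bsub>M\<^esub> m) = E v (r (r' v)) \<odot>\<^bsub>M\<^esub> m"
      if "v \<in> V" for v using F.A.E_act[OF M r_r'_R(2)[OF that] r_r'_R(4)[OF that] m] by simp
    have k: "?k v \<in> F.tuples M" if v: "v \<in> V" for v
      unfolding F.tuples_def using Ev[OF v] Evr[OF v] M.act_zero_right F.rr by auto
    let ?n = "\<lambda>v\<in>V. enc (?k v)"
    have n: "?n \<in> G.tuples (F.obj M)"
    proof -
      have "F.B.E (r' v) (r' v) \<odot>\<^bsub>F.obj M\<^esub> enc (?k v) = enc (?k v)" if v: "v \<in> V" for v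
      proof -
        have rr: "(r' v, r' v) \<in> R'" using r_r'_R(5)[OF v] F.B.R_refl by blast
        show ?thesis unfolding F.E_act_tuple[OF M k[OF v] rr]
          by (rule F.enc_cong) (use Evr[OF v] r_r'_R(5)[OF v] in auto)
      qed
      thus ?thesis using k unfolding G.tuples_def by (auto simp: F.obj_carrier)
    qed
    have nX: "enc' ?n \<in> carrier ?X" using n by (auto simp: G.obj_carrier)
    have co: "component (enc' ?n) v = E v (r (r' v)) \<odot>\<^bsub>M\<^esub> m" if v: "v \<in> V" for v
      using v r_r'_R(5)[OF v] k[OF v] by (simp add: component_def)
    have "counit M (enc' ?n) = finsum M (\<lambda>v. E v v \<odot>\<^bsub>M\<^esub> m) V"
      unfolding counit_def restrict_apply'[OF nX]
    proof (rule M.finsum_cong'[OF refl])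
      show "(\<lambda>v. E v v \<odot>\<^bsub>M\<^esub> m) \<in> V \<rightarrow> carrier M"
        by (rule Pi_I) (rule M.act_closed[OF F.A.E_closed[OF r_r'_R(3)] m])
      fix v assume v: "v \<in> V"
      show "E (r (r' v)) v \<odot>\<^bsub>M\<^esub> component (enc' ?n) v = E v v \<odot>\<^bsub>M\<^esub> m"
        unfolding co[OF v] F.A.E_act[OF M r_r'_R(2)[OF v] r_r'_R(1)[OF v] m] by simp
    qed
    also have "\<dots> = m" by (rule F.A.act_decompose[OF M m, symmetric])
    finally show ?thesis using nX by (rule image_eqI[OF sym])
  qed
  ultimately show ?thesis unfolding bij_betw_def by (auto intro: rmod_homD(2)[OF counit_hom])
qed

end

lemma nat_iso: "nat_iso_id A F.mod_map G.mod_map counit"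
  unfolding nat_iso_id_def F.mod_map_def G.mod_map_def rmod_map.simps
proof (intro conjI allI impI)
  fix M :: "('a, 'u) module" assume "right_module A M"
  thus "counit M \<in> rmod_hom A (G.obj (F.obj M)) M"
    "bij_betw (counit M) (carrier (G.obj (F.obj M))) (carrier M)"
    by (rule counit_hom, rule counit_bij)
next
  fix M N :: "('a, 'u) module" and f assume M: "right_module A M" and N: "right_module A N" and f: "f \<in> rmod_hom A M N"
  let ?X = "G.obj (F.obj M)"
  interpret M: right_module A M by (rule M)
  interpret N: right_module A N by (rule N)
  note Ff = F.mor_hom[OF M N f]
  note GFf = G.mor_hom[OF F.obj_right_module[OF M] F.obj_right_module[OF N] Ff]
  show "compose (carrier ?X) (counit N) (G.mor (F.obj M) (F.obj N) (F.mor M N f)) =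
      compose (carrier ?X) f (counit M)" unfolding compose_def
  proof (rule restrict_ext)
    fix x assume x: "x \<in> carrier ?X"
    let ?y = "G.mor (F.obj M) (F.obj N) (F.mor M N f) x"
    have y: "?y \<in> carrier (G.obj (F.obj N))" using rmod_homD(2)[OF GFf x] .
    have "?y = enc' (\<lambda>v\<in>V. F.mor M N f (G.dec x v))"
      using G.mor_tuple(2)[OF Ff outer_tuple(1)[OF M x]] unfolding outer_tuple(2)[OF M x] .
    moreover have "F.mor M N f (G.dec x v) = enc (\<lambda>y\<in>V'. f (tup x v y))" if v: "v \<in> V" for v
      using F.mor_tuple(2)[OF f inner_tuple(1)[OF M x v]] unfolding inner_tuple(2)[OF M x v] .
    ultimately have cy: "component ?y v = f (component x v)" if v: "v \<in> V" for v
      using v r_r'_R(5)[OF v] by (simp add: component_def)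
    have "f (counit M x) = finsum N (\<lambda>v. f (E (r (r' v)) v \<odot>\<^bsub>M\<^esub> component x v)) V"
      unfolding counit_def restrict_apply'[OF x]
      by (rule additive_finsum[OF M.M.abelian_group_axioms N.M.abelian_group_axioms
        rmod_homD(2)[OF f] rmod_homD(3)[OF f] counit_terms[OF M x]])
    also have "\<dots> = finsum N (\<lambda>v. E (r (r' v)) v \<odot>\<^bsub>N\<^esub> component ?y v) V"
      by (rule N.finsum_cong'[OF refl counit_terms[OF N y]])
        (use cy rmod_homD(4)[OF f] r_r'_R(1) component_closed(1)[OF M x] in simp)
    finally show "counit N ?y = f (counit M x)" using y by (simp add: counit_def)
  qed
qed

end

text \<open>Monotone maps inverse to each other up to equivalence of vertices are an equivalence of
  the preorders as categories, and modules are linear functors on them.\<close>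

lemma morita_equivalentI:
  fixes A :: "('k::field, 'a) module" and B :: "('k, 'b) module"
    and V :: "'v set" and V' :: "'w set"
  assumes A: "preorder_algebra A V R \<phi>" and B: "preorder_algebra B V' R' \<phi>'"
    and r: "\<And>v. v \<in> V' \<Longrightarrow> r v \<in> V" and r': "\<And>v. v \<in> V \<Longrightarrow> r' v \<in> V'"
    and rR: "\<And>u v. (u, v) \<in> R' \<Longrightarrow> (r u, r v) \<in> R"
    and rR': "\<And>u v. (u, v) \<in> R \<Longrightarrow> (r' u, r' v) \<in> R'"
    and rr': "\<And>v. v \<in> V \<Longrightarrow> (r (r' v), v) \<in> R \<and> (v, r (r' v)) \<in> R"
    and r'r: "\<And>v. v \<in> V' \<Longrightarrow> (r' (r v), v) \<in> R' \<and> (v, r' (r v)) \<in> R'"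
  shows "morita_equivalent TYPE('u::infinite) A B"
proof -
  interpret A: preorder_algebra A V R \<phi> by (rule A)
  interpret B: preorder_algebra B V' R' \<phi>' by (rule B)
  obtain enc :: "('w \<Rightarrow> 'u) \<Rightarrow> 'u" where enc: "inj_on enc (extensional V')"
    using tuple_code[OF B.fin_V] by blast
  obtain enc' :: "('v \<Rightarrow> 'u) \<Rightarrow> 'u" where enc': "inj_on enc' (extensional V)"
    using tuple_code[OF A.fin_V] by blast
  interpret F: preorder_map A V R \<phi> B V' R' \<phi>' r enc by unfold_locales (use r rR enc in auto)
  interpret G: preorder_map B V' R' \<phi>' A V R \<phi> r' enc' by unfold_locales (use r' rR' enc' in auto)
  interpret FG: preorder_equivalence A V R \<phi> B V' R' \<phi>' r enc r' enc'
    by unfold_locales (use rr' in \<open>auto simp: A.eqv_def\<close>)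
  interpret GF: preorder_equivalence B V' R' \<phi>' A V R \<phi> r' enc' r enc
    by unfold_locales (use r'r in \<open>auto simp: B.eqv_def\<close>)
  show ?thesis unfolding morita_equivalent_def
    using F.linear_functor_mod_map G.linear_functor_mod_map FG.nat_iso GF.nat_iso by blast
qed

section \<open>Coordinates\<close>

context
  fixes M :: "('k::field, 'a) module" and R :: "'r set" and \<phi> :: "'a \<Rightarrow> 'r \<Rightarrow> 'k"
  assumes fin: "finite R" and M: "abelian_group M"
    and smult_closed: "\<And>c x. x \<in> carrier M \<Longrightarrow> c \<odot>\<^bsub>M\<^esub> x \<in> carrier M"
    and bij: "bij_betw \<phi> (carrier M) {f. \<forall>r. r \<notin> R \<longrightarrow> f r = 0}"
    and add: "\<And>x y r. x \<in> carrier M \<Longrightarrow> y \<in> carrier M \<Longrightarrow> \<phi> (x \<oplus>\<^bsub>M\<^esub> y) r = \<phi> x r + \<phi> y r"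
    and smult: "\<And>c x r. x \<in> carrier M \<Longrightarrow> \<phi> (c \<odot>\<^bsub>M\<^esub> x) r = c * \<phi> x r"
begin

interpretation M: abelian_group M by (rule M)

lemma coord_eqI:
  assumes "x \<in> carrier M" "y \<in> carrier M" "\<And>r. r \<in> R \<Longrightarrow> \<phi> x r = \<phi> y r" shows "x = y"
proof -
  have "\<phi> x \<in> {f. \<forall>r. r \<notin> R \<longrightarrow> f r = 0}" "\<phi> y \<in> {f. \<forall>r. r \<notin> R \<longrightarrow> f r = 0}"
    using bij_betwE[OF bij] assms(1,2) by blast+
  hence "\<phi> x = \<phi> y" using assms(3) by (auto simp: fun_eq_iff) metis
  thus ?thesis using inj_onD[OF bij_betw_imp_inj_on[OF bij]] assms(1,2) by blast
qed

lemma coord_exists: "\<exists>x\<in>carrier M. \<forall>r\<in>R. \<phi> x r = c r"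
proof -
  have "(\<lambda>r. if r \<in> R then c r else 0) \<in> \<phi> ` carrier M" using bij by (auto simp: bij_betw_def)
  then obtain x where "x \<in> carrier M" "\<phi> x = (\<lambda>r. if r \<in> R then c r else 0)" by auto
  thus ?thesis by (intro bexI[of _ x]) auto
qed

lemma coord_zero: "\<phi> \<zero>\<^bsub>M\<^esub> r = 0"
proof -
  have "\<phi> \<zero>\<^bsub>M\<^esub> r + \<phi> \<zero>\<^bsub>M\<^esub> r = \<phi> \<zero>\<^bsub>M\<^esub> r + 0"
    using add[of "\<zero>\<^bsub>M\<^esub>" "\<zero>\<^bsub>M\<^esub>" r] by (metis M.zero_closed M.l_zero add_0_right)
  thus ?thesis by (rule add_left_imp_eq)
qed

lemma coord_finsum: "f \<in> S \<rightarrow> carrier M \<Longrightarrow> \<phi> (finsum M f S) r = (\<Sum>s\<in>S. \<phi> (f s) r)"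
proof (induction S rule: infinite_finite_induct)
  case (insert s S)
  thus ?case using add[of "f s" "finsum M f S"] by auto
qed (auto simp: coord_zero)

lemma coord_vectorspace: "vectorspace class_ring M"
proof -
  have F: "field (class_ring :: 'k ring)" by (rule class_field.field_axioms)
  have "module_axioms (class_ring :: 'k ring) M" by (rule module_axioms.intro)
      (auto simp: smult_closed add smult algebra_simps intro!: coord_eqI)
  hence "module (class_ring :: 'k ring) M"
    by (intro module.intro M domain.axioms(1)[OF field.axioms(1)[OF F]])
  thus ?thesis by (intro vectorspace.intro F)
qed

interpretation VS: vectorspace class_ring M by (rule coord_vectorspace)

lemma coord_lincomb: "A \<subseteq> carrier M \<Longrightarrow> \<phi> (VS.lincomb a A) r = (\<Sum>v\<in>A. a v * \<phi> v r)"
proof -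
  assume A: "A \<subseteq> carrier M"
  have "(\<lambda>v. a v \<odot>\<^bsub>M\<^esub> v) \<in> A \<rightarrow> carrier M" using A smult_closed by auto
  thus ?thesis unfolding VS.lincomb_def using A smult
    by (simp add: coord_finsum subset_iff cong: sum.cong)
qed

text \<open>Independence is assumed for the family, so repeated members are excluded as well. This
  is why injectivity of the family comes out together with independence of its image.\<close>

lemma coord_independent:
  fixes f :: "'q \<Rightarrow> 'a"
  assumes Q: "finite Q" and f: "f ` Q \<subseteq> carrier M"
    and indep: "\<forall>c. (\<forall>r\<in>R. (\<Sum>q\<in>Q. c q * \<phi> (f q) r) = 0) \<longrightarrow> (\<forall>q\<in>Q. c q = 0)"
  shows "inj_on f Q" "VS.lin_indpt (f ` Q)"
proof -
  show inj: "inj_on f Q"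
  proof (rule inj_onI, rule ccontr)
    fix q q' assume q: "q \<in> Q" "q' \<in> Q" "f q = f q'" "q \<noteq> q'"
    \<comment> \<open>Two equal members would give the vanishing combination with coefficients 1 and
      -1; their being at different indices keeps it nontrivial.\<close>
    let ?c = "\<lambda>x. (if x = q then 1 else 0) - (if x = q' then 1 else 0) :: 'k"
    have "(\<Sum>x\<in>Q. ?c x * \<phi> (f x) r) = 0" for r
    proof -
      have "?c x * \<phi> (f x) r = (if x = q then \<phi> (f q) r else 0) - (if x = q' then \<phi> (f q) r else 0)" for x
        using q(3) by (cases "x = q"; cases "x = q'") simp_all
      thus ?thesis using Q q(1,2) by (simp add: sum_subtractf del: mult_minus_left)
    qed
    hence "?c q = 0" using q(1) indep[rule_format, of ?c] by blast
    thus False using q(4) by simp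
  qed
  note sub = f
  show "VS.lin_indpt (f ` Q)"
  proof (rule VS.finite_lin_indpt2)
    fix a assume "VS.lincomb a (f ` Q) = \<zero>\<^bsub>M\<^esub>"
    hence "(\<Sum>v\<in>f ` Q. a v * \<phi> v r) = 0" for r using coord_lincomb[OF sub, of a r] coord_zero by simp
    hence "(\<Sum>q\<in>Q. a (f q) * \<phi> (f q) r) = 0" for r by (simp add: sum.reindex[OF inj])
    hence "a (f q) = 0" if "q \<in> Q" for q using indep[rule_format, of "\<lambda>q. a (f q)"] that by blast
    thus "\<forall>v\<in>f ` Q. a v = \<zero>\<^bsub>class_ring\<^esub>" by simp
  qed (use Q sub in auto)
qed

lemma coord_dim: "VS.fin_dim" "VS.dim = card R"
proof -
  obtain e where e: "\<And>r. r \<in> R \<Longrightarrow> e r \<in> carrier M"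
      "\<And>r r'. r \<in> R \<Longrightarrow> r' \<in> R \<Longrightarrow> \<phi> (e r) r' = (if r' = r then 1 else 0)"
    using coord_exists[of "\<lambda>r'. if r' = _ then 1 else 0"] by metis
  have sum: "(\<Sum>q\<in>R. c q * \<phi> (e q) r) = c r" if "r \<in> R" for c r
  proof -
    have "(\<Sum>q\<in>R. c q * \<phi> (e q) r) = (\<Sum>q\<in>R. if r = q then c r else 0)"
      by (rule sum.cong) (use that e in auto)
    thus ?thesis using that fin by simp
  qed
  have sub: "e ` R \<subseteq> carrier M" using e(1) by auto
  have "\<forall>c. (\<forall>r\<in>R. (\<Sum>q\<in>R. c q * \<phi> (e q) r) = 0) \<longrightarrow> (\<forall>q\<in>R. c q = 0)" using sum by simp
  note li = coord_independent[OF fin sub this]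
  have "x \<in> VS.span (e ` R)" if x: "x \<in> carrier M" for x
  proof -
    let ?a = "\<lambda>v. \<phi> x (inv_into R e v)"
    have "VS.lincomb ?a (e ` R) \<in> carrier M" using sub by (intro VS.lincomb_closed) auto
    moreover have "\<phi> x r = \<phi> (VS.lincomb ?a (e ` R)) r" if "r \<in> R" for r
      using sum[OF that, of "\<phi> x"] unfolding coord_lincomb[OF sub] sum.reindex[OF li(1)]
      by (simp add: inv_into_f_f[OF li(1)] cong: sum.cong)
    ultimately have "x = VS.lincomb ?a (e ` R)" using x by (intro coord_eqI)
    thus ?thesis unfolding VS.span_def using fin by auto
  qed
  hence gen: "VS.span (e ` R) = carrier M" using VS.span_is_subset2[OF sub] by auto
  thus "VS.fin_dim" unfolding VS.fin_dim_def using fin sub by blast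
  have "VS.basis (e ` R)" unfolding VS.basis_def using li(2) gen sub by blast
  thus "VS.dim = card R" using VS.dim_basis[of "e ` R"] fin card_image[OF li(1)] by simp
qed

lemma coord_basis:
  fixes f :: "'q \<Rightarrow> 'a"
  assumes Q: "finite Q" and f: "f ` Q \<subseteq> carrier M"
    and indep: "\<forall>c. (\<forall>r\<in>R. (\<Sum>q\<in>Q. c q * \<phi> (f q) r) = 0) \<longrightarrow> (\<forall>q\<in>Q. c q = 0)"
    and card: "card Q = card R"
  shows "inj_on f Q" "VS.basis (f ` Q)"
proof -
  show inj: "inj_on f Q" by (rule coord_independent(1)[OF Q f indep])
  show "VS.basis (f ` Q)"
    by (rule VS.dim_li_is_basis[OF coord_dim(1) _ _ coord_independent(2)[OF Q f indep]])
      (use Q f coord_dim(2) card card_image[OF inj] in auto)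
qed

text \<open>The spanning property as an explicit finite sum in M, which can then be evaluated inside
  a subalgebra.\<close>

lemma coord_combination:
  fixes f :: "'q \<Rightarrow> 'a"
  assumes Q: "finite Q" and f: "f ` Q \<subseteq> carrier M"
    and indep: "\<forall>c. (\<forall>r\<in>R. (\<Sum>q\<in>Q. c q * \<phi> (f q) r) = 0) \<longrightarrow> (\<forall>q\<in>Q. c q = 0)"
    and card: "card Q = card R" and x: "x \<in> carrier M"
  shows "\<exists>a A. A \<subseteq> f ` Q \<and> finite A \<and> x = finsum M (\<lambda>v. a v \<odot>\<^bsub>M\<^esub> v) A"
proof -
  have "x \<in> VS.span (f ` Q)" using coord_basis(2)[OF assms(1-4)] x unfolding VS.basis_def by blast
  thus ?thesis unfolding VS.span_def VS.lincomb_def by blast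
qed

end

context coxeter_interval
begin

section \<open>Antisymmetric vectors\<close>

abbreviation T_carrier :: "('w \<Rightarrow> 'k::field) set" where
  "T_carrier \<equiv> carrier (T_space W w)"

abbreviation Asym :: "'i set \<Rightarrow> ('w \<Rightarrow> 'k::field) set" where
  "Asym \<equiv> left_antisym W w"

abbreviation TM :: "('k::field, 'w \<Rightarrow> 'k) module" where
  "TM \<equiv> T_space W w"

abbreviation SM :: "'i set \<Rightarrow> (('k::field, 'w) operator, ('w \<Rightarrow> 'k) set) module" where
  "SM \<equiv> S_rmod W w"

abbreviation Fm :: "('k::field, 'w) operator set" where
  "Fm \<equiv> F_monoid W w"

abbreviation PM :: "'i set \<Rightarrow> (('k::field, 'w) operator, 'w \<Rightarrow> 'k) module" where
  "PM \<equiv> P_rmod W w"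

lemma T_iff: "f \<in> T_carrier \<longleftrightarrow> (\<forall>u. u \<notin> V \<longrightarrow> f u = 0)"
  by (simp add: T_space_def)

lemma lin_ext_apply: "f \<in> T_carrier \<Longrightarrow> lin_ext W w \<psi> f v = (\<Sum>u\<in>V. f u * \<psi> u v)"
  by (simp add: lin_ext_def)

text \<open>For a fixed z, at most two basis vectors have z in their image under a generator or a
  left reflection. All coefficient formulas below are instances.\<close>

lemma sum_two_deltas:
  assumes "\<And>u. u \<in> V \<Longrightarrow> \<psi> u = (if u = x \<and> P then 1 else 0) + (if u = y \<and> Q then c else 0)"
  shows "(\<Sum>u\<in>V. f u * \<psi> u :: 'k::field) =
    (if x \<in> V \<and> P then f x else 0) + (if y \<in> V \<and> Q then f y * c else 0)"
proof -
  have "(\<Sum>u\<in>V. f u * \<psi> u) =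
      (\<Sum>u\<in>V. (if u = x then (if P then f x else 0) else 0) + (if u = y then (if Q then f y * c else 0) else 0))"
    by (rule sum.cong) (auto simp: assms algebra_simps)
  thus ?thesis using fin_V by (simp add: sum.distrib)
qed

lemma mult_s_eq: "u \<in> G \<Longrightarrow> v \<in> G \<Longrightarrow> i \<in> I \<Longrightarrow> u \<cdot> s i = v \<longleftrightarrow> u = v \<cdot> s i"
  by auto

lemma V_descent: assumes z: "z \<in> V" and i: "i \<in> rdes z" shows "z \<cdot> s i \<in> V"
proof -
  have I: "i \<in> I" using i by (simp add: right_descents_def)
  have zc: "z \<in> G" using V_closed[OF z] .
  have "rle (z \<cdot> s i) (z \<cdot> s i \<cdot> s i)" using rdes_len[OF zc I] i zc I by (subst right_le_mult) auto
  thus ?thesis using V_right_le[OF z] zc I by simp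
qed

lemma pi_apply:
  assumes f: "f \<in> T_carrier" and i: "i \<in> I" and z: "z \<in> V"
  shows "pi_op W w i f z = (if i \<in> rdes z then f z + f (z \<cdot> s i) else 0)"
proof -
  have zc: "z \<in> G" using V_closed[OF z] .
  have "(if i \<in> rdes u then bvec u else if u \<cdot> s i \<in> V then bvec (u \<cdot> s i) else (\<lambda>v. 0)) z =
      (if u = z \<and> i \<in> rdes z then 1 else 0) +
      (if u = z \<cdot> s i \<and> i \<in> rdes z then 1 else 0)" if u: "u \<in> V" for u
    using rdes_mult_s[OF zc i] mult_s_eq[OF V_closed[OF u] zc i] z zc i by (auto simp: bvec_def)
  from sum_two_deltas[OF this, of f] show ?thesis
    unfolding pi_op_def lin_ext_apply[OF f] using z V_descent[OF z] by simp
qed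

lemma pibar_apply:
  assumes f: "f \<in> T_carrier" and i: "i \<in> I" and z: "z \<in> V"
  shows "pibar_op W w i f z = (if i \<notin> rdes z \<and> z \<cdot> s i \<in> V then f z + f (z \<cdot> s i) else 0)"
proof -
  have zc: "z \<in> G" using V_closed[OF z] .
  have "(if u \<cdot> s i \<in> V then if i \<in> rdes u then bvec (u \<cdot> s i) else bvec u else (\<lambda>v. 0)) z =
      (if u = z \<and> (i \<notin> rdes z \<and> z \<cdot> s i \<in> V) then 1 else 0) +
      (if u = z \<cdot> s i \<and> (i \<notin> rdes z \<and> z \<cdot> s i \<in> V) then 1 else 0)" if u: "u \<in> V" for u
    using rdes_mult_s[OF zc i] mult_s_eq[OF V_closed[OF u] zc i] z zc i u by (auto simp: bvec_def)
  from sum_two_deltas[OF this, of f] show ?thesis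
    unfolding pibar_op_def lin_ext_apply[OF f] using z by simp
qed

lemma left_op_apply:
  assumes f: "f \<in> T_carrier" and t: "t \<in> refl" and z: "z \<in> V"
  shows "left_op W w t f z = (if t \<cdot> z \<in> V then f (t \<cdot> z) else - f z)"
proof -
  have zc: "z \<in> G" using V_closed[OF z] .
  have tu: "t \<cdot> u = z \<longleftrightarrow> u = t \<cdot> z" if "u \<in> V" for u
    using refl_cancel[OF t zc] refl_cancel[OF t V_closed[OF that]] by metis
  have "(if t \<cdot> u \<in> V then bvec (t \<cdot> u) else (\<lambda>v. - bvec u v)) z =
      (if u = t \<cdot> z \<and> True then 1 else 0) + (if u = z \<and> t \<cdot> z \<notin> V then - 1 else 0 :: 'k::field)"
    if u: "u \<in> V" for u
  proof -
    show ?thesis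
    proof (cases "t \<cdot> u = z")
      case True
      hence "u = t \<cdot> z" using tu[OF u] by blast
      thus ?thesis using True u z by (simp add: bvec_def)
    next
      case False
      hence ne: "u \<noteq> t \<cdot> z" using tu[OF u] by blast
      show ?thesis
      proof (cases "u = z")
        case True
        thus ?thesis using False ne by (simp add: bvec_def)
      next
        case uz: False
        hence "bvec u z = (0 :: 'k)" "bvec (t \<cdot> u) z = (0 :: 'k)" using False by (simp_all add: bvec_def)
        thus ?thesis using uz ne by simp
      qed
    qed
  qed
  from sum_two_deltas[OF this, of f] show ?thesis
    unfolding left_op_def lin_ext_apply[OF f] using z by simp
qed

lemma reflections_refl:
  assumes J: "J \<subseteq> I" and t: "t \<in> reflections W J" shows "t \<in> refl" "t \<in> par J"
proof -
  obtain a j where a: "a \<in> par J" "j \<in> J" "t = a \<cdot> s j \<cdot> inv a"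
    using t unfolding reflections_def by blast
  show "t \<in> par J"
    unfolding a(3) by (rule par_mult[OF J par_mult[OF J a(1) par_s[OF a(2)]] par_inv[OF J a(1)]])
  have ac: "a \<in> G" "j \<in> I" using par_closed[OF J a(1)] a(2) J by auto
  hence "t = conj (inv a) (s j)" using a(3) by (simp add: conj_def)
  thus "t \<in> refl" using refl_conj[OF s_refl[OF ac(2)], of "inv a"] ac(1) by simp
qed

lemma left_antisym_iff:
  assumes J: "J \<subseteq> I"
  shows "f \<in> Asym J \<longleftrightarrow> f \<in> T_carrier \<and> (\<forall>t\<in>reflections W J. \<forall>z\<in>V. t \<cdot> z \<in> V \<longrightarrow> f (t \<cdot> z) = - f z)"
proof -
  have "left_op W w t f = (\<lambda>u. - f u) \<longleftrightarrow> (\<forall>z\<in>V. t \<cdot> z \<in> V \<longrightarrow> f (t \<cdot> z) = - f z)"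
    if f: "f \<in> T_carrier" and t: "t \<in> reflections W J" for t
  proof
    assume eq: "left_op W w t f = (\<lambda>u. - f u)"
    show "\<forall>z\<in>V. t \<cdot> z \<in> V \<longrightarrow> f (t \<cdot> z) = - f z"
    proof (intro ballI impI)
      fix z assume "z \<in> V" "t \<cdot> z \<in> V"
      thus "f (t \<cdot> z) = - f z"
        using left_op_apply[OF f reflections_refl(1)[OF J t], of z] eq by simp
    qed
  next
    assume h: "\<forall>z\<in>V. t \<cdot> z \<in> V \<longrightarrow> f (t \<cdot> z) = - f z"
    show "left_op W w t f = (\<lambda>u. - f u)"
    proof
      fix z show "left_op W w t f z = - f z"
      proof (cases "z \<in> V")
        case True
        thus ?thesis using left_op_apply[OF f reflections_refl(1)[OF J t] True] h by simp
      next
        case False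
        hence "(\<Sum>u\<in>V. f u * (if t \<cdot> u \<in> V then bvec (t \<cdot> u) else (\<lambda>v. - bvec u v)) z) = 0"
          by (intro sum.neutral) (auto simp: bvec_def)
        thus ?thesis unfolding left_op_def lin_ext_apply[OF f] using f False by (simp add: T_iff)
      qed
    qed
  qed
  thus ?thesis by (auto simp: left_antisym_def)
qed

lemma left_antisym_T: "f \<in> Asym J \<Longrightarrow> f \<in> T_carrier"
  by (simp add: left_antisym_def)

lemma left_antisym_anti: "J \<subseteq> J' \<Longrightarrow> J' \<subseteq> I \<Longrightarrow> Asym J' \<subseteq> Asym J"
  using par_mono[of J J'] by (auto simp: left_antisym_def reflections_def) blast

lemma left_antisym_empty: "Asym {} = T_carrier"
  by (auto simp: left_antisym_def reflections_def)

text \<open>Remove the letters of a from the right: for a = c s_j, the product structure keeps c x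
  in the interval, and a x = t c x with t = c s_j c^{-1}. These t are general reflections of W_J,
  and antisymmetry under all of them is what fixes f on the coset.\<close>

lemma left_antisym_coset:
  assumes J: "J \<in> RB" and f: "f \<in> Asym J" and x: "lmin J x"
  shows "a \<in> par J \<Longrightarrow> a \<cdot> x \<in> V \<Longrightarrow> f (a \<cdot> x) = (- 1) ^ l a * f x"
proof -
  obtain K where K: "blk w J K" using J RB_iff by blast
  obtain b where b: "b \<in> par J" "w = b \<cdot> cut J" using block_factor[OF K] by metis
  note JI = RB_cut(4)[OF J] and fac = V_factor[OF K _ x b]
  have xc: "x \<in> G" using x by (simp add: lmin_def)
  have "red xs a \<Longrightarrow> a \<in> par J \<Longrightarrow> a \<cdot> x \<in> V \<Longrightarrow> f (a \<cdot> x) = (- 1) ^ l a * f x" for xs a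
  proof (induction xs arbitrary: a rule: rev_induct)
    case Nil
    hence "a = \<one>" using reduced_closed[OF Nil(1)] by simp
    thus ?case using xc by simp
  next
    case (snoc j xs)
    let ?c = "wp xs"
    have letters: "xs @ [j] \<in> lists J" using par_letters[OF JI snoc.prems(1,2)] .
    hence j: "j \<in> J" "j \<in> I" "xs \<in> lists J" using JI by auto
    have xsI: "xs \<in> lists I" using j(3) JI by (rule subsetD[OF lists_mono, rotated])
    note red = reduced_appendD[OF snoc.prems(1)]
    have sj: "wp [j] = s j" using j by simp
    have c: "?c \<in> par J" using par_word[OF JI] j(3) by blast
    have cc: "?c \<in> G" using par_closed[OF JI c] .
    have a1: "a = ?c \<cdot> s j" and "l a = l ?c + l (s j)" using red unfolding sj by blast+
    hence "l a = Suc (l ?c)" using j(2) len_s by simp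
    note a = a1 this
    have ca: "rle ?c a"
      unfolding a(1) right_le_mult[OF cc s_closed[OF j(2)]] a(2)[unfolded a(1)] using j(2) by simp
    have cV: "?c \<cdot> x \<in> V"
      using fac[OF c] fac[OF snoc.prems(2)] snoc.prems(3) right_le_trans[OF ca] by blast
    let ?t = "?c \<cdot> s j \<cdot> inv ?c"
    have t: "?t \<in> reflections W J" using c j(1) unfolding reflections_def by blast
    have tc: "?t \<cdot> (?c \<cdot> x) = a \<cdot> x" using a cc j(2) xc by (simp add: m_assoc)
    have "f (a \<cdot> x) = - f (?c \<cdot> x)"
      using f t cV snoc.prems(3) unfolding left_antisym_iff[OF JI] tc[symmetric] by blast
    also have "\<dots> = - ((- 1) ^ l ?c * f x)" using snoc.IH[of ?c] red c cV by simp
    finally show ?case using a(2) by simp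
  qed
  thus "a \<in> par J \<Longrightarrow> a \<cdot> x \<in> V \<Longrightarrow> f (a \<cdot> x) = (- 1) ^ l a * f x"
    using reduced_exists par_closed[OF JI] by blast
qed

text \<open>The basis of \<open>T\<^sub>w\<close> adapted to the subspaces \<open>P\<^sub>J\<close>.\<close>

definition bas :: "'w \<Rightarrow> 'w \<Rightarrow> 'k::field" where
  "bas u z = (if z \<in> V \<and> (\<exists>a\<in>par (JJ u). z = a \<cdot> u) then (- 1) ^ (l z + l u) else 0)"

lemma JJ_props: assumes "u \<in> V" shows "JJ u \<in> RB" "lmin (JJ u) u" "JJ u \<subseteq> I"
  using block_of[OF assms] RB_cut(4) by auto

lemma bas_self: "u \<in> V \<Longrightarrow> bas u u = 1"
proof -
  assume u: "u \<in> V"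
  have "\<exists>a\<in>par (JJ u). u = a \<cdot> u"
    using par_one[OF JJ_props(3)[OF u]] V_closed[OF u] by (metis l_one)
  thus ?thesis using u by (simp add: bas_def power_add power_mult_distrib[symmetric])
qed

text \<open>By minimality, u is the shortest element of W_J(u) u; so \<open>bas\<close> is
  unitriangular with respect to length, and linear independence is immediate.\<close>

lemma bas_nonzero:
  assumes u: "u \<in> V" and nz: "bas u z \<noteq> 0" shows "z = u \<or> l u < l z"
proof -
  note JJ = JJ_props[OF u]
  obtain a where a: "a \<in> par (JJ u)" "z = a \<cdot> u" using nz by (auto simp: bas_def split: if_splits)
  have ac: "a \<in> G" using par_closed[OF JJ(3) a(1)] .
  have "l z = l a + l u" using lmin_len[OF JJ(3) a(1) JJ(2)] a(2) by simp
  thus ?thesis using a(2) len_eq_0[OF ac] V_closed[OF u] by (cases "l a = 0") auto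
qed

lemma bas_T: "bas u \<in> T_carrier"
  by (simp add: T_iff bas_def)

text \<open>A reflection of W_J(u) preserves the coset of u and has odd length, so it reverses the
  sign of every coefficient it moves within the interval.\<close>

lemma bas_antisym: assumes u: "u \<in> V" shows "bas u \<in> Asym (JJ u)"
proof -
  note JJ = JJ_props[OF u]
  have "bas u (t \<cdot> z) = - (bas u z :: 'k::field)"
    if t: "t \<in> reflections W (JJ u)" and z: "z \<in> V" "t \<cdot> z \<in> V" for t z
  proof -
    note tr = reflections_refl[OF JJ(3) t]
    have zc: "z \<in> G" using V_closed[OF z(1)] .
    have uc: "u \<in> G" using V_closed[OF u] .
    have coset: "(\<exists>a\<in>par (JJ u). t \<cdot> z = a \<cdot> u) \<longleftrightarrow> (\<exists>a\<in>par (JJ u). z = a \<cdot> u)"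
    proof
      assume "\<exists>a\<in>par (JJ u). t \<cdot> z = a \<cdot> u"
      then obtain a where a: "a \<in> par (JJ u)" "t \<cdot> z = a \<cdot> u" by blast
      hence "z = (t \<cdot> a) \<cdot> u"
        using refl_cancel[OF tr(1) zc] par_closed[OF JJ(3) a(1)] uc refl_closed[OF tr(1)]
        by (metis m_assoc)
      thus "\<exists>a\<in>par (JJ u). z = a \<cdot> u" using par_mult[OF JJ(3) tr(2) a(1)] by blast
    next
      assume "\<exists>a\<in>par (JJ u). z = a \<cdot> u"
      then obtain a where a: "a \<in> par (JJ u)" "z = a \<cdot> u" by blast
      hence "t \<cdot> z = (t \<cdot> a) \<cdot> u"
        using par_closed[OF JJ(3) a(1)] uc refl_closed[OF tr(1)] by (simp add: m_assoc)
      thus "\<exists>a\<in>par (JJ u). t \<cdot> z = a \<cdot> u" using par_mult[OF JJ(3) tr(2) a(1)] by blast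
    qed
    have par: "even (l (t \<cdot> z)) \<longleftrightarrow> odd (l z)"
      using len_parity[OF refl_closed[OF tr(1)] zc] len_refl_odd[OF tr(1)] by simp
    have "(- 1) ^ (l (t \<cdot> z) + l u) = - ((- 1) ^ (l z + l u) :: 'k)"
      using par by (cases "even (l z)"; cases "even (l u)") (simp_all add: power_add)
    thus ?thesis unfolding bas_def coset using z by simp
  qed
  thus ?thesis unfolding left_antisym_iff[OF JJ(3)] using bas_T by blast
qed

definition comb :: "('w \<Rightarrow> 'k) \<Rightarrow> 'w \<Rightarrow> 'k::field" where
  "comb c = (\<lambda>z. \<Sum>u\<in>V. c u * bas u z)"

lemma comb_T: "comb c \<in> T_carrier"
  by (simp add: T_iff comb_def bas_def)

lemma left_antisym_add: "f \<in> Asym J \<Longrightarrow> g \<in> Asym J \<Longrightarrow> J \<subseteq> I \<Longrightarrow> (\<lambda>z. f z + g z) \<in> Asym J"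
  by (simp add: left_antisym_iff T_iff)

lemma left_antisym_smult: "f \<in> Asym J \<Longrightarrow> J \<subseteq> I \<Longrightarrow> (\<lambda>z. c * f z) \<in> Asym J"
  by (simp add: left_antisym_iff T_iff)

lemma left_antisym_sum: "finite S \<Longrightarrow> (\<And>x. x \<in> S \<Longrightarrow> f x \<in> Asym J) \<Longrightarrow> J \<subseteq> I \<Longrightarrow>
    (\<lambda>z. \<Sum>x\<in>S. f x z) \<in> Asym J"
proof (induction S rule: finite_induct)
  case empty
  thus ?case by (simp add: left_antisym_iff T_iff)
next
  case (insert x S)
  thus ?case using left_antisym_add[of "f x" J "\<lambda>z. \<Sum>x\<in>S. f x z"] by simp
qed

lemma comb_antisym:
  assumes J: "J \<subseteq> I" and c: "\<And>u. u \<in> V \<Longrightarrow> c u \<noteq> 0 \<Longrightarrow> J \<subseteq> JJ u"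
  shows "comb c \<in> Asym J"
  unfolding comb_def
proof (rule left_antisym_sum[OF fin_V _ J])
  fix u assume u: "u \<in> V"
  show "(\<lambda>z. c u * bas u z) \<in> Asym J"
  proof (cases "c u = 0")
    case True
    thus ?thesis using J by (simp add: left_antisym_iff T_iff)
  next
    case False
    hence "bas u \<in> Asym J"
      using left_antisym_anti[OF c[OF u False] JJ_props(3)[OF u]] bas_antisym[OF u] by blast
    thus ?thesis by (rule left_antisym_smult[OF _ J])
  qed
qed

text \<open>Descending induction on the smallest length of an element of the support.\<close>

lemma left_antisym_comb:
  assumes J: "J \<in> RB" and f: "f \<in> Asym J"
  shows "\<exists>c. (\<forall>u. u \<notin> V \<or> \<not> J \<subseteq> JJ u \<longrightarrow> c u = 0) \<and> f = comb c"
proof -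
  note JI = RB_cut(4)[OF J]
  have "\<exists>c. (\<forall>u. u \<notin> V \<or> \<not> J \<subseteq> JJ u \<longrightarrow> c u = 0) \<and> f = comb c"
    if "f \<in> Asym J" "\<And>z. z \<in> V \<Longrightarrow> l z + k \<le> l w \<Longrightarrow> f z = 0" for f :: "'w \<Rightarrow> 'k::field" and k using that
  proof (induction k arbitrary: f)
    case 0
    have "f z = 0" for z
    proof (cases "z \<in> V")
      case True
      hence "l z \<le> l w" using V_iff right_le_len by fastforce
      thus ?thesis using 0(2)[OF True] by simp
    next
      case False
      thus ?thesis using left_antisym_T[OF 0(1)] by (simp add: T_iff)
    qed
    thus ?case by (intro exI[of _ "\<lambda>u. 0"]) (auto simp: comb_def)
  next
    case (Suc k)
    \<comment> \<open>The coefficients of the shortest layer still alive, l(u) = l(w) - k. Within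
      one layer the vectors \<open>bas u\<close> do not interfere, so adding \<open>comb ?d\<close>
      cancels f exactly there.\<close>
    let ?d = "\<lambda>u. if u \<in> V \<and> J \<subseteq> JJ u \<and> l u + k = l w then - f u else 0"
    let ?g = "\<lambda>z. f z + comb ?d z"
    have "?g z = 0" if z: "z \<in> V" "l z + k \<le> l w" for z
    proof -
      have other: "?d u * bas u z = 0" if u: "u \<in> V" "u \<noteq> z" for u
      proof (cases "?d u = 0")
        case False
        hence "l u + k = l w" by (simp split: if_splits)
        hence "\<not> (z = u \<or> l u < l z)" using z u(2) by auto
        hence "bas u z = (0 :: 'k)" using bas_nonzero[OF u(1)] by blast
        thus ?thesis by simp
      qed simp
      have "comb ?d z = (\<Sum>u\<in>V. if u = z then ?d z else 0)" unfolding comb_def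
      proof (rule sum.cong[OF refl])
        fix u assume u: "u \<in> V"
        show "?d u * bas u z = (if u = z then ?d z else 0)"
        proof (cases "u = z")
          case True
          have "bas z z = (1 :: 'k)" by (rule bas_self[OF z(1)])
          thus ?thesis unfolding True by simp
        next
          case False
          thus ?thesis using other[OF u False] by simp
        qed
      qed
      hence cz: "comb ?d z = ?d z" using z(1) fin_V by simp
      consider "l z + Suc k \<le> l w" | "l z + k = l w" "J \<subseteq> JJ z" | "l z + k = l w" "\<not> J \<subseteq> JJ z"
        using z(2) by fastforce
      thus ?thesis
      proof cases
        case 1
        thus ?thesis using cz Suc.prems(2)[OF z(1)] by simp
      next
        case 2
        thus ?thesis using cz z(1) by simp
      next
        \<comment> \<open>Here z is not minimal for J, so f z is up to sign the value at the
          strictly shorter minimal element of its coset, where f already vanishes.\<close>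
        case 3
        have zc: "z \<in> G" using V_closed[OF z(1)] .
        obtain a y where y: "a \<in> par J" "lmin J y" "z = a \<cdot> y" using lmin_exists[OF JI zc] by blast
        have yc: "y \<in> G" using y(2) by (simp add: lmin_def)
        have "\<not> lmin J z" using 3 block_of(3)[OF z(1) J] by simp
        hence "a \<noteq> \<one>" using y yc by auto
        hence la: "l a > 0" using len_eq_0[OF par_closed[OF JI y(1)]] by auto
        have lz: "l z = l a + l y" using lmin_len[OF JI y(1,2)] y(3) by simp
        have fz: "f z = (- 1) ^ l a * f y"
          using left_antisym_coset[OF J Suc.prems(1) y(2,1)] z(1) y(3) by simp
        have "f y = 0"
        proof (cases "y \<in> V")
          case True
          thus ?thesis using Suc.prems(2)[OF True] lz la z(2) by simp
        next
          case False
          thus ?thesis using left_antisym_T[OF Suc.prems(1)] by (simp add: T_iff)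
        qed
        thus ?thesis using cz 3 fz by simp
      qed
    qed
    moreover have g: "?g \<in> Asym J"
      by (rule left_antisym_add[OF Suc.prems(1) comb_antisym[OF JI] JI]) (auto split: if_splits)
    ultimately obtain c where c: "\<forall>u. u \<notin> V \<or> \<not> J \<subseteq> JJ u \<longrightarrow> c u = 0" "?g = comb c"
      using Suc.IH[of ?g] by blast
    have "f z = comb (\<lambda>u. c u - ?d u) z" for z
    proof -
      have "f z + comb ?d z = comb c z" using fun_cong[OF c(2), of z] by simp
      hence "f z = comb c z - comb ?d z" by (rule iffD2[OF eq_diff_eq])
      thus ?thesis unfolding comb_def sum_subtractf[symmetric] by (simp add: left_diff_distrib)
    qed
    thus ?case using c(1) by (intro exI[of _ "\<lambda>u. c u - ?d u"]) auto
  qed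
  \<comment> \<open>With k = l(w) + 1 the vanishing hypothesis is empty.\<close>
  from this[OF f, of "Suc (l w)"] show ?thesis by simp
qed

lemma comb_eq_0:
  assumes "comb c = (\<lambda>z. 0)" shows "u \<in> V \<Longrightarrow> c u = 0"
proof (induction "l u" arbitrary: u rule: less_induct)
  case (less u)
  have "c v * bas v u = (if v = u then c u else 0)" if v: "v \<in> V" for v
    using bas_nonzero[OF v, of u] less.hyps[of v] v bas_self[OF less.prems] by auto
  hence "comb c u = (\<Sum>v\<in>V. if v = u then c u else 0)" unfolding comb_def by (rule sum.cong[OF refl])
  thus ?case using less.prems fin_V fun_cong[OF assms, of u] by simp
qed

lemma comb_inj:
  assumes eq: "comb c = comb d" and u: "u \<in> V" shows "c u = d u"
proof -
  have "comb (\<lambda>u. c u - d u) = (\<lambda>z. 0)"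
    using fun_cong[OF eq] by (simp add: comb_def left_diff_distrib sum_subtractf fun_eq_iff)
  thus ?thesis using comb_eq_0[OF _ u] by fastforce
qed

text \<open>Coordinates in the adapted basis. Existence is \<open>left_antisym_comb\<close> for the
  empty block, where P_J is all of T_w; uniqueness on V is unitriangularity.\<close>

definition cf :: "('w \<Rightarrow> 'k::field) \<Rightarrow> 'w \<Rightarrow> 'k" where
  "cf f = (SOME c. (\<forall>u. u \<notin> V \<longrightarrow> c u = 0) \<and> f = comb c)"

lemma cf_props:
  assumes "f \<in> T_carrier" shows "u \<notin> V \<Longrightarrow> cf f u = 0" "comb (cf f) = f"
proof -
  have "\<exists>c. (\<forall>u. u \<notin> V \<longrightarrow> c u = 0) \<and> f = comb c"
    using left_antisym_comb[OF RB_empty, of f] assms by (auto simp: left_antisym_empty)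
  from someI_ex[OF this] show "u \<notin> V \<Longrightarrow> cf f u = 0" "comb (cf f) = f" unfolding cf_def by auto
qed

lemma cf_comb: "u \<in> V \<Longrightarrow> cf (comb c) u = c u"
  by (rule comb_inj[OF cf_props(2)[OF comb_T]])

lemma cf_add: "f \<in> T_carrier \<Longrightarrow> g \<in> T_carrier \<Longrightarrow> cf (\<lambda>z. f z + g z) u = cf f u + cf g u"
proof -
  assume fg: "f \<in> T_carrier" "g \<in> T_carrier"
  hence h: "(\<lambda>z. f z + g z) \<in> T_carrier" by (simp add: T_iff)
  have "comb (cf (\<lambda>z. f z + g z)) = comb (\<lambda>u. cf f u + cf g u)"
    using cf_props(2)[OF h] cf_props(2)[OF fg(1)] cf_props(2)[OF fg(2)]
    by (simp add: comb_def fun_eq_iff distrib_right sum.distrib)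
  from comb_inj[OF this, of u] show ?thesis using cf_props(1)[OF h] cf_props(1)[OF fg(1)] cf_props(1)[OF fg(2)]
    by (cases "u \<in> V") auto
qed

lemma cf_smult: "f \<in> T_carrier \<Longrightarrow> cf (\<lambda>z. c * f z) u = c * cf f u"
proof -
  assume f: "f \<in> T_carrier"
  hence h: "(\<lambda>z. c * f z) \<in> T_carrier" by (simp add: T_iff)
  have "comb (cf (\<lambda>z. c * f z)) z = comb (\<lambda>u. c * cf f u) z" for z
    using fun_cong[OF cf_props(2)[OF h], of z] fun_cong[OF cf_props(2)[OF f], of z]
    by (simp add: comb_def mult.assoc sum_distrib_left[symmetric])
  from comb_inj[OF ext[OF this], of u] show ?thesis using cf_props(1)[OF h] cf_props(1)[OF f]
    by (cases "u \<in> V") auto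
qed

lemma bas_comb: "u \<in> V \<Longrightarrow> bas u = comb (\<lambda>v. if v = u then 1 else 0)"
  using fin_V by (simp add: comb_def fun_eq_iff if_distrib[of "\<lambda>x. x * _"] cong: if_cong)

lemma cf_bas: "u \<in> V \<Longrightarrow> cf (bas u) v = (if v = u then 1 else 0)"
  by (cases "v \<in> V") (auto simp: bas_comb cf_comb cf_props(1)[OF comb_T])

text \<open>One basis serves all blocks at once, because its definition uses the largest block of u
  and a vector antisymmetric for a larger block is so for a smaller one.\<close>

lemma antisym_iff_cf:
  assumes J: "J \<in> RB" and f: "f \<in> T_carrier"
  shows "f \<in> Asym J \<longleftrightarrow> (\<forall>u\<in>V. \<not> J \<subseteq> JJ u \<longrightarrow> cf f u = 0)"
proof
  assume "f \<in> Asym J"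
  then obtain c where c: "\<forall>u. u \<notin> V \<or> \<not> J \<subseteq> JJ u \<longrightarrow> c u = 0" "f = comb c"
    using left_antisym_comb[OF J] by blast
  thus "\<forall>u\<in>V. \<not> J \<subseteq> JJ u \<longrightarrow> cf f u = 0" by (simp add: cf_comb)
next
  assume "\<forall>u\<in>V. \<not> J \<subseteq> JJ u \<longrightarrow> cf f u = 0"
  hence "comb (cf f) \<in> Asym J" by (intro comb_antisym RB_cut(4)[OF J]) blast
  thus "f \<in> Asym J" using cf_props(2)[OF f] by simp
qed


section \<open>The stabiliser of the antisymmetric subspaces\<close>

abbreviation EA :: "('k::field, ('k, 'w) operator) module" where
  "EA \<equiv> endo_algebra TM"

lemma T_ops [simp]: "x \<oplus>\<^bsub>TM\<^esub> y = (\<lambda>z. x z + y z)" "\<zero>\<^bsub>TM\<^esub> = (\<lambda>z. 0)"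
  "c \<odot>\<^bsub>TM\<^esub> x = (\<lambda>z. c * x z)"
  by (simp_all add: T_space_def)

lemma T_closed [simp]: "x \<in> T_carrier \<Longrightarrow> y \<in> T_carrier \<Longrightarrow> (\<lambda>z. x z + y z) \<in> T_carrier"
  "(\<lambda>z. 0) \<in> T_carrier" "x \<in> T_carrier \<Longrightarrow> (\<lambda>z. c * x z) \<in> T_carrier"
  "x \<in> T_carrier \<Longrightarrow> (\<lambda>z. - x z) \<in> T_carrier"
  by (simp_all add: T_iff)

lemma EA_iff: "f \<in> carrier EA \<longleftrightarrow> f \<in> extensional T_carrier \<and> (\<forall>x\<in>T_carrier. f x \<in> T_carrier) \<and>
    (\<forall>x\<in>T_carrier. \<forall>y\<in>T_carrier. f (\<lambda>z. x z + y z) = (\<lambda>z. f x z + f y z)) \<and>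
    (\<forall>c. \<forall>x\<in>T_carrier. f (\<lambda>z. c * x z) = (\<lambda>z. c * f x z))"
  by (auto simp: endo_algebra_def PiE_def Pi_def)

lemma EA_D:
  assumes "f \<in> carrier EA" "x \<in> T_carrier"
  shows "f x \<in> T_carrier" "y \<in> T_carrier \<Longrightarrow> f (\<lambda>z. x z + y z) = (\<lambda>z. f x z + f y z)"
    "f (\<lambda>z. c * x z) = (\<lambda>z. c * f x z)"
  using assms unfolding EA_iff by blast+

lemma EA_apply: "x \<in> T_carrier \<Longrightarrow> (f \<oplus>\<^bsub>EA\<^esub> g) x = (\<lambda>z. f x z + g x z)"
  "x \<in> T_carrier \<Longrightarrow> (f \<otimes>\<^bsub>EA\<^esub> g) x = g (f x)" "x \<in> T_carrier \<Longrightarrow> \<one>\<^bsub>EA\<^esub> x = x"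
  "x \<in> T_carrier \<Longrightarrow> \<zero>\<^bsub>EA\<^esub> x = (\<lambda>z. 0)" "x \<in> T_carrier \<Longrightarrow> (c \<odot>\<^bsub>EA\<^esub> f) x = (\<lambda>z. c * f x z)"
  by (simp_all add: endo_algebra_def compose_def)

lemma EA_eqI:
  assumes "f \<in> carrier EA" "g \<in> carrier EA" "\<And>x. x \<in> T_carrier \<Longrightarrow> f x = g x" shows "f = g"
  using assms by (intro extensionalityI[of f T_carrier g]) (auto simp: EA_iff)

lemma EA_ext: "f \<oplus>\<^bsub>EA\<^esub> g \<in> extensional T_carrier" "f \<otimes>\<^bsub>EA\<^esub> g \<in> extensional T_carrier"
  "\<one>\<^bsub>EA\<^esub> \<in> extensional T_carrier" "\<zero>\<^bsub>EA\<^esub> \<in> extensional T_carrier" "c \<odot>\<^bsub>EA\<^esub> f \<in> extensional T_carrier"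
  by (simp_all add: endo_algebra_def compose_def)

lemma EA_closed:
  "f \<in> carrier EA \<Longrightarrow> g \<in> carrier EA \<Longrightarrow> f \<oplus>\<^bsub>EA\<^esub> g \<in> carrier EA"
  "f \<in> carrier EA \<Longrightarrow> g \<in> carrier EA \<Longrightarrow> f \<otimes>\<^bsub>EA\<^esub> g \<in> carrier EA"
  "\<one>\<^bsub>EA\<^esub> \<in> carrier EA" "\<zero>\<^bsub>EA\<^esub> \<in> carrier EA" "f \<in> carrier EA \<Longrightarrow> c \<odot>\<^bsub>EA\<^esub> f \<in> carrier EA"
proof -
  show "f \<in> carrier EA \<Longrightarrow> g \<in> carrier EA \<Longrightarrow> f \<oplus>\<^bsub>EA\<^esub> g \<in> carrier EA"
    by (subst EA_iff) (simp add: EA_ext EA_apply EA_D algebra_simps)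
  show "f \<in> carrier EA \<Longrightarrow> g \<in> carrier EA \<Longrightarrow> f \<otimes>\<^bsub>EA\<^esub> g \<in> carrier EA"
    by (subst EA_iff) (simp add: EA_ext EA_apply EA_D)
  show "\<one>\<^bsub>EA\<^esub> \<in> carrier EA" "\<zero>\<^bsub>EA\<^esub> \<in> carrier EA" by (subst EA_iff, simp add: EA_ext EA_apply)+
  show "f \<in> carrier EA \<Longrightarrow> c \<odot>\<^bsub>EA\<^esub> f \<in> carrier EA"
    by (subst EA_iff) (simp add: EA_ext EA_apply EA_D algebra_simps)
qed

lemma ring_EA: "ring (EA :: ('k::field, ('k, 'w) operator) module)"
proof (rule ringI)
  show "abelian_group (EA :: ('k, ('k, 'w) operator) module)"
  proof (rule abelian_groupI)
    fix f :: "('k, 'w) operator" assume f: "f \<in> carrier EA"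
    have "(- 1 \<odot>\<^bsub>EA\<^esub> f) \<oplus>\<^bsub>EA\<^esub> f = \<zero>\<^bsub>EA\<^esub>"
      by (rule EA_eqI) (use f in \<open>simp_all add: EA_closed EA_apply\<close>)
    thus "\<exists>g\<in>carrier EA. g \<oplus>\<^bsub>EA\<^esub> f = \<zero>\<^bsub>EA\<^esub>" using EA_closed(5)[OF f] by blast
  qed (auto intro!: EA_eqI EA_closed simp: EA_apply add.assoc add.commute)
  show "monoid (EA :: ('k, ('k, 'w) operator) module)"
    by (rule monoidI) (auto intro!: EA_eqI EA_closed simp: EA_apply EA_D)
qed (auto intro!: EA_eqI EA_closed simp: EA_apply EA_D)

lemma EA_uminus: assumes f: "f \<in> carrier EA" shows "\<ominus>\<^bsub>EA\<^esub> f = - 1 \<odot>\<^bsub>EA\<^esub> f"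
proof -
  interpret EA: ring EA by (rule ring_EA)
  have "(- 1 \<odot>\<^bsub>EA\<^esub> f) \<oplus>\<^bsub>EA\<^esub> f = \<zero>\<^bsub>EA\<^esub>"
    by (rule EA_eqI) (use f in \<open>simp_all add: EA_closed EA_apply\<close>)
  thus ?thesis by (rule EA.minus_equality) (use f in \<open>simp_all add: EA_closed\<close>)
qed

lemma subalgebra_ring:
  assumes B: "is_subalgebra B EA" shows "ring (EA\<lparr>carrier := B\<rparr>)"
proof -
  interpret EA: ring EA by (rule ring_EA)
  have c: "f \<in> B \<Longrightarrow> f \<in> carrier EA" for f using B by (auto simp: is_subalgebra_def)
  have neg: "\<exists>g\<in>B. g \<oplus>\<^bsub>EA\<^esub> f = \<zero>\<^bsub>EA\<^esub>" if f: "f \<in> B" for f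
    using B f EA_uminus[OF c[OF f]] EA.l_neg[OF c[OF f]] unfolding is_subalgebra_def
    by (intro bexI[of _ "- 1 \<odot>\<^bsub>EA\<^esub> f"]) simp_all
  have zero: "\<zero>\<^bsub>EA\<^esub> \<in> B" using neg[of "\<one>\<^bsub>EA\<^esub>"] B unfolding is_subalgebra_def by metis
  show ?thesis
  proof (rule ringI)
    show "abelian_group (EA\<lparr>carrier := B\<rparr>)"
      by (rule abelian_groupI) (use B c zero neg in \<open>auto simp: is_subalgebra_def EA.a_assoc EA.a_comm EA.a_lcomm\<close>)
    show "monoid (EA\<lparr>carrier := B\<rparr>)"
      by (rule monoidI) (use B c in \<open>auto simp: is_subalgebra_def EA.m_assoc\<close>)
  qed (use c in \<open>auto simp: EA.l_distr EA.r_distr\<close>)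
qed

lemma is_subalgebraD:
  assumes "is_subalgebra B A"
  shows "x \<in> B \<Longrightarrow> y \<in> B \<Longrightarrow> x \<oplus>\<^bsub>A\<^esub> y \<in> B" "x \<in> B \<Longrightarrow> y \<in> B \<Longrightarrow> x \<otimes>\<^bsub>A\<^esub> y \<in> B"
    "\<one>\<^bsub>A\<^esub> \<in> B" "x \<in> B \<Longrightarrow> c \<odot>\<^bsub>A\<^esub> x \<in> B"
  using assms unfolding is_subalgebra_def by blast+

lemma generated_subalgebra_least:
  "is_subalgebra B A \<Longrightarrow> X \<subseteq> B \<Longrightarrow> generated_subalgebra A X \<subseteq> B"
  by (auto simp: generated_subalgebra_def)

lemma generated_subalgebra_subalgebra:
  assumes "is_subalgebra B A" "X \<subseteq> B"
  shows "is_subalgebra (generated_subalgebra A X) A" "X \<subseteq> generated_subalgebra A X"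
proof -
  show "X \<subseteq> generated_subalgebra A X" by (auto simp: generated_subalgebra_def)
  have mem: "x \<in> generated_subalgebra A X \<longleftrightarrow> (\<forall>C. is_subalgebra C A \<and> X \<subseteq> C \<longrightarrow> x \<in> C)" for x
    by (auto simp: generated_subalgebra_def)
  show "is_subalgebra (generated_subalgebra A X) A"
    unfolding is_subalgebra_def[of "generated_subalgebra A X"]
  proof (intro conjI ballI allI)
    show "generated_subalgebra A X \<subseteq> carrier A"
      using generated_subalgebra_least[OF assms] assms(1) unfolding is_subalgebra_def by blast
    show "\<one>\<^bsub>A\<^esub> \<in> generated_subalgebra A X" unfolding mem by (simp add: is_subalgebra_def)
  next
    fix x y assume "x \<in> generated_subalgebra A X" "y \<in> generated_subalgebra A X"
    thus "x \<oplus>\<^bsub>A\<^esub> y \<in> generated_subalgebra A X" "x \<otimes>\<^bsub>A\<^esub> y \<in> generated_subalgebra A X"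
      unfolding mem by (simp_all add: is_subalgebra_def)
  next
    fix c x assume "x \<in> generated_subalgebra A X"
    thus "c \<odot>\<^bsub>A\<^esub> x \<in> generated_subalgebra A X" unfolding mem by (simp add: is_subalgebra_def)
  qed
qed

text \<open>The algebra of all operators stabilising every P_J. Its dimension is read off from
  matrices in the adapted basis; that it equals the generated algebra is only known after
  \<open>triangular_basis\<close>.\<close>

definition St :: "('k::field, 'w) operator set" where
  "St = {f \<in> carrier EA. \<forall>J\<in>RB. f ` Asym J \<subseteq> Asym J}"

lemma St_EA: "f \<in> St \<Longrightarrow> f \<in> carrier EA"
  by (simp add: St_def)

lemma St_antisym: "f \<in> St \<Longrightarrow> J \<in> RB \<Longrightarrow> x \<in> Asym J \<Longrightarrow> f x \<in> Asym J"
  by (auto simp: St_def)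

lemma StI: "f \<in> carrier EA \<Longrightarrow> (\<And>J x. J \<in> RB \<Longrightarrow> x \<in> Asym J \<Longrightarrow> f x \<in> Asym J) \<Longrightarrow> f \<in> St"
  by (auto simp: St_def)

lemma St_subalgebra: "is_subalgebra (St :: ('k::field, 'w) operator set) EA"
  unfolding is_subalgebra_def
proof (intro conjI ballI allI)
  show "\<one>\<^bsub>EA\<^esub> \<in> St" by (rule StI) (simp_all add: EA_closed EA_apply left_antisym_T)
  fix f g :: "('k, 'w) operator" and c assume f: "f \<in> St" and g: "g \<in> St"
  show "f \<oplus>\<^bsub>EA\<^esub> g \<in> St"
    by (rule StI) (use f g in \<open>simp_all add: St_EA EA_closed EA_apply left_antisym_T St_antisym
      left_antisym_add RB_cut(4)\<close>)
  show "f \<otimes>\<^bsub>EA\<^esub> g \<in> St"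
    by (rule StI) (use f g in \<open>simp_all add: St_EA EA_closed EA_apply left_antisym_T St_antisym\<close>)
next
  fix f :: "('k, 'w) operator" and c assume f: "f \<in> St"
  show "c \<odot>\<^bsub>EA\<^esub> f \<in> St"
    by (rule StI) (use f in \<open>simp_all add: St_EA EA_closed EA_apply left_antisym_T St_antisym
      left_antisym_smult RB_cut(4)\<close>)
qed (use St_EA in blast)

lemma lin_ext_EA:
  fixes \<psi> :: "'w \<Rightarrow> 'w \<Rightarrow> 'k::field"
  assumes "\<And>u v. u \<in> V \<Longrightarrow> v \<notin> V \<Longrightarrow> \<psi> u v = 0" shows "lin_ext W w \<psi> \<in> carrier EA"
  unfolding EA_iff
proof (intro conjI ballI allI)
  fix x y :: "'w \<Rightarrow> 'k" assume x: "x \<in> T_carrier"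
  show "lin_ext W w \<psi> x \<in> T_carrier" by (simp add: T_iff lin_ext_apply[OF x] assms)
  assume y: "y \<in> T_carrier"
  show "lin_ext W w \<psi> (\<lambda>z. x z + y z) = (\<lambda>z. lin_ext W w \<psi> x z + lin_ext W w \<psi> y z)"
    by (rule ext) (simp add: x y lin_ext_apply distrib_right sum.distrib)
next
  fix x :: "'w \<Rightarrow> 'k" and c assume x: "x \<in> T_carrier"
  show "lin_ext W w \<psi> (\<lambda>z. c * x z) = (\<lambda>z. c * lin_ext W w \<psi> x z)"
    by (rule ext) (simp add: x lin_ext_apply mult.assoc sum_distrib_left)
qed (simp add: lin_ext_def)

lemma pi_EA: "pi_op W w i \<in> carrier EA"
  unfolding pi_op_def by (rule lin_ext_EA) (auto simp: bvec_def)

lemma pibar_EA: "pibar_op W w i \<in> carrier EA"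
  unfolding pibar_op_def by (rule lin_ext_EA) (auto simp: bvec_def)

text \<open>Deodhar's dichotomy for minimal coset representatives: only the reflection x s_i x^{-1}
  can enter the inversion set, so a left descent j can only arise from s_j x = x s_i.\<close>

lemma lmin_mult_s:
  assumes x: "lmin J x" and i: "i \<in> I"
  shows "lmin J (x \<cdot> s i) \<or> (\<exists>j\<in>J. s j \<cdot> x = x \<cdot> s i)"
proof (rule disjCI)
  have xc: "x \<in> G" using x by (simp add: lmin_def)
  assume n: "\<not> (\<exists>j\<in>J. s j \<cdot> x = x \<cdot> s i)"
  show "lmin J (x \<cdot> s i)" using x xc i n N_mult_s[OF xc i] by (auto simp: lmin_def ldes_def)
qed

text \<open>
  Either right multiplication by \<open>s\<^sub>i\<close> acts on the coset of \<open>z\<close> like a reflection, so that \<open>f\<close>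
  is antisymmetric under it, or it maps the coset to another one, uniformly.
\<close>

lemma antisym_mult_s:
  assumes J: "J \<in> RB" and f: "f \<in> Asym J" and i: "i \<in> I"
    and t: "t \<in> reflections W J" and z: "z \<in> V" "t \<cdot> z \<in> V"
  shows "((z \<cdot> s i \<in> V \<longrightarrow> f (z \<cdot> s i) = - f z) \<and>
      (t \<cdot> z \<cdot> s i \<in> V \<longrightarrow> f (t \<cdot> z \<cdot> s i) = - f (t \<cdot> z))) \<or> ((i \<in> rdes (t \<cdot> z) \<longleftrightarrow> i \<in> rdes z) \<and>
      (t \<cdot> z \<cdot> s i \<in> V \<longleftrightarrow> z \<cdot> s i \<in> V))"
proof -
  note JI = RB_cut(4)[OF J]
  note tr = reflections_refl[OF JI t]
  have zc: "z \<in> G" using V_closed[OF z(1)] .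
  obtain a x where x: "a \<in> par J" "lmin J x" "z = a \<cdot> x" using lmin_exists[OF JI zc] by blast
  have xc: "x \<in> G" using x(2) by (simp add: lmin_def)
  have ac: "a \<in> G" using par_closed[OF JI x(1)] .
  have ta: "t \<cdot> a \<in> par J" by (rule par_mult[OF JI tr(2) x(1)])
  have tz: "t \<cdot> z = (t \<cdot> a) \<cdot> x" using x(3) refl_closed[OF tr(1)] ac xc by (simp add: m_assoc)
  from lmin_mult_s[OF x(2) i] show ?thesis
  proof
    assume m: "lmin J (x \<cdot> s i)"
    obtain K where K: "blk w J K" using J RB_iff by blast
    obtain b where b: "b \<in> par J" "w = b \<cdot> cut J" using block_factor[OF K] by metis
    have des: "i \<in> rdes (c \<cdot> x) \<longleftrightarrow> i \<in> rdes x" if c: "c \<in> par J" for c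
    proof -
      have cc: "c \<in> G" using par_closed[OF JI c] .
      have "l (c \<cdot> x \<cdot> s i) = l c + l (x \<cdot> s i)"
        using lmin_len[OF JI c m] cc xc i by (simp add: m_assoc)
      thus ?thesis using rdes_len[of "c \<cdot> x" i] rdes_len[OF xc i] lmin_len[OF JI c x(2)] cc xc i by auto
    qed
    have V: "c \<cdot> x \<cdot> s i \<in> V \<longleftrightarrow> rle (x \<cdot> s i) (cut J)"
      if c: "c \<in> par J" "c \<cdot> x \<in> V" for c
    proof -
      have "c \<cdot> x \<cdot> s i = c \<cdot> (x \<cdot> s i)" using par_closed[OF JI c(1)] xc i by (simp add: m_assoc)
      thus ?thesis using V_factor[OF K c(1) m b] V_factor[OF K c(1) x(2) b] c(2) by simp
    qed
    have "i \<in> rdes (t \<cdot> z) \<longleftrightarrow> i \<in> rdes z" unfolding tz des[OF ta] unfolding x(3) des[OF x(1)] ..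
    moreover have "t \<cdot> z \<cdot> s i \<in> V \<longleftrightarrow> z \<cdot> s i \<in> V"
      unfolding tz V[OF ta z(2)[unfolded tz]] unfolding x(3) V[OF x(1) z(1)[unfolded x(3)]] ..
    ultimately show ?thesis by blast
  next
    assume "\<exists>j\<in>J. s j \<cdot> x = x \<cdot> s i"
    then obtain j where j: "j \<in> J" "s j \<cdot> x = x \<cdot> s i" by blast
    have anti: "f (c \<cdot> x \<cdot> s i) = - f (c \<cdot> x)"
      if c: "c \<in> par J" "c \<cdot> x \<in> V" "c \<cdot> x \<cdot> s i \<in> V" for c
    proof -
      have cc: "c \<in> G" "j \<in> I" using par_closed[OF JI c(1)] j(1) JI by auto
      let ?r = "c \<cdot> s j \<cdot> inv c"
      have r: "?r \<in> reflections W J" using c(1) j(1) unfolding reflections_def by blast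
      have "?r \<cdot> (c \<cdot> x) = c \<cdot> (s j \<cdot> x)" using cc xc by (simp add: m_assoc)
      hence "?r \<cdot> (c \<cdot> x) = c \<cdot> x \<cdot> s i" using cc xc i j(2) by (simp add: m_assoc)
      thus ?thesis using f r c(2,3) unfolding left_antisym_iff[OF JI] by metis
    qed
    show ?thesis using anti[OF ta] anti[OF x(1)] z x(3) tz by simp
  qed
qed

text \<open>If s_i acts on the coset like a reflection, the two values added by pi_i or its bar
  version cancel, and the result is zero at z and at t z. Otherwise the formulas at z and t z have
  the same shape, and antisymmetry passes through them.\<close>

lemma gens_antisym:
  assumes J: "J \<in> RB" and f: "f \<in> Asym J" and i: "i \<in> I"
  shows "pi_op W w i f \<in> Asym J" "pibar_op W w i f \<in> Asym J"
proof -
  note JI = RB_cut(4)[OF J] and fT = left_antisym_T[OF f]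
  have anti: "f (t \<cdot> z) = - f z" if "t \<in> reflections W J" "z \<in> V" "t \<cdot> z \<in> V" for t z
    using f that unfolding left_antisym_iff[OF JI] by blast
  have assoc: "t \<cdot> z \<cdot> s i = t \<cdot> (z \<cdot> s i)" if t: "t \<in> reflections W J" and z: "z \<in> V" for t z
    using refl_closed[OF reflections_refl(1)[OF JI t]] V_closed[OF z] i by (simp add: m_assoc)
  have "pi_op W w i f (t \<cdot> z) = - pi_op W w i f z \<and> pibar_op W w i f (t \<cdot> z) = - pibar_op W w i f z"
    if t: "t \<in> reflections W J" and z: "z \<in> V" "t \<cdot> z \<in> V" for t z
    using antisym_mult_s[OF J f i t z]
  proof (elim disjE conjE)
    assume 1: "z \<cdot> s i \<in> V \<longrightarrow> f (z \<cdot> s i) = - f z"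
      and 2: "t \<cdot> z \<cdot> s i \<in> V \<longrightarrow> f (t \<cdot> z \<cdot> s i) = - f (t \<cdot> z)"
    show ?thesis using 1 2 V_descent[OF z(1), of i] V_descent[OF z(2), of i]
      by (simp add: pi_apply[OF fT i] pibar_apply[OF fT i] z)
  next
    assume d: "(i \<in> rdes (t \<cdot> z)) = (i \<in> rdes z)"
      and v: "(t \<cdot> z \<cdot> s i \<in> V) = (z \<cdot> s i \<in> V)"
    have "z \<cdot> s i \<in> V \<Longrightarrow> f (t \<cdot> z \<cdot> s i) = - f (z \<cdot> s i)" using anti[OF t] v assoc[OF t z(1)] by simp
    thus ?thesis using d v anti[OF t z] V_descent[OF z(1), of i]
      by (simp add: pi_apply[OF fT i] pibar_apply[OF fT i] z)
  qed
  thus "pi_op W w i f \<in> Asym J" "pibar_op W w i f \<in> Asym J"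
    unfolding left_antisym_iff[OF JI] using EA_D(1)[OF pi_EA fT] EA_D(1)[OF pibar_EA fT] by blast+
qed

lemma gens_St: "pi_op W w ` I \<union> pibar_op W w ` I \<subseteq> St"
  using gens_antisym by (auto intro!: StI pi_EA pibar_EA)

section \<open>Matrices of operators in the adapted basis\<close>

lemma EA_sum:
  assumes f: "f \<in> carrier EA"
  shows "finite S \<Longrightarrow> (\<And>x. x \<in> S \<Longrightarrow> g x \<in> T_carrier) \<Longrightarrow> f (\<lambda>z. \<Sum>x\<in>S. g x z) = (\<lambda>z. \<Sum>x\<in>S. f (g x) z)"
proof (induction S rule: finite_induct)
  case empty
  have "f (\<lambda>z. 0 * (\<lambda>z. 0) z) = (\<lambda>z. 0 * f (\<lambda>z. 0) z)" by (rule EA_D(3)[OF f T_closed(2)])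
  thus ?case by simp
next
  case (insert x S)
  have "(\<lambda>z. \<Sum>x\<in>S. g x z) \<in> T_carrier" using insert.prems by (auto simp: T_iff intro!: sum.neutral)
  from EA_D(2)[OF f _ this, of "g x"] show ?case using insert by simp
qed

lemma cf_sum: "finite S \<Longrightarrow> (\<And>x. x \<in> S \<Longrightarrow> g x \<in> T_carrier) \<Longrightarrow>
    cf (\<lambda>z. \<Sum>x\<in>S. g x z) u = (\<Sum>x\<in>S. cf (g x) u)"
proof (induction S rule: finite_induct)
  case empty
  thus ?case using cf_smult[OF T_closed(2), of 0 u] by simp
next
  case (insert x S)
  have "(\<lambda>z. \<Sum>x\<in>S. g x z) \<in> T_carrier" using insert.prems by (auto simp: T_iff intro!: sum.neutral)
  from cf_add[OF _ this, of "g x"] show ?case using insert by simp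
qed

definition mat :: "('k::field, 'w) operator \<Rightarrow> 'w \<times> 'w \<Rightarrow> 'k" where
  "mat f = (\<lambda>(u, v). if u \<in> V then cf (f (bas u)) v else 0)"

definition Rel :: "('w \<times> 'w) set" where
  "Rel = {(u, v). u \<in> V \<and> v \<in> V \<and> JJ u \<subseteq> JJ v}"

lemma cf_apply:
  assumes f: "f \<in> carrier EA" and x: "x \<in> T_carrier"
  shows "cf (f x) v = (\<Sum>u\<in>V. cf x u * mat f (u, v))"
proof -
  have cl: "(\<lambda>z. cf x u * bas u z) \<in> T_carrier" "f (bas u) \<in> T_carrier" for u
    using T_closed(3)[OF bas_T] EA_D(1)[OF f bas_T] by auto
  have "f x = f (comb (cf x))" using cf_props(2)[OF x] by simp
  also have "\<dots> = (\<lambda>z. \<Sum>u\<in>V. f (\<lambda>z. cf x u * bas u z) z)"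
    unfolding comb_def by (rule EA_sum[OF f fin_V]) (rule cl)
  also have "\<dots> = (\<lambda>z. \<Sum>u\<in>V. cf x u * f (bas u) z)" by (simp add: EA_D(3)[OF f bas_T])
  finally have "cf (f x) v = (\<Sum>u\<in>V. cf (\<lambda>z. cf x u * f (bas u) z) v)"
    using cf_sum[OF fin_V, of "\<lambda>u z. cf x u * f (bas u) z" v] T_closed(3)[OF cl(2)] by simp
  thus ?thesis by (simp add: cf_smult[OF cl(2)] mat_def)
qed

text \<open>The vector \<open>bas u\<close> lies in the subspace for its own block, so its image has
  coordinates only at those v whose block contains that of u.\<close>

lemma mat_zero: assumes "f \<in> St" "p \<notin> Rel" shows "mat f p = 0"
proof (cases p)
  case (Pair u v)
  show ?thesis
  proof (cases "u \<in> V")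
    case True
    note T = EA_D(1)[OF St_EA[OF assms(1)] bas_T]
    have "f (bas u) \<in> Asym (JJ u)"
      by (rule St_antisym[OF assms(1) JJ_props(1)[OF True] bas_antisym[OF True]])
    hence "\<forall>v\<in>V. \<not> JJ u \<subseteq> JJ v \<longrightarrow> cf (f (bas u)) v = 0"
      using antisym_iff_cf[OF JJ_props(1)[OF True] T] by blast
    thus ?thesis using Pair True assms(2) cf_props(1)[OF T] by (auto simp: mat_def Rel_def)
  qed (simp add: Pair mat_def)
qed

lemma mat_inj:
  fixes f g :: "('k::field, 'w) operator"
  assumes f: "f \<in> carrier EA" and g: "g \<in> carrier EA" and eq: "\<And>u v. u \<in> V \<Longrightarrow> v \<in> V \<Longrightarrow> mat f (u, v) = mat g (u, v)"
  shows "f = g"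
proof (rule EA_eqI[OF f g])
  fix x :: "'w \<Rightarrow> 'k" assume x: "x \<in> T_carrier"
  note T = EA_D(1)[OF f x] EA_D(1)[OF g x]
  have "cf (f x) v = cf (g x) v" for v
    using cf_apply[OF f x, of v] cf_apply[OF g x, of v] eq cf_props(1)[OF T(1)] cf_props(1)[OF T(2)]
    by (cases "v \<in> V") simp_all
  hence "comb (cf (f x)) = comb (cf (g x))" by (simp add: comb_def)
  thus "f x = g x" using cf_props(2)[OF T(1)] cf_props(2)[OF T(2)] by simp
qed

lemma comb_add: "comb (\<lambda>u. c u + d u) = (\<lambda>z. comb c z + comb d z)"
  by (simp add: comb_def distrib_right sum.distrib)

lemma comb_smult: "comb (\<lambda>u. k * c u) = (\<lambda>z. k * comb c z)"
  by (simp add: comb_def mult.assoc sum_distrib_left)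

text \<open>The operator is defined by its rows. For a vector of P_J only rows u with J inside the
  block of u occur, and the support condition sends them to v with larger blocks, so P_J is
  preserved.\<close>

lemma mat_surj:
  fixes m :: "'w \<times> 'w \<Rightarrow> 'k::field"
  assumes m: "\<And>p. p \<notin> Rel \<Longrightarrow> m p = 0" shows "\<exists>f\<in>St. mat f = m"
proof -
  let ?f = "\<lambda>x\<in>T_carrier. comb (\<lambda>v. \<Sum>u\<in>V. cf x u * m (u, v))"
  have f: "?f \<in> carrier EA" unfolding EA_iff
    by (simp add: comb_T cf_add cf_smult distrib_right sum.distrib comb_add
      mult.assoc sum_distrib_left[symmetric] comb_smult)
  have "?f \<in> St"
  proof (rule StI[OF f])
    fix J and x :: "'w \<Rightarrow> 'k" assume J: "J \<in> RB" and x: "x \<in> Asym J"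
    note xT = left_antisym_T[OF x]
    have "cf x u * m (u, v) = 0" if v: "v \<in> V" "\<not> J \<subseteq> JJ v" and u: "u \<in> V" for u v
      using m[of "(u, v)"] antisym_iff_cf[OF J xT] x u v by (auto simp: Rel_def)
    hence z: "(\<Sum>u\<in>V. cf x u * m (u, v)) = 0" if "v \<in> V" "\<not> J \<subseteq> JJ v" for v
      using that by (intro sum.neutral) blast
    have "comb (\<lambda>v. \<Sum>u\<in>V. cf x u * m (u, v)) \<in> Asym J"
      by (rule comb_antisym[OF RB_cut(4)[OF J]]) (use z in blast)
    thus "?f x \<in> Asym J" using xT by simp
  qed
  moreover have "mat ?f p = m p" for p
  proof (cases p)
    case (Pair u v)
    show ?thesis
    proof (cases "u \<in> V \<and> v \<in> V")
      case True
      have "cf (bas u) x * m (x, v) = (if x = u then m (u, v) else 0)" for x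
        using True by (simp add: cf_bas)
      thus ?thesis using True Pair fin_V by (simp add: mat_def cf_comb bas_T)
    next
      case False
      thus ?thesis using mat_zero[OF \<open>?f \<in> St\<close>, of p] m[of p] Pair by (auto simp: Rel_def)
    qed
  qed
  ultimately show ?thesis by blast
qed

abbreviation A0 :: "('k::field, ('k, 'w) operator) module" where
  "A0 \<equiv> EA\<lparr>carrier := St\<rparr>"

lemma mat_mult:
  assumes f: "f \<in> carrier EA" and g: "g \<in> carrier EA"
  shows "mat (f \<otimes>\<^bsub>EA\<^esub> g) (u, x) = (\<Sum>v\<in>V. mat f (u, v) * mat g (v, x))"
proof (cases "u \<in> V")
  case True
  thus ?thesis
    using cf_apply[OF g EA_D(1)[OF f bas_T], of u x] by (simp add: mat_def EA_apply bas_T)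
qed (simp add: mat_def)

lemma mat_add: "f \<in> carrier EA \<Longrightarrow> g \<in> carrier EA \<Longrightarrow> mat (f \<oplus>\<^bsub>EA\<^esub> g) p = mat f p + mat g p"
  by (cases p) (simp add: mat_def EA_apply bas_T cf_add EA_D(1)[OF _ bas_T])

lemma mat_smult: "f \<in> carrier EA \<Longrightarrow> mat (c \<odot>\<^bsub>EA\<^esub> f) p = c * mat f p"
  by (cases p) (simp add: mat_def EA_apply bas_T cf_smult EA_D(1)[OF _ bas_T])

lemma preorder_algebra_A0: "preorder_algebra (A0 :: ('k::field, ('k, 'w) operator) module) V Rel mat"
proof (rule preorder_algebra.intro)
  show "ring (A0 :: ('k, ('k, 'w) operator) module)" by (rule subalgebra_ring[OF St_subalgebra])
  have R: "(u, v) \<in> Rel \<Longrightarrow> (v, x) \<in> Rel \<Longrightarrow> (u, x) \<in> Rel" for u v x by (auto simp: Rel_def)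
  thus "(u, v) \<in> Rel \<Longrightarrow> (v, x) \<in> Rel \<Longrightarrow> (u, x) \<in> Rel" for u v x .
  have c: "carrier (pair_algebra Rel) = {m :: 'w \<times> 'w \<Rightarrow> 'k. \<forall>p. p \<notin> Rel \<longrightarrow> m p = 0}"
    by (simp add: pair_algebra_def)
  have mult: "mat (f \<otimes>\<^bsub>EA\<^esub> g) = mat f \<otimes>\<^bsub>pair_algebra Rel\<^esub> mat g"
    if f: "f \<in> St" and g: "g \<in> St" for f g :: "('k, 'w) operator"
  proof
    fix p :: "'w \<times> 'w"
    obtain u x where p: "p = (u, x)" by (cases p)
    show "mat (f \<otimes>\<^bsub>EA\<^esub> g) p = (mat f \<otimes>\<^bsub>pair_algebra Rel\<^esub> mat g) p"
      unfolding p mat_mult[OF St_EA[OF f] St_EA[OF g]]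
      by (rule pair_algebra_mult[symmetric]) (use fin_V mat_zero[OF f] mat_zero[OF g] in \<open>auto simp: c, auto simp: Rel_def\<close>)
  qed
  have one: "mat \<one>\<^bsub>EA\<^esub> = (\<one>\<^bsub>pair_algebra Rel\<^esub> :: 'w \<times> 'w \<Rightarrow> 'k)"
    by (auto simp: fun_eq_iff mat_def pair_algebra_def Rel_def EA_apply bas_T cf_bas)
  have inj: "inj_on mat (St :: ('k, 'w) operator set)"
    by (rule inj_onI) (rule mat_inj, auto intro: St_EA)
  have surj: "m \<in> mat ` St" if "m \<in> carrier (pair_algebra Rel)" for m :: "'w \<times> 'w \<Rightarrow> 'k"
  proof -
    have "\<exists>f\<in>St. mat f = m" by (rule mat_surj) (use that[unfolded c] in blast)
    thus ?thesis by blast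
  qed
  have hom: "mat \<in> Ring.ring_hom A0 (pair_algebra Rel :: ('k, 'w \<times> 'w \<Rightarrow> 'k) module)"
  proof (rule ring_hom_memI)
    show "mat (f \<oplus>\<^bsub>A0\<^esub> g) = mat f \<oplus>\<^bsub>pair_algebra Rel\<^esub> mat g"
      if "f \<in> carrier A0" "g \<in> carrier A0" for f g :: "('k, 'w) operator"
      using that by (simp add: fun_eq_iff mat_add St_EA pair_algebra_def)
  qed (use mult one mat_zero in \<open>auto simp: c\<close>)
  show "mat \<in> ring_iso A0 (pair_algebra Rel :: ('k, 'w \<times> 'w \<Rightarrow> 'k) module)"
    unfolding ring_iso_def bij_betw_def using hom inj surj mat_zero by (auto simp: c)
  show "c \<odot>\<^bsub>A0\<^esub> f \<in> carrier A0" if "f \<in> carrier A0" for c and f :: "('k, 'w) operator"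
    using is_subalgebraD(4)[OF St_subalgebra] that by simp
  show "mat (c \<odot>\<^bsub>A0\<^esub> f) = (\<lambda>p. c * mat f p)" if "f \<in> carrier A0" for c and f :: "('k, 'w) operator"
    using that by (simp add: fun_eq_iff mat_smult St_EA)
qed (use fin_V in \<open>auto simp: Rel_def\<close>)


section \<open>A triangular basis\<close>

abbreviation H :: "('k::field, ('k, 'w) operator) module" where
  "H \<equiv> bihecke W w"

lemma H_eq: "H = EA\<lparr>carrier := carrier H\<rparr>"
  by (simp add: bihecke_def)

lemma H_ops [simp]: "mult H = mult EA" "one H = one EA" "add H = add EA" "zero H = zero EA" "smult H = smult EA"
  by (simp_all add: bihecke_def)

lemma H_subalgebra: "is_subalgebra (carrier H) EA" "pi_op W w ` I \<union> pibar_op W w ` I \<subseteq> carrier H"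
  "carrier H \<subseteq> St"
  using generated_subalgebra_subalgebra[OF St_subalgebra gens_St]
    generated_subalgebra_least[OF St_subalgebra gens_St] by (simp_all add: bihecke_def)

lemma H_closed:
  "f \<in> carrier H \<Longrightarrow> g \<in> carrier H \<Longrightarrow> f \<oplus>\<^bsub>EA\<^esub> g \<in> carrier H"
  "f \<in> carrier H \<Longrightarrow> g \<in> carrier H \<Longrightarrow> f \<otimes>\<^bsub>EA\<^esub> g \<in> carrier H"
  "\<one>\<^bsub>EA\<^esub> \<in> carrier H" "f \<in> carrier H \<Longrightarrow> c \<odot>\<^bsub>EA\<^esub> f \<in> carrier H"
  "i \<in> I \<Longrightarrow> pi_op W w i \<in> carrier H" "i \<in> I \<Longrightarrow> pibar_op W w i \<in> carrier H"
  by (fact is_subalgebraD[OF H_subalgebra(1)] | (rule subsetD[OF H_subalgebra(2)], blast))+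

lemma H_EA: "f \<in> carrier H \<Longrightarrow> f \<in> carrier EA"
  using H_subalgebra(3) St_EA by blast

lemma ring_H: "ring (H :: ('k::field, ('k, 'w) operator) module)"
  using subalgebra_ring[OF H_subalgebra(1)] H_eq by metis

lemma H_uminus: assumes f: "f \<in> carrier H" shows "\<ominus>\<^bsub>H\<^esub> f = - 1 \<odot>\<^bsub>EA\<^esub> f"
proof -
  interpret H: ring H by (rule ring_H)
  have "(- 1 \<odot>\<^bsub>EA\<^esub> f) \<oplus>\<^bsub>EA\<^esub> f = \<zero>\<^bsub>EA\<^esub>"
    by (rule EA_eqI) (use H_EA[OF f] in \<open>simp_all add: EA_closed EA_apply\<close>)
  thus ?thesis using H.minus_equality[of "- 1 \<odot>\<^bsub>EA\<^esub> f" f] H_closed(4)[OF f] f by simp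
qed

lemma s_op_eq: "i \<in> I \<Longrightarrow> s_op W w i = (pi_op W w i \<oplus>\<^bsub>EA\<^esub> pibar_op W w i) \<oplus>\<^bsub>EA\<^esub> (- 1 \<odot>\<^bsub>EA\<^esub> \<one>\<^bsub>EA\<^esub>)"
  by (simp add: s_op_def a_minus_def H_uminus[OF H_closed(3)])

lemma F_monoid_gens:
  "pi_op W w ` I \<union> pibar_op W w ` I \<union> s_op W w ` I \<subseteq> Fm"
  by (auto simp: F_monoid_def generated_submonoid_def)

lemma F_monoid_one: "\<one>\<^bsub>EA\<^esub> \<in> Fm"
  using submonoid.one_closed[of _ H] by (auto simp: F_monoid_def generated_submonoid_def)

lemma F_monoid_mult:
  fixes f g :: "('k::field, 'w) operator"
  assumes fg: "f \<in> Fm" "g \<in> Fm" shows "f \<otimes>\<^bsub>EA\<^esub> g \<in> Fm"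
  unfolding F_monoid_def generated_submonoid_def
proof (rule InterI)
  fix N :: "('k, 'w) operator set"
  assume N: "N \<in> {N. submonoid N H \<and> pi_op W w ` I \<union> pibar_op W w ` I \<union> s_op W w ` I \<subseteq> N}"
  hence "f \<in> N" "g \<in> N" using fg unfolding F_monoid_def generated_submonoid_def by blast+
  hence "f \<otimes>\<^bsub>H\<^esub> g \<in> N" using N submonoid.m_closed[of N H f g] by blast
  thus "f \<otimes>\<^bsub>EA\<^esub> g \<in> N" by simp
qed

lemma F_monoid_H: "Fm \<subseteq> (carrier H :: ('k::field, 'w) operator set)"
proof -
  have "submonoid (carrier H) (H :: ('k, ('k, 'w) operator) module)"
    by (rule submonoid.intro) (simp_all add: H_closed)
  moreover have "s_op W w i \<in> (carrier H :: ('k, 'w) operator set)" if "i \<in> I" for i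
    using that by (simp add: s_op_eq H_closed)
  hence "pi_op W w ` I \<union> pibar_op W w ` I \<union> s_op W w ` I \<subseteq> (carrier H :: ('k, 'w) operator set)"
    by (auto simp: H_closed)
  ultimately show ?thesis unfolding F_monoid_def generated_submonoid_def by blast
qed

lemma bvec_T: "x \<in> V \<Longrightarrow> bvec x \<in> T_carrier"
  by (auto simp: T_iff bvec_def)

lemma lin_ext_bvec: "x \<in> V \<Longrightarrow> lin_ext W w \<psi> (bvec x) = \<psi> x"
proof
  fix v assume x: "x \<in> V"
  have "lin_ext W w \<psi> (bvec x) v = (\<Sum>u\<in>V. if u = x then \<psi> x v else 0)"
    unfolding lin_ext_apply[OF bvec_T[OF x]] by (rule sum.cong) (auto simp: bvec_def)
  thus "lin_ext W w \<psi> (bvec x) v = \<psi> x v" using x fin_V by simp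
qed

text \<open>f acts as p up to signs, with \<open>None\<close> meaning annihilation.\<close>

definition represents :: "('k::field, 'w) operator \<Rightarrow> ('w \<Rightarrow> 'w option) \<Rightarrow> bool" where
  "represents f p \<longleftrightarrow> (\<forall>x\<in>V. (p x = None \<longrightarrow> f (bvec x) = (\<lambda>z. 0)) \<and> (\<forall>y. p x = Some y \<longrightarrow> sends f x y))"

lemma representsI: "(\<And>x. x \<in> V \<Longrightarrow> p x = None \<Longrightarrow> f (bvec x) = (\<lambda>z. 0)) \<Longrightarrow>
    (\<And>x y. x \<in> V \<Longrightarrow> p x = Some y \<Longrightarrow> sends f x y) \<Longrightarrow> represents f p"
  by (simp add: represents_def)

lemma EA_zero_minus:
  assumes f: "f \<in> carrier EA" and x: "x \<in> T_carrier"
  shows "f (\<lambda>z. 0) = (\<lambda>z. 0)" "f (\<lambda>z. - x z) = (\<lambda>z. - f x z)"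
  using EA_D(3)[OF f x, of 0] EA_D(3)[OF f x, of "- 1"] by simp_all

lemma represents_comp:
  assumes f: "f \<in> carrier EA" "represents f p" and p: "pmap p" and g: "g \<in> carrier EA" "represents g q"
  shows "represents (f \<otimes>\<^bsub>EA\<^esub> g) (\<lambda>x. Option.bind (p x) q)"
proof (rule representsI)
  fix x assume x: "x \<in> V"
  have fg: "(f \<otimes>\<^bsub>EA\<^esub> g) (bvec x) = g (f (bvec x))" by (rule EA_apply(2)[OF bvec_T[OF x]])
  note z = EA_zero_minus[OF g(1)]
  {
    assume n: "Option.bind (p x) q = None"
    show "(f \<otimes>\<^bsub>EA\<^esub> g) (bvec x) = (\<lambda>z. 0)"
    proof (cases "p x")
      case None
      hence "f (bvec x) = (\<lambda>z. 0)" using f(2) x by (simp add: represents_def)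
      thus ?thesis using fg z(1)[OF bvec_T[OF x]] by simp
    next
      case (Some y)
      have y: "y \<in> V" using pmap_V[OF p x Some] .
      have "g (bvec y) = (\<lambda>z. 0)" using g(2) n Some y by (simp add: represents_def)
      moreover have "sends f x y" using f(2) x Some by (simp add: represents_def)
      ultimately show ?thesis using fg z(2)[OF bvec_T[OF y]] by (auto simp: sends_def)
    qed
  next
    fix v assume "Option.bind (p x) q = Some v"
    then obtain y where y: "p x = Some y" "q y = Some v" by (cases "p x") auto
    have yV: "y \<in> V" using pmap_V[OF p x y(1)] .
    have "sends f x y" "sends g y v" using f(2) g(2) x y yV by (auto simp: represents_def)
    thus "sends (f \<otimes>\<^bsub>EA\<^esub> g) x v" using fg z(2)[OF bvec_T[OF yV]] by (auto simp: sends_def)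
  }
qed

lemma represents_pi: "i \<in> I \<Longrightarrow> represents (pi_op W w i) (pfun i)"
  by (rule representsI) (auto simp: pi_op_def lin_ext_bvec pfun_def sends_def split: if_splits)

text \<open>Inside the interval, pi_i and its bar version produce x and x s_i between them, and
  subtracting the identity leaves x s_i. Outside, both vanish and -x remains, which is the source of
  the signs.\<close>

lemma represents_s: assumes i: "i \<in> I" shows "represents (s_op W w i) (\<lambda>x. Some (sfun i x))"
proof (rule representsI)
  fix x y assume x: "x \<in> V" and y: "Some (sfun i x) = Some y"
  have "s_op W w i (bvec x) = (\<lambda>z. pi_op W w i (bvec x) z + pibar_op W w i (bvec x) z - bvec x z)"
    by (simp add: s_op_eq[OF i] EA_apply bvec_T[OF x])
  moreover have "i \<in> rdes x \<Longrightarrow> x \<cdot> s i \<in> V" using V_descent[OF x] .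
  ultimately show "sends (s_op W w i) x y"
    using y unfolding sends_def pi_op_def pibar_op_def lin_ext_bvec[OF x] sfun_def
    by (cases "i \<in> rdes x"; cases "x \<cdot> s i \<in> V") (auto simp: fun_eq_iff)
qed simp

lemma pmap_represented: "pmap p \<Longrightarrow> \<exists>f\<in>(Fm :: ('k::field, 'w) operator set). represents f p"
proof (induction rule: pmap.induct)
  case pmap_id
  show ?case
    by (rule bexI[OF _ F_monoid_one]) (auto intro!: representsI simp: EA_apply bvec_T sends_def)
next
  case (pmap_s i)
  thus ?case using represents_s F_monoid_gens by blast
next
  case (pmap_p i)
  thus ?case using represents_pi F_monoid_gens by blast
next
  case (pmap_comp p q)
  then obtain f g :: "('k, 'w) operator" where "f \<in> Fm" "represents f p" "g \<in> Fm" "represents g q" by blast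
  thus ?case using represents_comp[of f p g q] pmap_comp.hyps F_monoid_mult F_monoid_H H_EA by blast
qed

text \<open>The target is identified by the support alone, so the argument is insensitive to the
  sign and also valid in characteristic two.\<close>

lemma sends_nonzero: "sends f x y \<Longrightarrow> f (bvec x) z \<noteq> 0 \<longleftrightarrow> z = y"
  by (auto simp: sends_def bvec_def split: if_splits)

lemma represents_sends:
  assumes f: "represents f p" and x: "x \<in> V" shows "sends f x y \<longleftrightarrow> p x = Some y"
proof
  assume y: "sends f x y"
  hence nz: "f (bvec x) y \<noteq> 0" using sends_nonzero[of f x y y] by simp
  then obtain v where v: "p x = Some v" using f x by (cases "p x") (auto simp: represents_def)
  hence "sends f x v" using f x by (simp add: represents_def)
  hence "y = v" using sends_nonzero[of f x v y] nz by simp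
  thus "p x = Some y" using v by simp
qed (use f x in \<open>simp add: represents_def\<close>)

lemma unique_extremal:
  assumes "v \<in> S" "\<And>y. y \<in> S \<Longrightarrow> r v y" "\<And>y. y \<in> S \<Longrightarrow> r y v \<Longrightarrow> y = v"
  shows "{y \<in> S. \<forall>z\<in>S. r z y \<longrightarrow> z = y} = {v}"
  using assms by blast

lemma tri_triangular:
  assumes f: "represents f p" and p: "pmap p" "tri u v p" and u: "u \<in> V" "v \<in> V"
  shows "triangular W w u v f"
proof -
  have tri: "p u = Some v" "\<And>x y. x \<in> V \<Longrightarrow> p x = Some y \<Longrightarrow> br v y \<and> (y = v \<longrightarrow> br x u)"
    using p(2) by (auto simp: tri_def)
  let ?im = "{y \<in> V. \<exists>x\<in>V. sends f x y}" and ?pre = "{x \<in> V. sends f x v}"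
  have im: "y \<in> ?im \<longleftrightarrow> (\<exists>x\<in>V. p x = Some y)" for y
    using represents_sends[OF f] pmap_V[OF p(1)] by auto
  have pre: "x \<in> ?pre \<longleftrightarrow> x \<in> V \<and> p x = Some v" for x using represents_sends[OF f] by auto
  have b: "brle x y \<longleftrightarrow> br x y" if "x \<in> V" "y \<in> V" for x y
    using bruhat_iff[OF V_closed[OF that(1)] V_closed[OF that(2)]] .
  have 1: "v \<in> ?im" "y \<in> ?im \<Longrightarrow> brle v y" for y
  proof -
    show "v \<in> ?im" using im u tri(1) by blast
    assume y: "y \<in> ?im"
    then obtain x where "x \<in> V" "p x = Some y" using im by blast
    hence "br v y" using tri(2) by blast
    thus "brle v y" using b[OF u(2)] y by blast
  qed
  have 2: "u \<in> ?pre" "x \<in> ?pre \<Longrightarrow> brle x u" for x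
  proof -
    show "u \<in> ?pre" using pre u tri(1) by blast
    assume x: "x \<in> ?pre"
    hence "br x u" using pre tri(2) by blast
    thus "brle x u" using b[OF _ u(1)] x by blast
  qed
  have anti: "x = y" if "brle x y" "brle y x" "x \<in> V" "y \<in> V" for x y
    using that b br_antisym by blast
  have "{y \<in> ?im. \<forall>z\<in>?im. brle z y \<longrightarrow> z = y} = {v}"
    using 1 anti u(2) by (intro unique_extremal) blast+
  moreover have "{x \<in> ?pre. \<forall>z\<in>?pre. brle x z \<longrightarrow> z = x} = {u}"
    using 2 anti u(1) by (intro unique_extremal[where r = "\<lambda>x y. brle y x"]) blast+
  ultimately show ?thesis unfolding triangular_def Let_def by blast
qed

text \<open>
  In a vanishing combination, take a pair with a nonzero coefficient whose second component is
  shortest and, among those, whose first component is longest.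
\<close>

lemma triangular_independent:
  fixes f :: "'w \<times> 'w \<Rightarrow> ('k::field, 'w) operator"
  assumes p: "\<And>q. q \<in> Rel \<Longrightarrow> tri (fst q) (snd q) (p q)" "\<And>q. q \<in> Rel \<Longrightarrow> represents (f q) (p q)"
    and zero: "\<And>u v. u \<in> V \<Longrightarrow> v \<in> V \<Longrightarrow> (\<Sum>q\<in>Rel. c q * f q (bvec u) v) = 0"
  shows "\<forall>q\<in>Rel. c q = 0"
proof (rule ccontr)
  assume "\<not> (\<forall>q\<in>Rel. c q = 0)"
  then obtain q1 where "q1 \<in> Rel \<and> c q1 \<noteq> 0" by blast
  from ex_has_least_nat[where P = "\<lambda>q. q \<in> Rel \<and> c q \<noteq> 0" and m = "\<lambda>q. l (snd q)", OF this]
  obtain q2 where q2: "q2 \<in> Rel" "c q2 \<noteq> 0"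
    "\<And>q. q \<in> Rel \<Longrightarrow> c q \<noteq> 0 \<Longrightarrow> l (snd q2) \<le> l (snd q)" by blast
  have bound: "\<forall>q. q \<in> Rel \<and> c q \<noteq> 0 \<and> l (snd q) = l (snd q2) \<longrightarrow> l (fst q) < Suc (l w)"
  proof (intro allI impI)
    fix q assume "q \<in> Rel \<and> c q \<noteq> 0 \<and> l (snd q) = l (snd q2)"
    hence "rle (fst q) w" using V_iff by (auto simp: Rel_def)
    thus "l (fst q) < Suc (l w)" using right_le_len by fastforce
  qed
  have "q2 \<in> Rel \<and> c q2 \<noteq> 0 \<and> l (snd q2) = l (snd q2)" using q2 by simp
  from ex_has_greatest_nat[OF this bound]
  obtain q0 where q0: "q0 \<in> Rel" "c q0 \<noteq> 0" "l (snd q0) = l (snd q2)"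
    "\<And>q. q \<in> Rel \<Longrightarrow> c q \<noteq> 0 \<Longrightarrow> l (snd q) = l (snd q2) \<Longrightarrow> l (fst q) \<le> l (fst q0)" by blast
  define u v where "u = fst q0" and "v = snd q0"
  have uv: "u \<in> V" "v \<in> V" using q0(1) by (auto simp: u_def v_def Rel_def)
  \<comment> \<open>A contribution at (u, v) forces \<open>snd q\<close> <= v, with equality as v is
    shortest; then u <= \<open>fst q\<close>, with equality as u is longest. So q is the chosen
    pair.\<close>
  have other: "c q * f q (bvec u) v = 0" if q: "q \<in> Rel" "q \<noteq> q0" for q
  proof (rule ccontr)
    assume nz: "c q * f q (bvec u) v \<noteq> 0"
    hence cq: "c q \<noteq> 0" and fq: "f q (bvec u) v \<noteq> 0" by auto
    obtain y where y: "p q u = Some y"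
      using fq p(2)[OF q(1)] uv(1) by (cases "p q u") (auto simp: represents_def)
    hence "sends (f q) u y" using represents_sends[OF p(2)[OF q(1)] uv(1)] by simp
    hence "y = v" using fq by (auto simp: sends_def bvec_def split: if_splits)
    hence b: "br (snd q) v" "v = snd q \<longrightarrow> br u (fst q)"
      using p(1)[OF q(1)] y uv(1) unfolding tri_def by blast+
    have "snd q = v" using br_len[OF b(1)] q2(3)[OF q(1) cq] q0(3) by (auto simp: v_def)
    moreover from this have "u = fst q"
      using br_len[of u "fst q"] b(2) q0(4)[OF q(1) cq] q0(3) by (auto simp: u_def v_def)
    ultimately show False using q(2) by (simp add: u_def v_def prod_eq_iff)
  qed
  have fin: "finite Rel" by (rule finite_subset[of _ "V \<times> V"]) (use fin_V in \<open>auto simp: Rel_def\<close>)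
  have "(\<Sum>q\<in>Rel. c q * f q (bvec u) v) = (\<Sum>q\<in>Rel. if q = q0 then c q0 * f q0 (bvec u) v else 0)"
    by (rule sum.cong) (use other in auto)
  hence "c q0 * f q0 (bvec u) v = 0" using zero[OF uv] fin q0(1) by simp
  hence "f q0 (bvec u) v = 0" using q0(2) by simp
  moreover have "p q0 u = Some v" using p(1)[OF q0(1)] by (simp add: tri_def u_def v_def)
  hence "sends (f q0) u v" using represents_sends[OF p(2)[OF q0(1)] uv(1)] by simp
  ultimately show False by (auto simp: sends_def bvec_def)
qed

text \<open>Passes from vanishing matrix combinations, the form used for counting dimensions, to
  vanishing of operators on vectors, the form in which triangularity is visible.\<close>

lemma mat_independent:
  fixes f :: "'w \<times> 'w \<Rightarrow> ('k::field, 'w) operator"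
  assumes f: "\<And>q. q \<in> Rel \<Longrightarrow> f q \<in> St"
    and zero: "\<And>r. r \<in> Rel \<Longrightarrow> (\<Sum>q\<in>Rel. c q * mat (f q) r) = 0" and x: "x \<in> T_carrier"
  shows "(\<Sum>q\<in>Rel. c q * f q x v) = 0"
proof -
  have fin: "finite Rel" by (rule finite_subset[of _ "V \<times> V"]) (use fin_V in \<open>auto simp: Rel_def\<close>)
  have fx: "f q x \<in> T_carrier" if "q \<in> Rel" for q using EA_D(1)[OF St_EA[OF f[OF that]] x] .
  let ?g = "\<lambda>z. \<Sum>q\<in>Rel. c q * f q x z"
  have all: "(\<Sum>q\<in>Rel. c q * mat (f q) r) = 0" for r
    using zero[of r] mat_zero[OF f, of _ r] by (cases "r \<in> Rel") simp_all
  have g: "?g \<in> T_carrier" using fx by (auto simp: T_iff intro!: sum.neutral)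
  have "cf ?g y = 0" for y
  proof -
    have "cf ?g y = (\<Sum>q\<in>Rel. cf (\<lambda>z. c q * f q x z) y)"
      by (rule cf_sum[OF fin]) (rule T_closed(3)[OF fx])
    also have "\<dots> = (\<Sum>q\<in>Rel. \<Sum>u\<in>V. cf x u * (c q * mat (f q) (u, y)))"
      by (rule sum.cong) (simp_all add: cf_smult fx cf_apply[OF St_EA[OF f] x] sum_distrib_left algebra_simps)
    also have "\<dots> = (\<Sum>u\<in>V. cf x u * (\<Sum>q\<in>Rel. c q * mat (f q) (u, y)))"
      by (subst sum.swap) (simp add: sum_distrib_left)
    finally show ?thesis using all by simp
  qed
  hence "comb (cf ?g) = (\<lambda>z. 0)" by (simp add: comb_def)
  thus ?thesis using fun_cong[OF cf_props(2)[OF g], of v] by simp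
qed

lemma finsum_subalgebra:
  assumes B: "is_subalgebra B EA" "B \<subseteq> St" and S: "finite S" and g: "g ` S \<subseteq> B"
  shows "finsum A0 g S \<in> B"
  using S g
proof (induction S rule: finite_induct)
  interpret A0: ring A0 by (rule subalgebra_ring[OF St_subalgebra])
  case empty
  have "\<zero>\<^bsub>EA\<^esub> \<in> B" using ring.ring_simprules(2)[OF subalgebra_ring[OF B(1)]] by simp
  thus ?case by simp
next
  interpret A0: ring A0 by (rule subalgebra_ring[OF St_subalgebra])
  case (insert x S)
  have "g \<in> S \<rightarrow> carrier A0" "g x \<in> carrier A0" using insert.prems B(2) by auto
  from A0.finsum_insert[OF insert.hyps this] have "finsum A0 g (insert x S) = g x \<oplus>\<^bsub>EA\<^esub> finsum A0 g S"
    by simp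
  moreover have "g x \<in> B" "finsum A0 g S \<in> B" using insert by auto
  ultimately show ?case using is_subalgebraD(1)[OF B(1)] by simp
qed

lemma triangular_basis:
  shows "carrier H = (St :: ('k::field, 'w) operator set)"
    "\<exists>f :: 'w \<times> 'w \<Rightarrow> ('k, 'w) operator. (\<forall>q\<in>Rel. f q \<in> Fm \<and> triangular W w (fst q) (snd q) (f q)) \<and>
       inj_on f Rel \<and> vectorspace.basis class_ring H (f ` Rel)"
    "vectorspace.dim class_ring (H :: ('k, ('k, 'w) operator) module) = card Rel"
proof -
  let ?A = "A0 :: ('k, ('k, 'w) operator) module"
  interpret P: preorder_algebra ?A V Rel mat by (rule preorder_algebra_A0)
  have bij: "bij_betw mat (carrier ?A) {f. \<forall>r. r \<notin> Rel \<longrightarrow> f r = 0}"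
    using P.\<phi>_bij by (simp add: pair_algebra_def)
  note coord = P.fin_R P.abelian_group_axioms P.smult_closed bij P.\<phi>_add fun_cong[OF P.\<phi>_smult]
  have "\<exists>p f. pmap p \<and> tri (fst q) (snd q) p \<and> f \<in> Fm \<and> represents (f :: ('k, 'w) operator) p"
    if "q \<in> Rel" for q
  proof -
    have "\<exists>p. pmap p \<and> tri (fst q) (snd q) p" by (rule tri_exists) (use that in \<open>auto simp: Rel_def\<close>)
    thus ?thesis using pmap_represented by blast
  qed
  then obtain p and f :: "'w \<times> 'w \<Rightarrow> ('k, 'w) operator" where
    p: "\<And>q. q \<in> Rel \<Longrightarrow> pmap (p q)" "\<And>q. q \<in> Rel \<Longrightarrow> tri (fst q) (snd q) (p q)"
      "\<And>q. q \<in> Rel \<Longrightarrow> represents (f q) (p q)" and fF: "\<And>q. q \<in> Rel \<Longrightarrow> f q \<in> Fm" by metis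
  have fH: "f q \<in> carrier H" if "q \<in> Rel" for q using fF[OF that] F_monoid_H by blast
  have fSt: "f q \<in> St" if "q \<in> Rel" for q using fH[OF that] H_subalgebra(3) by blast
  have indep: "\<forall>c. (\<forall>r\<in>Rel. (\<Sum>q\<in>Rel. c q * mat (f q) r) = 0) \<longrightarrow> (\<forall>q\<in>Rel. c q = 0)"
  proof (intro allI impI)
    fix c assume "\<forall>r\<in>Rel. (\<Sum>q\<in>Rel. c q * mat (f q) r) = 0"
    hence "(\<Sum>q\<in>Rel. c q * f q (bvec u) v) = 0" if "u \<in> V" for u v
      by (intro mat_independent[OF fSt _ bvec_T[OF that]]) auto
    thus "\<forall>q\<in>Rel. c q = 0" by (intro triangular_independent[OF p(2,3)]) auto
  qed
  have fA: "f ` Rel \<subseteq> carrier ?A" using fSt by auto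
  show eq: "carrier H = (St :: ('k, 'w) operator set)"
  proof
    show "(St :: ('k, 'w) operator set) \<subseteq> carrier H"
    proof
      fix x :: "('k, 'w) operator" assume "x \<in> St"
      hence x: "x \<in> carrier ?A" by simp
      note comb = coord_combination[where M = ?A and R = Rel and \<phi> = mat and Q = Rel and f = f and x = x]
      obtain a A where A: "A \<subseteq> f ` Rel" "finite A" "x = finsum ?A (\<lambda>v. a v \<odot>\<^bsub>?A\<^esub> v) A"
        using comb[OF coord P.fin_R fA indep refl x] by blast
      have AH: "A \<subseteq> carrier H" using A(1) fH by blast
      have "(\<lambda>v. a v \<odot>\<^bsub>EA\<^esub> v) ` A \<subseteq> carrier H"
        by (rule image_subsetI) (rule H_closed(4), use AH in blast)
      hence "finsum ?A (\<lambda>v. a v \<odot>\<^bsub>EA\<^esub> v) A \<in> carrier H"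
        by (rule finsum_subalgebra[OF H_subalgebra(1) H_subalgebra(3) A(2)])
      thus "x \<in> carrier H" using A(3) by simp
    qed
  qed (rule H_subalgebra(3))
  have HA: "H = ?A" unfolding eq[symmetric] by (rule H_eq)
  show "vectorspace.dim class_ring (H :: ('k, ('k, 'w) operator) module) = card Rel"
    unfolding HA by (rule coord_dim(2)[where R = Rel and \<phi> = mat, OF coord])
  have "inj_on f Rel" "vectorspace.basis class_ring H (f ` Rel)" unfolding HA
    using coord_basis[where M = ?A and R = Rel and \<phi> = mat and Q = Rel and f = f, OF coord P.fin_R fA indep refl]
    by auto
  moreover have "triangular W w (fst q) (snd q) (f q)" if "q \<in> Rel" for q
    by (rule tri_triangular[OF p(3)[OF that] p(1)[OF that] p(2)[OF that]])
      (use that in \<open>auto simp: Rel_def\<close>)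
  ultimately show "\<exists>f :: 'w \<times> 'w \<Rightarrow> ('k, 'w) operator.
      (\<forall>q\<in>Rel. f q \<in> Fm \<and> triangular W w (fst q) (snd q) (f q)) \<and>
       inj_on f Rel \<and> vectorspace.basis class_ring H (f ` Rel)" using fF by blast
qed

lemma H_stabilises:
  "f \<in> carrier H \<Longrightarrow> J \<in> RB \<Longrightarrow> f ` Asym J \<subseteq> Asym J"
  by (simp add: triangular_basis(1) St_def)

lemma H_maximal:
  "is_subalgebra B EA \<Longrightarrow> \<forall>f\<in>B. \<forall>J\<in>RB. f ` Asym J \<subseteq> Asym J \<Longrightarrow> B \<subseteq> carrier H"
  by (auto simp: triangular_basis(1) St_def is_subalgebra_def)

lemma H_A0: "H = (A0 :: ('k::field, ('k, 'w) operator) module)"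
  unfolding triangular_basis(1)[symmetric] by (rule H_eq)

end

section \<open>Incidence algebras\<close>

text \<open>The pair algebra is its own coordinate model, so the identity serves as coordinate
  map.\<close>

lemma preorder_algebra_pair_algebra:
  fixes R :: "('v \<times> 'v) set"
  assumes V: "finite V" "R \<subseteq> V \<times> V" and refl: "\<And>u. u \<in> V \<Longrightarrow> (u, u) \<in> R"
    and trans: "\<And>u v x. (u, v) \<in> R \<Longrightarrow> (v, x) \<in> R \<Longrightarrow> (u, x) \<in> R"
  shows "preorder_algebra (pair_algebra R :: ('k::field, 'v \<times> 'v \<Rightarrow> 'k) module) V R id"
proof (rule preorder_algebra.intro)
  let ?A = "pair_algebra R :: ('k, 'v \<times> 'v \<Rightarrow> 'k) module"
  have c: "f \<in> carrier ?A \<longleftrightarrow> (\<forall>p. p \<notin> R \<longrightarrow> f p = 0)" for f by (simp add: pair_algebra_def)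
  note mult = pair_algebra_mult[OF V]
  have closed: "f \<otimes>\<^bsub>?A\<^esub> g \<in> carrier ?A" if fg: "f \<in> carrier ?A" "g \<in> carrier ?A" for f g unfolding c
  proof (intro allI impI)
    fix p assume p: "p \<notin> R"
    obtain u x where ux: "p = (u, x)" by (cases p)
    have "{v. (u, v) \<in> R \<and> (v, x) \<in> R} = {}" using p trans unfolding ux by blast
    have "(f \<otimes>\<^bsub>?A\<^esub> g) (u, x) = (\<Sum>v | (u, v) \<in> R \<and> (v, x) \<in> R. f (u, v) * g (v, x))"
      by (simp add: pair_algebra_def)
    thus "(f \<otimes>\<^bsub>?A\<^esub> g) p = 0" unfolding \<open>{v. (u, v) \<in> R \<and> (v, x) \<in> R} = {}\<close> ux by simp
  qed
  have one: "\<one>\<^bsub>?A\<^esub> \<in> carrier ?A" unfolding c by (auto simp: pair_algebra_def)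
  have one_apply: "\<one>\<^bsub>?A\<^esub> (u, v) = (if v = u then if u \<in> V then 1 else 0 else 0)" for u v
    using refl V(2) by (auto simp: pair_algebra_def)
  show "ring ?A"
  proof (rule ringI)
    show "abelian_group ?A"
    proof (rule abelian_groupI)
      fix f assume "f \<in> carrier ?A"
      thus "\<exists>g\<in>carrier ?A. g \<oplus>\<^bsub>?A\<^esub> f = \<zero>\<^bsub>?A\<^esub>"
        by (intro bexI[of _ "\<lambda>p. - f p"]) (simp_all add: pair_algebra_def)
    qed (auto simp: pair_algebra_def algebra_simps)
    show "monoid ?A"
    proof (rule monoidI)
      fix f g h assume f: "f \<in> carrier ?A" and g: "g \<in> carrier ?A" and h: "h \<in> carrier ?A"
      show "f \<otimes>\<^bsub>?A\<^esub> g \<otimes>\<^bsub>?A\<^esub> h = f \<otimes>\<^bsub>?A\<^esub> (g \<otimes>\<^bsub>?A\<^esub> h)"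
      proof
        fix p :: "'v \<times> 'v"
        obtain u y where p: "p = (u, y)" by (cases p)
        have "(f \<otimes>\<^bsub>?A\<^esub> g \<otimes>\<^bsub>?A\<^esub> h) p = (\<Sum>v\<in>V. \<Sum>x\<in>V. f (u, x) * (g (x, v) * h (v, y)))"
          using mult[OF closed[OF f g] h] mult[OF f g] by (simp add: p sum_distrib_right mult.assoc)
        also have "\<dots> = (\<Sum>x\<in>V. \<Sum>v\<in>V. f (u, x) * (g (x, v) * h (v, y)))" by (rule sum.swap)
        also have "\<dots> = (f \<otimes>\<^bsub>?A\<^esub> (g \<otimes>\<^bsub>?A\<^esub> h)) p"
          using mult[OF f closed[OF g h]] mult[OF g h] by (simp add: p sum_distrib_left)
        finally show "(f \<otimes>\<^bsub>?A\<^esub> g \<otimes>\<^bsub>?A\<^esub> h) p = (f \<otimes>\<^bsub>?A\<^esub> (g \<otimes>\<^bsub>?A\<^esub> h)) p" .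
      qed
    next
      fix f assume f: "f \<in> carrier ?A"
      have out: "u \<in> V" "v \<in> V" if "f (u, v) \<noteq> 0" for u v using f that V(2) unfolding c by auto
      show "\<one>\<^bsub>?A\<^esub> \<otimes>\<^bsub>?A\<^esub> f = f" "f \<otimes>\<^bsub>?A\<^esub> \<one>\<^bsub>?A\<^esub> = f"
      proof -
        have "(\<one>\<^bsub>?A\<^esub> \<otimes>\<^bsub>?A\<^esub> f) (u, x) = f (u, x)" for u x
        proof -
          have "(\<one>\<^bsub>?A\<^esub> \<otimes>\<^bsub>?A\<^esub> f) (u, x) = (\<Sum>v\<in>V. if v = u then f (u, x) else 0)"
            unfolding mult[OF one f] by (rule sum.cong) (auto simp: one_apply)
          thus ?thesis using V(1) out(1)[of u x] by auto
        qed
        thus "\<one>\<^bsub>?A\<^esub> \<otimes>\<^bsub>?A\<^esub> f = f" by (simp add: fun_eq_iff)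
        have "(f \<otimes>\<^bsub>?A\<^esub> \<one>\<^bsub>?A\<^esub>) (u, x) = f (u, x)" for u x
        proof -
          have "(f \<otimes>\<^bsub>?A\<^esub> \<one>\<^bsub>?A\<^esub>) (u, x) = (\<Sum>v\<in>V. if v = x then f (u, x) else 0)"
            unfolding mult[OF f one] by (rule sum.cong) (auto simp: one_apply)
          thus ?thesis using V(1) out(2)[of u x] by auto
        qed
        thus "f \<otimes>\<^bsub>?A\<^esub> \<one>\<^bsub>?A\<^esub> = f" by (simp add: fun_eq_iff)
      qed
    qed (use closed one in auto)
  qed (auto simp: pair_algebra_def fun_eq_iff algebra_simps sum.distrib)
  show "id \<in> ring_iso ?A (pair_algebra R)" by (auto simp: ring_iso_def intro!: ring_hom_memI closed)
qed (use assms in \<open>auto simp: pair_algebra_def\<close>)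

context coxeter_interval
begin

section \<open>The modules \<open>P\<^sub>J\<close> and \<open>S\<^sub>J\<close>\<close>

lemma T_space_abelian_group: "abelian_group (TM :: ('k::field, 'w \<Rightarrow> 'k) module)"
proof (rule abelian_groupI)
  fix x :: "'w \<Rightarrow> 'k" assume "x \<in> T_carrier"
  thus "\<exists>y\<in>T_carrier. y \<oplus>\<^bsub>TM\<^esub> x = \<zero>\<^bsub>TM\<^esub>"
    by (intro bexI[of _ "\<lambda>z. - x z"]) simp_all
qed (simp_all add: algebra_simps)

lemma T_space_finsum:
  "p \<in> S \<rightarrow> T_carrier \<Longrightarrow> finite S \<Longrightarrow> finsum TM p S = (\<lambda>z. \<Sum>s\<in>S. p s z)"
proof -
  interpret T: abelian_group "TM :: ('b, 'w \<Rightarrow> 'b) module" by (rule T_space_abelian_group)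
  show "p \<in> S \<rightarrow> T_carrier \<Longrightarrow> finite S \<Longrightarrow> finsum TM p S = (\<lambda>z. \<Sum>s\<in>S. p s z)"
    by (rotate_tac, induction S rule: finite_induct) auto
qed

lemma T_zero_iff: "q \<in> T_carrier \<Longrightarrow> q = (\<lambda>z. 0) \<longleftrightarrow> (\<forall>v\<in>V. cf q v = 0)"
proof
  assume q: "q \<in> T_carrier" "q = (\<lambda>z. 0)"
  have "comb (cf q) = (\<lambda>z. 0)" using cf_props(2)[OF q(1)] q(2) by simp
  thus "\<forall>v\<in>V. cf q v = 0" using comb_eq_0 by blast
next
  assume q: "q \<in> T_carrier" and z: "\<forall>v\<in>V. cf q v = 0"
  have "comb (cf q) = (\<lambda>z. 0)" using z by (simp add: comb_def)
  thus "q = (\<lambda>z. 0)" using cf_props(2)[OF q] by simp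
qed

text \<open>Sort the coordinates of q by the block of v. Those with block J' form a vector of P_J',
  so q is a sum from strictly larger blocks exactly when nothing sits at J itself. This makes the
  sum the radical of P_J.\<close>

lemma P_above_eq:
  assumes J: "J \<in> RB"
  shows "P_above W w J = {q \<in> Asym J. \<forall>v\<in>V. JJ v = J \<longrightarrow> cf q v = (0 :: 'k::field)}"
proof -
  define X where "X = {J' \<in> RB. J \<subset> J'}"
  have finX: "finite X" using fin_RB by (simp add: X_def)
  have above: "P_above W w J = {finsum TM p X | p. \<forall>J'\<in>X. p J' \<in> (Asym J' :: ('w \<Rightarrow> 'k) set)}"
    by (simp add: P_above_def X_def Let_def)
  show ?thesis
  proof (intro equalityI subsetI)
    fix q :: "'w \<Rightarrow> 'k" assume "q \<in> P_above W w J"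
    then obtain p where p: "\<forall>J'\<in>X. p J' \<in> (Asym J' :: ('w \<Rightarrow> 'k) set)"
      and q: "q = finsum TM p X" unfolding above by blast
    have pT: "p J' \<in> T_carrier" if "J' \<in> X" for J' using p that left_antisym_T by blast
    hence q': "q = (\<lambda>z. \<Sum>J'\<in>X. p J' z)" unfolding q by (intro T_space_finsum finX) auto
    have "p J' \<in> Asym J" if "J' \<in> X" for J'
      using p that left_antisym_anti[of J J'] RB_cut(4)[of J'] by (auto simp: X_def)
    hence "q \<in> Asym J" unfolding q' by (intro left_antisym_sum finX RB_cut(4)[OF J])
    moreover have "cf q v = 0" if v: "v \<in> V" "JJ v = J" for v
    proof -
      have "cf (p J') v = 0" if J': "J' \<in> X" for J'
        using antisym_iff_cf[of J' "p J'"] p pT[OF J'] J' v by (auto simp: X_def)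
      thus ?thesis unfolding q' using cf_sum[OF finX pT] by simp
    qed
    ultimately show "q \<in> {q \<in> Asym J. \<forall>v\<in>V. JJ v = J \<longrightarrow> cf q v = 0}" by blast
  next
    fix q :: "'w \<Rightarrow> 'k" assume "q \<in> {q \<in> Asym J. \<forall>v\<in>V. JJ v = J \<longrightarrow> cf q v = 0}"
    hence q: "q \<in> Asym J" and z: "\<forall>v\<in>V. JJ v = J \<longrightarrow> cf q v = 0" by auto
    note qT = left_antisym_T[OF q]
    let ?p = "\<lambda>J'. comb (\<lambda>v. if JJ v = J' then cf q v else 0)"
    have p: "?p J' \<in> Asym J'" if "J' \<in> X" for J'
      using that RB_cut(4)[of J'] by (intro comb_antisym) (auto simp: X_def split: if_splits)
    have "(\<Sum>J'\<in>X. ?p J' y) = q y" for y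
    proof -
      have "(\<Sum>J'\<in>X. ?p J' y) = (\<Sum>v\<in>V. \<Sum>J'\<in>X. (if JJ v = J' then cf q v else 0) * bas v y)"
        unfolding comb_def by (rule sum.swap)
      also have "\<dots> = (\<Sum>v\<in>V. cf q v * bas v y)"
      proof (rule sum.cong[OF refl])
        fix v assume v: "v \<in> V"
        have X: "JJ v \<in> X" if "cf q v \<noteq> 0"
          using that z v antisym_iff_cf[OF J qT] q block_of(1)[OF v] by (auto simp: X_def)
        have "(\<Sum>J'\<in>X. (if JJ v = J' then cf q v else 0) * bas v y) =
            (\<Sum>J'\<in>X. if J' = JJ v then cf q v * bas v y else 0)" by (rule sum.cong) auto
        thus "(\<Sum>J'\<in>X. (if JJ v = J' then cf q v else 0) * bas v y) = cf q v * bas v y"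
          using X finX by auto
      qed
      also have "\<dots> = q y" using fun_cong[OF cf_props(2)[OF qT], of y] by (simp add: comb_def)
      finally show ?thesis .
    qed
    moreover have "finsum TM ?p X = (\<lambda>y. \<Sum>J'\<in>X. ?p J' y)"
      by (rule T_space_finsum[OF _ finX]) (simp add: comb_T)
    ultimately have "q = finsum TM ?p X" by (simp add: fun_eq_iff)
    thus "q \<in> P_above W w J" unfolding above using p by blast
  qed
qed

context
  fixes K :: "'k::field itself"
begin

abbreviation HK :: "('k, ('k, 'w) operator) module" where "HK \<equiv> bihecke W w"

interpretation HP: preorder_algebra HK V Rel mat
  unfolding H_A0 by (rule preorder_algebra_A0)

lemma H_act_T: "f \<in> carrier HK \<Longrightarrow> x \<in> T_carrier \<Longrightarrow> f x \<in> T_carrier"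
  using EA_D(1) H_EA by blast

lemma T_rmod_right_module: "right_module HK (T_rmod W w)"
proof (intro right_module.intro right_module_axioms.intro)
  show "ring HK" by (rule ring_H)
  show "abelian_group (T_rmod W w :: (('k, 'w) operator, 'w \<Rightarrow> 'k) module)"
  proof (rule abelian_groupI)
    fix x :: "'w \<Rightarrow> 'k" assume "x \<in> carrier (T_rmod W w)"
    thus "\<exists>y\<in>carrier (T_rmod W w). y \<oplus>\<^bsub>T_rmod W w\<^esub> x = \<zero>\<^bsub>T_rmod W w\<^esub>"
      by (intro bexI[of _ "\<lambda>z. - x z"]) (simp_all add: T_rmod_def)
  qed (simp_all add: T_rmod_def algebra_simps)
qed (simp_all add: T_rmod_def H_act_T EA_apply EA_D(2)[OF H_EA])

lemma P_rmod_right_module: assumes J: "J \<in> RB" shows "right_module HK (PM J)"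
proof -
  interpret T: right_module HK "T_rmod W w" by (rule T_rmod_right_module)
  have "Module.submodule (Asym J) HK (T_rmod W w)"
  proof (rule T.submoduleI)
    show "f \<odot>\<^bsub>T_rmod W w\<^esub> x \<in> Asym J"
      if "f \<in> carrier HK" "x \<in> Asym J" for f and x :: "'w \<Rightarrow> 'k"
      using St_antisym[OF _ J] that triangular_basis(1) by (auto simp: T_rmod_def)
  qed (use RB_cut(4)[OF J] left_antisym_T in \<open>auto simp: T_rmod_def left_antisym_iff\<close>)
  thus ?thesis unfolding P_rmod_def by (rule T.submodule_right_module)
qed

lemma P_ops [simp]: "carrier (PM J) = Asym J"
  "x \<oplus>\<^bsub>PM J\<^esub> y = (\<lambda>z. x z + y z)" "\<zero>\<^bsub>PM J\<^esub> = (\<lambda>z. 0)" "f \<odot>\<^bsub>PM J\<^esub> x = f x"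
  by (simp_all add: P_rmod_def T_rmod_def)

lemma apply_bas: assumes f: "f \<in> carrier HK" and u: "u \<in> V" shows "f (bas u) = comb (\<lambda>v. mat f (u, v))"
proof -
  have "comb (cf (f (bas u))) = f (bas u)" by (rule cf_props(2)[OF H_act_T[OF f bas_T]])
  moreover have "cf (f (bas u)) = (\<lambda>v. mat f (u, v))" using u by (simp add: mat_def)
  ultimately show ?thesis by simp
qed

lemma E_apply: assumes v: "v \<in> V" and q: "q \<in> T_carrier"
  shows "HP.E v v q = (\<lambda>z. 0) \<longleftrightarrow> cf q v = 0"
proof -
  have vv: "(v, v) \<in> Rel" using HP.R_refl[OF v] .
  note E = HP.E_closed[OF vv]
  have "cf (HP.E v v q) y = (if y = v then cf q v else 0)" if "y \<in> V" for y
  proof -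
    have "cf (HP.E v v q) y = (\<Sum>u\<in>V. if u = v then (if y = v then cf q v else 0) else 0)"
      unfolding cf_apply[OF H_EA[OF E] q] by (rule sum.cong) (auto simp: HP.\<phi>_E[OF vv])
    thus ?thesis using v fin_V by simp
  qed
  thus ?thesis using T_zero_iff[OF H_act_T[OF E q]] v by auto
qed

text \<open>An operator sends \<open>bas x\<close> to its matrix row at x. Rows at x are arbitrary
  functions on the v whose block contains that of x, which are the coordinates of P_J; and a
  vanishing row means vanishing multiplication by \<open>E x x\<close>.\<close>

lemma proj_at_P: assumes x: "x \<in> V" shows "HP.proj_at x (PM (JJ x)) (bas x)"
  unfolding HP.proj_at_def
proof (intro conjI ballI impI)
  note J = block_of(1)[OF x]
  have xx: "(x, x) \<in> Rel" using HP.R_refl[OF x] .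
  show "right_module HK (PM (JJ x))" by (rule P_rmod_right_module[OF J])
  show "bas x \<in> carrier (PM (JJ x))" using bas_antisym[OF x] by simp
  show "HP.E x x \<odot>\<^bsub>PM (JJ x)\<^esub> bas x = bas x"
    using apply_bas[OF HP.E_closed[OF xx] x] by (simp add: HP.\<phi>_E[OF xx] bas_comb[OF x])
  fix a assume a: "a \<in> carrier HK"
  show "HP.E x x \<otimes>\<^bsub>HK\<^esub> a = \<zero>\<^bsub>HK\<^esub>" if "a \<odot>\<^bsub>PM (JJ x)\<^esub> bas x = \<zero>\<^bsub>PM (JJ x)\<^esub>"
  proof (rule HP.\<phi>_eq)
    show "HP.E x x \<otimes>\<^bsub>HK\<^esub> a \<in> carrier HK" by (rule HP.m_closed[OF HP.E_closed[OF xx] a])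
    fix u v assume uv: "(u, v) \<in> Rel"
    have "comb (\<lambda>v. mat a (x, v)) = (\<lambda>z. 0)" using apply_bas[OF a x] that by simp
    hence "mat a (x, v) = 0" using comb_eq_0 uv by (auto simp: Rel_def)
    thus "mat (HP.E x x \<otimes>\<^bsub>HK\<^esub> a) (u, v) = mat \<zero>\<^bsub>HK\<^esub> (u, v)"
      using HP.E_mult_left[OF xx a, of u v] HP.\<phi>_zero by simp
  qed (rule HP.zero_closed)
next
  note J = block_of(1)[OF x]
  fix q :: "'w \<Rightarrow> 'k" assume "q \<in> carrier (PM (JJ x))"
  hence q: "q \<in> Asym (JJ x)" by simp
  note qT = left_antisym_T[OF q]
  \<comment> \<open>The matrix whose only nonzero row is the one at x, filled with the coordinates
    of q.\<close>
  let ?m = "\<lambda>(u, v). if u = x then cf q v else 0"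
  have "\<exists>f\<in>St. mat f = ?m"
  proof (rule mat_surj)
    fix p assume "p \<notin> Rel"
    thus "?m p = 0"
      using antisym_iff_cf[OF J qT] q cf_props(1)[OF qT] x by (cases p) (auto simp: Rel_def)
  qed
  then obtain f where f: "f \<in> carrier HK" "mat f = ?m" using triangular_basis(1) by blast
  have "f (bas x) = q" using apply_bas[OF f(1) x] cf_props(2)[OF qT] by (simp add: f(2))
  thus "\<exists>a\<in>carrier HK. q = a \<odot>\<^bsub>PM (JJ x)\<^esub> bas x" using f(1) by auto
qed (rule x)

lemma eqv_iff: "HP.eqv u v \<longleftrightarrow> u \<in> V \<and> v \<in> V \<and> JJ u = JJ v"
  unfolding HP.eqv_def by (auto simp: Rel_def)

lemma rad_at_P: assumes x: "x \<in> V" shows "HP.rad_at x (PM (JJ x)) = P_above W w (JJ x)"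
  unfolding P_above_eq[OF block_of(1)[OF x]] HP.rad_at_def eqv_iff P_ops
proof (rule Collect_cong, rule conj_cong[OF refl])
  fix q :: "'w \<Rightarrow> 'k" assume "q \<in> Asym (JJ x)"
  hence "HP.E v v q = (\<lambda>z. 0) \<longleftrightarrow> cf q v = 0" if "v \<in> V" for v
    using E_apply[OF that left_antisym_T] by blast
  thus "(\<forall>v. x \<in> V \<and> v \<in> V \<and> JJ x = JJ v \<longrightarrow> HP.E v v q = (\<lambda>z. 0)) \<longleftrightarrow>
      (\<forall>v\<in>V. JJ v = JJ x \<longrightarrow> cf q v = 0)" using x by auto
qed

lemma S_rmod_eq: "x \<in> V \<Longrightarrow> SM (JJ x) = quotient_rmod (PM (JJ x)) (HP.rad_at x (PM (JJ x)))"
  by (simp add: S_rmod_def rad_at_P)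

lemma P_rmod_projective:
  assumes J: "J \<in> RB"
  shows "indecomposable_rmod HK (PM J)" "projective_rmod HK (PM J)"
  using HP.proj_at_indecomposable[OF proj_at_P[OF RB_cut(1)[OF J]]]
    HP.proj_at_projective[OF proj_at_P[OF RB_cut(1)[OF J]]] by (simp_all add: JJ_cut[OF J])

lemma P_rmod_iso:
  assumes J: "J \<in> RB" "J' \<in> RB" and iso: "rmod_iso HK (PM J) (PM J')" shows "J = J'"
proof -
  have "HP.eqv (cut J) (cut J')"
    using HP.proj_at_iso[OF proj_at_P[OF RB_cut(1)[OF J(1)]] proj_at_P[OF RB_cut(1)[OF J(2)]]] iso
    by (simp add: JJ_cut J)
  thus ?thesis by (simp add: eqv_iff JJ_cut J)
qed

lemma P_rmod_complete:
  fixes M :: "(('k, 'w) operator, 'm) module"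
  assumes "indecomposable_rmod HK M" "projective_rmod HK M"
  shows "\<exists>J\<in>RB. rmod_iso HK M (PM J)"
proof -
  obtain x where x: "x \<in> V"
    "\<And>(P :: (('k, 'w) operator, 'w \<Rightarrow> 'k) module) p. HP.proj_at x P p \<Longrightarrow> rmod_iso HK M P"
    using HP.projective_indecomposable[OF assms] by blast
  from x(2)[OF proj_at_P[OF x(1)]] show ?thesis using block_of(1)[OF x(1)] by blast
qed

lemma S_rmod_simple: assumes J: "J \<in> RB" shows "simple_rmod HK (SM J)"
  using HP.simple_quotient[OF proj_at_P[OF RB_cut(1)[OF J]]] S_rmod_eq[OF RB_cut(1)[OF J]]
  by (simp add: JJ_cut[OF J])

lemma S_rmod_iso:
  assumes J: "J \<in> RB" "J' \<in> RB" and iso: "rmod_iso HK (SM J) (SM J')" shows "J = J'"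
proof -
  have "HP.eqv (cut J) (cut J')"
    using HP.simple_quotient_iso[OF proj_at_P[OF RB_cut(1)[OF J(1)]] proj_at_P[OF RB_cut(1)[OF J(2)]]] iso
      S_rmod_eq[OF RB_cut(1)[OF J(1)]] S_rmod_eq[OF RB_cut(1)[OF J(2)]] by (simp add: JJ_cut J)
  thus ?thesis by (simp add: eqv_iff JJ_cut J)
qed

lemma S_rmod_complete:
  fixes M :: "(('k, 'w) operator, 'm) module"
  assumes "simple_rmod HK M" shows "\<exists>J\<in>RB. rmod_iso HK M (SM J)"
proof -
  obtain x where x: "x \<in> V"
    "\<And>(P :: (('k, 'w) operator, 'w \<Rightarrow> 'k) module) p. HP.proj_at x P p \<Longrightarrow>
      rmod_iso HK M (quotient_rmod P (HP.rad_at x P))"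
    using HP.simple_classification[OF assms] by blast
  from x(2)[OF proj_at_P[OF x(1)]] have "rmod_iso HK M (SM (JJ x))"
    unfolding S_rmod_eq[OF x(1)] .
  thus ?thesis using block_of(1)[OF x(1)] by blast
qed

text \<open>Coordinates on S_J are the adapted coordinates at the descent class of J. They do not
  depend on the representative, as the subspace divided out consists of the vectors of P_J vanishing
  there.\<close>

lemma S_rmod_dim:
  assumes J: "J \<in> RB"
  shows "vectorspace.dim class_ring (restrict_scalars HK (SM J)) = card {u \<in> V. JJ u = J}"
proof -
  let ?P = "PM J :: (('k, 'w) operator, 'w \<Rightarrow> 'k) module" and ?N = "P_above W w J :: ('w \<Rightarrow> 'k) set"
  let ?D = "{u \<in> V. JJ u = J}"
  define \<psi> where "\<psi> X = (\<lambda>v. if v \<in> ?D then cf (SOME q. q \<in> carrier ?P \<and> X = ?N +>\<^bsub>?P\<^esub> q) v else 0)" for X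
  have \<psi>_out: "\<psi> X r = 0" if "r \<notin> ?D" for X r unfolding \<psi>_def using that by (simp only: if_False)
  note JI = RB_cut(4)[OF J]
  note PM = P_rmod_right_module[OF J]
  interpret P: right_module HK ?P by (rule PM)
  have N: "Module.submodule ?N HK ?P"
    using HP.rad_at_submodule[OF proj_at_P[OF RB_cut(1)[OF J]]] rad_at_P[OF RB_cut(1)[OF J]]
    by (simp add: JJ_cut[OF J])
  interpret Q: right_module HK "SM J"
    unfolding S_rmod_def by (rule quot_right_module[OF PM N])
  have neg: "\<ominus>\<^bsub>?P\<^esub> y = (\<lambda>z. - y z)" if y: "y \<in> carrier ?P" for y
    by (rule P.M.minus_equality) (use y JI in \<open>auto simp: left_antisym_iff T_iff\<close>)
  have eq_iff: "?N +>\<^bsub>?P\<^esub> x = ?N +>\<^bsub>?P\<^esub> y \<longleftrightarrow> (\<forall>v\<in>?D. cf x v = cf y v)"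
    if x: "x \<in> carrier ?P" and y: "y \<in> carrier ?P" for x y
  proof -
    have T: "x \<in> T_carrier" "y \<in> T_carrier" using x y left_antisym_T by auto
    have d: "(\<lambda>z. x z + - y z) \<in> Asym J" using x y JI by (auto simp: left_antisym_iff T_iff)
    have "cf (\<lambda>z. - 1 * y z) v = - 1 * cf y v" for v by (rule cf_smult[OF T(2)])
    hence "cf (\<lambda>z. x z + - y z) v = cf x v - cf y v" for v
      using cf_add[OF T(1) T_closed(4)[OF T(2)], of v] by simp
    hence "x \<oplus>\<^bsub>?P\<^esub> (\<ominus>\<^bsub>?P\<^esub> y) \<in> ?N \<longleftrightarrow> (\<forall>v\<in>?D. cf x v = cf y v)"
      unfolding neg[OF y] P_ops P_above_eq[OF J] using d by auto
    thus ?thesis using quot_eq_iff[OF PM N x y] by blast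
  qed
  have \<psi>: "\<psi> (?N +>\<^bsub>?P\<^esub> q) = (\<lambda>v. if v \<in> ?D then cf q v else 0)" if q: "q \<in> carrier ?P" for q
  proof -
    let ?q = "SOME q'. q' \<in> carrier ?P \<and> ?N +>\<^bsub>?P\<^esub> q = ?N +>\<^bsub>?P\<^esub> q'"
    have "?q \<in> carrier ?P \<and> ?N +>\<^bsub>?P\<^esub> q = ?N +>\<^bsub>?P\<^esub> ?q" by (rule someI[of _ q]) (use q in simp)
    hence "\<forall>v\<in>?D. cf q v = cf ?q v" using eq_iff[OF q, of ?q] by blast
    thus ?thesis unfolding \<psi>_def by auto
  qed
  have carr: "carrier (SM J) = (\<lambda>x. ?N +>\<^bsub>?P\<^esub> x) ` carrier ?P"
    unfolding S_rmod_def by (rule quot_carrier[OF PM N])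
  let ?S = "restrict_scalars HK (SM J) :: ('k, ('w \<Rightarrow> 'k) set) module"
  have S: "carrier ?S = carrier (SM J)" "X \<oplus>\<^bsub>?S\<^esub> Y = X \<oplus>\<^bsub>SM J\<^esub> Y"
    "\<zero>\<^bsub>?S\<^esub> = \<zero>\<^bsub>SM J\<^esub>" "c \<odot>\<^bsub>?S\<^esub> X = (c \<odot>\<^bsub>HK\<^esub> \<one>\<^bsub>HK\<^esub>) \<odot>\<^bsub>SM J\<^esub> X" for X Y c
    by (simp_all add: restrict_scalars_def)
  have smult: "c \<odot>\<^bsub>?S\<^esub> (?N +>\<^bsub>?P\<^esub> q) = ?N +>\<^bsub>?P\<^esub> (\<lambda>z. c * q z)" if q: "q \<in> carrier ?P" for c q
  proof -
    have eq: "(c \<odot>\<^bsub>HK\<^esub> \<one>\<^bsub>HK\<^esub>) \<odot>\<^bsub>?P\<^esub> q = (\<lambda>z. c * q z)"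
      using left_antisym_T[of q J] q by (simp add: EA_apply)
    have "(c \<odot>\<^bsub>HK\<^esub> \<one>\<^bsub>HK\<^esub>) \<odot>\<^bsub>SM J\<^esub> (?N +>\<^bsub>?P\<^esub> q) = ?N +>\<^bsub>?P\<^esub> ((c \<odot>\<^bsub>HK\<^esub> \<one>\<^bsub>HK\<^esub>) \<odot>\<^bsub>?P\<^esub> q)"
      unfolding S_rmod_def by (rule quot_act[OF PM N HP.scal_closed q])
    thus ?thesis unfolding S by (simp only: eq)
  qed
  show ?thesis
  proof (rule coord_dim(2)[where M = ?S and \<phi> = \<psi>])
    show "finite ?D" using fin_V by simp
    show "abelian_group ?S"
    proof (rule abelian_groupI)
      fix X assume "X \<in> carrier ?S"
      thus "\<exists>Y\<in>carrier ?S. Y \<oplus>\<^bsub>?S\<^esub> X = \<zero>\<^bsub>?S\<^esub>"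
        unfolding S by (intro bexI[of _ "\<ominus>\<^bsub>SM J\<^esub> X"]) (simp_all add: Q.M.l_neg)
    qed (simp_all add: S Q.M.a_assoc Q.M.a_comm Q.M.a_lcomm)
    show "c \<odot>\<^bsub>?S\<^esub> X \<in> carrier ?S" if "X \<in> carrier ?S" for c X
      using that unfolding S by (intro Q.act_closed HP.scal_closed)
    show "bij_betw \<psi> (carrier ?S) {f. \<forall>r. r \<notin> ?D \<longrightarrow> f r = 0}" unfolding bij_betw_def
    proof (rule conjI, rule inj_onI)
      fix X Y assume XY: "X \<in> carrier ?S" "Y \<in> carrier ?S" "\<psi> X = \<psi> Y"
      obtain x y where x: "x \<in> carrier ?P" "X = ?N +>\<^bsub>?P\<^esub> x" and y: "y \<in> carrier ?P" "Y = ?N +>\<^bsub>?P\<^esub> y"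
        using XY(1,2) unfolding S carr by blast
      have "cf x v = cf y v" if "v \<in> ?D" for v
        using fun_cong[OF XY(3), of v] \<psi>[OF x(1)] \<psi>[OF y(1)] that unfolding x(2) y(2) by simp
      thus "X = Y" unfolding x(2) y(2) using eq_iff[OF x(1) y(1)] by blast
    next
      show "\<psi> ` carrier ?S = {f. \<forall>r. r \<notin> ?D \<longrightarrow> f r = 0}"
      proof (rule equalityI; rule subsetI)
        fix f assume "f \<in> \<psi> ` carrier ?S"
        thus "f \<in> {f. \<forall>r. r \<notin> ?D \<longrightarrow> f r = 0}" using \<psi>_out by blast
      next
        fix f :: "'w \<Rightarrow> 'k" assume "f \<in> {f. \<forall>r. r \<notin> ?D \<longrightarrow> f r = 0}"
        hence f: "\<And>r. r \<notin> ?D \<Longrightarrow> f r = 0" by blast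
        have c: "comb f \<in> carrier ?P" unfolding P_ops by (rule comb_antisym[OF JI]) (use f in blast)
        have "\<psi> (?N +>\<^bsub>?P\<^esub> comb f) = f" unfolding \<psi>[OF c] using f by (auto simp: cf_comb)
        thus "f \<in> \<psi> ` carrier ?S" unfolding S carr using c by (metis image_eqI)
      qed
    qed
    show "\<psi> (X \<oplus>\<^bsub>?S\<^esub> Y) v = \<psi> X v + \<psi> Y v" if XY: "X \<in> carrier ?S" "Y \<in> carrier ?S" for X Y v
    proof -
      obtain x y where x: "x \<in> carrier ?P" "X = ?N +>\<^bsub>?P\<^esub> x" and y: "y \<in> carrier ?P" "Y = ?N +>\<^bsub>?P\<^esub> y"
        using XY unfolding S carr by blast
      have "X \<oplus>\<^bsub>?S\<^esub> Y = ?N +>\<^bsub>?P\<^esub> (x \<oplus>\<^bsub>?P\<^esub> y)"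
        unfolding S x(2) y(2) unfolding S_rmod_def by (rule quot_add[OF PM N x(1) y(1)])
      moreover have "cf (\<lambda>z. x z + y z) v = cf x v + cf y v"
        by (rule cf_add) (use x(1) y(1) left_antisym_T in auto)
      ultimately show ?thesis
        using \<psi>[OF P.M.a_closed[OF x(1) y(1)]] unfolding x(2) y(2) \<psi>[OF x(1)] \<psi>[OF y(1)] by simp
    qed
    show "\<psi> (c \<odot>\<^bsub>?S\<^esub> X) v = c * \<psi> X v" if X: "X \<in> carrier ?S" for c X v
    proof -
      obtain x where x: "x \<in> carrier ?P" "X = ?N +>\<^bsub>?P\<^esub> x" using X unfolding S carr by blast
      have cx: "(\<lambda>z. c * x z) \<in> carrier ?P" using x(1) left_antisym_smult[OF _ JI] by simp
      have "cf (\<lambda>z. c * x z) v = c * cf x v" by (rule cf_smult) (use x(1) left_antisym_T in auto)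
      thus ?thesis unfolding x(2) smult[OF x(1)] \<psi>[OF cx] \<psi>[OF x(1)] by simp
    qed
  qed
qed

lemma H_digraph_algebra: "algebra_iso HK (digraph_algebra V (G_edges W w))"
proof -
  have "{(u, v). u \<in> V \<and> v \<in> V \<and> (u, v) \<in> (G_edges W w)\<^sup>*} = Rel"
    using G_paths by (auto simp: Rel_def)
  hence eq: "digraph_algebra V (G_edges W w) = (pair_algebra Rel :: ('k, 'w \<times> 'w \<Rightarrow> 'k) module)"
    by (simp add: digraph_algebra_def)
  have "mat (c \<odot>\<^bsub>HK\<^esub> f) = c \<odot>\<^bsub>pair_algebra Rel\<^esub> mat f" if "f \<in> carrier HK" for c f
    using HP.\<phi>_smult[OF that, of c] by (simp add: pair_algebra_def)
  thus ?thesis unfolding algebra_iso_def eq using HP.\<phi>_iso by blast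
qed

text \<open>The maps of preorders are the inclusion of the cutting points into the interval and u ->
  the cutting point of its block. Each u is equivalent to its cutting point, and on cutting points
  the preorder becomes the order of the lattice.\<close>

lemma H_morita: "morita_equivalent TYPE('u::infinite) HK (poset_algebra (cut_interval W w) (cutting_point W))"
proof -
  define R' where "R' = {(x, y). x \<in> cut_interval W w \<and> y \<in> cut_interval W w \<and> cutting_point W y x}"
  have iff: "(cut J1, cut J2) \<in> R' \<longleftrightarrow> J1 \<subseteq> J2" if "J1 \<in> RB" "J2 \<in> RB" for J1 J2
    by (simp add: R'_def cut_interval_eq cutting_point_cut[OF that] that)
  have mem: "x \<in> cut_interval W w \<Longrightarrow> \<exists>J\<in>RB. x = cut J" for x by (auto simp: cut_interval_eq)
  have R'V: "R' \<subseteq> cut_interval W w \<times> cut_interval W w" by (auto simp: R'_def)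
  have P: "preorder_algebra (pair_algebra R' :: ('k, 'w \<times> 'w \<Rightarrow> 'k) module) (cut_interval W w) R' id"
  proof (rule preorder_algebra_pair_algebra[OF _ R'V])
    show "finite (cut_interval W w)" by (simp add: cut_interval_eq fin_RB)
    show "(u, u) \<in> R'" if "u \<in> cut_interval W w" for u using mem[OF that] iff by auto
    fix u v x assume uv: "(u, v) \<in> R'" and vx: "(v, x) \<in> R'"
    have "u \<in> cut_interval W w" "v \<in> cut_interval W w" "x \<in> cut_interval W w"
      using uv vx by (simp_all add: R'_def)
    then obtain J1 J2 J3 where J: "J1 \<in> RB" "u = cut J1" "J2 \<in> RB" "v = cut J2" "J3 \<in> RB" "x = cut J3"
      using mem[of u] mem[of v] mem[of x] by auto
    have "J1 \<subseteq> J2" "J2 \<subseteq> J3" using uv vx iff[OF J(1,3)] iff[OF J(3,5)] J(2,4,6) by blast+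
    thus "(u, x) \<in> R'" using iff[OF J(1,5)] J(2,6) by blast
  qed
  have "morita_equivalent TYPE('u) HK (pair_algebra R' :: ('k, 'w \<times> 'w \<Rightarrow> 'k) module)"
  proof (rule morita_equivalentI[where r = id and r' = "\<lambda>u. cut (JJ u)", OF HP.preorder_algebra_axioms P])
    show "id v \<in> V" if "v \<in> cut_interval W w" for v using mem[OF that] RB_cut(1) by auto
    show "cut (JJ v) \<in> cut_interval W w" if "v \<in> V" for v
      using block_of(1)[OF that] by (simp add: cut_interval_eq)
    show "(id u, id v) \<in> Rel" if uv: "(u, v) \<in> R'" for u v
    proof -
      have "u \<in> cut_interval W w" "v \<in> cut_interval W w" using uv by (simp_all add: R'_def)
      then obtain J1 J2 where J: "J1 \<in> RB" "u = cut J1" "J2 \<in> RB" "v = cut J2"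
        using mem[of u] mem[of v] by auto
      thus ?thesis using uv iff[OF J(1,3)] RB_cut(1) by (simp add: Rel_def JJ_cut)
    qed
    show "(cut (JJ u), cut (JJ v)) \<in> R'" if "(u, v) \<in> Rel" for u v
      using that iff[OF block_of(1) block_of(1), of u v] by (auto simp: Rel_def)
    show "(id (cut (JJ v)), v) \<in> Rel \<and> (v, id (cut (JJ v))) \<in> Rel" if "v \<in> V" for v
      using that RB_cut(1)[OF block_of(1)[OF that]] JJ_cut[OF block_of(1)[OF that]] by (auto simp: Rel_def)
    show "(cut (JJ (id v)), v) \<in> R' \<and> (v, cut (JJ (id v))) \<in> R'" if v: "v \<in> cut_interval W w" for v
    proof -
      obtain J where J: "J \<in> RB" "v = cut J" using mem[OF v] by blast
      thus ?thesis using iff[OF J(1) J(1)] by (simp add: JJ_cut)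
    qed
  qed
  thus ?thesis by (simp add: poset_algebra_def R'_def)
qed

end

end

theorem theorem5p10:
  fixes W :: "('w, 'i) coxeter" and w :: 'w
    and H :: "('k::field, ('k, 'w) operator) module"
  assumes "coxeter_group W" and "finite (carrier W)" and "w \<in> carrier W"
    and "H = bihecke W w"
  shows
    \<comment> \<open>(1)\<close>
    "(is_subalgebra (carrier H) (endo_algebra (T_space W w)) \<and>
      (\<forall>f\<in>carrier H. \<forall>J\<in>reduced_left_blocks W w. f ` left_antisym W w J \<subseteq> left_antisym W w J) \<and>
      (\<forall>B. is_subalgebra B (endo_algebra (T_space W w)) \<and>
           (\<forall>f\<in>B. \<forall>J\<in>reduced_left_blocks W w. f ` left_antisym W w J \<subseteq> left_antisym W w J)
           \<longrightarrow> B \<subseteq> carrier H))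
     \<and>
     \<comment> \<open>(2)\<close>
     ((\<exists>f :: 'w \<times> 'w \<Rightarrow> ('k, 'w) operator.
         (let pairs = {(u, v). u \<in> right_interval W w \<and> v \<in> right_interval W w \<and>
                               right_block_of W w u \<subseteq> right_block_of W w v}
          in (\<forall>(u, v)\<in>pairs. f (u, v) \<in> F_monoid W w \<and> triangular W w u v (f (u, v))) \<and>
             inj_on f pairs \<and> vectorspace.basis class_ring H (f ` pairs))) \<and>
      vectorspace.dim class_ring H =
        card {(u, v). u \<in> right_interval W w \<and> v \<in> right_interval W w \<and>
                      left_block_of W w u \<subseteq> left_block_of W w v})
     \<and>
     \<comment> \<open>(3)\<close>
     algebra_iso H (digraph_algebra (right_interval W w) (G_edges W w))
     \<and>
     \<comment> \<open>(4)\<close>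
     ((\<forall>J\<in>reduced_left_blocks W w.
         indecomposable_rmod H (P_rmod W w J) \<and> projective_rmod H (P_rmod W w J)) \<and>
      (\<forall>J\<in>reduced_left_blocks W w. \<forall>J'\<in>reduced_left_blocks W w.
         rmod_iso H (P_rmod W w J) (P_rmod W w J') \<longrightarrow> J = J') \<and>
      (\<forall>M :: (('k, 'w) operator, 'm) module.
         indecomposable_rmod H M \<and> projective_rmod H M \<longrightarrow>
         (\<exists>J\<in>reduced_left_blocks W w. rmod_iso H M (P_rmod W w J))))
     \<and>
     \<comment> \<open>(5)\<close>
     ((\<forall>J\<in>reduced_left_blocks W w. simple_rmod H (S_rmod W w J)) \<and>
      (\<forall>J\<in>reduced_left_blocks W w. \<forall>J'\<in>reduced_left_blocks W w.
         rmod_iso H (S_rmod W w J) (S_rmod W w J') \<longrightarrow> J = J') \<and>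
      (\<forall>M :: (('k, 'w) operator, 'm) module. simple_rmod H M \<longrightarrow>
         (\<exists>J\<in>reduced_left_blocks W w. rmod_iso H M (S_rmod W w J))) \<and>
      (\<forall>J\<in>reduced_left_blocks W w.
         vectorspace.dim class_ring (restrict_scalars H (S_rmod W w J)) =
           card {u \<in> right_interval W w. left_block_of W w u = J}))
     \<and>
     \<comment> \<open>(6)\<close>
     morita_equivalent TYPE('u::infinite) H
       (poset_algebra (cut_interval W w) (cutting_point W))"
proof -
  interpret coxeter_interval W w
    using assms(1-3) by (intro coxeter_interval.intro coxeter_system.intro coxeter_interval_axioms.intro)
  note H = assms(4)
  have L: "{(u, v). u \<in> V \<and> v \<in> V \<and> JJ u \<subseteq> JJ v} = Rel" by (simp add: Rel_def)
  \<comment> \<open>Corresponding left and right blocks are ordered alike, so both index sets of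
    pairs are \<open>Rel\<close>.\<close>
  have R: "{(u, v). u \<in> V \<and> v \<in> V \<and> right_block_of W w u \<subseteq> right_block_of W w v} = Rel"
    using right_block_of_mono by (auto simp: Rel_def)
  have 2: "\<exists>f :: 'w \<times> 'w \<Rightarrow> ('k, 'w) operator.
      (\<forall>(u, v)\<in>Rel. f (u, v) \<in> Fm \<and> triangular W w u v (f (u, v))) \<and>
      inj_on f Rel \<and> vectorspace.basis class_ring H (f ` Rel)"
    using triangular_basis(2) unfolding H by (simp add: case_prod_unfold)
  show ?thesis unfolding L R Let_def H by (intro conjI ballI allI impI)
      (rule H_subalgebra, erule (1) H_stabilises, erule conjE, erule (1) H_maximal,
        rule 2[unfolded H], rule triangular_basis(3), rule H_digraph_algebra,
        erule P_rmod_projective, erule P_rmod_projective, rule P_rmod_iso, assumption+,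
        erule conjE, rule P_rmod_complete, assumption+, erule S_rmod_simple, rule S_rmod_iso,
        assumption+, erule S_rmod_complete, erule S_rmod_dim, rule H_morita)
qed

end
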